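(* Let $n\ge2$, $\boldsymbol\lambda\in\mathbb C^n$ with $\sum_l\lambda_l=0$, $\varsigma\in\{+,-\}$, and let $\xi$ be an $n$-th root of $\varsigma1$. Then for $z\in\mathbb U$ $$J(z;\boldsymbol\lambda;\xi)=\sqrt n\Big(-\frac{\pi i\xi}2\Big)^{\frac{n-1}2}\sum_{l=1}^n\big(i\overline\xi\big)^{n\lambda_l}S_l(\boldsymbol\lambda)J_l(z;\varsigma,\boldsymbol\lambda),\qquad S_l(\boldsymbol\lambda)=\prod_{k\ne l}\frac1{\sin(\pi(\lambda_l-\lambda_k))}.$$ When some two components of $\boldsymbol\lambda$ differ by an integer (i.e. $\boldsymbol\lambda$ is not generic), the right-hand side is to be replaced by its limit, as generic indices (of zero component-sum) tend to $\boldsymbol\lambda$.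
   Context: $\mathbb U$ is the universal cover of $\mathbb C\smallsetminus\{0\}$, with elements $z=|z|e^{i\arg z}$, $\arg z\in\mathbb R$, $z^a=e^{a\log z}$. The root $\xi$ is regarded as a point of $\mathbb U$ (a choice of $\arg\xi$ is fixed). Conventions: $(-\frac{\pi i\xi}{2})^{\frac{n-1}2}=(\frac\pi2)^{\frac{n-1}2}e^{\frac{n-1}2(-\frac12\pi i+i\arg\xi)}$ and $(i\overline\xi)^{n\lambda_l}=e^{\frac12\pi in\lambda_l-in\lambda_l\arg\xi}$. Signs are identified with $\pm1$. Bessel functions of the first kind: $$J_l(z;\varsigma,\boldsymbol\lambda)=\sum_{m=0}^\infty\frac{(\varsigma i^n)^mz^{n(-\lambda_l+m)}}{\prod_{k=1}^n\Gamma(\lambda_k-\lambda_l+m+1)},\qquad z\in\mathbb U.$$ Bessel functions of the second kind: the Bessel equation of index $\boldsymbol\lambda$ and sign $\varsigma$ is $$\sum_{j=1}^nV_{n,j}(\boldsymbol\lambda)z^jw^{(j)}+\big(V_{n,0}(\boldsymbol\lambda)-\varsigma(in)^nz^n\big)w=0,\qquad V_{n,j}(\boldsymbol\lambda)=\sum_{m=0}^{n-j}A_{j,n-j-m}\,n^m\sigma_m(\boldsymbol\lambda),$$ $\sigma_m$ the $m$-th elementary symmetric polynomial, $A_{0,0}=1$, $A_{0,m}=0$ ($m\ge1$), $A_{j,m}=\sum_{r=1}^j\frac{(-1)^{j-r}r^{m+j}}{r!(j-r)!}$ ($j\ge1,m\ge0$). There is a unique sequence of symmetric polynomials $B_m(\boldsymbol\lambda;\xi)$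 with $B_0=1$ such that $\widehat J(z;\boldsymbol\lambda;\xi)=e^{in\xi z}z^{-\frac{n-1}2}\sum_{m\ge0}B_m(\boldsymbol\lambda;\xi)z^{-m}$ is a formal solution, and $J(z;\boldsymbol\lambda;\xi)$ is the unique solution on $\mathbb U$ having $\widehat J(z;\boldsymbol\lambda;\xi)$ as its asymptotic expansion (as $|z|\to\infty$) on $\{z\in\mathbb U:|\arg z-(\frac\pi2-\arg\xi)|<\frac\pi n\}$. *)

theory Defs
  imports
    "HOL-Complex_Analysis.Complex_Analysis"
    "HOL-Computational_Algebra.Formal_Laurent_Series"
    "HOL-Library.Landau_Symbols"
begin

section \<open>The universal cover of the punctured plane\<close>

text \<open>
  The logarithm is a global holomorphic chart of the universal cover of the punctured plane.
  A point \<open>z = |z| exp (i arg z)\<close> of the cover is represented by \<open>log z = ln |z| + i arg z\<close>,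
  and \<open>d/dz\<close> becomes \<open>exp (- s) d/ds\<close> in the coordinate \<open>s = log z\<close>.
\<close>

type_synonym ucover = complex

definition uproj :: "ucover \<Rightarrow> complex" where
  "uproj z = exp z"

definition umod :: "ucover \<Rightarrow> real" where
  "umod z = exp (Re z)"

definition uarg :: "ucover \<Rightarrow> real" where
  "uarg z = Im z"

definition upow :: "ucover \<Rightarrow> complex \<Rightarrow> complex" where
  "upow z a = exp (a * z)"

definition uderiv :: "(ucover \<Rightarrow> complex) \<Rightarrow> ucover \<Rightarrow> complex" where
  "uderiv w z = deriv w z / uproj z"


section \<open>Indices\<close>

definition zero_sum :: "(complex ^ 'n) set" where
  "zero_sum = {\<mu>. (\<Sum>l\<in>UNIV. \<mu> $ l) = 0}"

definition generic :: "complex ^ 'n \<Rightarrow> bool" where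
  "generic \<mu> \<longleftrightarrow> (\<forall>k l. k \<noteq> l \<longrightarrow> \<mu> $ k - \<mu> $ l \<notin> \<int>)"


section \<open>Bessel functions of the first kind\<close>

text \<open>The entire function \<open>rGamma\<close> is the reciprocal of the Gamma function.\<close>

definition bessel_first :: "complex \<Rightarrow> complex ^ 'n \<Rightarrow> 'n \<Rightarrow> ucover \<Rightarrow> complex" where
  "bessel_first \<sigma> \<mu> l z =
     (\<Sum>m. (\<sigma> * \<i> ^ CARD('n)) ^ m * upow z (of_nat CARD('n) * (- (\<mu> $ l) + of_nat m)) *
          (\<Prod>k\<in>UNIV. rGamma (\<mu> $ k - \<mu> $ l + of_nat m + 1)))"


section \<open>The Bessel equation\<close>

definition elem_sym :: "nat \<Rightarrow> complex ^ 'n \<Rightarrow> complex" where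
  "elem_sym m \<mu> = (\<Sum>S\<in>{S. card S = m}. \<Prod>k\<in>S. \<mu> $ k)"

definition bessel_A :: "nat \<Rightarrow> nat \<Rightarrow> complex" where
  "bessel_A j m =
     (if j = 0 then (if m = 0 then 1 else 0)
      else (\<Sum>r=1..j. (-1) ^ (j - r) * of_nat r ^ (m + j) / (fact r * fact (j - r))))"

definition bessel_V :: "complex ^ 'n \<Rightarrow> nat \<Rightarrow> complex" where
  "bessel_V \<mu> j =
     (\<Sum>m=0..CARD('n) - j. bessel_A j (CARD('n) - j - m) * of_nat CARD('n) ^ m * elem_sym m \<mu>)"

definition bessel_solution ::
    "complex \<Rightarrow> complex ^ 'n \<Rightarrow> (ucover \<Rightarrow> complex) \<Rightarrow> bool" where
  "bessel_solution \<sigma> \<mu> w \<longleftrightarrow>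
     w holomorphic_on UNIV \<and>
     (\<forall>z. (\<Sum>j=1..CARD('n). bessel_V \<mu> j * uproj z ^ j * (uderiv ^^ j) w z) +
          (bessel_V \<mu> 0 - \<sigma> * (\<i> * of_nat CARD('n)) ^ CARD('n) * uproj z ^ CARD('n)) * w z = 0)"


section \<open>The formal solution at infinity\<close>

text \<open>
  The formal expression \<open>exp (c z) z\<^sup>a f\<close>, with \<open>f\<close> a formal Laurent series in \<open>X = 1/z\<close>, is
  represented by \<open>f\<close>; so \<open>z\<close> is \<open>fls_X_inv\<close>. As \<open>dX/dz = - X\<^sup>2\<close>, differentiation with respect to
  \<open>z\<close> sends \<open>f\<close> to \<open>c f + a X f - X\<^sup>2 f'\<close>.
\<close>

definition formal_deriv :: "complex \<Rightarrow> complex \<Rightarrow> complex fls \<Rightarrow> complex fls" where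
  "formal_deriv c a f = fls_const c * f + fls_const a * fls_X * f - fls_X ^ 2 * fls_deriv f"

definition bessel_formal_solution ::
    "complex \<Rightarrow> complex ^ 'n \<Rightarrow> complex \<Rightarrow> complex \<Rightarrow> complex fls \<Rightarrow> bool" where
  "bessel_formal_solution \<sigma> \<mu> c a f \<longleftrightarrow>
     (\<Sum>j=1..CARD('n). fls_const (bessel_V \<mu> j) * fls_X_inv ^ j * (formal_deriv c a ^^ j) f) +
     (fls_const (bessel_V \<mu> 0) -
        fls_const (\<sigma> * (\<i> * of_nat CARD('n)) ^ CARD('n)) * fls_X_inv ^ CARD('n)) * f = 0"

definition symmetric_polynomial :: "(complex ^ 'n \<Rightarrow> complex) \<Rightarrow> bool" where
  "symmetric_polynomial p \<longleftrightarrow>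
     (\<exists>(E :: ('n \<Rightarrow> nat) set) c. finite E \<and>
        (\<forall>\<mu>. p \<mu> = (\<Sum>\<alpha>\<in>E. c \<alpha> * (\<Prod>k\<in>UNIV. (\<mu> $ k) ^ \<alpha> k)))) \<and>
     (\<forall>\<pi>. bij \<pi> \<longrightarrow> (\<forall>\<mu>. p (\<chi> k. \<mu> $ \<pi> k) = p \<mu>))"

text \<open>
  The formal solution exists only for indices of zero component-sum, so the polynomials \<open>B m\<close>
  are unique as functions on that hyperplane, that is, modulo the first elementary symmetric
  polynomial. The definite description is therefore put on the value at \<open>\<mu>\<close>, and is meaningful
  for \<open>\<mu> \<in> zero_sum\<close>. The sign of the equation is the \<open>n\<close>-th power of \<open>\<xi>\<close>.
\<close>

definition bessel_B :: "ucover \<Rightarrow> nat \<Rightarrow> complex ^ 'n \<Rightarrow> complex" where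
  "bessel_B \<xi> m \<mu> =
     (THE b. \<exists>B :: nat \<Rightarrow> complex ^ 'n \<Rightarrow> complex.
        (\<forall>i. symmetric_polynomial (B i)) \<and> B 0 = (\<lambda>_. 1) \<and>
        (\<forall>\<nu>\<in>zero_sum. bessel_formal_solution (uproj \<xi> ^ CARD('n)) \<nu>
            (\<i> * of_nat CARD('n) * uproj \<xi>) (- (of_nat CARD('n) - 1) / 2)
            (fps_to_fls (Abs_fps (\<lambda>i. B i \<nu>)))) \<and>
        b = B m \<mu>)"


section \<open>Bessel functions of the second kind\<close>

definition sector_at_infinity :: "real \<Rightarrow> real \<Rightarrow> ucover filter" where
  "sector_at_infinity \<phi> \<delta> =
     inf (filtercomap umod at_top) (principal {z. \<bar>uarg z - \<phi>\<bar> \<le> \<delta>})"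

text \<open>
  \<open>w\<close> has \<open>exp (c z) z\<^sup>a (\<Sum>m. b m z\<^bsup>-m\<^esup>)\<close> as its asymptotic expansion on the open sector
  \<open>|arg z - \<phi>| < \<rho>\<close>: as usual, uniformly on every closed subsector as \<open>|z|\<close> tends to infinity.
\<close>

definition has_asymp_expansion ::
    "(ucover \<Rightarrow> complex) \<Rightarrow> complex \<Rightarrow> complex \<Rightarrow> (nat \<Rightarrow> complex) \<Rightarrow> real \<Rightarrow> real \<Rightarrow> bool" where
  "has_asymp_expansion w c a b \<phi> \<rho> \<longleftrightarrow>
     (\<forall>\<delta><\<rho>. \<forall>M.
        (\<lambda>z. w z / (exp (c * uproj z) * upow z a) - (\<Sum>m<M. b m * inverse (uproj z) ^ m))
        \<in> O[sector_at_infinity \<phi> \<delta>](\<lambda>z. inverse (uproj z) ^ M))"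

definition bessel_second :: "complex ^ 'n \<Rightarrow> ucover \<Rightarrow> ucover \<Rightarrow> complex" where
  "bessel_second \<mu> \<xi> =
     (THE w. bessel_solution (uproj \<xi> ^ CARD('n)) \<mu> w \<and>
        has_asymp_expansion w
          (\<i> * of_nat CARD('n) * uproj \<xi>) (- (of_nat CARD('n) - 1) / 2) (\<lambda>m. bessel_B \<xi> m \<mu>)
          (pi / 2 - uarg \<xi>) (pi / CARD('n)))"


section \<open>Coefficients of the connection formula\<close>

text \<open>For \<open>\<xi>\<close> of modulus one: \<open>(- \<pi> i \<xi> / 2)\<close> to the power \<open>(n - 1) / 2\<close>.\<close>

definition connection_factor :: "nat \<Rightarrow> ucover \<Rightarrow> complex" where
  "connection_factor n \<xi> =
     of_real ((pi / 2) powr ((real n - 1) / 2)) *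
     exp ((of_nat n - 1) / 2 * (- (1/2) * pi * \<i> + \<i> * uarg \<xi>))"

text \<open>For \<open>\<xi>\<close> of modulus one: \<open>i\<close> times the conjugate of \<open>\<xi>\<close>, to the power \<open>n \<mu>\<^sub>l\<close>.\<close>

definition conj_power :: "complex ^ 'n \<Rightarrow> ucover \<Rightarrow> 'n \<Rightarrow> complex" where
  "conj_power \<mu> \<xi> l =
     exp (1/2 * pi * \<i> * of_nat CARD('n) * \<mu> $ l - \<i> * of_nat CARD('n) * \<mu> $ l * uarg \<xi>)"

definition bessel_S :: "complex ^ 'n \<Rightarrow> 'n \<Rightarrow> complex" where
  "bessel_S \<mu> l = (\<Prod>k\<in>UNIV - {l}. 1 / sin (of_real pi * (\<mu> $ l - \<mu> $ k)))"

end

theory Submission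
  imports Defs
begin

text \<open>
  Put \<open>y = - i n \<xi> z\<close>, so that \<open>exp (i n \<xi> z) = exp (- y)\<close>. By the reflection formula the
  right-hand side is, for generic indices, a constant times the sum of the residues of
  \<open>\<Prod>\<^sub>k \<Gamma>(s - \<lambda>\<^sub>k) (y / n) powr (- n s)\<close>, that is, a Mellin-Barnes integral over a vertical line. After
  replacing \<open>s\<close> by \<open>s / n\<close>, the function \<open>n powr s \<Prod>\<^sub>k \<Gamma>(s / n - \<lambda>\<^sub>k)\<close> and the formal series \<open>\<Sum>\<^sub>m b\<^sub>m \<Gamma>(s + a - m)\<close> obtained from the formal
  solution satisfy the same difference equation, and the quotient \<open>g\<close> of \<open>\<Gamma>(s + a)\<close> by that function satisfies
  \<open>g (s + n) / g s = 1 + O(1/s\<^sup>2)\<close>, so it is bounded above and below and has a limit along \<open>s + n \<nat>\<close>; hence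
  the truncated series approximates the function with an error \<open>O(\<Gamma>(s + a - M))\<close>, uniformly for bounded
  indices. Transforming back gives the asymptotic expansion
  uniformly in the indices. A solution with this expansion is unique: for the difference of two of them an
  energy on the positive ray, diagonalising the leading part of the equation after removal of the factor
  \<open>exp (- y)\<close>, cannot decay faster than a fixed power of \<open>y\<close>, yet decays faster than every power. For
  nongeneric \<open>\<lambda>\<close> the generic solutions near \<open>\<lambda>\<close> are locally bounded by a Gronwall estimate, so by Montel's
  theorem each sequence has a subsequence converging to a solution, which inherits the expansion
  because the error bounds are uniform; uniqueness identifies the limit.
\<close>

section \<open>Decay of the Gamma function on vertical lines\<close>

text \<open>The limit at nongeneric \<lambda> cannot be taken term by term: the factors
  \<open>bessel_S\<close> have poles there which cancel only in the sum. Hence all constants below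
  depend on bounds for the indices only, and the cancellation is never made explicit. The difference
  equation serves the same end: it compares the Gamma product with Gamma(s + a) uniformly in the
  indices, using the functional equation instead of a complex Stirling expansion. The exponent a =
  -(n - 1)/2 and the zero component-sum remove the term of order 1/s from g (s + n) / g s; with such
  a term the infinite product of these quotients would not converge. The limit of g does not depend
  on the indices. It is computed at one special choice of them for which g is constant along the
  steps; there it reduces to the constants of Gauss' multiplication formula, the source of the
  constant in the theorem. The Mellin-Barnes integral converges for |arg y| < pi/2, and n >= 2 is
  what places the required sector of half-opening pi/n inside this half-plane.\<close>

lemma not_nonpos_Ints_if_Re_pos: "Re z > 0 \<Longrightarrow> z \<notin> \<int>\<^sub>\<le>\<^sub>0"
  by (auto elim!: nonpos_Ints_cases)

text \<open>In Euler's limit the numerators of the approximants have equal modulus at z and at Re z,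
  while each factor z + i of the denominator has modulus at least Re z + i.\<close>

lemma norm_Gamma_le_Gamma_Re:
  assumes "Re z > 0"
  shows "norm (Gamma z) \<le> Gamma (Re z)"
proof -
  have "(\<lambda>n. norm (Gamma_series z n)) \<longlonglongrightarrow> norm (Gamma z)"
    by (intro tendsto_intros)
  moreover have "Gamma_series (Re z) \<longlonglongrightarrow> Gamma (Re z)"
    by (intro tendsto_intros)
  moreover have "norm (Gamma_series z n) \<le> Gamma_series (Re z) n" if "n > 0" for n
  proof -
    have "pochhammer (Re z) (n+1) \<le> norm (pochhammer z (n+1))"
      unfolding pochhammer_prod prod_norm[symmetric]
    proof (rule prod_mono)
      fix i assume "i \<in> {0..<n+1}"
      show "0 \<le> Re z + of_nat i \<and> Re z + of_nat i \<le> norm (z + of_nat i)"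
        using assms complex_Re_le_cmod[of "z + of_nat i"] by auto
    qed
    moreover have "pochhammer (Re z) (n+1) > 0" using assms by (intro pochhammer_pos)
    moreover have "norm (exp (z * of_real (ln (real n)))) = exp (Re z * ln (real n))"
      by (simp add: norm_exp_eq_Re)
    ultimately show ?thesis unfolding Gamma_series_def
      by (auto simp: norm_mult norm_divide intro!: divide_left_mono mult_nonneg_nonneg mult_pos_pos)
  qed
  ultimately show ?thesis
    by (intro LIMSEQ_le[OF _ _ exI[of _ 1]]) auto
qed

text \<open>The value of \<open>\<integral>\<^sub>c\<^sup>\<infinity> ln (1 + t\<^sup>2 / x\<^sup>2) / 2 dx\<close>, which bounds
  \<open>ln (\<Gamma>(c) / \<bar>\<Gamma>(c + i t)\<bar>) = \<Sum>\<^sub>m ln (1 + t\<^sup>2 / (c + m)\<^sup>2) / 2\<close> from below.\<close>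

definition gamma_decay :: "real \<Rightarrow> real \<Rightarrow> real" where
  "gamma_decay t c = t * arctan (t / c) - c / 2 * ln (1 + t^2 / c^2)"

lemma gamma_decay_deriv:
  assumes "c > 0"
  shows "(gamma_decay t has_real_derivative - ln (1 + t^2 / c^2) / 2) (at c)"
proof -
  have p: "1 + t^2 / c^2 > 0" by (intro add_pos_nonneg) auto
  have s: "t^2 + c^2 > 0" using assms by (intro add_nonneg_pos) auto
  have q: "1 + t^2 / c^2 = (t^2 + c^2) / c^2" using assms by (simp add: field_simps)
  show ?thesis unfolding gamma_decay_def[abs_def]
    apply (rule derivative_eq_intros refl | use assms p in force)+
    using assms p s unfolding power_divide q by (simp add: divide_simps) (simp add: algebra_simps power2_eq_square power4_eq_xxxx)
qed

text \<open>The left-hand side is the integral of the decreasing function ln (1 + t^2 / x^2) / 2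
  over [c, c + 1]; the mean value theorem bounds it by the integrand at c.\<close>

lemma gamma_decay_step:
  assumes "c > 0"
  shows "gamma_decay t c - gamma_decay t (c + 1) \<le> ln (1 + t^2 / c^2) / 2"
proof -
  have "\<exists>x. c < x \<and> x < c + 1 \<and> gamma_decay t (c+1) - gamma_decay t c = (c + 1 - c) * (- ln (1 + t^2 / x^2) / 2)"
    using assms gamma_decay_deriv[of _ t] by (intro MVT2) auto
  then obtain x where x: "x > c" "gamma_decay t (c+1) - gamma_decay t c = - ln (1 + t^2 / x^2) / 2"
    by auto
  have "t^2/x^2 \<le> t^2/c^2" using x assms by (intro divide_left_mono) auto
  then have "ln (1 + t^2 / x^2) \<le> ln (1 + t^2/c^2)"
    by (subst ln_le_cancel_iff) (auto intro!: add_pos_nonneg)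
  with x show ?thesis by simp
qed

text \<open>This removes the remainder at c + N when the functional equation is iterated N
  times.\<close>

lemma gamma_decay_le:
  assumes "c > 0"
  shows "gamma_decay t c \<le> t^2 / c"
proof -
  have "t * arctan (t/c) \<le> t * (t/c)"
  proof (cases "t \<ge> 0")
    case True then show ?thesis using arctan_le_self[of "t/c"] assms by (intro mult_left_mono) auto
  next
    case False
    then have "arctan (-(t/c)) \<le> - (t/c)" using assms by (intro arctan_le_self) (auto simp: field_simps)
    then show ?thesis using False unfolding arctan_minus by (intro mult_left_mono_neg) auto
  qed
  moreover have "c / 2 * ln (1 + t^2/c^2) \<ge> 0" using assms by auto
  ultimately show ?thesis unfolding gamma_decay_def by (simp add: power2_eq_square)
qed

text \<open>For fixed t and c the left-hand side is concave in \<theta> and maximal at arctan (t /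
  c), where it equals \<open>gamma_decay t c\<close>. One decay function thus encodes the
  exponential bounds for all angles.\<close>

lemma gamma_decay_ge:
  assumes "c > 0" "\<bar>\<theta>\<bar> < pi/2"
  shows "t * \<theta> + c * ln (cos \<theta>) \<le> gamma_decay t c"
proof -
  define \<phi> where "\<phi> = arctan (t/c)"
  have \<phi>: "- (pi/2) < \<phi>" "\<phi> < pi/2" "tan \<phi> = t/c" unfolding \<phi>_def
    using arctan_lbound[of "t/c"] arctan_ubound[of "t/c"] by (simp_all add: arctan tan_arctan)
  have cp: "cos \<phi> > 0" using \<phi> by (intro cos_gt_zero_pi) auto
  have "1 + t^2/c^2 = 1 + (tan \<phi>)^2" using \<phi> by (simp add: power_divide)
  also have "\<dots> = inverse ((cos \<phi>)^2)"
    using cp tan_sec[of \<phi>] by (simp add: power_inverse)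
  finally have "ln (1 + t^2/c^2) = - 2 * ln (cos \<phi>)" using cp by (simp add: ln_inverse ln_realpow)
  then have G: "gamma_decay t c = t * \<phi> + c * ln (cos \<phi>)" unfolding gamma_decay_def \<phi>_def by simp
  define f where "f x = - t * x - c * ln (cos x)" for x
  have df: "(f has_real_derivative (- t + c * tan x)) (at x)" if "-(pi/2) < x" "x < pi/2" for x
  proof -
    have "cos x > 0" using that by (intro cos_gt_zero_pi) auto
    then show ?thesis unfolding f_def by (auto intro!: derivative_eq_intros simp: tan_def)
  qed
  have "f \<phi> \<le> f \<theta>"
  proof (cases "\<phi> \<le> \<theta>")
    case True
    show ?thesis
    proof (rule DERIV_nonneg_imp_nondecreasing[OF True])
      fix x assume x: "\<phi> \<le> x" "x \<le> \<theta>"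
      have "tan \<phi> \<le> tan x" using x \<phi> assms by (intro tan_mono_le) auto
      then have "t / c \<le> tan x" using \<phi> by simp
      then have "0 \<le> - t + c * tan x" using assms by (simp add: field_simps)
      then show "\<exists>y. (f has_real_derivative y) (at x) \<and> 0 \<le> y"
        using df[of x] x \<phi> assms by (intro exI[of _ "- t + c * tan x"] conjI df) (auto simp: abs_less_iff)
    qed
  next
    case False
    then have "\<theta> \<le> \<phi>" by simp
    then show ?thesis
    proof (rule DERIV_nonpos_imp_nonincreasing)
      fix x assume x: "\<theta> \<le> x" "x \<le> \<phi>"
      have "tan x \<le> tan \<phi>" using x \<phi> assms by (intro tan_mono_le) auto
      then have "tan x \<le> t/c" using \<phi> by simp
      then have "- t + c * tan x \<le> 0" using assms by (simp add: field_simps)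
      then show "\<exists>y. (f has_real_derivative y) (at x) \<and> y \<le> 0"
        using df[of x] x \<phi> assms by (intro exI[of _ "- t + c * tan x"] conjI df) (auto simp: abs_less_iff)
    qed
  qed
  then show ?thesis unfolding G f_def by simp
qed

text \<open>The log-quotient E loses exactly ln (1 + t^2 / x^2) / 2 in the step from x to x + 1, at
  least as much as \<open>gamma_decay\<close> does. Summing N steps and using E >= 0 at the far end
  leaves an error of at most t^2 / (c + N).\<close>

lemma norm_Gamma_le_gamma_decay:
  assumes "c > 0"
  shows "norm (Gamma (Complex c t)) \<le> Gamma c * exp (- gamma_decay t c)"
proof -
  define E where "E x = ln (Gamma x) - ln (norm (Gamma (Complex x t)))" for x
  have nz: "Gamma (Complex x t) \<noteq> 0" if "x > 0" for x
    using that not_nonpos_Ints_if_Re_pos[of "Complex x t"] by (simp add: Gamma_eq_zero_iff)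
  have E0: "E x \<ge> 0" if "x > 0" for x
    using norm_Gamma_le_Gamma_Re[of "Complex x t"] nz[OF that] that unfolding E_def by auto
  have step: "E x - E (x+1) = ln (1 + t^2/x^2) / 2" if "x > 0" for x
  proof -
    have 1: "Complex (x+1) t = Complex x t + 1" by (simp add: complex_eq_iff)
    have "Gamma (Complex (x+1) t) = Complex x t * Gamma (Complex x t)"
      unfolding 1 using that not_nonpos_Ints_if_Re_pos[of "Complex x t"] by (intro Gamma_plus1) auto
    moreover have "Gamma (x+1) = x * Gamma x" using that by (intro Gamma_plus1) (auto elim!: nonpos_Ints_cases)
    moreover have "Gamma x \<noteq> 0" "Gamma x > 0" "Complex x t \<noteq> 0" using that Gamma_real_pos[of x] by (auto simp: complex_eq_iff simp del: Gamma_real_pos)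
    ultimately have "E x - E (x+1) = ln (norm (Complex x t)) - ln x"
      using that nz[OF that] unfolding E_def by (simp add: norm_mult ln_mult_pos)
    also have "norm (Complex x t) = sqrt (x^2 * (1 + t^2/x^2))"
      using that by (simp add: cmod_def field_simps)
    also have "\<dots> = x * sqrt (1 + t^2/x^2)" using that by (simp add: real_sqrt_mult)
    also have "ln \<dots> - ln x = ln (1 + t^2/x^2) / 2"
    proof -
      have "1 + t^2/x^2 > 0" by (intro add_pos_nonneg) auto
      then show ?thesis using that by (subst ln_mult) (auto simp: ln_sqrt)
    qed
    finally show ?thesis .
  qed
  have ind: "E c \<ge> gamma_decay t c + E (c + real N) - gamma_decay t (c + real N)" for N
  proof (induction N)
    case (Suc N)
    have "c + real N > 0" using assms by simp
    from step[OF this] gamma_decay_step[OF this, of t] Suc show ?case by (simp add: add_ac)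
  qed simp
  have "gamma_decay t c - t^2 / (c + real N) \<le> E c" for N
    using ind[of N] E0[of "c + real N"] gamma_decay_le[of "c + real N" t] assms by force
  moreover have "(\<lambda>N. gamma_decay t c - t^2 / (c + real N)) \<longlonglongrightarrow> gamma_decay t c - 0"
    by (intro tendsto_intros tendsto_divide_0[OF tendsto_const] filterlim_at_top_imp_at_infinity
        filterlim_tendsto_add_at_top[OF tendsto_const filterlim_real_sequentially])
  ultimately have "gamma_decay t c \<le> E c" by (intro LIMSEQ_le_const2) auto
  then have "ln (norm (Gamma (Complex c t))) \<le> ln (Gamma c) - gamma_decay t c" unfolding E_def by simp
  then have "exp (ln (norm (Gamma (Complex c t)))) \<le> exp (ln (Gamma c) - gamma_decay t c)" by simp
  then show ?thesis using nz[OF assms] assms by (simp add: exp_diff exp_minus field_simps)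
qed

text \<open>The estimate that turning the ray of integration in Euler's integral by \<theta> would
  give. In the Mellin-Barnes integral the factor \<open>exp (Im s * \<theta>)\<close> is the growth
  of y^(-s) caused by arg y = \<theta>.\<close>

lemma norm_Gamma_rotated:
  assumes "Re s > 0" "\<bar>\<theta>\<bar> < pi/2"
  shows "norm (Gamma s) * exp (Im s * \<theta>) \<le> Gamma (Re s) * cos \<theta> powr (- Re s)"
proof -
  have "cos \<theta> > 0" using assms by (intro cos_gt_zero_pi) auto
  then have e: "cos \<theta> powr (- Re s) = exp (- Re s * ln (cos \<theta>))" by (simp add: powr_def)
  have "norm (Gamma s) * exp (Im s * \<theta>) \<le> Gamma (Re s) * exp (- gamma_decay (Im s) (Re s)) * exp (Im s * \<theta>)"
    using norm_Gamma_le_gamma_decay[OF assms(1), of "Im s"] by (intro mult_right_mono) auto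
  also have "\<dots> = Gamma (Re s) * exp (Im s * \<theta> - gamma_decay (Im s) (Re s))"
    by (simp add: exp_diff exp_minus field_simps)
  also have "\<dots> \<le> Gamma (Re s) * exp (- Re s * ln (cos \<theta>))"
    using gamma_decay_ge[OF assms, of "Im s"] assms(1) by (intro mult_left_mono) auto
  finally show ?thesis unfolding e .
qed

text \<open>A crude Stirling bound: u does not increase under c -> c + 1, by ln x <= x - 1 at x = c
  / (c + 1), and it is bounded on [1, 2]. The lost factor c^(-1/2) costs nothing in the end, because
  the expansion is later taken two terms further than asked for.\<close>

lemma Gamma_real_upper_bound: "\<exists>C>0. \<forall>c\<ge>1. Gamma (c::real) \<le> C * c powr c * exp (- c)"
proof -
  define u where "u c = ln (Gamma c) - c * ln c + c" for c :: real
  have step: "u (c+1) \<le> u c" if "c \<ge> 1" for c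
  proof -
    have G: "Gamma (c+1) = c * Gamma c" using that by (intro Gamma_plus1) (auto elim!: nonpos_Ints_cases)
    have "ln (c / (c+1)) \<le> c/(c+1) - 1" using that by (intro ln_le_minus_one) auto
    then have "(c+1) * ln (c/(c+1)) \<le> (c+1) * (c/(c+1) - 1)" using that by (intro mult_left_mono) auto
    also have "\<dots> = -1" using that by (simp add: field_simps)
    finally have "(c+1) * (ln c - ln (c+1)) \<le> -1" using that by (simp add: ln_div)
    moreover have "ln (c * Gamma c) = ln c + ln (Gamma c)" using that Gamma_real_pos[of c] by (intro ln_mult_pos) auto
    ultimately show ?thesis using that unfolding u_def G by (simp add: algebra_simps)
  qed
  have "continuous_on {1..2} (u :: real \<Rightarrow> real)" unfolding u_def
    by (intro continuous_intros) (auto elim!: nonpos_Ints_cases intro!: less_imp_neq[symmetric] Gamma_real_pos)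
  then have "bounded (u ` {1..2})" by (intro compact_imp_bounded compact_continuous_image) auto
  then obtain B where B: "\<And>x. 1 \<le> x \<Longrightarrow> x \<le> 2 \<Longrightarrow> \<bar>u x\<bar> \<le> B" unfolding bounded_iff by fastforce
  have ind: "u (x + real k) \<le> B" if "1 \<le> x" "x \<le> 2" for x k
  proof (induction k)
    case 0 then show ?case using B[OF that] by simp
  next
    case (Suc k)
    show ?case using Suc step[of "x + real k"] that by (simp add: add_ac)
  qed
  have "Gamma c \<le> exp B * c powr c * exp (-c)" if "c \<ge> 1" for c
  proof -
    define k where "k = nat \<lfloor>c - 1\<rfloor>"
    have "u ((c - real k) + real k) \<le> B"
      using that unfolding k_def by (intro ind) linarith+
    then have "exp (ln (Gamma c)) \<le> exp (B + c * ln c - c)" unfolding u_def by simp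
    then show ?thesis using that by (simp add: powr_def exp_diff exp_add exp_minus field_simps)
  qed
  then show ?thesis by (intro exI[of _ "exp B"]) auto
qed

section \<open>The Mellin-Barnes integral\<close>

definition gamma_prod :: "('a::finite \<Rightarrow> complex) \<Rightarrow> complex \<Rightarrow> complex" where
  "gamma_prod \<nu> s = (\<Prod>k\<in>UNIV. Gamma (s - \<nu> k))"

text \<open>Here w is a logarithm of y / n, so that the exponential is the branch of (y / n)^(- n s)
  on the cover.\<close>

definition barnes :: "('a::finite \<Rightarrow> complex) \<Rightarrow> complex \<Rightarrow> complex \<Rightarrow> complex" where
  "barnes \<nu> w s = gamma_prod \<nu> s * exp (- (of_nat CARD('a) * s * w))"

text \<open>The residue of \<open>barnes \<nu> w\<close> at \<open>\<nu> l - m\<close>.\<close>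

definition barnes_term :: "('a::finite \<Rightarrow> complex) \<Rightarrow> complex \<Rightarrow> 'a \<Rightarrow> nat \<Rightarrow> complex" where
  "barnes_term \<nu> w l m = (-1) ^ m / fact m * (\<Prod>k\<in>UNIV - {l}. Gamma (\<nu> l - \<nu> k - of_nat m)) *
     exp (- (of_nat CARD('a) * (\<nu> l - of_nat m) * w))"

definition vertical_integral :: "real \<Rightarrow> real \<Rightarrow> (complex \<Rightarrow> complex) \<Rightarrow> complex" where
  "vertical_integral c T F = contour_integral (linepath (Complex c (- T)) (Complex c T)) F"

text \<open>The majorant A / (1 + t^2) has integral A pi over the whole line. The bound is therefore
  independent of T and survives T -> infinity without improper integrals.\<close>

lemma norm_vertical_integral_le:
  assumes "T > 0" "A \<ge> 0"
    and F: "continuous_on {z. Re z = c} F"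
    and le: "\<And>t. norm (F (Complex c t)) \<le> A / (1 + t\<^sup>2)"
  shows "norm (vertical_integral c T F) \<le> A * pi"
proof -
  have 1: "vertical_integral c T F = \<i> * integral {-T..T} (\<lambda>x. F (Complex c x))"
    unfolding vertical_integral_def using assms by (intro contour_integral_linepath_same_Re) auto
  have hi: "((\<lambda>t. A / (1 + t\<^sup>2)) has_integral A * arctan T - A * arctan (-T)) {-T..T}"
  proof (rule fundamental_theorem_of_calculus)
    fix x
    have "((\<lambda>t. A * arctan t) has_real_derivative A / (1 + x\<^sup>2)) (at x within {-T..T})"
      by (auto intro!: derivative_eq_intros simp: divide_inverse)
    then show "((\<lambda>t. A * arctan t) has_vector_derivative A / (1 + x\<^sup>2)) (at x within {-T..T})"
      by (simp add: has_real_derivative_iff_has_vector_derivative)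
  qed (use assms in auto)
  have "norm (integral {-T..T} (\<lambda>x. F (Complex c x))) \<le> integral {-T..T} (\<lambda>t. A / (1 + t\<^sup>2))"
  proof (rule integral_norm_bound_integral)
    have "continuous_on {-T..T} (F \<circ> (\<lambda>x. Complex c x))"
      by (intro continuous_on_compose continuous_on_subset[OF F])
         (auto simp: Complex_eq intro!: continuous_intros)
    then show "(\<lambda>x. F (Complex c x)) integrable_on {-T..T}"
      by (intro integrable_continuous_real) (simp add: o_def)
  qed (use hi le in auto)
  also have "\<dots> = A * arctan T - A * arctan (-T)" using hi by (rule integral_unique)
  also have "\<dots> \<le> A * (pi/2) + A * (pi/2)"
  proof -
    have "A * arctan T \<le> A * (pi/2)" using assms arctan_ubound[of T] by (intro mult_left_mono) auto
    then show ?thesis by (simp add: arctan_minus)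
  qed
  finally show ?thesis unfolding 1 by (simp add: norm_mult)
qed

text \<open>Moving s to the right by N, until the rotated bound applies, multiplies Gamma by factors
  s + i of modulus at least |Im s| >= 1; the value at the shifted point dominates.\<close>

lemma norm_Gamma_strip:
  assumes "0 < \<theta>" "\<theta> < pi/2"
  shows "\<exists>C. \<forall>s. \<alpha> \<le> Re s \<and> Re s \<le> \<beta> \<and> \<bar>Im s\<bar> \<ge> 1 \<longrightarrow> norm (Gamma s) \<le> C * exp (- \<theta> * \<bar>Im s\<bar>)"
proof -
  define N where "N = nat \<lceil>1 - \<alpha>\<rceil>"
  define b where "b = max 1 (\<beta> + real N)"
  obtain C where C: "C > 0" "\<And>c. c \<ge> 1 \<Longrightarrow> Gamma (c::real) \<le> C * c powr c * exp (- c)"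
    using Gamma_real_upper_bound by blast
  have ct: "cos \<theta> > 0" "cos \<theta> \<le> 1" using assms by (auto intro!: cos_gt_zero_pi)
  have "norm (Gamma s) \<le> C * b powr b * cos \<theta> powr (-b) * exp (- \<theta> * \<bar>Im s\<bar>)"
    if s: "\<alpha> \<le> Re s" "Re s \<le> \<beta>" "\<bar>Im s\<bar> \<ge> 1" for s
  proof -
    have sn: "s \<notin> \<int>\<^sub>\<le>\<^sub>0" using s by (auto elim!: nonpos_Ints_cases)
    define s' where "s' = s + of_nat N"
    have N: "real N \<ge> 1 - \<alpha>" unfolding N_def by linarith
    have s': "Re s' \<ge> 1" "Re s' \<le> b" "Im s' = Im s" using s N unfolding s'_def b_def by auto
    have "pochhammer s N = Gamma s' / Gamma s" unfolding s'_def by (rule pochhammer_Gamma[OF sn])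
    moreover have "norm (pochhammer s N) \<ge> 1"
    proof -
      have "1 \<le> norm (s + of_nat i)" for i using abs_Im_le_cmod[of "s + of_nat i"] s by simp
      then have "(\<Prod>i\<in>{0..<N}. norm (s + of_nat i)) \<ge> 1" by (intro prod_ge_1) auto
      then show ?thesis unfolding pochhammer_prod prod_norm[symmetric] by simp
    qed
    moreover have "Gamma s \<noteq> 0" using sn by (simp add: Gamma_eq_zero_iff)
    ultimately have "norm (Gamma s) \<le> norm (Gamma s')"
      using mult_left_mono[of 1 "norm (pochhammer s N)" "norm (Gamma s)"] by (simp add: norm_divide field_simps norm_mult flip: norm_mult)
    also have "norm (Gamma s') * exp (\<theta> * \<bar>Im s\<bar>) \<le> Gamma (Re s') * cos \<theta> powr (- Re s')"
      using norm_Gamma_rotated[of s' "\<theta> * sgn (Im s)"] s' assms s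
      by (cases "Im s > 0") (auto simp: abs_mult sgn_if mult_ac abs_if)
    then have "norm (Gamma s') \<le> Gamma (Re s') * cos \<theta> powr (- Re s') * exp (- \<theta> * \<bar>Im s\<bar>)"
      by (simp add: exp_minus field_simps)
    also have "\<dots> \<le> (C * b powr b) * cos \<theta> powr (-b) * exp (- \<theta> * \<bar>Im s\<bar>)"
    proof (intro mult_right_mono mult_mono)
      have "Gamma (Re s') \<le> C * Re s' powr Re s' * exp (- Re s')" using C s' by auto
      also have "\<dots> \<le> C * b powr b * 1"
        using s' C by (intro mult_mono powr_mono_both) auto
      finally show "Gamma (Re s') \<le> C * b powr b" by simp
      show "cos \<theta> powr (- Re s') \<le> cos \<theta> powr (- b)" using ct s' by (intro powr_mono') auto
    qed (use C in auto)
    finally show ?thesis .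
  qed
  then show ?thesis by blast
qed

lemma barnes_holomorphic:
  assumes "\<And>z k. z \<in> A \<Longrightarrow> z - \<nu> k \<notin> \<int>\<^sub>\<le>\<^sub>0"
  shows "barnes \<nu> w holomorphic_on A"
  unfolding barnes_def[abs_def] gamma_prod_def using assms
  by (intro holomorphic_intros) auto

lemma barnes_continuous:
  assumes "\<And>z k. z \<in> A \<Longrightarrow> z - \<nu> k \<notin> \<int>\<^sub>\<le>\<^sub>0"
  shows "continuous_on A (barnes \<nu> w)"
  using barnes_holomorphic[OF assms] by (rule holomorphic_on_imp_continuous_on)

lemma barnes_strip:
  fixes \<nu> :: "'a::finite \<Rightarrow> complex"
  assumes "\<bar>Im w\<bar> < pi/2"
  shows "\<exists>C \<kappa> T. \<kappa> > 0 \<and> C \<ge> 0 \<and> (\<forall>s. \<alpha> \<le> Re s \<and> Re s \<le> \<beta> \<and> \<bar>Im s\<bar> \<ge> T \<longrightarrow>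
           norm (barnes \<nu> w s) \<le> C * exp (- \<kappa> * \<bar>Im s\<bar>))"
proof -
  \<comment> \<open>An angle strictly between |Im w| and pi/2: each of the n Gamma factors decays at
    rate \<theta>, the exponential grows at most at rate n |Im w|, and n (\<theta> - |Im w|) > 0 is
    left.\<close>
  define \<theta> where "\<theta> = (\<bar>Im w\<bar> + pi/2) / 2"
  have \<theta>: "0 < \<theta>" "\<theta> < pi/2" "\<bar>Im w\<bar> < \<theta>" using assms unfolding \<theta>_def by (auto simp: add_nonneg_pos)
  define B where "B = Max (range (\<lambda>k. norm (\<nu> k)))"
  have B: "norm (\<nu> k) \<le> B" for k unfolding B_def by (intro Max_ge) auto
  have B': "\<bar>Re (\<nu> k)\<bar> \<le> B" "\<bar>Im (\<nu> k)\<bar> \<le> B" for k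
    using B[of k] abs_Re_le_cmod[of "\<nu> k"] abs_Im_le_cmod[of "\<nu> k"] by linarith+
  obtain C where C: "\<And>s. \<alpha> - B \<le> Re s \<Longrightarrow> Re s \<le> \<beta> + B \<Longrightarrow> \<bar>Im s\<bar> \<ge> 1 \<Longrightarrow>
      norm (Gamma s) \<le> C * exp (- \<theta> * \<bar>Im s\<bar>)"
    using norm_Gamma_strip[OF \<theta>(1,2), of "\<alpha> - B" "\<beta> + B"] by metis
  define n where "n = real CARD('a)"
  have n: "n > 0" unfolding n_def by simp
  define D where "D = (\<bar>C\<bar> * exp (\<theta> * B)) ^ CARD('a) * exp (n * (\<bar>\<alpha>\<bar> + \<bar>\<beta>\<bar>) * \<bar>Re w\<bar>)"
  have "norm (barnes \<nu> w s) \<le> D * exp (- (n * (\<theta> - \<bar>Im w\<bar>)) * \<bar>Im s\<bar>)"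
    if s: "\<alpha> \<le> Re s" "Re s \<le> \<beta>" "\<bar>Im s\<bar> \<ge> 1 + B" for s
  proof -
    have "norm (gamma_prod \<nu> s) \<le> (\<Prod>k\<in>(UNIV::'a set). \<bar>C\<bar> * exp (\<theta> * B) * exp (- \<theta> * \<bar>Im s\<bar>))"
      unfolding gamma_prod_def prod_norm[symmetric]
    proof (intro prod_mono conjI)
      fix k
      have "norm (Gamma (s - \<nu> k)) \<le> C * exp (- \<theta> * \<bar>Im (s - \<nu> k)\<bar>)"
        using s B'[of k] by (intro C) auto
      also have "\<dots> \<le> \<bar>C\<bar> * exp (\<theta> * B - \<theta> * \<bar>Im s\<bar>)"
      proof (intro mult_mono)
        have "\<theta> * \<bar>Im s\<bar> \<le> \<theta> * (B + \<bar>Im (s - \<nu> k)\<bar>)" using \<theta> B'[of k] by (intro mult_left_mono) auto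
        then show "exp (- \<theta> * \<bar>Im (s - \<nu> k)\<bar>) \<le> exp (\<theta> * B - \<theta> * \<bar>Im s\<bar>)" by (simp add: algebra_simps)
      qed auto
      finally show "norm (Gamma (s - \<nu> k)) \<le> \<bar>C\<bar> * exp (\<theta> * B) * exp (- \<theta> * \<bar>Im s\<bar>)"
        by (simp add: exp_diff exp_minus field_simps)
    qed auto
    also have "\<dots> = (\<bar>C\<bar> * exp (\<theta> * B)) ^ CARD('a) * exp (- (n * \<theta>) * \<bar>Im s\<bar>)"
      by (simp add: power_mult_distrib exp_of_nat_mult[symmetric] n_def mult_ac)
    finally have 1: "norm (gamma_prod \<nu> s) \<le> (\<bar>C\<bar> * exp (\<theta> * B)) ^ CARD('a) * exp (- (n * \<theta>) * \<bar>Im s\<bar>)" .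
    have 2: "norm (exp (- (of_nat CARD('a) * s * w))) \<le> exp (n * (\<bar>\<alpha>\<bar> + \<bar>\<beta>\<bar>) * \<bar>Re w\<bar> + n * \<bar>Im w\<bar> * \<bar>Im s\<bar>)"
    proof -
      have a: "- (Re s * Re w) \<le> (\<bar>\<alpha>\<bar> + \<bar>\<beta>\<bar>) * \<bar>Re w\<bar>"
      proof -
        have "- (Re s * Re w) \<le> \<bar>Re s\<bar> * \<bar>Re w\<bar>" by (metis abs_ge_minus_self abs_mult)
        also have "\<dots> \<le> (\<bar>\<alpha>\<bar> + \<bar>\<beta>\<bar>) * \<bar>Re w\<bar>" using s by (intro mult_right_mono) auto
        finally show ?thesis .
      qed
      have b: "Im s * Im w \<le> \<bar>Im w\<bar> * \<bar>Im s\<bar>" by (metis abs_ge_self abs_mult mult.commute)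
      have "n * (- (Re s * Re w) + Im s * Im w) \<le> n * ((\<bar>\<alpha>\<bar> + \<bar>\<beta>\<bar>) * \<bar>Re w\<bar> + \<bar>Im w\<bar> * \<bar>Im s\<bar>)"
        using a b n by (intro mult_left_mono add_mono) auto
      then show ?thesis unfolding norm_exp_eq_Re n_def by (simp add: algebra_simps)
    qed
    have "norm (barnes \<nu> w s) \<le> ((\<bar>C\<bar> * exp (\<theta> * B)) ^ CARD('a) * exp (- (n * \<theta>) * \<bar>Im s\<bar>)) *
        exp (n * (\<bar>\<alpha>\<bar> + \<bar>\<beta>\<bar>) * \<bar>Re w\<bar> + n * \<bar>Im w\<bar> * \<bar>Im s\<bar>)"
      unfolding barnes_def norm_mult using 1 2 by (intro mult_mono) auto
    also have "\<dots> = D * exp (- (n * (\<theta> - \<bar>Im w\<bar>)) * \<bar>Im s\<bar>)"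
      unfolding D_def by (simp add: exp_add exp_minus exp_diff field_simps)
    finally show ?thesis .
  qed
  moreover have "n * (\<theta> - \<bar>Im w\<bar>) > 0" using n \<theta> by simp
  moreover have "D \<ge> 0" unfolding D_def by simp
  ultimately show ?thesis by blast
qed

lemma continuous_times_decay_bounded:
  fixes f :: "real \<Rightarrow> 'b::real_normed_vector"
  assumes f: "continuous_on UNIV f" and "\<kappa> > 0"
    and le: "\<And>t. \<bar>t\<bar> \<ge> T \<Longrightarrow> norm (f t) \<le> C * exp (- \<kappa> * \<bar>t\<bar>)"
  shows "\<exists>A\<ge>0. \<forall>t. norm (f t) \<le> A / (1 + t\<^sup>2)"
proof -
  have "((\<lambda>t. C * exp (- \<kappa> * t) * (1 + t^2)) \<longlongrightarrow> 0) at_top"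
    using \<open>\<kappa> > 0\<close> by real_asymp
  then have "eventually (\<lambda>t. norm (C * exp (- \<kappa> * t) * (1 + t^2)) < 1) at_top"
    by (intro order_tendstoD(2)[OF tendsto_norm_zero]) auto
  then obtain T1 where T1: "\<And>t. t \<ge> T1 \<Longrightarrow> \<bar>C * exp (- \<kappa> * t) * (1 + t^2)\<bar> < 1"
    unfolding eventually_at_top_linorder by auto
  define R where "R = max \<bar>T\<bar> \<bar>T1\<bar>"
  have "bounded (f ` {-R..R})"
    by (intro compact_imp_bounded compact_continuous_image continuous_on_subset[OF f]) auto
  then obtain B where B: "\<And>t. \<bar>t\<bar> \<le> R \<Longrightarrow> norm (f t) \<le> B" unfolding bounded_iff by (fastforce simp: abs_le_iff)
  have B0: "B \<ge> 0" using B[of 0] by (intro order_trans[OF norm_ge_zero[of "f 0"]]) (auto simp: R_def)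
  have "norm (f t) * (1 + t^2) \<le> B * (1 + R^2) + 1" for t
  proof (cases "\<bar>t\<bar> \<le> R")
    case True
    then have "t^2 \<le> R^2" by (metis abs_le_square_iff abs_ge_self order_trans)
    then have "norm (f t) * (1 + t^2) \<le> B * (1 + R^2)" using B[OF True] B0 by (intro mult_mono) auto
    then show ?thesis by simp
  next
    case False
    then have "norm (f t) * (1 + t^2) \<le> C * exp (- \<kappa> * \<bar>t\<bar>) * (1 + t^2)"
      by (intro mult_right_mono le) (auto simp: R_def)
    also have "\<dots> \<le> 1"
    proof -
      have "T1 \<le> \<bar>t\<bar>" using False by (auto simp: R_def)
      from T1[OF this] show ?thesis by (simp add: abs_less_iff)
    qed
    finally show ?thesis using B0 by (simp add: add_increasing)
  qed
  then have "norm (f t) \<le> (B * (1 + R^2) + 1) / (1 + t^2)" for t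
    by (simp add: pos_le_divide_eq add_pos_nonneg)
  then show ?thesis using B0 by (intro exI[of _ "B * (1 + R^2) + 1"]) auto
qed

lemma barnes_line_bound:
  assumes "\<bar>Im w\<bar> < pi/2" "\<And>k. Re (\<nu> k) < c"
  shows "\<exists>A\<ge>0. \<forall>t. norm (barnes \<nu> w (Complex c t)) \<le> A / (1 + t\<^sup>2)"
proof -
  obtain C \<kappa> T where *: "\<kappa> > 0" "\<And>s. c \<le> Re s \<Longrightarrow> Re s \<le> c \<Longrightarrow> \<bar>Im s\<bar> \<ge> T \<Longrightarrow>
      norm (barnes \<nu> w s) \<le> C * exp (- \<kappa> * \<bar>Im s\<bar>)"
    using barnes_strip[OF assms(1), of c c \<nu>] by metis
  have "continuous_on {z. Re z = c} (barnes \<nu> w)"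
    using assms by (intro barnes_continuous not_nonpos_Ints_if_Re_pos) auto
  then have "continuous_on UNIV (barnes \<nu> w \<circ> Complex c)"
    by (intro continuous_on_compose)
       (auto simp: Complex_eq[abs_def] intro!: continuous_intros elim: continuous_on_subset)
  then have "continuous_on UNIV (\<lambda>t. barnes \<nu> w (Complex c t))" by (simp add: o_def)
  then show ?thesis using *(1)
  proof (rule continuous_times_decay_bounded)
    show "norm (barnes \<nu> w (Complex c t)) \<le> C * exp (- \<kappa> * \<bar>t\<bar>)" if "\<bar>t\<bar> \<ge> T" for t
      using *(2)[of "Complex c t"] that by simp
  qed
qed

section \<open>Moving the line of integration to the left; residues\<close>

lemma Gamma_minus_of_nat:
  assumes "\<And>j. z - of_nat j \<notin> \<int>\<^sub>\<le>\<^sub>0"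
  shows "Gamma z = Gamma (z - of_nat L) * (\<Prod>j\<in>{1..L}. z - of_nat j)"
proof (induction L)
  case (Suc L)
  have "Gamma (z - of_nat (Suc L) + 1) = (z - of_nat (Suc L)) * Gamma (z - of_nat (Suc L))"
    using assms by (intro Gamma_plus1)
  moreover have "z - of_nat (Suc L) + 1 = z - of_nat L" by simp
  ultimately have "Gamma (z - of_nat L) = (z - of_nat (Suc L)) * Gamma (z - of_nat (Suc L))" by simp
  then show ?case using Suc by (simp add: mult_ac)
qed simp

text \<open>The integrand on a line moved L units to the left is compared pointwise with that on the
  original line. The linear factors will be bounded below by their real parts, which makes the
  comparison uniform along the line.\<close>

lemma barnes_shift:
  fixes \<nu> :: "'a::finite \<Rightarrow> complex"
  assumes "\<And>k. s - \<nu> k \<notin> \<int>"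
  shows "norm (barnes \<nu> w (s - of_nat L)) =
     norm (barnes \<nu> w s) * (exp (real CARD('a) * real L * Re w) / (\<Prod>k\<in>UNIV. \<Prod>j\<in>{1..L}. norm (s - \<nu> k - of_nat j)))"
proof -
  have ni: "s - \<nu> k - of_nat j \<notin> \<int>" for k j
    using assms[of k] Ints_add[of "s - \<nu> k - of_nat j" "of_nat j"] by auto
  have nz: "s - \<nu> k - of_nat j \<noteq> 0" for k j using ni[of k j] by (metis Ints_0)
  have "Gamma (s - of_nat L - \<nu> k) = Gamma (s - \<nu> k) / (\<Prod>j\<in>{1..L}. s - \<nu> k - of_nat j)" for k
  proof -
    have "Gamma (s - \<nu> k) = Gamma (s - \<nu> k - of_nat L) * (\<Prod>j\<in>{1..L}. s - \<nu> k - of_nat j)"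
      using ni[of k] by (intro Gamma_minus_of_nat) (metis not_in_Ints_imp_not_in_nonpos_Ints)
    moreover have "(\<Prod>j\<in>{1..L}. s - \<nu> k - of_nat j) \<noteq> 0" using nz[of k] by simp
    moreover have "s - of_nat L - \<nu> k = s - \<nu> k - of_nat L" by simp
    ultimately show ?thesis by (metis nonzero_mult_div_cancel_right)
  qed
  then have "gamma_prod \<nu> (s - of_nat L) = gamma_prod \<nu> s / (\<Prod>k\<in>UNIV. \<Prod>j\<in>{1..L}. s - \<nu> k - of_nat j)"
    unfolding gamma_prod_def by (simp add: prod_dividef)
  moreover have "exp (- (of_nat CARD('a) * (s - of_nat L) * w)) =
      exp (- (of_nat CARD('a) * s * w)) * exp (of_nat CARD('a) * of_nat L * w)"
    unfolding exp_add[symmetric] by (simp add: algebra_simps)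
  ultimately show ?thesis unfolding barnes_def
    by (simp add: norm_mult norm_divide prod_norm norm_exp_eq_Re)
qed

text \<open>Factorial growth of the products beats the exponential; the limit is read off from
  summability by the ratio test. The hypothesis keeps every factor nonzero.\<close>

lemma exp_over_products_tendsto_0:
  fixes d :: "'a::finite \<Rightarrow> real"
  assumes "\<And>k j::nat. d k \<noteq> real j"
  shows "(\<lambda>L. exp (real L * r) / (\<Prod>k\<in>UNIV. \<Prod>j\<in>{1..L}. \<bar>d k - real j\<bar>)) \<longlonglongrightarrow> 0"
proof -
  define f where "f L = exp (real L * r) / (\<Prod>k\<in>UNIV. \<Prod>j\<in>{1..L}. \<bar>d k - real j\<bar>)" for L
  define D where "D = Max (range d)"
  have D: "d k \<le> D" for k unfolding D_def by (intro Max_ge) auto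
  define L0 where "L0 = nat \<lceil>D + 1 + 2 * exp r\<rceil>"
  have f0: "f L \<ge> 0" for L unfolding f_def by (intro divide_nonneg_nonneg prod_nonneg) auto
  have "summable f"
  proof (rule summable_ratio_test[of "1/2"])
    fix L assume "L0 \<le> L"
    then have L: "real L \<ge> D + 1 + 2 * exp r" unfolding L0_def by linarith
    have "\<bar>d k - real (Suc L)\<bar> \<ge> 1 + 2 * exp r" for k using L D[of k] exp_ge_zero[of r] by linarith
    then have b: "\<bar>d k - real (Suc L)\<bar> \<ge> 1" "\<bar>d k - real (Suc L)\<bar> \<ge> 2 * exp r" for k
      using exp_ge_zero[of r] by (meson add_increasing2 add_increasing order_trans le_add_same_cancel1 mult_nonneg_nonneg zero_le_numeral zero_le_one order_refl)+
    have "(\<Prod>k\<in>UNIV. \<bar>d k - real (Suc L)\<bar>) \<ge> 2 * exp r"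
    proof -
      \<comment> \<open>One factor supplies 2 exp r, the others are at least 1.\<close>
      obtain k0 :: 'a where True by simp
      have "(\<Prod>k\<in>UNIV. \<bar>d k - real (Suc L)\<bar>) = \<bar>d k0 - real (Suc L)\<bar> * (\<Prod>k\<in>UNIV-{k0}. \<bar>d k - real (Suc L)\<bar>)"
        by (rule prod.remove) auto
      moreover have "(\<Prod>k\<in>UNIV-{k0}. \<bar>d k - real (Suc L)\<bar>) \<ge> 1" using b by (intro prod_ge_1) auto
      ultimately show ?thesis using mult_mono[OF b(2)[of k0], of 1 "(\<Prod>k\<in>UNIV-{k0}. \<bar>d k - real (Suc L)\<bar>)"] by simp
    qed
    then have "exp r / (\<Prod>k\<in>UNIV. \<bar>d k - real (Suc L)\<bar>) \<le> exp r / (2 * exp r)"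
      by (intro divide_left_mono) (use exp_gt_zero[of r] in \<open>auto intro!: mult_pos_pos prod_pos simp: assms[of _ "Suc L", simplified]\<close>)
    moreover have "f (Suc L) = f L * (exp r / (\<Prod>k\<in>UNIV. \<bar>d k - real (Suc L)\<bar>))"
      unfolding f_def by (simp add: prod.distrib exp_add algebra_simps)
    moreover have "exp r / (2 * exp r) = 1 / 2" by simp
    ultimately have "f (Suc L) \<le> f L * (1/2)" using f0[of L] by (metis mult_left_mono)
    then show "norm (f (Suc L)) \<le> 1/2 * norm (f L)" using f0 by simp
  qed simp
  then show ?thesis unfolding f_def by (rule summable_LIMSEQ_zero)
qed

lemma barnes_residue:
  fixes \<nu> :: "'a::finite \<Rightarrow> complex"
  assumes gen: "\<And>k l. k \<noteq> l \<Longrightarrow> \<nu> k - \<nu> l \<notin> \<int>"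
  shows "residue (barnes \<nu> w) (\<nu> l - of_nat j) = barnes_term \<nu> w l j"
proof -
  define p where "p = \<nu> l - of_nat j"
  \<comment> \<open>The complement of all poles of the Gamma factors other than p: within S only the
    l-th factor can be singular, and only at p.\<close>
  define S where "S = - (\<Union>k. (\<lambda>x. \<nu> k + x) ` (\<int>\<^sub>\<le>\<^sub>0 - {p - \<nu> k}))"
  have S: "open S" unfolding S_def
    by (intro open_Compl closed_UN closed_translation closed_subset_Ints ballI) (auto dest: nonpos_Ints_Int)
  have pn: "p - \<nu> k \<notin> \<int>" if "k \<noteq> l" for k
  proof
    assume "p - \<nu> k \<in> \<int>"
    then have "p - \<nu> k + of_nat j \<in> \<int>" by (intro Ints_add) auto
    then show False using gen[of l k] that by (simp add: p_def)
  qed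
  have pS: "p \<in> S" unfolding S_def by auto
  have hol: "barnes \<nu> w holomorphic_on S - {p}"
  proof (rule barnes_holomorphic)
    fix z k assume z: "z \<in> S - {p}"
    show "z - \<nu> k \<notin> \<int>\<^sub>\<le>\<^sub>0"
    proof
      assume "z - \<nu> k \<in> \<int>\<^sub>\<le>\<^sub>0"
      then have "z \<in> (\<lambda>x. \<nu> k + x) ` (\<int>\<^sub>\<le>\<^sub>0 - {p - \<nu> k})"
        using z by (intro image_eqI[of _ _ "z - \<nu> k"]) auto
      then show False using z unfolding S_def by blast
    qed
  qed
  define R where "R z = (\<Prod>k\<in>UNIV - {l}. Gamma (z - \<nu> k)) * exp (- (of_nat CARD('a) * z * w))" for z
  have R: "isCont R p" unfolding R_def using pn not_in_Ints_imp_not_in_nonpos_Ints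
    by (intro continuous_intros) auto
  have fl: "filterlim (\<lambda>z. z - \<nu> l) (at (- of_nat j)) (at p)"
  proof (rule filterlim_atI)
    have "((\<lambda>z. z - \<nu> l) \<longlongrightarrow> p - \<nu> l) (at p)" by (intro tendsto_intros)
    then show "((\<lambda>z. z - \<nu> l) \<longlongrightarrow> - of_nat j) (at p)" by (simp add: p_def)
    show "\<forall>\<^sub>F x in at p. x - \<nu> l \<noteq> - of_nat j"
      unfolding eventually_at_filter by (auto simp: p_def algebra_simps)
  qed
  have "((\<lambda>z. Gamma (z - \<nu> l) * ((z - \<nu> l) + of_nat j)) \<longlongrightarrow> (-1) ^ j / fact j) (at p)"
    by (rule filterlim_compose[OF Gamma_residues fl])
  then have "((\<lambda>z. (Gamma (z - \<nu> l) * ((z - \<nu> l) + of_nat j)) * R z) \<longlongrightarrow> ((-1) ^ j / fact j) * R p) (at p)"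
    using R unfolding isCont_def by (rule tendsto_mult)
  moreover have "(Gamma (z - \<nu> l) * ((z - \<nu> l) + of_nat j)) * R z = barnes \<nu> w z * (z - p)" for z
    unfolding R_def barnes_def gamma_prod_def p_def by (subst (2) prod.remove[of _ l]) (auto simp: algebra_simps)
  ultimately have "((\<lambda>z. barnes \<nu> w z * (z - p)) \<longlongrightarrow> ((-1) ^ j / fact j) * R p) (at p)" by simp
  from residue_simple'[OF S pS hol this]
  show ?thesis unfolding p_def R_def barnes_term_def by (simp add: algebra_simps)
qed

lemma barnes_rectangle:
  fixes \<nu> :: "'a::finite \<Rightarrow> complex"
  assumes gen: "\<And>k l. k \<noteq> l \<Longrightarrow> \<nu> k - \<nu> l \<notin> \<int>"
    and T: "\<And>k. \<bar>Im (\<nu> k)\<bar> < T" and c: "\<And>k. Re (\<nu> k) < c"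
    and x: "x < c" "\<And>k j. Re (\<nu> k) - real j \<noteq> x"
  shows "contour_integral (rectpath (Complex x (-T)) (Complex c T)) (barnes \<nu> w) =
     2 * pi * \<i> * (\<Sum>l\<in>UNIV. \<Sum>j | x < Re (\<nu> l) - real j. barnes_term \<nu> w l j)"
proof -
  define J where "J y l = {j. y < Re (\<nu> l) - real j}" for y l
  have fJ: "finite (J y l)" for y l
  proof (rule finite_subset)
    show "J y l \<subseteq> {..nat \<lceil>Re (\<nu> l) - y\<rceil>}" unfolding J_def by (auto) linarith
  qed simp
  define g where "g = (\<lambda>(l,j). \<nu> l - of_nat j :: complex)"
  \<comment> \<open>The open set S reaches beyond the left side of the rectangle, so the poles with
    real part between x - 1 and x have to be listed too; their winding number is 0.\<close>
  define pts where "pts = g ` Sigma UNIV (J (x - 1))"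
  define S where "S = {z. x - 1 < Re z}"
  define P where "P = rectpath (Complex x (-T)) (Complex c T)"
  have T0: "T > 0" using T[of undefined] by linarith
  have S: "open S" "convex S" unfolding S_def by (auto intro: open_halfspace_Re_gt convex_halfspace_Re_gt)
  have inj: "inj_on g A" for A
  proof (rule inj_onI)
    fix p q assume "g p = g q"
    then have e: "\<nu> (fst p) - \<nu> (fst q) = of_nat (snd p) - of_nat (snd q)"
      unfolding g_def by (auto simp: case_prod_beta algebra_simps)
    then have "\<nu> (fst p) - \<nu> (fst q) \<in> \<int>" by simp
    then have "fst p = fst q" using gen by blast
    with e show "p = q" by (auto simp: prod_eq_iff)
  qed
  have hol: "barnes \<nu> w holomorphic_on S - pts"
  proof (rule barnes_holomorphic)
    fix z k assume z: "z \<in> S - pts"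
    show "z - \<nu> k \<notin> \<int>\<^sub>\<le>\<^sub>0"
    proof
      assume "z - \<nu> k \<in> \<int>\<^sub>\<le>\<^sub>0"
      then obtain j where j: "z - \<nu> k = - of_nat j" by (auto elim!: nonpos_Ints_cases')
      then have "z = g (k, j)" by (simp add: g_def algebra_simps)
      moreover have "Re z = Re (\<nu> k) - real j" using j by (simp add: complex_eq_iff)
      ultimately show False using z unfolding pts_def S_def J_def by auto
    qed
  qed
  have img: "path_image P \<subseteq> S - pts"
  proof
    fix z assume "z \<in> path_image P"
    then have z: "(Re z = x \<or> Re z = c) \<or> (x \<le> Re z \<and> (Im z = T \<or> Im z = - T))" "x \<le> Re z"
      using x T0 unfolding P_def by (auto simp: path_image_rectpath)
    have "z \<notin> pts"
    proof
      assume "z \<in> pts"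
      then obtain k j where kj: "z = \<nu> k - of_nat j" unfolding pts_def g_def by auto
      then show False using z(1) x(2)[of k j] c[of k] T[of k] by auto
    qed
    then show "z \<in> S - pts" using z unfolding S_def by auto
  qed
  have wn: "winding_number P (g (l, j)) = (if j \<in> J x l then 1 else 0)" if "j \<in> J (x-1) l" for l j
  proof (cases "j \<in> J x l")
    case True
    then have "g (l,j) \<in> box (Complex x (-T)) (Complex c T)"
      using c[of l] T[of l] unfolding in_box_complex_iff J_def g_def by auto
    then show ?thesis using True unfolding P_def by (simp add: winding_number_rectpath)
  next
    case False
    then have "g (l,j) \<notin> cbox (Complex x (-T)) (Complex c T)"
      using x(2)[of l j] unfolding in_cbox_complex_iff J_def g_def by auto
    then show ?thesis using False x T0 unfolding P_def by (simp add: winding_number_rectpath_outside)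
  qed
  have "contour_integral P (barnes \<nu> w) = 2 * pi * \<i> * (\<Sum>p\<in>pts. winding_number P p * residue (barnes \<nu> w) p)"
  proof (rule Residue_theorem[of S])
    show "finite pts" unfolding pts_def using fJ by auto
    show "\<forall>z. z \<notin> S \<longrightarrow> winding_number P z = 0"
    proof (intro allI impI)
      fix z assume "z \<notin> S"
      then have "z \<notin> cbox (Complex x (-T)) (Complex c T)" unfolding S_def in_cbox_complex_iff by auto
      then show "winding_number P z = 0" using x T0 unfolding P_def by (simp add: winding_number_rectpath_outside)
    qed
  qed (use S hol img in \<open>auto simp: P_def convex_connected\<close>)
  also have "(\<Sum>p\<in>pts. winding_number P p * residue (barnes \<nu> w) p) =
     (\<Sum>(l,j)\<in>Sigma UNIV (J (x-1)). winding_number P (g (l,j)) * residue (barnes \<nu> w) (g (l,j)))"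
    unfolding pts_def by (subst sum.reindex[OF inj]) (auto intro!: sum.cong)
  also have "\<dots> = (\<Sum>(l,j)\<in>Sigma UNIV (J (x-1)). if j \<in> J x l then barnes_term \<nu> w l j else 0)"
  proof (intro sum.cong refl)
    have res: "residue (barnes \<nu> w) (\<nu> l - of_nat j) = barnes_term \<nu> w l j" for l j
      by (intro barnes_residue gen)
    fix q assume "q \<in> Sigma UNIV (J (x-1))"
    then show "(case q of (l, j) \<Rightarrow> winding_number P (g (l,j)) * residue (barnes \<nu> w) (g (l,j))) =
        (case q of (l, j) \<Rightarrow> if j \<in> J x l then barnes_term \<nu> w l j else 0)"
      using wn by (auto simp: g_def res)
  qed
  also have "\<dots> = (\<Sum>l\<in>UNIV. \<Sum>j\<in>J (x-1) l. if j \<in> J x l then barnes_term \<nu> w l j else 0)"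
    using fJ by (subst sum.Sigma) auto
  also have "\<dots> = (\<Sum>l\<in>UNIV. \<Sum>j\<in>J x l. barnes_term \<nu> w l j)"
  proof (rule sum.cong)
    fix l
    have "J (x - 1) l \<inter> {j. j \<in> J x l} = J x l" unfolding J_def by auto
    then show "(\<Sum>j\<in>J (x-1) l. if j \<in> J x l then barnes_term \<nu> w l j else 0) = (\<Sum>j\<in>J x l. barnes_term \<nu> w l j)"
      using sum.inter_restrict[OF fJ[of "x - 1" l], of "barnes_term \<nu> w l" "{j. j \<in> J x l}"] by simp
  qed simp
  finally show ?thesis unfolding P_def J_def .
qed

lemma barnes_term_summable:
  fixes \<nu> :: "'a::finite \<Rightarrow> complex"
  assumes gen: "\<And>k l. k \<noteq> l \<Longrightarrow> \<nu> k - \<nu> l \<notin> \<int>"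
  shows "summable (barnes_term \<nu> w l)"
proof (rule summable_ratio_test[of "1/2"])
  define E where "E = exp (of_nat CARD('a) * w)"
  define B where "B = Max (range (\<lambda>k. norm (\<nu> l - \<nu> k)))"
  have B: "norm (\<nu> l - \<nu> k) \<le> B" for k unfolding B_def by (intro Max_ge) auto
  \<comment> \<open>From this threshold on every linear factor has modulus at least 1 and m + 1 is
    at least 2 |E|, which gives the ratio 1/2.\<close>
  fix m assume "m \<ge> nat \<lceil>B + 1 + 2 * norm E\<rceil>"
  then have m: "real m \<ge> B + 1 + 2 * norm E" by linarith
  have B0: "B \<ge> 0" using B[of l] by simp
  have G: "Gamma (\<nu> l - \<nu> k - of_nat (Suc m)) = Gamma (\<nu> l - \<nu> k - of_nat m) / (\<nu> l - \<nu> k - of_nat (Suc m))"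
    if "k \<noteq> l" for k
  proof -
    have ni: "\<nu> l - \<nu> k - of_nat (Suc m) \<notin> \<int>"
    proof
      assume "\<nu> l - \<nu> k - of_nat (Suc m) \<in> \<int>"
      then have "\<nu> l - \<nu> k - of_nat (Suc m) + of_nat (Suc m) \<in> \<int>" by (intro Ints_add) auto
      then show False using gen[of l k] that by simp
    qed
    then have "Gamma (\<nu> l - \<nu> k - of_nat (Suc m) + 1) = (\<nu> l - \<nu> k - of_nat (Suc m)) * Gamma (\<nu> l - \<nu> k - of_nat (Suc m))"
      by (intro Gamma_plus1) (use not_in_Ints_imp_not_in_nonpos_Ints in blast)
    moreover have "\<nu> l - \<nu> k - of_nat (Suc m) + 1 = \<nu> l - \<nu> k - of_nat m" by simp
    moreover have "\<nu> l - \<nu> k - of_nat (Suc m) \<noteq> 0" using ni by (metis Ints_0)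
    ultimately show ?thesis by (metis nonzero_mult_div_cancel_left)
  qed
  have e: "exp (- (of_nat CARD('a) * (\<nu> l - of_nat (Suc m)) * w)) = exp (- (of_nat CARD('a) * (\<nu> l - of_nat m) * w)) * E"
    unfolding E_def exp_add[symmetric] by (simp add: algebra_simps)
  have "barnes_term \<nu> w l (Suc m) = barnes_term \<nu> w l m * (- E / (of_nat (Suc m) * (\<Prod>k\<in>UNIV-{l}. \<nu> l - \<nu> k - of_nat (Suc m))))"
    unfolding barnes_term_def e by (simp add: G prod_dividef mult_ac del: of_nat_Suc)
  moreover have "norm (- E / (of_nat (Suc m) * (\<Prod>k\<in>UNIV-{l}. \<nu> l - \<nu> k - of_nat (Suc m)))) \<le> 1/2"
  proof -
    have n1: "1 \<le> norm (\<nu> l - \<nu> k - of_nat (Suc m))" for k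
    proof -
      have "norm (of_nat (Suc m) :: complex) - norm (\<nu> l - \<nu> k) \<le> norm (of_nat (Suc m) - (\<nu> l - \<nu> k))"
        by (rule norm_triangle_ineq2)
      moreover have "norm (of_nat (Suc m) :: complex) = real (Suc m)" by (rule norm_of_nat)
      moreover have "norm (of_nat (Suc m) - (\<nu> l - \<nu> k)) = norm (\<nu> l - \<nu> k - of_nat (Suc m))"
        by (rule norm_minus_commute)
      moreover have "norm E \<ge> 0" by simp
      ultimately show ?thesis using B[of k] m by linarith
    qed
    define P where "P = (\<Prod>k\<in>UNIV-{l}. norm (\<nu> l - \<nu> k - of_nat (Suc m)))"
    have P: "1 \<le> P" unfolding P_def using n1 by (intro prod_ge_1) auto
    have "real (Suc m) \<ge> 2 * norm E" using m B0 by simp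
    then have "2 * norm E * 1 \<le> real (Suc m) * P" using P by (intro mult_mono) auto
    moreover have "real (Suc m) * P > 0" using P by (intro mult_pos_pos) auto
    ultimately have "norm E / (real (Suc m) * P) \<le> 1/2" by (simp add: pos_divide_le_eq)
    then show ?thesis
      by (simp add: norm_divide norm_mult prod_norm[symmetric] P_def del: of_nat_Suc)
  qed
  ultimately have "norm (barnes_term \<nu> w l (Suc m)) \<le> norm (barnes_term \<nu> w l m) * (1/2)"
    by (simp only: norm_mult) (rule mult_left_mono, auto)
  then show "norm (barnes_term \<nu> w l (Suc m)) \<le> 1/2 * norm (barnes_term \<nu> w l m)" by simp
qed simp

text \<open>Only countably many abscissae are integer translates of some Re (\<nu> k). Avoiding all
  of them at once ensures that none of the lines c0 - L meets a pole.\<close>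

lemma exists_gt_avoiding:
  fixes \<nu> :: "'a::finite \<Rightarrow> complex"
  shows "\<exists>c0<c. (\<forall>k. Re (\<nu> k) < c \<longrightarrow> Re (\<nu> k) < c0) \<and> (\<forall>k. c0 - Re (\<nu> k) \<notin> \<int>)"
proof -
  define b where "b = Max (insert (c - 1) ((\<lambda>k. Re (\<nu> k)) ` {k. Re (\<nu> k) < c}))"
  have b: "b < c" "\<And>k. Re (\<nu> k) < c \<Longrightarrow> Re (\<nu> k) \<le> b" unfolding b_def by auto
  define X where "X = (\<Union>k. (\<lambda>i. Re (\<nu> k) + i) ` (\<int> :: real set))"
  have "countable X" unfolding X_def by (auto simp: Ints_def intro!: countable_UN countable_image)
  moreover have "uncountable {b<..<c}" using b by (simp add: uncountable_open_interval)
  ultimately obtain c0 where c0: "c0 \<in> {b<..<c}" "c0 \<notin> X"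
    by (metis countable_subset subsetI)
  have "c0 - Re (\<nu> k) \<notin> \<int>" for k
  proof
    assume "c0 - Re (\<nu> k) \<in> \<int>"
    then have "c0 \<in> X" unfolding X_def by (auto intro!: bexI[of _ "c0 - Re (\<nu> k)"] exI[of _ k] simp: image_iff)
    with c0 show False by simp
  qed
  then show ?thesis using c0 b by (intro exI[of _ c0]) force
qed

text \<open>The rectangle lies between c0 - L and c. For fixed L the horizontal sides vanish as T ->
  infinity and the left side is at most \<open>\<rho> L * A * pi\<close>; only afterwards does L
  tend to infinity. This order requires decay of the integrand in one fixed strip at a time.\<close>

theorem barnes_vertical_integral:
  fixes \<nu> :: "'a::finite \<Rightarrow> complex"
  assumes gen: "\<And>k l. k \<noteq> l \<Longrightarrow> \<nu> k - \<nu> l \<notin> \<int>"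
    and w: "\<bar>Im w\<bar> < pi/2" and c: "\<And>k. Re (\<nu> k) < c"
  shows "((\<lambda>T. vertical_integral c T (barnes \<nu> w)) \<longlongrightarrow>
           2 * pi * \<i> * (\<Sum>l\<in>UNIV. \<Sum>j. barnes_term \<nu> w l j)) at_top"
proof -
  obtain c0 where c0: "c0 < c" "\<And>k. Re (\<nu> k) < c0" "\<And>k. c0 - Re (\<nu> k) \<notin> \<int>"
    using exists_gt_avoiding[of c \<nu>] c by auto
  obtain A where A: "A \<ge> 0" "\<And>t. norm (barnes \<nu> w (Complex c0 t)) \<le> A / (1 + t\<^sup>2)"
    using barnes_line_bound[OF w, of \<nu> c0] c0 by blast
  define d where "d k = c0 - Re (\<nu> k)" for k
  have d: "d k \<noteq> real j" for k j using c0(3)[of k] unfolding d_def by auto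
  define \<rho> where "\<rho> L = exp (real L * (real CARD('a) * Re w)) / (\<Prod>k\<in>UNIV. \<Prod>j\<in>{1..L}. \<bar>d k - real j\<bar>)" for L
  have \<rho>: "\<rho> \<longlonglongrightarrow> 0" unfolding \<rho>_def by (intro exp_over_products_tendsto_0 d)
  have \<rho>0: "\<rho> L \<ge> 0" for L unfolding \<rho>_def by (intro divide_nonneg_nonneg prod_nonneg) auto
  define S where "S = (\<Sum>l\<in>UNIV. \<Sum>j. barnes_term \<nu> w l j)"
  define SL where "SL L = (\<Sum>l\<in>UNIV. \<Sum>j | c0 - real L < Re (\<nu> l) - real j. barnes_term \<nu> w l j)" for L
  have SL: "SL \<longlonglongrightarrow> S" unfolding SL_def S_def
  proof (intro tendsto_sum)
    fix l
    have e: "{j. c0 - real L < Re (\<nu> l) - real j} = {..<nat \<lceil>real L - d l\<rceil>}" for L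
      unfolding d_def by (auto; linarith)
    have "filterlim (\<lambda>L. nat \<lceil>real L - d l\<rceil>) sequentially sequentially"
      unfolding filterlim_at_top
    proof
      fix Z
      have "Z \<le> nat \<lceil>real L - d l\<rceil>" if "L \<ge> nat \<lceil>real Z + d l\<rceil>" for L
        using that by linarith
      then show "\<forall>\<^sub>F L in sequentially. Z \<le> nat \<lceil>real L - d l\<rceil>" unfolding eventually_sequentially by blast
    qed
    from filterlim_compose[OF summable_LIMSEQ[OF barnes_term_summable[OF gen]] this]
    show "(\<lambda>L. \<Sum>j | c0 - real L < Re (\<nu> l) - real j. barnes_term \<nu> w l j) \<longlonglongrightarrow> (\<Sum>j. barnes_term \<nu> w l j)"
      unfolding e .
  qed
  \<comment> \<open>The estimate for one fixed L: the first summand bounds the left side of the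
    rectangle, e absorbs the two horizontal sides.\<close>
  have main: "eventually (\<lambda>T. norm (vertical_integral c T (barnes \<nu> w) - 2 * pi * \<i> * SL L) < \<rho> L * A * pi + e) at_top"
    if e: "e > 0" for L e
  proof -
    define x where "x = c0 - real L"
    have x: "x < c" using c0 unfolding x_def by simp
    have xn: "x - Re (\<nu> k) + real i \<noteq> real j" for k i j
    proof
      assume "x - Re (\<nu> k) + real i = real j"
      then have "c0 - Re (\<nu> k) = of_nat L + of_nat j - of_nat i" unfolding x_def by simp
      then show False using c0(3)[of k] by (metis Ints_add Ints_diff Ints_of_nat)
    qed
    obtain C \<kappa> T0 where C: "\<kappa> > 0" "C \<ge> 0" "\<And>s. x \<le> Re s \<Longrightarrow> Re s \<le> c \<Longrightarrow> \<bar>Im s\<bar> \<ge> T0 \<Longrightarrow>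
        norm (barnes \<nu> w s) \<le> C * exp (- \<kappa> * \<bar>Im s\<bar>)"
      using barnes_strip[OF w, of x c \<nu>] by metis
    have "((\<lambda>T. 2 * (C * exp (- \<kappa> * T) * (c - x))) \<longlongrightarrow> 0) at_top" using C(1) by real_asymp
    then have "eventually (\<lambda>T. 2 * (C * exp (- \<kappa> * T) * (c - x)) < e) at_top"
      using e by (rule order_tendstoD(2))
    moreover have "eventually (\<lambda>T. T > max 0 (Max (insert T0 (range (\<lambda>k. \<bar>Im (\<nu> k)\<bar>))))) at_top"
      by (rule eventually_gt_at_top)
    ultimately show ?thesis
    proof eventually_elim
      case (elim T)
      then have T: "T > 0" "T > T0" "\<And>k. T > \<bar>Im (\<nu> k)\<bar>" by auto
      define F where "F = barnes \<nu> w"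
      have np: "z - \<nu> k \<notin> \<int>\<^sub>\<le>\<^sub>0" if "\<bar>Im z\<bar> = T \<or> Re z = c \<or> Re z = x" for z k
      proof
        assume "z - \<nu> k \<in> \<int>\<^sub>\<le>\<^sub>0"
        then obtain j where "z - \<nu> k = - of_nat j" by (auto elim!: nonpos_Ints_cases')
        then have "Re z = Re (\<nu> k) - real j" "Im z = Im (\<nu> k)" by (auto simp: complex_eq_iff)
        then show False using that T(3)[of k] xn[of k j 0] c[of k] by auto
      qed
      have cF: "continuous_on {z. \<bar>Im z\<bar> = T \<or> Re z = c \<or> Re z = x} F"
        unfolding F_def using np by (intro barnes_continuous) auto
      define a1 a2 a3 a4 where "a1 = Complex x (-T)" "a2 = Complex c (-T)" "a3 = Complex c T" "a4 = Complex x T"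
      have sg: "closed_segment a1 a2 \<subseteq> {z. Im z = - T \<and> x \<le> Re z \<and> Re z \<le> c}"
        "closed_segment a3 a4 \<subseteq> {z. Im z = T \<and> x \<le> Re z \<and> Re z \<le> c}"
        "closed_segment a2 a3 \<subseteq> {z. Re z = c}" "closed_segment a4 a1 \<subseteq> {z. Re z = x}"
        using x T by (auto simp: a1_a2_a3_a4_def closed_segment_same_Re closed_segment_same_Im closed_segment_eq_real_ivl)
      have ci: "F contour_integrable_on linepath a1 a2" "F contour_integrable_on linepath a2 a3"
        "F contour_integrable_on linepath a3 a4" "F contour_integrable_on linepath a4 a1"
        using sg T by (auto intro!: contour_integrable_continuous_linepath continuous_on_subset[OF cF])
      have rect: "contour_integral (rectpath a1 a3) F = contour_integral (linepath a1 a2) F +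
          (contour_integral (linepath a2 a3) F + (contour_integral (linepath a3 a4) F + contour_integral (linepath a4 a1) F))"
      proof -
        have "rectpath a1 a3 = linepath a1 a2 +++ linepath a2 a3 +++ linepath a3 a4 +++ linepath a4 a1"
          by (simp add: rectpath_def Let_def a1_a2_a3_a4_def)
        moreover have "F contour_integrable_on (linepath a3 a4 +++ linepath a4 a1)"
          using ci by (intro contour_integrable_joinI) auto
        moreover from this have "F contour_integrable_on (linepath a2 a3 +++ linepath a3 a4 +++ linepath a4 a1)"
          using ci by (intro contour_integrable_joinI) auto
        ultimately show ?thesis using ci by (simp only: contour_integral_join valid_path_linepath
            valid_path_join_eq pathstart_join pathfinish_join pathstart_linepath pathfinish_linepath)
      qed
      have xn': "Re (\<nu> k) - real j \<noteq> x" for k j using xn[of k j 0] by auto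
      have "contour_integral (rectpath a1 a3) F = 2 * pi * \<i> * SL L"
        unfolding a1_a2_a3_a4_def F_def SL_def x_def[symmetric]
        by (rule barnes_rectangle) (use gen T c x xn' in auto)
      moreover have "vertical_integral c T F = contour_integral (linepath a2 a3) F"
        unfolding vertical_integral_def a1_a2_a3_a4_def by simp
      ultimately have eq: "vertical_integral c T F - 2 * pi * \<i> * SL L =
          - (contour_integral (linepath a1 a2) F + contour_integral (linepath a3 a4) F) - contour_integral (linepath a4 a1) F"
        unfolding rect by (simp add: algebra_simps)
      have b1: "norm (contour_integral (linepath a1 a2) F) \<le> C * exp (- \<kappa> * T) * norm (a2 - a1)"
      proof (rule contour_integral_bound_linepath[OF ci(1)])
        fix z assume "z \<in> closed_segment a1 a2"
        then have "Im z = - T" "x \<le> Re z" "Re z \<le> c" using sg(1) by auto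
        then show "norm (F z) \<le> C * exp (- \<kappa> * T)" using C(3)[of z] T unfolding F_def by simp
      qed (use C in simp)
      have b2: "norm (contour_integral (linepath a3 a4) F) \<le> C * exp (- \<kappa> * T) * norm (a4 - a3)"
      proof (rule contour_integral_bound_linepath[OF ci(3)])
        fix z assume "z \<in> closed_segment a3 a4"
        then have "Im z = T" "x \<le> Re z" "Re z \<le> c" using sg(2) by auto
        then show "norm (F z) \<le> C * exp (- \<kappa> * T)" using C(3)[of z] T unfolding F_def by simp
      qed (use C in simp)
      have n: "norm (a2 - a1) = c - x" "norm (a4 - a3) = c - x"
        using x unfolding a1_a2_a3_a4_def by (simp_all add: cmod_def)
      have "contour_integral (linepath a4 a1) F = - vertical_integral x T F"
        unfolding vertical_integral_def a1_a2_a3_a4_def[symmetric]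
        using contour_integral_reversepath[of "linepath a1 a4" F] by simp
      moreover have "norm (vertical_integral x T F) \<le> (\<rho> L * A) * pi"
      proof (rule norm_vertical_integral_le)
        show "continuous_on {z. Re z = x} F" by (rule continuous_on_subset[OF cF]) auto
        fix t
        have ni: "Complex c0 t - \<nu> k \<notin> \<int>" for k
        proof
          assume "Complex c0 t - \<nu> k \<in> \<int>"
          then obtain i where "Complex c0 t - \<nu> k = of_int i" by (auto elim: Ints_cases)
          then have "c0 - Re (\<nu> k) = of_int i" by (simp add: complex_eq_iff)
          then show False using c0(3)[of k] by auto
        qed
        have "Complex x t = Complex c0 t - of_nat L" unfolding x_def by (simp add: complex_eq_iff)
        then have "norm (F (Complex x t)) = norm (F (Complex c0 t)) *
            (exp (real CARD('a) * real L * Re w) / (\<Prod>k\<in>UNIV. \<Prod>j\<in>{1..L}. norm (Complex c0 t - \<nu> k - of_nat j)))"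
          unfolding F_def using barnes_shift[OF ni, where w=w and L=L] by simp
        also have "\<dots> \<le> (A / (1 + t^2)) * \<rho> L"
        proof (intro mult_mono)
          show "norm (F (Complex c0 t)) \<le> A / (1 + t^2)" unfolding F_def by (rule A)
          have "(\<Prod>k\<in>UNIV. \<Prod>j\<in>{1..L}. \<bar>d k - real j\<bar>) \<le> (\<Prod>k\<in>UNIV. \<Prod>j\<in>{1..L}. norm (Complex c0 t - \<nu> k - of_nat j))"
            using abs_Re_le_cmod[of "Complex c0 t - \<nu> _ - of_nat _"] unfolding d_def
            by (intro prod_mono conjI prod_nonneg) auto
          moreover have "(\<Prod>k\<in>UNIV. \<Prod>j\<in>{1..L}. \<bar>d k - real j\<bar>) > 0" using d by (intro prod_pos) auto
          ultimately show "exp (real CARD('a) * real L * Re w) / (\<Prod>k\<in>UNIV. \<Prod>j\<in>{1..L}. norm (Complex c0 t - \<nu> k - of_nat j)) \<le> \<rho> L"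
            unfolding \<rho>_def by (intro frac_le) (auto simp: mult_ac)
        qed (use A in \<open>auto intro!: divide_nonneg_nonneg prod_nonneg\<close>)
        finally show "norm (F (Complex x t)) \<le> \<rho> L * A / (1 + t^2)" by (simp add: mult_ac)
      qed (use T A \<rho>0 in auto)
      ultimately have b3: "norm (contour_integral (linepath a4 a1) F) \<le> \<rho> L * A * pi" by simp
      have "norm (vertical_integral c T F - 2 * pi * \<i> * SL L) \<le>
          norm (contour_integral (linepath a1 a2) F) + norm (contour_integral (linepath a3 a4) F) + norm (contour_integral (linepath a4 a1) F)"
        unfolding eq by norm
      also have "\<dots> < \<rho> L * A * pi + e" using b1 b2 b3 elim(1) unfolding n by simp
      finally show ?case unfolding F_def .
    qed
  qed
  show ?thesis unfolding S_def[symmetric]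
  proof (rule tendstoI)
    fix e :: real assume e: "e > 0"
    have "(\<lambda>L. \<rho> L * A * pi + norm (2 * pi * \<i> * SL L - 2 * pi * \<i> * S)) \<longlonglongrightarrow> 0 * A * pi + norm (2 * pi * \<i> * S - 2 * pi * \<i> * S)"
      by (intro tendsto_intros \<rho> SL)
    then have "eventually (\<lambda>L. \<rho> L * A * pi + norm (2 * pi * \<i> * SL L - 2 * pi * \<i> * S) < e / 2) sequentially"
      using e by (intro order_tendstoD(2)) auto
    then obtain L where L: "\<rho> L * A * pi + norm (2 * pi * \<i> * SL L - 2 * pi * \<i> * S) < e / 2"
      unfolding eventually_sequentially by auto
    have "e / 2 > 0" using e by simp
    from main[OF this, of L]
    show "eventually (\<lambda>T. dist (vertical_integral c T (barnes \<nu> w)) (2 * pi * \<i> * S) < e) at_top"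
    proof eventually_elim
      case (elim T)
      have "dist (vertical_integral c T (barnes \<nu> w)) (2 * pi * \<i> * S) \<le>
         norm (vertical_integral c T (barnes \<nu> w) - 2 * pi * \<i> * SL L) + norm (2 * pi * \<i> * SL L - 2 * pi * \<i> * S)"
        unfolding dist_norm by norm
      with elim L show ?case by linarith
    qed
  qed
qed

section \<open>Gamma products and series of shifted Gamma functions\<close>

text \<open>The constant may depend only on D and on the index set, since the u i will carry the
  indices of the Bessel equation.\<close>

lemma prod_one_plus_expansion:
  fixes D :: real
  assumes "finite I" "D \<ge> 0"
  shows "\<exists>C\<ge>0. \<forall>(u :: 'i \<Rightarrow> complex) r. 0 \<le> r \<and> r \<le> 1 \<and> (\<forall>i\<in>I. norm (u i) \<le> D * r) \<longrightarrow>
     norm ((\<Prod>i\<in>I. 1 + u i) - 1 - (\<Sum>i\<in>I. u i)) \<le> C * r\<^sup>2"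
  using assms(1)
proof (induction I rule: finite_induct)
  case (insert x I)
  then obtain C where C: "C \<ge> 0" "\<And>(u :: 'i \<Rightarrow> complex) r. 0 \<le> r \<Longrightarrow> r \<le> 1 \<Longrightarrow> (\<And>i. i \<in> I \<Longrightarrow> norm (u i) \<le> D * r) \<Longrightarrow>
     norm ((\<Prod>i\<in>I. 1 + u i) - 1 - (\<Sum>i\<in>I. u i)) \<le> C * r\<^sup>2" by metis
  have "norm ((\<Prod>i\<in>insert x I. 1 + u i) - 1 - (\<Sum>i\<in>insert x I. u i)) \<le> (D * (real (card I) * D) + C + D * C) * r\<^sup>2"
    if r: "0 \<le> r" "r \<le> 1" and u: "\<forall>i\<in>insert x I. norm (u i) \<le> D * r" for u :: "'i \<Rightarrow> complex" and r
  proof -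
    define \<delta> where "\<delta> = (\<Prod>i\<in>I. 1 + u i) - 1 - (\<Sum>i\<in>I. u i)"
    define \<Sigma> where "\<Sigma> = (\<Sum>i\<in>I. u i)"
    have d: "norm \<delta> \<le> C * r\<^sup>2" unfolding \<delta>_def using C r u by auto
    have s: "norm \<Sigma> \<le> real (card I) * (D * r)" unfolding \<Sigma>_def using u by (intro sum_norm_bound) auto
    have ux: "norm (u x) \<le> D * r" using u by auto
    have "(\<Prod>i\<in>insert x I. 1 + u i) - 1 - (\<Sum>i\<in>insert x I. u i) = u x * \<Sigma> + \<delta> + u x * \<delta>"
      using insert by (simp add: \<delta>_def \<Sigma>_def algebra_simps)
    also have "norm \<dots> \<le> norm (u x) * norm \<Sigma> + norm \<delta> + norm (u x) * norm \<delta>"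
      unfolding norm_mult[symmetric] by norm
    also have "\<dots> \<le> (D * r) * (real (card I) * (D * r)) + C * r\<^sup>2 + (D * 1) * (C * r\<^sup>2)"
      using d s ux r assms(2) order_trans[OF ux mult_left_mono[OF r(2) assms(2)]] by (intro add_mono mult_mono) auto
    finally show ?thesis by (simp add: algebra_simps power2_eq_square)
  qed
  moreover have "D * (real (card I) * D) + C + D * C \<ge> 0" using C assms by simp
  ultimately show ?case by blast
qed auto

text \<open>After division of both products by s^n the terms of first order are the sums of \<alpha>
  and of \<beta> divided by s, and these vanish. What is left is of order 1/s^2, small enough for
  the infinite product along s + n j to converge.\<close>

lemma prod_quotient_near_1:
  assumes "D \<ge> 0"
  shows "\<exists>C>0. \<exists>S\<ge>1. \<forall>(\<alpha> :: 'a::finite \<Rightarrow> complex) (\<beta> :: 'a \<Rightarrow> complex) s. norm s \<ge> S \<and> (\<forall>k. norm (\<alpha> k) \<le> D) \<and> (\<forall>k. norm (\<beta> k) \<le> D) \<and>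
     (\<Sum>k\<in>UNIV. \<alpha> k) = 0 \<and> (\<Sum>k\<in>UNIV. \<beta> k) = 0 \<longrightarrow>
     norm ((\<Prod>k\<in>UNIV. s + \<alpha> k) / (\<Prod>k\<in>UNIV. s + \<beta> k) - 1) \<le> C / norm s ^ 2"
proof -
  obtain C where C: "C \<ge> 0" "\<And>(u :: 'a \<Rightarrow> complex) r. 0 \<le> r \<Longrightarrow> r \<le> 1 \<Longrightarrow> (\<And>i. norm (u i) \<le> D * r) \<Longrightarrow>
     norm ((\<Prod>i\<in>UNIV. 1 + u i) - 1 - (\<Sum>i\<in>UNIV. u i)) \<le> C * r\<^sup>2"
    using prod_one_plus_expansion[of "UNIV :: 'a set", OF finite assms] by auto
  have "norm ((\<Prod>k\<in>UNIV. s + \<alpha> k) / (\<Prod>k\<in>UNIV. s + \<beta> k) - 1) \<le> (4 * C + 1) / norm s ^ 2"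
    if s: "norm s \<ge> 2 * C + 2" and a: "\<forall>k. norm (\<alpha> k) \<le> D" "\<forall>k. norm (\<beta> k) \<le> D"
      "(\<Sum>k\<in>UNIV. \<alpha> k) = 0" "(\<Sum>k\<in>UNIV. \<beta> k) = 0" for \<alpha> \<beta> :: "'a \<Rightarrow> complex" and s
  proof -
    define r where "r = 1 / norm s"
    have s0: "s \<noteq> 0" using s C by auto
    have "norm s \<ge> 1" using s C(1) by linarith
    then have r: "0 \<le> r" "r \<le> 1" unfolding r_def by (auto simp: divide_le_eq_1)
    have *: "norm ((\<Prod>k\<in>UNIV. s + x k) / s ^ CARD('a) - 1) \<le> C * r\<^sup>2"
      if "\<forall>k. norm (x k) \<le> D" "(\<Sum>k\<in>UNIV. x k) = 0" for x :: "'a \<Rightarrow> complex"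
    proof -
      have "(\<Prod>k\<in>UNIV. s + x k) = (\<Prod>k\<in>(UNIV::'a set). s * (1 + x k / s))" using s0 by (intro prod.cong) (auto simp: distrib_left)
      also have "\<dots> = s ^ CARD('a) * (\<Prod>k\<in>UNIV. 1 + x k / s)" by (simp add: prod.distrib)
      finally have "(\<Prod>k\<in>UNIV. s + x k) / s ^ CARD('a) = (\<Prod>k\<in>UNIV. 1 + x k / s)" using s0 by simp
      moreover have "(\<Sum>k\<in>UNIV. x k / s) = 0" using that by (simp add: sum_divide_distrib[symmetric])
      moreover have "norm (x k / s) \<le> D * r" for k
        using that(1) unfolding r_def by (simp add: norm_divide divide_right_mono)
      ultimately show ?thesis using C(2)[OF r, of "\<lambda>k. x k / s"] by simp
    qed
    define A where "A = (\<Prod>k\<in>UNIV. s + \<alpha> k) / s ^ CARD('a)"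
    define Bb where "Bb = (\<Prod>k\<in>UNIV. s + \<beta> k) / s ^ CARD('a)"
    have A: "norm (A - 1) \<le> C * r\<^sup>2" and Bb: "norm (Bb - 1) \<le> C * r\<^sup>2"
      unfolding A_def Bb_def using * a by auto
    have "C * r\<^sup>2 \<le> 1/2"
    proof -
      have "2 * C \<le> norm s * 1" using s by simp
      also have "\<dots> \<le> norm s * norm s" using s C by (intro mult_left_mono) auto
      finally show ?thesis using s0 unfolding r_def by (simp add: field_simps power2_eq_square)
    qed
    then have B2: "norm Bb \<ge> 1/2" using Bb norm_triangle_ineq2[of 1 Bb] by (simp add: norm_minus_commute)
    then have "Bb \<noteq> 0" by auto
    then have "(\<Prod>k\<in>UNIV. s + \<alpha> k) / (\<Prod>k\<in>UNIV. s + \<beta> k) - 1 = ((A - 1) - (Bb - 1)) / Bb"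
      unfolding A_def Bb_def using s0 by (simp add: field_simps)
    also have "norm \<dots> \<le> (C * r\<^sup>2 + C * r\<^sup>2) / (1/2)"
      unfolding norm_divide using A Bb B2 norm_triangle_ineq4[of "A - 1" "Bb - 1"] C
      by (intro frac_le) auto
    also have "\<dots> \<le> (4 * C + 1) / norm s ^ 2" unfolding r_def using s0 by (simp add: field_simps)
    finally show ?thesis .
  qed
  moreover have "4 * C + 1 > 0" "2 * C + 2 \<ge> 1" using C(1) by auto
  ultimately show ?thesis by blast
qed

lemma sum_inverse_squares_le: "(\<Sum>j<N. 1 / (real j + 1)\<^sup>2) \<le> 2"
proof -
  have "(\<Sum>j<N. 1 / (real j + 1)\<^sup>2) \<le> 2 - (if N = 0 then 1 else 1 / real N)"
  proof (induction N)
    case (Suc N)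
    show ?case
    proof (cases "N = 0")
      case False
      have "1 / (real N + 1)^2 \<le> 1 / real N - 1 / (real N + 1)"
      proof -
        have "1 / real N - 1 / (real N + 1) = 1 / (real N * (real N + 1))" using False by (simp add: field_simps)
        moreover have "1 / (real N + 1)^2 \<le> 1 / (real N * (real N + 1))"
          using False by (intro divide_left_mono) (auto simp: power2_eq_square)
        ultimately show ?thesis by simp
      qed
      then show ?thesis using Suc False by (simp add: add_ac)
    qed simp
  qed simp
  also have "\<dots> \<le> 2" by simp
  finally show ?thesis .
qed

text \<open>A quantitative form of the convergence of an infinite product: ln |g| changes by at most
  2 e j in the j-th step, and the e j sum to at most 2 C. The second condition on S gives e j <=
  1/2, which the lower estimate needs.\<close>

lemma bounded_below_above_by_limit:
  fixes g :: "complex \<Rightarrow> complex" and n :: nat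
  assumes n: "n > 0" and C: "C > 0" and S: "S \<ge> 1" "S\<^sup>2 \<ge> 2 * C" and s: "Re s \<ge> S"
    and step: "\<And>s. Re s \<ge> S \<Longrightarrow> norm (g (s + of_nat n) - g s) \<le> C / norm s ^ 2 * norm (g s)"
    and lim: "(\<lambda>N. g (s + of_nat n * of_nat N)) \<longlonglongrightarrow> K"
  shows "norm K \<le> norm (g s) * exp (2 * C)" "norm (g s) \<le> norm K * exp (4 * C)"
proof -
  define e where "e j = C / norm (s + of_nat n * of_nat j) ^ 2" for j
  have re: "Re (s + of_nat n * of_nat j) \<ge> S" for j using s by (simp add: add_increasing2)
  have nrm: "norm (s + of_nat n * of_nat j) \<ge> S" "norm (s + of_nat n * of_nat j) \<ge> real j + 1" for j
  proof -
    show "norm (s + of_nat n * of_nat j) \<ge> S"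
      using re[of j] complex_Re_le_cmod[of "s + of_nat n * of_nat j"] by linarith
    have "real j \<le> real n * real j" using n by (simp add: mult_le_cancel_right1)
    then have "Re (s + of_nat n * of_nat j) \<ge> real j + 1" using s S by simp
    then show "norm (s + of_nat n * of_nat j) \<ge> real j + 1"
      using complex_Re_le_cmod[of "s + of_nat n * of_nat j"] by linarith
  qed
  have e1: "0 \<le> e j" "e j \<le> C / (real j + 1)^2" "e j \<le> 1/2" for j
  proof -
    show "0 \<le> e j" unfolding e_def using C by simp
    have "0 < norm (s + of_nat n * of_nat j)" using nrm(2)[of j] by linarith
    then show "e j \<le> C / (real j + 1)^2" unfolding e_def using C nrm(2)[of j]
      by (intro divide_left_mono power_mono mult_pos_pos zero_less_power) auto
    have "e j \<le> C / S^2" unfolding e_def using C S nrm(1)[of j]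
      by (intro divide_left_mono power_mono mult_pos_pos zero_less_power) auto
    also have "\<dots> \<le> 1/2" using S C by (simp add: field_simps)
    finally show "e j \<le> 1/2" .
  qed
  have st: "norm (g (s + of_nat n * of_nat (Suc j)) - g (s + of_nat n * of_nat j)) \<le> e j * norm (g (s + of_nat n * of_nat j))" for j
    using step[OF re[of j]] unfolding e_def by (simp add: algebra_simps)
  have es: "(\<Sum>j<N. e j) \<le> 2 * C" for N
  proof -
    have "(\<Sum>j<N. e j) \<le> (\<Sum>j<N. C * (1 / (real j + 1)^2))" using e1 by (intro sum_mono) auto
    also have "\<dots> \<le> C * 2" unfolding sum_distrib_left[symmetric] using C sum_inverse_squares_le by (intro mult_left_mono) auto
    finally show ?thesis by simp
  qed
  have up: "norm (g (s + of_nat n * of_nat N)) \<le> norm (g s) * exp (\<Sum>j<N. e j)" for N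
  proof (induction N)
    case (Suc N)
    have "norm (g (s + of_nat n * of_nat (Suc N))) \<le> norm (g (s + of_nat n * of_nat N)) * (1 + e N)"
      using st[of N] norm_triangle_ineq2[of "g (s + of_nat n * of_nat (Suc N))" "g (s + of_nat n * of_nat N)"] by (simp add: algebra_simps)
    also have "\<dots> \<le> (norm (g s) * exp (\<Sum>j<N. e j)) * exp (e N)"
      using Suc e1(1)[of N] exp_ge_add_one_self[of "e N"] by (intro mult_mono) auto
    finally show ?case by (simp add: exp_add mult_ac)
  qed simp
  have low: "norm (g s) \<le> norm (g (s + of_nat n * of_nat N)) * exp (2 * (\<Sum>j<N. e j))" for N
  proof (induction N)
    case (Suc N)
    have x: "norm (g (s + of_nat n * of_nat N)) * (1 - e N) \<le> norm (g (s + of_nat n * of_nat (Suc N)))"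
      using st[of N] norm_triangle_ineq2[of "g (s + of_nat n * of_nat N)" "g (s + of_nat n * of_nat (Suc N))"] by (simp add: algebra_simps norm_minus_commute)
    \<comment> \<open>For 0 <= e <= 1/2 one has (1 - e) (1 + 2 e) = 1 + e (1 - 2 e) >= 1.\<close>
    have "1 \<le> (1 - e N) * exp (2 * e N)"
    proof -
      have "1 \<le> (1 - e N) * (1 + 2 * e N)" using e1[of N] mult_nonneg_nonneg[of "e N" "1 - 2 * e N"] by (simp add: algebra_simps)
      also have "\<dots> \<le> (1 - e N) * exp (2 * e N)" using e1[of N] exp_ge_add_one_self[of "2 * e N"] by (intro mult_left_mono) auto
      finally show ?thesis .
    qed
    then have "norm (g (s + of_nat n * of_nat N)) * 1 \<le> norm (g (s + of_nat n * of_nat N)) * ((1 - e N) * exp (2 * e N))"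
      by (intro mult_left_mono) auto
    also have "\<dots> = (norm (g (s + of_nat n * of_nat N)) * (1 - e N)) * exp (2 * e N)" by simp
    also have "\<dots> \<le> norm (g (s + of_nat n * of_nat (Suc N))) * exp (2 * e N)" using x by (intro mult_right_mono) auto
    finally have "norm (g (s + of_nat n * of_nat N)) * exp (2 * (\<Sum>j<N. e j)) \<le> norm (g (s + of_nat n * of_nat (Suc N))) * exp (2 * e N) * exp (2 * (\<Sum>j<N. e j))"
      by (intro mult_right_mono) auto
    then have "norm (g s) \<le> norm (g (s + of_nat n * of_nat (Suc N))) * exp (2 * e N) * exp (2 * (\<Sum>j<N. e j))"
      using Suc by (rule order_trans[rotated])
    then show ?case by (simp only: sum.lessThan_Suc distrib_left exp_add mult_ac)
  qed simp
  have nl: "(\<lambda>N. norm (g (s + of_nat n * of_nat N))) \<longlonglongrightarrow> norm K" using lim by (rule tendsto_norm)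
  show "norm K \<le> norm (g s) * exp (2 * C)"
  proof (rule LIMSEQ_le_const2[OF nl], intro exI allI impI)
    fix N show "norm (g (s + of_nat n * of_nat N)) \<le> norm (g s) * exp (2 * C)"
      using up[of N] es[of N] by (elim order_trans) (auto intro!: mult_left_mono)
  qed
  have "(\<lambda>N. norm (g (s + of_nat n * of_nat N)) * exp (4 * C)) \<longlonglongrightarrow> norm K * exp (4 * C)" by (intro tendsto_intros nl)
  then show "norm (g s) \<le> norm K * exp (4 * C)"
  proof (rule LIMSEQ_le_const, intro exI allI impI)
    fix N show "norm (g s) \<le> norm (g (s + of_nat n * of_nat N)) * exp (4 * C)"
      using low[of N] es[of N] by (elim order_trans) (auto intro!: mult_left_mono)
  qed
qed

section \<open>The quotient of Gamma(s + a) by the Gamma product\<close>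

lemma Gamma_asymp_factorial:
  assumes "z \<notin> \<int>\<^sub>\<le>\<^sub>0"
  shows "(\<lambda>N. Gamma (z + of_nat N + 1) / (fact N * exp (z * of_real (ln (real N))))) \<longlonglongrightarrow> (1 :: complex)"
proof -
  have nz: "Gamma z \<noteq> 0" using assms by (simp add: Gamma_eq_zero_iff)
  have "(\<lambda>N. Gamma z / Gamma_series z N) \<longlonglongrightarrow> Gamma z / Gamma z" by (intro tendsto_intros nz)
  moreover have "Gamma z / Gamma_series z N = Gamma (z + of_nat N + 1) / (fact N * exp (z * of_real (ln (real N))))" for N
  proof -
    have "pochhammer z (N + 1) = Gamma (z + of_nat (N + 1)) / Gamma z" by (rule pochhammer_Gamma[OF assms])
    then have "Gamma (z + of_nat N + 1) = pochhammer z (N+1) * Gamma z" using nz by (simp add: add_ac)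
    then show ?thesis unfolding Gamma_series_def by simp
  qed
  ultimately show ?thesis using nz by simp
qed

text \<open>\<open>gamma_ratio\<close> compares the Gamma product with a single Gamma function, which is the Mellin
  transform of the leading term of the expansion at infinity.\<close>

definition bessel_exponent :: "nat \<Rightarrow> complex" where
  "bessel_exponent n = - (of_nat n - 1) / 2"

definition gamma_Phi :: "('a::finite \<Rightarrow> complex) \<Rightarrow> complex \<Rightarrow> complex" where
  "gamma_Phi \<nu> s = exp (s * of_real (ln (real CARD('a)))) * gamma_prod \<nu> (s / of_nat CARD('a))"

definition gamma_ratio :: "('a::finite \<Rightarrow> complex) \<Rightarrow> complex \<Rightarrow> complex" where
  "gamma_ratio \<nu> s = Gamma (s + bessel_exponent CARD('a)) / gamma_Phi \<nu> s"

lemma gamma_prod_plus_1: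
  assumes "\<And>k. s - \<nu> k \<notin> \<int>\<^sub>\<le>\<^sub>0"
  shows "gamma_prod \<nu> (s + 1) = (\<Prod>k\<in>UNIV. s - \<nu> k) * gamma_prod \<nu> s"
proof -
  have "Gamma (s + 1 - \<nu> k) = (s - \<nu> k) * Gamma (s - \<nu> k)" for k
    using Gamma_plus1[OF assms[of k]] by (simp add: algebra_simps)
  then show ?thesis unfolding gamma_prod_def by (simp add: prod.distrib)
qed

lemma gamma_Phi_step:
  fixes \<nu> :: "'a::finite \<Rightarrow> complex"
  assumes "\<And>k. s / of_nat CARD('a) - \<nu> k \<notin> \<int>\<^sub>\<le>\<^sub>0"
  shows "gamma_Phi \<nu> (s + of_nat CARD('a)) = (\<Prod>k\<in>UNIV. s - of_nat CARD('a) * \<nu> k) * gamma_Phi \<nu> s"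
proof -
  let ?n = "of_nat CARD('a) :: complex"
  have 1: "(s + ?n) / ?n = s / ?n + 1" by (simp add: add_divide_distrib)
  have 2: "exp ((s + ?n) * of_real (ln (real CARD('a)))) = exp (s * of_real (ln (real CARD('a)))) * ?n ^ CARD('a)"
  proof -
    have "exp (?n * of_real (ln (real CARD('a)))) = of_real (exp (ln (real CARD('a)))) ^ CARD('a)"
      by (simp only: exp_of_real[symmetric] exp_of_nat_mult[symmetric])
    then show ?thesis by (simp add: ring_distribs exp_add)
  qed
  have "(\<Prod>k\<in>UNIV. s - ?n * \<nu> k) = (\<Prod>k\<in>(UNIV::'a set). ?n * (s / ?n - \<nu> k))" by (intro prod.cong) (auto simp: right_diff_distrib)
  then have 3: "(\<Prod>k\<in>UNIV. s - ?n * \<nu> k) = ?n ^ CARD('a) * (\<Prod>k\<in>UNIV. s / ?n - \<nu> k)" by (simp add: prod.distrib)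
  show ?thesis unfolding gamma_Phi_def 1 2 3 using gamma_prod_plus_1[OF assms] by simp
qed

lemma gamma_Phi_nonzero:
  fixes \<nu> :: "'a::finite \<Rightarrow> complex"
  assumes "\<And>k. s / of_nat CARD('a) - \<nu> k \<notin> \<int>\<^sub>\<le>\<^sub>0"
  shows "gamma_Phi \<nu> s \<noteq> 0"
  unfolding gamma_Phi_def gamma_prod_def using assms by (simp add: Gamma_eq_zero_iff)

text \<open>A step by n produces n linear factors both above and below. The exponent -(n - 1)/2 is
  the one for which the shifts a + j with j < n sum to zero, as the shifts in the denominator
  do.\<close>

lemma gamma_ratio_step:
  fixes \<nu> :: "'a::finite \<Rightarrow> complex"
  assumes "\<And>k. s / of_nat CARD('a) - \<nu> k \<notin> \<int>\<^sub>\<le>\<^sub>0" "s + bessel_exponent CARD('a) \<notin> \<int>\<^sub>\<le>\<^sub>0"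
  shows "gamma_ratio \<nu> (s + of_nat CARD('a)) =
    (\<Prod>j<CARD('a). s + (bessel_exponent CARD('a) + of_nat j)) / (\<Prod>k\<in>UNIV. s - of_nat CARD('a) * \<nu> k) * gamma_ratio \<nu> s"
proof -
  have "pochhammer (s + bessel_exponent CARD('a)) CARD('a) =
      Gamma (s + bessel_exponent CARD('a) + of_nat CARD('a)) / Gamma (s + bessel_exponent CARD('a))"
    by (rule pochhammer_Gamma[OF assms(2)])
  moreover have "Gamma (s + bessel_exponent CARD('a)) \<noteq> 0" using assms by (simp add: Gamma_eq_zero_iff)
  ultimately have "Gamma (s + of_nat CARD('a) + bessel_exponent CARD('a)) =
     (\<Prod>j<CARD('a). s + (bessel_exponent CARD('a) + of_nat j)) * Gamma (s + bessel_exponent CARD('a))"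
    by (simp add: pochhammer_prod atLeast0LessThan field_simps)
  then show ?thesis unfolding gamma_ratio_def gamma_Phi_step[OF assms(1)] by simp
qed

text \<open>\<open>gamma_ratio\<close> at \<open>s = n (N + 1)\<close> for zero indices, with \<open>\<Gamma>(s + a)\<close> replaced by \<open>(n N)! (n N) powr (a + n - 1)\<close>.\<close>

definition gamma_ratio_seq :: "nat \<Rightarrow> nat \<Rightarrow> complex" where
  "gamma_ratio_seq n N = fact (n * N) * exp ((bessel_exponent n + of_nat n - 1) * of_real (ln (real (n * N)))) /
     (exp (of_nat (n * (N + 1)) * of_real (ln (real n))) * fact N ^ n)"

text \<open>The powers of n and N whose exponents contain s cancel between numerator and
  denominator; all further dependence on s and \<nu> sits in factors tending to 1. Hence the limit
  of \<open>gamma_ratio\<close> along the steps is the same for all admissible s and \<nu>.\<close>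

lemma gamma_ratio_asymp:
  fixes \<nu> :: "'a::finite \<Rightarrow> complex"
  assumes s: "\<And>k. s / of_nat CARD('a) - \<nu> k \<notin> \<int>\<^sub>\<le>\<^sub>0" "s + bessel_exponent CARD('a) + of_nat CARD('a) - 1 \<notin> \<int>\<^sub>\<le>\<^sub>0"
    and sum: "(\<Sum>k\<in>UNIV. \<nu> k) = 0"
  shows "\<exists>\<rho>. \<rho> \<longlonglongrightarrow> 1 \<and> (\<forall>N>0. gamma_ratio \<nu> (s + of_nat CARD('a) * of_nat (N + 1)) = \<rho> N * gamma_ratio_seq CARD('a) N)"
proof -
  define n where "n = CARD('a)"
  have n: "n > 0" unfolding n_def by simp
  define r where "r z N = Gamma (z + of_nat N + 1) / (fact N * exp (z * of_real (ln (real N))))" for z :: complex and N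
  define z where "z = s + bessel_exponent n + of_nat n - 1"
  define \<rho> where "\<rho> N = r z (n * N) / (\<Prod>k\<in>UNIV. r (s / of_nat n - \<nu> k) N)" for N
  have "filterlim (\<lambda>N. n * N) sequentially sequentially"
    using n by (intro filterlim_subseq strict_monoI) auto
  then have "(\<lambda>N. r z (n * N)) \<longlonglongrightarrow> 1"
    unfolding r_def using s(2) by (intro filterlim_compose[OF Gamma_asymp_factorial]) (auto simp: z_def n_def)
  moreover have "r (s / of_nat n - \<nu> k) \<longlonglongrightarrow> 1" for k
    unfolding r_def using s(1) by (intro Gamma_asymp_factorial) (auto simp: n_def)
  ultimately have "\<rho> \<longlonglongrightarrow> 1 / (\<Prod>k\<in>(UNIV::'a set). 1)" unfolding \<rho>_def by (intro tendsto_intros) auto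
  then have lim: "\<rho> \<longlonglongrightarrow> 1" by simp
  have "gamma_ratio \<nu> (s + of_nat n * of_nat (N + 1)) = \<rho> N * gamma_ratio_seq n N" if N: "N > 0" for N
  proof -
    have z1: "s + of_nat n * of_nat (N + 1) + bessel_exponent n = z + of_nat (n * N) + 1"
      unfolding z_def by (simp add: algebra_simps)
    have num: "Gamma (s + of_nat n * of_nat (N + 1) + bessel_exponent n) =
        r z (n * N) * (fact (n * N) * exp (z * of_real (ln (real (n * N)))))"
      unfolding z1 r_def by simp
    have "Gamma ((s + of_nat n * of_nat (N + 1)) / of_nat n - \<nu> k) =
        r (s / of_nat n - \<nu> k) N * (fact N * exp ((s / of_nat n - \<nu> k) * of_real (ln (real N))))" for k
    proof -
      have "(s + of_nat n * of_nat (N + 1)) / of_nat n - \<nu> k = s / of_nat n - \<nu> k + of_nat N + 1"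
        using n by (simp add: add_divide_distrib)
      then show ?thesis unfolding r_def by (simp only:) simp
    qed
    then have "gamma_prod \<nu> ((s + of_nat n * of_nat (N + 1)) / of_nat n) =
        (\<Prod>k\<in>UNIV. r (s / of_nat n - \<nu> k) N) * (fact N ^ n * exp (\<Sum>k\<in>UNIV. (s / of_nat n - \<nu> k) * of_real (ln (real N))))"
      unfolding gamma_prod_def by (simp add: prod.distrib exp_sum n_def)
    \<comment> \<open>Here the zero component-sum removes the indices from the exponent of
      N.\<close>
    also have "(\<Sum>k\<in>UNIV. (s / of_nat n - \<nu> k) * of_real (ln (real N))) = s * of_real (ln (real N))"
      unfolding sum_distrib_right[symmetric] using sum n by (simp add: sum_subtractf n_def)
    finally have den: "gamma_prod \<nu> ((s + of_nat n * of_nat (N + 1)) / of_nat n) =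
        (\<Prod>k\<in>UNIV. r (s / of_nat n - \<nu> k) N) * (fact N ^ n * exp (s * of_real (ln (real N))))" .
    have ln: "of_real (ln (real (n * N))) = (of_real (ln (real n)) + of_real (ln (real N)) :: complex)"
      using n N by (simp add: ln_mult_pos)
    have e: "exp (z * of_real (ln (real (n * N)))) = exp ((bessel_exponent n + of_nat n - 1) * of_real (ln (real (n * N)))) *
        exp (s * of_real (ln (real n))) * exp (s * of_real (ln (real N)))"
      unfolding exp_add[symmetric] ln z_def by (simp add: algebra_simps)
    have e2: "exp ((s + of_nat n * of_nat (N + 1)) * of_real (ln (real n))) =
        exp (of_nat (n * (N + 1)) * of_real (ln (real n))) * exp (s * of_real (ln (real n)))"
      unfolding exp_add[symmetric] by (simp add: algebra_simps)
    show ?thesis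
      unfolding gamma_ratio_def gamma_Phi_def n_def[symmetric] num den \<rho>_def gamma_ratio_seq_def e e2 by simp
  qed
  then show ?thesis using lim unfolding n_def by blast
qed

section \<open>Value of the limit: the constants of Gauss' multiplication formula\<close>

lemma prod_sin_pi_fractions:
  assumes "n > 0"
  shows "(\<Prod>j\<in>{1..<n}. 2 * sin (pi * real j / real n)) = real n"
proof -
  define \<omega> where "\<omega> j = cis (2 * pi * real j / real n)" for j
  have inj: "inj_on \<omega> {..<n}" and roots: "\<omega> ` {..<n} = {z. z ^ n = 1}"
    using Complex.bij_betw_roots_unity[OF assms] unfolding bij_betw_def \<omega>_def by auto
  \<comment> \<open>P is the factorisation of Q = z^n - 1 over the roots of unity. Cancelling z - 1
    and putting z = 1 gives the product of the 1 - \<omega> j, whose moduli are the factors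
    sought.\<close>
  define P where "P = (\<Prod>j<n. [:- \<omega> j, 1:])"
  define Q where "Q = (monom 1 n - 1 :: complex poly)"
  have "degree Q = n" "lead_coeff Q = 1"
  proof -
    have "degree (monom 1 n + (- 1) :: complex poly) = degree (monom 1 n :: complex poly)"
      by (intro degree_add_eq_left) (use assms in \<open>auto simp: degree_monom_eq\<close>)
    then show d: "degree Q = n" unfolding Q_def by (simp add: degree_monom_eq)
    show "lead_coeff Q = 1" unfolding d using assms unfolding Q_def by simp
  qed
  moreover have "degree P = n" unfolding P_def by (subst degree_prod_eq_sum_degree) auto
  moreover have "lead_coeff P = 1" unfolding P_def by (simp add: lead_coeff_prod)
  moreover have "poly P z = poly Q z" if "z \<in> {z. z ^ n = 1}" for z
  proof -
    have "z \<in> \<omega> ` {..<n}" unfolding roots by (rule that)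
    then obtain j where "j < n" "z = \<omega> j" by auto
    then have "poly P z = 0" unfolding P_def poly_prod by (intro prod_zero bexI[of _ j]) auto
    moreover have "poly Q z = 0" using that unfolding Q_def by (simp add: poly_monom)
    ultimately show ?thesis by simp
  qed
  moreover have "card {z::complex. z ^ n = 1} = n" using assms by (intro card_roots_unity_eq) auto
  ultimately have PQ: "P = Q"
    by (intro poly_eqI_degree_lead_coeff[of _ n _ "{z. z ^ n = 1}"]) auto
  have "Q = [:-1, 1:] * (\<Sum>i<n. monom 1 i)"
    unfolding Q_def using power_diff_1_eq[of "[:0, 1:] :: complex poly" n]
    by (simp add: monom_altdef one_pCons)
  moreover have "P = [:-1, 1:] * (\<Prod>j\<in>{1..<n}. [:- \<omega> j, 1:])"
  proof -
    have "{..<n} = insert 0 {1..<n}" using assms by auto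
    then show ?thesis unfolding P_def by (simp add: \<omega>_def)
  qed
  ultimately have "(\<Prod>j\<in>{1..<n}. [:- \<omega> j, 1:]) = (\<Sum>i<n. monom 1 i)"
    using PQ by (simp only: mult_cancel_left) simp
  then have "poly (\<Prod>j\<in>{1..<n}. [:- \<omega> j, 1:]) 1 = poly (\<Sum>i<n. monom 1 i) 1" by simp
  then have "(\<Prod>j\<in>{1..<n}. 1 - \<omega> j) = of_nat n" by (simp add: poly_prod poly_sum poly_monom)
  then have "(\<Prod>j\<in>{1..<n}. norm (1 - \<omega> j)) = real n" by (metis prod_norm norm_of_nat)
  moreover have "norm (1 - \<omega> j) = 2 * sin (pi * real j / real n)" if "j \<in> {1..<n}" for j
  proof -
    define x where "x = pi * real j / real n"
    have x: "0 \<le> x" "x \<le> pi" using that unfolding x_def by (auto simp: field_simps)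
    have "norm (1 - \<omega> j)^2 = (1 - cos (2 * x))^2 + (sin (2 * x))^2"
      unfolding \<omega>_def x_def cmod_power2 by (simp add: mult.assoc)
    also have "\<dots> = (2 * sin x)^2"
    proof -
      have "(1 - (1 - 2 * (sin x)^2))^2 + (2 * sin x * cos x)^2 = (2 * sin x)^2 * ((sin x)^2 + (cos x)^2)"
        by algebra
      then show ?thesis unfolding cos_double_sin sin_double by (simp only: sin_cos_squared_add mult_1_right)
    qed
    finally have "norm (1 - \<omega> j) = 2 * sin x"
      by (rule power2_eq_imp_eq) (use sin_ge_zero[OF x] in simp_all)
    then show ?thesis unfolding x_def .
  qed
  ultimately show ?thesis by simp
qed

text \<open>In the square of the product, pairing j with n - j turns every pair into a reflection
  formula, so that only a product of sines remains; nonnegativity fixes the root.\<close>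

lemma prod_Gamma_fractions:
  assumes "n > 0"
  shows "(\<Prod>j\<in>{1..<n}. Gamma (real j / real n)) = (2 * pi) powr ((real n - 1) / 2) / sqrt (real n)"
proof -
  define G where "G = (\<Prod>j\<in>{1..<n}. Gamma (real j / real n))"
  have "bij_betw (\<lambda>j. n - j) {1..<n} {1..<n}"
    by (intro bij_betwI[of _ _ _ "\<lambda>j. n - j"]) auto
  then have "G = (\<Prod>j\<in>{1..<n}. Gamma (real (n - j) / real n))"
    unfolding G_def by (rule prod.reindex_bij_betw[symmetric])
  also have "\<dots> = (\<Prod>j\<in>{1..<n}. Gamma (1 - real j / real n))"
    by (intro prod.cong refl) (auto simp: of_nat_diff diff_divide_distrib)
  finally have "G * G = (\<Prod>j\<in>{1..<n}. Gamma (real j / real n) * Gamma (1 - real j / real n))"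
    unfolding G_def by (simp add: prod.distrib)
  also have "\<dots> = (\<Prod>j\<in>{1..<n}. 2 * pi / (2 * sin (pi * real j / real n)))"
  proof (intro prod.cong refl)
    fix j
    define y where "y = real j / real n"
    have "complex_of_real (Gamma y * Gamma (1 - y)) = of_real (pi / sin (pi * y))"
      using Gamma_reflection_complex[of "of_real y"]
      by (simp add: Gamma_complex_of_real[symmetric] sin_of_real[symmetric] del: Gamma_complex_of_real)
    then have "Gamma y * Gamma (1 - y) = pi / sin (pi * y)" by (simp only: of_real_eq_iff)
    then show "Gamma (real j / real n) * Gamma (1 - real j / real n) = 2 * pi / (2 * sin (pi * real j / real n))"
      unfolding y_def by simp
  qed
  also have "\<dots> = (2 * pi) ^ (n - 1) / real n"
    by (simp only: prod_dividef prod_sin_pi_fractions[OF assms]) simp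
  also have "\<dots> = ((2 * pi) powr ((real n - 1) / 2) / sqrt (real n)) * ((2 * pi) powr ((real n - 1) / 2) / sqrt (real n))"
  proof -
    have "(2 * pi) powr ((real n - 1) / 2) * (2 * pi) powr ((real n - 1) / 2) = (2 * pi) powr real (n - 1)"
      unfolding powr_add[symmetric] using assms by (simp add: of_nat_diff)
    also have "\<dots> = (2 * pi) ^ (n - 1)" by (rule powr_realpow) auto
    finally show ?thesis by simp
  qed
  finally have sq: "G\<^sup>2 = ((2 * pi) powr ((real n - 1) / 2) / sqrt (real n))\<^sup>2" by (simp add: power2_eq_square)
  have "G \<ge> 0" unfolding G_def by (intro prod_nonneg Gamma_real_nonneg) auto
  then show ?thesis using sq unfolding G_def[symmetric] by (intro power2_eq_imp_eq[OF sq]) auto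
qed

definition gamma_ratio_limit :: "nat \<Rightarrow> real" where
  "gamma_ratio_limit n = (2 * pi) powr (- (real n - 1) / 2) * real n powr (- real n / 2)"

text \<open>The sequence contains no indices, so it may be evaluated with indices for which the two
  products in \<open>gamma_ratio_step\<close> coincide. Then \<open>gamma_ratio\<close> is constant
  along the steps and the limit is its value at s = 1 - a, where the numerator is Gamma(1) = 1 and
  the Gamma product runs over the fractions j / n.\<close>

lemma gamma_ratio_seq_tendsto:
  "(gamma_ratio_seq CARD('a::finite)) \<longlonglongrightarrow> of_real (gamma_ratio_limit CARD('a))"
proof -
  define n where "n = CARD('a)"
  have n: "n > 0" unfolding n_def by simp
  define a where "a = bessel_exponent n"
  have a: "a = - (of_nat n - 1) / 2" unfolding a_def bessel_exponent_def ..
  obtain h :: "'a \<Rightarrow> nat" where h: "bij_betw h UNIV {..<n}"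
    using ex_bij_betw_finite_nat[of "UNIV :: 'a set"] unfolding n_def by (auto simp: atLeast0LessThan)
  \<comment> \<open>The factors s - n \<nu> k = s + a + h k are those of the numerator in another
    order, and the value of a makes the \<nu> k sum to zero.\<close>
  define \<nu> where "\<nu> k = - (a + of_nat (h k)) / of_nat n" for k
  have "(\<Sum>k\<in>UNIV. \<nu> k) = (\<Sum>j<n. - (a + of_nat j) / of_nat n)"
    unfolding \<nu>_def by (rule sum.reindex_bij_betw[OF h])
  also have "\<dots> = - (of_nat n * a + (\<Sum>j<n. of_nat j)) / of_nat n"
    by (simp add: sum_divide_distrib[symmetric] sum.distrib sum_negf sum_subtractf)
  also have "(\<Sum>j<n. of_nat j) = (of_nat n * (of_nat n - 1) / 2 :: complex)"
    by (induction n) (auto simp: field_simps)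
  finally have sum: "(\<Sum>k\<in>UNIV. \<nu> k) = 0" unfolding a by (simp add: field_simps)
  define s where "s = 1 - a"
  have sk: "s / of_nat n - \<nu> k = of_nat (1 + h k) / of_nat n" for k
    unfolding s_def \<nu>_def by (simp add: add_divide_distrib diff_divide_distrib)
  have Nn: "0 < Re ((s + of_nat n * of_nat N) / of_nat n - \<nu> k)" for N k
  proof -
    have "(s + of_nat n * of_nat N) / of_nat n - \<nu> k = of_nat (1 + h k) / of_nat n + of_nat N"
      unfolding sk[symmetric] using n by (simp add: add_divide_distrib)
    also have "\<dots> = of_real (real (1 + h k) / real n + real N)" by simp
    also have "Re \<dots> > 0" unfolding Re_complex_of_real using n by (intro add_pos_nonneg) auto
    finally show ?thesis .
  qed
  have const: "gamma_ratio \<nu> (s + of_nat n * of_nat N) = gamma_ratio \<nu> s" for N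
  proof (induction N)
    case (Suc N)
    define s' where "s' = s + of_nat n * of_nat N"
    have "(\<Prod>k\<in>UNIV. s' - of_nat n * \<nu> k) = (\<Prod>k\<in>UNIV. s' + (a + of_nat (h k)))"
      unfolding \<nu>_def using n by (intro prod.cong refl) (simp add: field_simps)
    also have "\<dots> = (\<Prod>j<n. s' + (a + of_nat j))"
      by (rule prod.reindex_bij_betw[OF h])
    finally have p: "(\<Prod>k\<in>UNIV. s' - of_nat n * \<nu> k) = (\<Prod>j<n. s' + (a + of_nat j))" .
    have "s' + (a + of_nat j) \<noteq> 0" for j
    proof -
      have "Re (s' + (a + of_nat j)) > 0" unfolding s'_def s_def by (auto intro!: add_pos_nonneg)
      then show ?thesis by (metis less_irrefl zero_complex.simps(1))
    qed
    then have "(\<Prod>j<n. s' + (a + of_nat j)) \<noteq> 0" by simp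
    moreover have "gamma_ratio \<nu> (s' + of_nat n) = (\<Prod>j<n. s' + (a + of_nat j)) / (\<Prod>k\<in>UNIV. s' - of_nat n * \<nu> k) * gamma_ratio \<nu> s'"
      unfolding n_def a_def
    proof (rule gamma_ratio_step)
      show "s' / of_nat CARD('a) - \<nu> k \<notin> \<int>\<^sub>\<le>\<^sub>0" for k
        using Nn[of N k] unfolding s'_def n_def by (intro not_nonpos_Ints_if_Re_pos) auto
      show "s' + bessel_exponent CARD('a) \<notin> \<int>\<^sub>\<le>\<^sub>0"
        unfolding s'_def s_def a_def n_def by (intro not_nonpos_Ints_if_Re_pos) (auto intro!: add_pos_nonneg)
    qed
    ultimately have "gamma_ratio \<nu> (s' + of_nat n) = gamma_ratio \<nu> s'" unfolding p by simp
    then show ?case using Suc unfolding s'_def by (simp add: algebra_simps)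
  qed simp
  have "\<exists>\<rho>. \<rho> \<longlonglongrightarrow> 1 \<and> (\<forall>N>0. gamma_ratio \<nu> (s + of_nat CARD('a) * of_nat (N + 1)) = \<rho> N * gamma_ratio_seq CARD('a) N)"
  proof (rule gamma_ratio_asymp)
    show "s / of_nat CARD('a) - \<nu> k \<notin> \<int>\<^sub>\<le>\<^sub>0" for k
      using Nn[of 0 k] unfolding n_def by (intro not_nonpos_Ints_if_Re_pos) auto
    show "s + bessel_exponent CARD('a) + of_nat CARD('a) - 1 \<notin> \<int>\<^sub>\<le>\<^sub>0"
      using n unfolding s_def a_def n_def by (intro not_nonpos_Ints_if_Re_pos) auto
  qed (rule sum)
  then obtain \<rho> where \<rho>: "\<rho> \<longlonglongrightarrow> 1" "\<And>N. N > 0 \<Longrightarrow> gamma_ratio \<nu> s = \<rho> N * gamma_ratio_seq n N"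
    using const unfolding n_def by metis
  have "(\<lambda>N. gamma_ratio \<nu> s / \<rho> N) \<longlonglongrightarrow> gamma_ratio \<nu> s / 1" by (intro tendsto_intros \<rho>) auto
  moreover have "eventually (\<lambda>N. \<rho> N \<noteq> 0) sequentially"
    using tendsto_imp_eventually_ne[OF \<rho>(1)] by auto
  then have "eventually (\<lambda>N. gamma_ratio \<nu> s / \<rho> N = gamma_ratio_seq n N) sequentially"
    using eventually_gt_at_top[of 0] by eventually_elim (auto simp: \<rho>(2))
  ultimately have lim: "gamma_ratio_seq n \<longlonglongrightarrow> gamma_ratio \<nu> s"
    by (auto elim: Lim_transform_eventually)
  have "gamma_prod \<nu> (s / of_nat n) = (\<Prod>k\<in>UNIV. complex_of_real (Gamma (real (1 + h k) / real n)))"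
    unfolding gamma_prod_def sk by (intro prod.cong refl) (simp add: Gamma_complex_of_real[symmetric] del: Gamma_complex_of_real)
  also have "\<dots> = (\<Prod>j<n. complex_of_real (Gamma (real (1 + j) / real n)))"
    by (rule prod.reindex_bij_betw[OF h])
  also have "\<dots> = of_real (\<Prod>j<n. Gamma (real (Suc j) / real n))" by simp
  also have "(\<Prod>j<n. Gamma (real (Suc j) / real n)) = (\<Prod>j\<in>{1..n}. Gamma (real j / real n))"
    by (rule prod.reindex_bij_witness[of _ "\<lambda>j. j - 1" Suc]) auto
  also have "{1..n} = insert n {1..<n}" using n by auto
  also have "(\<Prod>j\<in>\<dots>. Gamma (real j / real n)) = (2 * pi) powr ((real n - 1) / 2) / sqrt (real n)"
    using n prod_Gamma_fractions[OF n] by simp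
  finally have gp: "gamma_prod \<nu> (s / of_nat n) = of_real ((2 * pi) powr ((real n - 1) / 2) / sqrt (real n))" .
  have s_eq: "s = of_real ((real n + 1) / 2)" unfolding s_def a by (simp add: field_simps)
  then have e: "exp (s * of_real (ln (real n))) = of_real (real n powr ((real n + 1) / 2))"
  proof -
    have "s * of_real (ln (real n)) = of_real ((real n + 1) / 2 * ln (real n))"
      unfolding s_eq by simp
    then show ?thesis using n by (simp only: exp_of_real powr_def) simp
  qed
  have "gamma_ratio \<nu> s = of_real (1 / (real n powr ((real n + 1) / 2) * ((2 * pi) powr ((real n - 1) / 2) / sqrt (real n))))"
    unfolding gamma_ratio_def gamma_Phi_def n_def[symmetric] e gp a_def[symmetric] by (simp add: s_def)
  also have "1 / (real n powr ((real n + 1) / 2) * ((2 * pi) powr ((real n - 1) / 2) / sqrt (real n))) = gamma_ratio_limit n"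
  proof -
    define X where "X = real n powr ((real n + 1) / 2)"
    define Y where "Y = (2 * pi) powr ((real n - 1) / 2)"
    have XY: "X > 0" "Y > 0" unfolding X_def Y_def using n by auto
    have "real n powr (- real n / 2) * X = real n powr (1/2)"
      unfolding powr_add[symmetric] X_def by (simp add: field_simps)
    then have 1: "real n powr (- real n / 2) = sqrt (real n) / X"
      using n XY by (simp add: powr_half_sqrt field_simps)
    have "(2 * pi) powr (- (real n - 1) / 2) * Y = (2 * pi) powr 0"
      unfolding powr_add[symmetric] Y_def by (simp add: field_simps)
    then have 2: "(2 * pi) powr (- (real n - 1) / 2) = 1 / Y" using XY by (simp add: field_simps)
    show ?thesis unfolding gamma_ratio_limit_def 1 2 X_def[symmetric] Y_def[symmetric] by simp
  qed
  finally show ?thesis using lim unfolding n_def by simp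
qed

lemma gamma_ratio_tendsto:
  fixes \<nu> :: "'a::finite \<Rightarrow> complex"
  assumes s: "\<And>k. s / of_nat CARD('a) - \<nu> k \<notin> \<int>\<^sub>\<le>\<^sub>0" "s + bessel_exponent CARD('a) + of_nat CARD('a) - 1 \<notin> \<int>\<^sub>\<le>\<^sub>0"
    and sum: "(\<Sum>k\<in>UNIV. \<nu> k) = 0"
  shows "(\<lambda>N. gamma_ratio \<nu> (s + of_nat CARD('a) * of_nat N)) \<longlonglongrightarrow> of_real (gamma_ratio_limit CARD('a))"
proof -
  obtain \<rho> where \<rho>: "\<rho> \<longlonglongrightarrow> 1"
    "\<And>N. N > 0 \<Longrightarrow> gamma_ratio \<nu> (s + of_nat CARD('a) * of_nat (N + 1)) = \<rho> N * gamma_ratio_seq CARD('a) N"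
    using gamma_ratio_asymp[OF assms] by blast
  have "(\<lambda>N. \<rho> N * gamma_ratio_seq CARD('a) N) \<longlonglongrightarrow> 1 * of_real (gamma_ratio_limit CARD('a))"
    by (intro tendsto_mult \<rho> gamma_ratio_seq_tendsto)
  moreover have "eventually (\<lambda>N. \<rho> N * gamma_ratio_seq CARD('a) N = gamma_ratio \<nu> (s + of_nat CARD('a) * of_nat (Suc N))) sequentially"
    using eventually_gt_at_top[of 0] by eventually_elim (simp add: \<rho>(2)[symmetric])
  ultimately have "(\<lambda>N. gamma_ratio \<nu> (s + of_nat CARD('a) * of_nat (Suc N))) \<longlonglongrightarrow> of_real (gamma_ratio_limit CARD('a))"
    by (auto elim: Lim_transform_eventually)
  then show ?thesis by (rule LIMSEQ_imp_Suc)
qed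

lemma gamma_ratio_bounds:
  fixes B :: real
  assumes B: "B \<ge> 0"
  shows "\<exists>c0>0. \<exists>c1 S. \<forall>(\<nu> :: 'a::finite \<Rightarrow> complex) s. (\<Sum>k\<in>UNIV. \<nu> k) = 0 \<and> (\<forall>k. norm (\<nu> k) \<le> B) \<and> Re s \<ge> S \<longrightarrow>
     c0 \<le> norm (gamma_ratio \<nu> s) \<and> norm (gamma_ratio \<nu> s) \<le> c1"
proof -
  define n where "n = CARD('a)"
  have n: "n > 0" unfolding n_def by simp
  define a where "a = bessel_exponent n"
  have a: "a = - (of_nat n - 1) / 2" unfolding a_def bessel_exponent_def ..
  have aR: "a = of_real (- (real n - 1) / 2)" unfolding a by simp
  obtain h :: "'a \<Rightarrow> nat" where h: "bij_betw h UNIV {..<n}"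
    using ex_bij_betw_finite_nat[of "UNIV :: 'a set"] unfolding n_def by (auto simp: atLeast0LessThan)
  define \<alpha> where "\<alpha> k = a + of_nat (h k)" for k
  have "(\<Sum>k\<in>UNIV. \<alpha> k) = (\<Sum>j<n. a + of_nat j)"
    unfolding \<alpha>_def by (rule sum.reindex_bij_betw[OF h])
  also have "(\<Sum>j<n. a + of_nat j) = of_nat n * a + (\<Sum>j<n. of_nat j)" by (simp add: sum.distrib)
  also have "(\<Sum>j<n. of_nat j) = (of_nat n * (of_nat n - 1) / 2 :: complex)"
    by (induction n) (auto simp: field_simps)
  finally have sum\<alpha>: "(\<Sum>k\<in>UNIV. \<alpha> k) = 0" unfolding a by (simp add: field_simps)
  have n\<alpha>: "norm (\<alpha> k) \<le> 2 * real n + real n * B" for k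
  proof -
    have "h k < n" using h by (auto simp: bij_betw_def)
    moreover have "norm a \<le> real n" unfolding aR norm_of_real using n by simp
    moreover have "norm (\<alpha> k) \<le> norm a + real (h k)" unfolding \<alpha>_def by (metis norm_of_nat norm_triangle_ineq)
    moreover have "real n * B \<ge> 0" using B by simp
    ultimately show ?thesis by linarith
  qed
  obtain C S0 where C: "C > 0" "S0 \<ge> 1" "\<And>(\<alpha> :: 'a \<Rightarrow> complex) (\<beta> :: 'a \<Rightarrow> complex) s. norm s \<ge> S0 \<Longrightarrow>
     (\<And>k. norm (\<alpha> k) \<le> 2 * real n + real n * B) \<Longrightarrow> (\<And>k. norm (\<beta> k) \<le> 2 * real n + real n * B) \<Longrightarrow>
     (\<Sum>k\<in>UNIV. \<alpha> k) = 0 \<Longrightarrow> (\<Sum>k\<in>UNIV. \<beta> k) = 0 \<Longrightarrow>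
     norm ((\<Prod>k\<in>UNIV. s + \<alpha> k) / (\<Prod>k\<in>UNIV. s + \<beta> k) - 1) \<le> C / norm s ^ 2"
    using prod_quotient_near_1[of "2 * real n + real n * B", where 'a='a] B by auto
  \<comment> \<open>Large enough for S >= S0 and S^2 >= 2 C, and for s / n - \<nu> k and s + a to
    stay in the right half-plane, away from the poles.\<close>
  define S where "S = S0 + 2 * C + real n * (B + 1) + 1"
  define K where "K = gamma_ratio_limit n"
  have K: "K > 0" unfolding K_def gamma_ratio_limit_def using n by simp
  have nB: "real n * (B + 1) \<ge> 1 * 1" using n B by (intro mult_mono) auto
  have S: "S \<ge> 1" "S \<ge> S0" "S\<^sup>2 \<ge> 2 * C"
  proof -
    show 1: "S \<ge> 1" "S \<ge> S0" unfolding S_def using C nB by auto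
    have "2 * C \<le> S * 1" unfolding S_def using C nB by auto
    also have "\<dots> \<le> S * S" using 1 by (intro mult_left_mono) auto
    finally show "S\<^sup>2 \<ge> 2 * C" by (simp add: power2_eq_square)
  qed
  have main: "K / exp (2 * C) \<le> norm (gamma_ratio \<nu> s) \<and> norm (gamma_ratio \<nu> s) \<le> K * exp (4 * C)"
    if \<nu>: "(\<Sum>k\<in>UNIV. \<nu> k) = 0" "\<forall>k. norm (\<nu> k) \<le> B" and s: "Re s \<ge> S" for \<nu> :: "'a \<Rightarrow> complex" and s
  proof -
    have pole: "t / of_nat n - \<nu> k \<notin> \<int>\<^sub>\<le>\<^sub>0" "t + a \<notin> \<int>\<^sub>\<le>\<^sub>0" "t + a + of_nat n - 1 \<notin> \<int>\<^sub>\<le>\<^sub>0" if t: "Re t \<ge> S" for t k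
    proof -
      have "Re t / real n > B"
      proof -
        have "real n * B < Re t" using t n C unfolding S_def by (simp add: algebra_simps)
        then show ?thesis using n by (simp add: pos_less_divide_eq mult.commute)
      qed
      moreover have "Re (\<nu> k) \<le> B" using \<nu>(2) complex_Re_le_cmod[of "\<nu> k"] by (meson order_trans)
      ultimately have "Re (t / of_nat n - \<nu> k) > 0" by (simp add: Re_divide_of_nat)
      then show "t / of_nat n - \<nu> k \<notin> \<int>\<^sub>\<le>\<^sub>0" by (rule not_nonpos_Ints_if_Re_pos)
      have "real n * 1 \<le> real n * (B + 1)" using B by (intro mult_left_mono) auto
      then have "Re t > real n" using t C(1,2) unfolding S_def by linarith
      moreover have "real n \<ge> 1" using n by simp
      ultimately have "Re t + (- (real n - 1) / 2) > 0" by (simp add: field_simps)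
      then have "Re (t + a) > 0" unfolding aR by simp
      then show "t + a \<notin> \<int>\<^sub>\<le>\<^sub>0" "t + a + of_nat n - 1 \<notin> \<int>\<^sub>\<le>\<^sub>0"
        using n by (auto intro!: not_nonpos_Ints_if_Re_pos)
    qed
    have step: "norm (gamma_ratio \<nu> (t + of_nat n) - gamma_ratio \<nu> t) \<le> C / norm t ^ 2 * norm (gamma_ratio \<nu> t)"
      if t: "Re t \<ge> S" for t
    proof -
      have "gamma_ratio \<nu> (t + of_nat n) = (\<Prod>j<n. t + (a + of_nat j)) / (\<Prod>k\<in>UNIV. t - of_nat n * \<nu> k) * gamma_ratio \<nu> t"
        unfolding n_def a_def by (rule gamma_ratio_step) (use pole[OF t] in \<open>auto simp: n_def a_def\<close>)
      also have "(\<Prod>j<n. t + (a + of_nat j)) = (\<Prod>k\<in>UNIV. t + \<alpha> k)"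
        unfolding \<alpha>_def by (rule prod.reindex_bij_betw[OF h, symmetric])
      finally have "gamma_ratio \<nu> (t + of_nat n) - gamma_ratio \<nu> t =
          ((\<Prod>k\<in>UNIV. t + \<alpha> k) / (\<Prod>k\<in>UNIV. t + (- of_nat n * \<nu> k)) - 1) * gamma_ratio \<nu> t"
        by (simp add: left_diff_distrib)
      moreover have "norm ((\<Prod>k\<in>UNIV. t + \<alpha> k) / (\<Prod>k\<in>UNIV. t + (- of_nat n * \<nu> k)) - 1) \<le> C / norm t ^ 2"
      proof (rule C(3))
        show "norm t \<ge> S0" using t S complex_Re_le_cmod[of t] by linarith
        show "norm (- of_nat n * \<nu> k) \<le> 2 * real n + real n * B" for k
          using \<nu>(2) mult_left_mono[of "norm (\<nu> k)" B "real n"] by (simp add: norm_mult add_increasing)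
        show "(\<Sum>k\<in>UNIV. - of_nat n * \<nu> k) = 0" using \<nu>(1) by (simp add: sum_negf sum_distrib_left[symmetric])
      qed (use n\<alpha> sum\<alpha> in auto)
      ultimately show ?thesis by (simp only: norm_mult) (rule mult_right_mono, auto)
    qed
    have lim: "(\<lambda>N. gamma_ratio \<nu> (s + of_nat n * of_nat N)) \<longlonglongrightarrow> of_real K"
      unfolding n_def K_def
      by (rule gamma_ratio_tendsto) (use pole[OF s] \<nu> in \<open>auto simp: n_def a_def\<close>)
    note * = bounded_below_above_by_limit[OF n C(1) S(1,3) s step lim]
    have nK: "norm (of_real K :: complex) = K" using K by simp
    show ?thesis using * unfolding nK by (simp add: pos_divide_le_eq)
  qed
  have "K / exp (2 * C) > 0" using K by simp
  with main show ?thesis by blast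
qed

section \<open>Formal series and their Mellin transforms\<close>

text \<open>The action of \<open>z d/dz\<close> on \<open>exp (c z) z powr a \<Sum>\<^sub>i f i z powr (- i)\<close>, on coefficients.\<close>

definition formal_theta :: "complex \<Rightarrow> complex \<Rightarrow> (int \<Rightarrow> complex) \<Rightarrow> int \<Rightarrow> complex" where
  "formal_theta c a f i = c * f (i + 1) + (a - of_int i) * f i"

lemma formal_theta_Suc:
  "(formal_theta c a ^^ Suc j) f i = c * (formal_theta c a ^^ j) f (i + 1) + (a - of_int i) * (formal_theta c a ^^ j) f i"
  unfolding funpow.simps o_apply by (rule formal_theta_def)

lemma formal_theta_local:
  assumes "\<And>k. i \<le> k \<Longrightarrow> k \<le> i + int j \<Longrightarrow> f k = g k"
  shows "(formal_theta c a ^^ j) f i = (formal_theta c a ^^ j) g i"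
  using assms
proof (induction j arbitrary: i)
  case (Suc j)
  have "(formal_theta c a ^^ j) f (i + 1) = (formal_theta c a ^^ j) g (i + 1)"
    "(formal_theta c a ^^ j) f i = (formal_theta c a ^^ j) g i"
    by (rule Suc.IH; rule Suc.prems; simp)+
  then show ?case unfolding formal_theta_Suc by simp
qed simp

text \<open>The entry f (i + j) enters the j-th power only through c^j. This is what is needed for a
  series cut off exactly at index i + j.\<close>

lemma formal_theta_top:
  assumes "\<And>k. i \<le> k \<Longrightarrow> k < i + int j \<Longrightarrow> f k = g k"
  shows "(formal_theta c a ^^ j) f i - c ^ j * f (i + int j) = (formal_theta c a ^^ j) g i - c ^ j * g (i + int j)"
  using assms
proof (induction j arbitrary: i)
  case (Suc j)
  have 1: "(formal_theta c a ^^ j) f (i + 1) - c ^ j * f (i + 1 + int j) = (formal_theta c a ^^ j) g (i + 1) - c ^ j * g (i + 1 + int j)"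
    by (rule Suc.IH; rule Suc.prems; simp)
  have 2: "(formal_theta c a ^^ j) f i = (formal_theta c a ^^ j) g i"
    by (rule formal_theta_local; rule Suc.prems; simp)
  have e: "i + int (Suc j) = i + 1 + int j" by simp
  have "(formal_theta c a ^^ Suc j) f i - c ^ Suc j * f (i + 1 + int j) =
     c * ((formal_theta c a ^^ j) f (i + 1) - c ^ j * f (i + 1 + int j)) + (a - of_int i) * (formal_theta c a ^^ j) f i"
    unfolding formal_theta_Suc by (simp add: algebra_simps)
  also have "\<dots> = (formal_theta c a ^^ Suc j) g i - c ^ Suc j * g (i + 1 + int j)"
    unfolding 1 2 formal_theta_Suc by (simp add: algebra_simps)
  finally show ?case unfolding e .
qed simp

lemma formal_theta_bound:
  assumes "\<And>i. \<bar>i\<bar> \<le> L \<Longrightarrow> norm (f i) \<le> D" "D \<ge> 0"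
  shows "\<bar>i\<bar> \<le> L - int j \<Longrightarrow> norm ((formal_theta c a ^^ j) f i) \<le> (norm c + norm a + \<bar>of_int L\<bar>) ^ j * D"
proof (induction j arbitrary: i)
  case (Suc j)
  define X where "X = (norm c + norm a + \<bar>of_int L\<bar>) ^ j * D"
  have X: "X \<ge> 0" unfolding X_def using assms by simp
  have "norm ((formal_theta c a ^^ Suc j) f i) \<le> norm c * norm ((formal_theta c a ^^ j) f (i + 1)) + (norm a + \<bar>of_int i\<bar>) * norm ((formal_theta c a ^^ j) f i)"
  proof -
    have "norm (a - of_int i) \<le> norm a + \<bar>of_int i\<bar>" using norm_triangle_ineq4[of a "of_int i"] by simp
    then have "norm ((a - of_int i) * (formal_theta c a ^^ j) f i) \<le> (norm a + \<bar>of_int i\<bar>) * norm ((formal_theta c a ^^ j) f i)"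
      unfolding norm_mult by (intro mult_right_mono) auto
    then show ?thesis
      using norm_triangle_ineq[of "c * (formal_theta c a ^^ j) f (i + 1)" "(a - of_int i) * (formal_theta c a ^^ j) f i"]
      unfolding formal_theta_Suc norm_mult by linarith
  qed
  also have "\<dots> \<le> norm c * X + (norm a + \<bar>of_int L\<bar>) * X"
  proof (intro add_mono mult_mono)
    show "norm ((formal_theta c a ^^ j) f (i + 1)) \<le> X" "norm ((formal_theta c a ^^ j) f i) \<le> X"
      unfolding X_def by (rule Suc.IH; use Suc.prems in linarith)+
    show "\<bar>real_of_int i\<bar> \<le> \<bar>real_of_int L\<bar>" using Suc.prems by linarith
  qed (use X in auto)
  also have "\<dots> = (norm c + norm a + \<bar>of_int L\<bar>) ^ Suc j * D" unfolding X_def by (simp add: algebra_simps)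
  finally show ?case .
qed (use assms in auto)

text \<open>The termwise Mellin transform of exp(-y) times the sum of f i y^(a - i). It is meant for
  finite support; over an infinite support the sum defaults to 0.\<close>

definition gamma_series :: "complex \<Rightarrow> (int \<Rightarrow> complex) \<Rightarrow> complex \<Rightarrow> complex" where
  "gamma_series a f s = (\<Sum>i | f i \<noteq> 0. f i * Gamma (s + a - of_int i))"

lemma gamma_series_superset:
  assumes "finite A" "{i. f i \<noteq> 0} \<subseteq> A"
  shows "gamma_series a f s = (\<Sum>i\<in>A. f i * Gamma (s + a - of_int i))"
  unfolding gamma_series_def using assms by (intro sum.mono_neutral_left) auto

lemma gamma_series_add:
  assumes "finite {i. f i \<noteq> 0}" "finite {i. g i \<noteq> 0}"
  shows "gamma_series a (\<lambda>i. f i + g i) s = gamma_series a f s + gamma_series a g s"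
proof -
  let ?A = "{i. f i \<noteq> 0} \<union> {i. g i \<noteq> 0}"
  have "gamma_series a (\<lambda>i. f i + g i) s = (\<Sum>i\<in>?A. (f i + g i) * Gamma (s + a - of_int i))"
    using assms by (intro gamma_series_superset) auto
  also have "\<dots> = gamma_series a f s + gamma_series a g s"
    using assms by (subst (1 2) gamma_series_superset[of ?A]) (auto simp: ring_distribs sum.distrib)
  finally show ?thesis .
qed

lemma gamma_series_cmult: "gamma_series a (\<lambda>i. c * f i) s = c * gamma_series a f s"
  by (cases "c = 0") (auto simp: gamma_series_def sum_distrib_left mult_ac)

lemma gamma_series_sum:
  assumes "finite J" "\<And>j. j \<in> J \<Longrightarrow> finite {i. f j i \<noteq> 0}"
  shows "gamma_series a (\<lambda>i. \<Sum>j\<in>J. f j i) s = (\<Sum>j\<in>J. gamma_series a (f j) s) \<and> finite {i. (\<Sum>j\<in>J. f j i) \<noteq> 0}"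
  using assms
proof (induction J rule: finite_induct)
  case (insert x J)
  have fin: "finite {i. f x i + (\<Sum>j\<in>J. f j i) \<noteq> 0}"
    by (rule finite_subset[of _ "{i. f x i \<noteq> 0} \<union> {i. (\<Sum>j\<in>J. f j i) \<noteq> 0}"]) (use insert in auto)
  then show ?case using insert by (simp add: gamma_series_add)
qed (auto simp: gamma_series_def)

text \<open>A shift of the coefficients is multiplication by y^m, hence a translation of the Mellin
  variable.\<close>

lemma gamma_series_shift: "gamma_series a (\<lambda>i. f (i + m)) s = gamma_series a f (s + of_int m)"
  unfolding gamma_series_def
  by (rule sum.reindex_bij_witness[of _ "\<lambda>i. i - m" "\<lambda>i. i + m"]) (auto simp: algebra_simps)

lemma finite_support_shift:
  assumes "finite {i. f i \<noteq> (0::complex)}"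
  shows "finite {i::int. f (i + m) \<noteq> 0}"
proof -
  have "{i. f (i + m) \<noteq> 0} = (\<lambda>i. i - m) ` {i. f i \<noteq> 0}"
    by (auto intro!: image_eqI[of _ _ "_ + m"])
  then show ?thesis using assms by simp
qed

lemma formal_theta_finite_support:
  assumes "finite {i. f i \<noteq> 0}"
  shows "finite {i. formal_theta c a f i \<noteq> 0}"
  by (rule finite_subset[of _ "{i. f (i + 1) \<noteq> 0} \<union> {i. f i \<noteq> 0}"])
     (use assms finite_support_shift in \<open>auto simp: formal_theta_def\<close>)

text \<open>Multiplication by \<open>-s\<close> is the Mellin transform of \<open>y d/dy\<close>.\<close>

lemma gamma_series_formal_theta:
  assumes fin: "finite {i. f i \<noteq> 0}" and M: "\<And>i. i \<ge> M \<Longrightarrow> f i = 0" and s: "Re (s + a) > of_int M"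
  shows "gamma_series a (formal_theta (-1) a f) s = - s * gamma_series a f s"
proof -
  have fin2: "finite {i. (a - of_int i) * f i \<noteq> 0}" by (rule finite_subset[OF _ fin]) auto
  have fin1: "finite {i. - 1 * f (i + 1) \<noteq> 0}" using finite_support_shift[OF fin, of 1] by simp
  have "gamma_series a (formal_theta (-1) a f) s = gamma_series a (\<lambda>i. - 1 * f (i + 1) + (a - of_int i) * f i) s"
    by (simp add: formal_theta_def[abs_def])
  also have "\<dots> = - gamma_series a f (s + 1) + gamma_series a (\<lambda>i. (a - of_int i) * f i) s"
    unfolding gamma_series_add[OF fin1 fin2] gamma_series_cmult gamma_series_shift by simp
  also have "gamma_series a f (s + 1) = (\<Sum>i | f i \<noteq> 0. f i * ((s + a - of_int i) * Gamma (s + a - of_int i)))"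
    unfolding gamma_series_def
  proof (intro sum.cong refl arg_cong2[of _ _ _ _ "(*)"])
    fix i assume "i \<in> {i. f i \<noteq> 0}"
    then have "i < M" using M[of i] by (cases "i < M") auto
    then have "Re (s + a - of_int i) > 0" using s by simp
    then have "Gamma (s + a - of_int i + 1) = (s + a - of_int i) * Gamma (s + a - of_int i)"
      by (intro Gamma_plus1 not_nonpos_Ints_if_Re_pos)
    moreover have "s + 1 + a - of_int i = s + a - of_int i + 1" by simp
    ultimately show "Gamma (s + 1 + a - of_int i) = (s + a - of_int i) * Gamma (s + a - of_int i)" by (simp only:)
  qed
  also have "gamma_series a (\<lambda>i. (a - of_int i) * f i) s = (\<Sum>i | f i \<noteq> 0. (a - of_int i) * f i * Gamma (s + a - of_int i))"
    using fin by (intro gamma_series_superset) auto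
  also have "- (\<Sum>i | f i \<noteq> 0. f i * ((s + a - of_int i) * Gamma (s + a - of_int i))) + \<dots> = - s * gamma_series a f s"
    unfolding gamma_series_def sum_negf[symmetric] sum.distrib[symmetric] sum_distrib_left
    by (intro sum.cong refl) (simp add: algebra_simps)
  finally show ?thesis .
qed

lemma formal_theta_zero_above:
  assumes "\<And>i. i \<ge> M \<Longrightarrow> f i = 0"
  shows "i \<ge> M \<Longrightarrow> (formal_theta c a ^^ j) f i = 0"
  by (induction j arbitrary: i) (auto simp: formal_theta_def assms)

lemma gamma_series_formal_theta_power:
  assumes fin: "finite {i. f i \<noteq> 0}" and M: "\<And>i. i \<ge> M \<Longrightarrow> f i = 0" and s: "Re (s + a) > of_int M"
  shows "finite {i. (formal_theta (-1) a ^^ j) f i \<noteq> 0} \<and>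
    gamma_series a ((formal_theta (-1) a ^^ j) f) s = (- s) ^ j * gamma_series a f s"
proof (induction j)
  case (Suc j)
  have "gamma_series a (formal_theta (-1) a ((formal_theta (-1) a ^^ j) f)) s = - s * gamma_series a ((formal_theta (-1) a ^^ j) f) s"
    using Suc formal_theta_zero_above[OF M] s by (intro gamma_series_formal_theta[of _ M]) auto
  then show ?case using Suc formal_theta_finite_support by (simp del: One_nat_def)
qed (use fin in auto)

text \<open>In the coordinate log z the operator of the Bessel equation, without the term in z^n, is
  this polynomial in the derivative; its roots - n \<nu> k are the exponents at the origin.\<close>

definition index_poly :: "('a::finite \<Rightarrow> complex) \<Rightarrow> complex poly" where
  "index_poly \<nu> = (\<Prod>k\<in>UNIV. [:of_nat CARD('a) * \<nu> k, 1:])"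

lemma degree_index_poly: "degree (index_poly (\<nu> :: 'a::finite \<Rightarrow> complex)) = CARD('a)"
  unfolding index_poly_def by (subst degree_prod_eq_sum_degree) auto

lemma lead_coeff_index_poly: "coeff (index_poly (\<nu> :: 'a::finite \<Rightarrow> complex)) CARD('a) = 1"
proof -
  have "lead_coeff (index_poly \<nu>) = 1" unfolding index_poly_def by (simp add: lead_coeff_prod)
  then show ?thesis by (simp add: degree_index_poly)
qed

lemma poly_index_poly: "poly (index_poly (\<nu> :: 'a::finite \<Rightarrow> complex)) (- s) = (-1) ^ CARD('a) * (\<Prod>k\<in>UNIV. s - of_nat CARD('a) * \<nu> k)"
proof -
  have "poly (index_poly \<nu>) (- s) = (\<Prod>k\<in>(UNIV::'a set). (-1) * (s - of_nat CARD('a) * \<nu> k))"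
    unfolding index_poly_def poly_prod by simp
  then show ?thesis by (simp only: prod.distrib prod_constant)
qed

lemma norm_coeff_prod_linear_le:
  assumes "finite I" "\<And>i. i \<in> I \<Longrightarrow> norm (y i) \<le> Y" "Y \<ge> 0"
  shows "norm (coeff (\<Prod>i\<in>I. [:y i, 1:] :: complex poly) j) \<le> (1 + Y) ^ card I"
  using assms(1,2)
proof (induction I arbitrary: j rule: finite_induct)
  case (insert x I)
  define p where "p = (\<Prod>i\<in>I. [:y i, 1:])"
  have IH: "norm (coeff p j) \<le> (1 + Y) ^ card I" for j unfolding p_def using insert by auto
  have "coeff (\<Prod>i\<in>insert x I. [:y i, 1:]) j = y x * coeff p j + (if j = 0 then 0 else coeff p (j - 1))"
    using insert by (simp add: p_def[symmetric] mult_pCons_left coeff_pCons split: nat.splits)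
  also have "norm \<dots> \<le> Y * (1 + Y) ^ card I + (1 + Y) ^ card I"
  proof (intro order_trans[OF norm_triangle_ineq] add_mono)
    show "norm (y x * coeff p j) \<le> Y * (1 + Y) ^ card I"
      unfolding norm_mult using insert IH assms by (intro mult_mono) auto
    show "norm (if j = 0 then 0 else coeff p (j - 1)) \<le> (1 + Y) ^ card I" using IH assms by auto
  qed
  finally show ?case using insert by (simp add: algebra_simps)
qed auto

text \<open>The recurrence that expresses Q(y d/dy) u = (-y)^n u for u = exp(-y) y^a times the sum
  of f i y^(-i), where Q is \<open>index_poly \<nu>\<close>. Indexing by integers with zeros below 0
  makes multiplication by y^n a plain shift.\<close>

definition formal_normal_solution :: "('a::finite \<Rightarrow> complex) \<Rightarrow> (int \<Rightarrow> complex) \<Rightarrow> bool" where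
  "formal_normal_solution \<nu> f \<longleftrightarrow> (\<forall>i<0. f i = 0) \<and>
     (\<forall>i. (\<Sum>j\<le>CARD('a). coeff (index_poly \<nu>) j * (formal_theta (-1) (bessel_exponent CARD('a)) ^^ j) f i) =
          (-1) ^ CARD('a) * f (i + int CARD('a)))"

section \<open>Comparison of the truncated series with the Gamma product\<close>

lemma norm_pochhammer_bounds:
  fixes z :: complex
  assumes "norm z \<ge> 2 * (real m + 1)"
  shows "(norm z / 2) ^ m \<le> norm (pochhammer z m)" "norm (pochhammer z m) \<le> (2 * norm z) ^ m"
proof -
  have b: "norm z / 2 \<le> norm (z + of_nat i) \<and> norm (z + of_nat i) \<le> 2 * norm z" if "i < m" for i
    using norm_triangle_ineq[of z "of_nat i"] norm_triangle_ineq2[of z "- of_nat i"] that assms by auto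
  have p: "norm (pochhammer z m) = (\<Prod>i<m. norm (z + of_nat i))"
    by (simp add: pochhammer_prod prod_norm atLeast0LessThan)
  have "(\<Prod>i<m. norm z / 2) \<le> norm (pochhammer z m)" unfolding p using b by (intro prod_mono) auto
  then show "(norm z / 2) ^ m \<le> norm (pochhammer z m)" by simp
  have "norm (pochhammer z m) \<le> (\<Prod>i<m. 2 * norm z)" unfolding p using b by (intro prod_mono) auto
  then show "norm (pochhammer z m) \<le> (2 * norm z) ^ m" by simp
qed

lemma Gamma_shift_bounds:
  fixes z :: complex
  assumes "Re z > 0" "norm z \<ge> 2 * (real m + 1)"
  shows "(norm z / 2) ^ m * norm (Gamma z) \<le> norm (Gamma (z + of_nat m))"
    "norm (Gamma (z + of_nat m)) \<le> (2 * norm z) ^ m * norm (Gamma z)"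
proof -
  have "z \<notin> \<int>\<^sub>\<le>\<^sub>0" using assms(1) by (rule not_nonpos_Ints_if_Re_pos)
  then have "Gamma (z + of_nat m) = pochhammer z m * Gamma z"
    using pochhammer_Gamma[of z m] by (simp add: Gamma_eq_zero_iff)
  then show "(norm z / 2) ^ m * norm (Gamma z) \<le> norm (Gamma (z + of_nat m))"
    "norm (Gamma (z + of_nat m)) \<le> (2 * norm z) ^ m * norm (Gamma z)"
    using norm_pochhammer_bounds[OF assms(2)] by (auto simp: norm_mult intro!: mult_right_mono)
qed

text \<open>Summing errors of order M + 1 along the progression costs one power. For Re s >= 1 one
  has |s + n j|^2 >= (|s| + j)^2 / 2, so that the sum is dominated by a telescoping one.\<close>

lemma tail_sum_bound:
  assumes "Re s \<ge> 1" "n > 0" "M \<ge> 1"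
  shows "(\<Sum>j<N. 1 / norm (s + of_nat n * of_nat j) ^ (M + 1)) \<le> 4 / norm s ^ M"
proof -
  define r where "r = norm s"
  have r: "r \<ge> 1" using assms complex_Re_le_cmod[of s] unfolding r_def by linarith
  have nr: "norm (s + of_nat n * of_nat j) \<ge> r" "norm (s + of_nat n * of_nat j) ^ 2 \<ge> (r + real j)\<^sup>2 / 2" for j
  proof -
    have "real j \<le> real n * real j" using assms by (simp add: mult_le_cancel_right1)
    then have j2: "(real j)^2 \<le> (real n * real j)^2" by (intro power_mono) auto
    have eq: "norm (s + of_nat n * of_nat j) ^ 2 = (Re s + real n * real j)^2 + (Im s)^2" unfolding cmod_power2 by simp
    have "0 \<le> 2 * Re s * (real n * real j)" using assms by simp
    then have "(Re s)^2 + (real n * real j)^2 \<le> (Re s + real n * real j)^2" unfolding power2_sum by linarith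
    then have 1: "r^2 + (real j)^2 \<le> norm (s + of_nat n * of_nat j) ^ 2"
      using j2 unfolding eq unfolding r_def cmod_power2 by linarith
    have "r\<^sup>2 \<le> norm (s + of_nat n * of_nat j) ^ 2" using 1 by (smt (verit) zero_le_power2)
    then show "norm (s + of_nat n * of_nat j) \<ge> r" by (rule power2_le_imp_le) simp
    have "0 \<le> (r - real j)^2" by simp
    then have "(r + real j)\<^sup>2 / 2 \<le> r^2 + (real j)^2" unfolding power2_sum power2_diff by simp
    with 1 show "norm (s + of_nat n * of_nat j) ^ 2 \<ge> (r + real j)\<^sup>2 / 2" by linarith
  qed
  have "(\<Sum>j<N. 1 / norm (s + of_nat n * of_nat j) ^ (M + 1)) \<le> (\<Sum>j<N. 2 / r ^ (M - 1) * (1 / (r + real j)\<^sup>2))"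
  proof (rule sum_mono)
    fix j
    have "r ^ (M - 1) * ((r + real j)\<^sup>2 / 2) \<le> norm (s + of_nat n * of_nat j) ^ (M - 1) * norm (s + of_nat n * of_nat j) ^ 2"
      using nr[of j] r by (intro mult_mono power_mono) auto
    also have "\<dots> = norm (s + of_nat n * of_nat j) ^ (M + 1)"
      using assms(3) unfolding power_add[symmetric] by simp
    finally have "1 / norm (s + of_nat n * of_nat j) ^ (M + 1) \<le> 1 / (r ^ (M - 1) * ((r + real j)\<^sup>2 / 2))"
    proof (intro divide_left_mono mult_pos_pos zero_less_power)
      show "norm (s + of_nat n * of_nat j) > 0" using nr(1)[of j] r by linarith
      show "r > 0" "(r + real j)\<^sup>2 / 2 > 0" using r by auto
    qed auto
    then show "1 / norm (s + of_nat n * of_nat j) ^ (M + 1) \<le> 2 / r ^ (M - 1) * (1 / (r + real j)\<^sup>2)" by simp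
  qed
  also have "\<dots> = 2 / r ^ (M - 1) * (\<Sum>j<N. 1 / (r + real j)\<^sup>2)" by (simp add: sum_distrib_left)
  also have "\<dots> \<le> 2 / r ^ (M - 1) * (2 / r)"
  proof (rule mult_left_mono)
    have "(\<Sum>j<N. 1 / (r + real j)\<^sup>2) \<le> 2 / r - 2 / (r + real N)"
    proof (induction N)
      case (Suc N)
      have p: "r + real N \<ge> 1" using r by simp
      then have "2 / (r + real N) - 2 / (r + real N + 1) = 2 / ((r + real N) * (r + real N + 1))"
        by (simp add: field_simps)
      moreover have "1 / ((r + real N) * (r + real N)) \<le> 2 / ((r + real N) * (r + real N + 1))"
      proof -
        have "(r + real N) * (r + real N + 1) \<le> (r + real N) * (2 * (r + real N))" using p by (intro mult_left_mono) auto
        then have "2 / ((r + real N) * (2 * (r + real N))) \<le> 2 / ((r + real N) * (r + real N + 1))"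
          using p by (intro divide_left_mono mult_pos_pos) auto
        moreover have "2 / ((r + real N) * (2 * (r + real N))) = 1 / ((r + real N) * (r + real N))" using p by (simp add: divide_simps)
        ultimately show ?thesis by simp
      qed
      ultimately have "1 / (r + real N)\<^sup>2 \<le> 2 / (r + real N) - 2 / (r + real (Suc N))"
        by (simp add: power2_eq_square add_ac)
      then show ?case using Suc by simp
    qed simp
    also have "\<dots> \<le> 2 / r" using r by simp
    finally show "(\<Sum>j<N. 1 / (r + real j)\<^sup>2) \<le> 2 / r" .
  qed (use r in auto)
  also have "\<dots> = 4 / r ^ M" using assms(3) by (cases M) auto
  finally show ?thesis unfolding r_def .
qed

text \<open>Let Q be the truncated Mellin transform \<Psi> divided by \<open>gamma_Phi\<close>. By
  the formal equation one step changes Q by an error of order M + 1, and Q has the same limit K as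
  \<open>gamma_ratio\<close>; summing the steps to infinity bounds K - Q s by a multiple of
  |s|^(-M). Multiplication by \<open>gamma_Phi\<close>, which is comparable to Gamma(s + a), turns
  this into Gamma(s + a - M).\<close>

theorem gamma_Phi_expansion:
  fixes B D :: real and M :: nat
  assumes B: "B \<ge> 0" and D: "D \<ge> 0" and M: "M \<ge> 1"
  shows "\<exists>C S. C \<ge> 0 \<and> (\<forall>(\<nu> :: 'a::finite \<Rightarrow> complex) f s. (\<Sum>k\<in>UNIV. \<nu> k) = 0 \<and> (\<forall>k. norm (\<nu> k) \<le> B) \<and>
     formal_normal_solution \<nu> f \<and> f 0 = 1 \<and> (\<forall>i<M. norm (f (int i)) \<le> D) \<and> Re s \<ge> S \<longrightarrow>
     norm (of_real (gamma_ratio_limit CARD('a)) * gamma_Phi \<nu> s - (\<Sum>i<M. f (int i) * Gamma (s + bessel_exponent CARD('a) - of_nat i)))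
       \<le> C * norm (Gamma (s + bessel_exponent CARD('a) - of_nat M)))"
proof -
  define n where "n = CARD('a)"
  have n: "n > 0" unfolding n_def by simp
  define a where "a = bessel_exponent n"
  have a: "a = of_real (- (real n - 1) / 2)" unfolding a_def bessel_exponent_def by simp
  have Ra: "Re a = - (real n - 1) / 2" "norm a \<le> real n" using n unfolding a norm_of_real by auto
  obtain c0 c1 S0 where g: "c0 > 0" "\<And>(\<nu> :: 'a \<Rightarrow> complex) s. (\<Sum>k\<in>UNIV. \<nu> k) = 0 \<Longrightarrow> (\<And>k. norm (\<nu> k) \<le> B) \<Longrightarrow> Re s \<ge> S0 \<Longrightarrow>
     c0 \<le> norm (gamma_ratio \<nu> s) \<and> norm (gamma_ratio \<nu> s) \<le> c1"
    using gamma_ratio_bounds[OF B, where 'a='a] by metis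
  define L where "L = int M + 2 * int n"
  define X where "X = 1 + norm a + real_of_int L"
  have X: "X \<ge> 1" unfolding X_def L_def by simp
  define Rb where "Rb = real (n + 1) * ((1 + real n * B) ^ n * (X ^ n * D)) + D"
  have Rb: "Rb \<ge> 0" unfolding Rb_def using B D X by simp
  define c1' where "c1' = \<bar>c1\<bar>"
  define E where "E = real n * (Rb * 4 ^ (M + 1)) * c1'"
  have E: "E \<ge> 0" unfolding E_def c1'_def using Rb by simp
  define S where "S = \<bar>S0\<bar> + 4 * (real n + real M + 1) + 2 * (norm a + real M + real n) + 4 + real n * B"
  define K where "K = gamma_ratio_limit n"
  have "norm (of_real K * gamma_Phi \<nu> s - (\<Sum>i<M. f (int i) * Gamma (s + a - of_nat i)))
       \<le> (4 * E * 4 ^ M / c0) * norm (Gamma (s + a - of_nat M))"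
    if \<nu>: "(\<Sum>k\<in>UNIV. \<nu> k) = 0" "\<forall>k. norm (\<nu> k) \<le> B" and f: "formal_normal_solution \<nu> f" "f 0 = 1"
      "\<forall>i<M. norm (f (int i)) \<le> D" and s: "Re s \<ge> S" for \<nu> :: "'a \<Rightarrow> complex" and f s
  proof -
    define fM where "fM i = (if i < int M then f i else 0)" for i
    have f0: "f i = 0" if "i < 0" for i using f that unfolding formal_normal_solution_def by auto
    have supp: "{i. fM i \<noteq> 0} \<subseteq> {0..<int M}"
    proof
      fix i assume "i \<in> {i. fM i \<noteq> 0}"
      then show "i \<in> {0..<int M}" using f0[of i] unfolding fM_def by (auto split: if_splits simp: not_less[symmetric])
    qed
    then have fin: "finite {i. fM i \<noteq> 0}" by (rule finite_subset) auto
    have fMz: "fM i = 0" if "i \<ge> int M" for i using that unfolding fM_def by simp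
    have fMD: "norm (fM i) \<le> D" for i
    proof (cases "0 \<le> i \<and> i < int M")
      case True
      then show ?thesis using f(3) unfolding fM_def by (auto simp: zle_iff_zadd)
    qed (use f0[of i] D in \<open>auto simp: fM_def\<close>)
    define \<Psi> where "\<Psi> t = gamma_series a fM t" for t
    have \<Psi>: "\<Psi> t = (\<Sum>i<M. f (int i) * Gamma (t + a - of_nat i))" for t
    proof -
      have "\<Psi> t = (\<Sum>i\<in>{0..<int M}. fM i * Gamma (t + a - of_int i))"
        unfolding \<Psi>_def by (rule gamma_series_superset) (use supp in auto)
      also have "\<dots> = (\<Sum>i<M. f (int i) * Gamma (t + a - of_nat i))"
        by (rule sum.reindex_bij_witness[of _ int nat]) (auto simp: fM_def)
      finally show ?thesis .
    qed
    define q where "q j = coeff (index_poly \<nu>) j" for j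
    define th where "th j = (formal_theta (-1) a ^^ j)" for j
    \<comment> \<open>The defect of the truncated series in the formal equation. It will be
      supported in M - n < i < M.\<close>
    define r where "r i = (\<Sum>j\<le>n. q j * th j fM i) + (- ((-1) ^ n)) * fM (i + int n)" for i
    have r_hi: "r i = 0" if "i \<ge> int M" for i
    proof -
      have "th j fM i = 0" for j unfolding th_def by (rule formal_theta_zero_above[OF fMz]) (use that in auto)
      then show ?thesis unfolding r_def using fMz[of "i + int n"] that by simp
    qed
    have r_lo: "r i = 0" if i: "i \<le> int M - int n" for i
    proof -
      have 1: "th j fM i = th j f i" if "j < n" for j
        unfolding th_def by (rule formal_theta_local) (use i that in \<open>auto simp: fM_def\<close>)
      \<comment> \<open>At i = M - n the entry of index M has been cut off. It occurs in both terms
        with the same coefficient (-1)^n, so their difference does not see the truncation.\<close>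
      have 2: "th n fM i - (-1) ^ n * fM (i + int n) = th n f i - (-1) ^ n * f (i + int n)"
        unfolding th_def by (rule formal_theta_top) (use i in \<open>auto simp: fM_def\<close>)
      have qn: "q n = 1" unfolding q_def n_def by (rule lead_coeff_index_poly)
      have split: "(\<Sum>j\<le>n. q j * h j) = (\<Sum>j<n. q j * h j) + h n" for h :: "nat \<Rightarrow> complex"
        using qn by (simp add: lessThan_Suc_atMost[symmetric])
      have "(\<Sum>j\<le>n. q j * th j f i) = (-1) ^ n * f (i + int n)"
        using f(1) unfolding formal_normal_solution_def q_def th_def n_def a_def by auto
      then have "(\<Sum>j<n. q j * th j f i) + (th n f i - (-1) ^ n * f (i + int n)) = 0"
        unfolding split add_diff_eq right_minus_eq .
      then have "(\<Sum>j<n. q j * th j fM i) + (th n fM i - (-1) ^ n * fM (i + int n)) = 0"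
        unfolding 2 by (simp add: 1)
      then show ?thesis unfolding r_def split by (simp add: algebra_simps)
    qed
    have r_bd: "norm (r i) \<le> Rb" if i: "int M - int n < i" "i < int M" for i
    proof -
      have "norm (q j * th j fM i) \<le> (1 + real n * B) ^ n * (X ^ n * D)" if j: "j \<le> n" for j
      proof -
        have "norm (q j) \<le> (1 + real n * B) ^ n"
          unfolding q_def index_poly_def n_def[symmetric]
          using norm_coeff_prod_linear_le[of "UNIV :: 'a set" "\<lambda>k. of_nat n * \<nu> k" "real n * B" j] \<nu>(2) B
          by (simp add: norm_mult mult_left_mono n_def)
        moreover have "norm (th j fM i) \<le> (norm (-1 :: complex) + norm a + \<bar>of_int L\<bar>) ^ j * D"
          unfolding th_def by (rule formal_theta_bound[of L]) (use fMD D i j in \<open>auto simp: L_def\<close>)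
        moreover have "(norm (-1 :: complex) + norm a + \<bar>of_int L\<bar>) ^ j * D \<le> X ^ n * D"
        proof -
          have "norm (-1 :: complex) + norm a + \<bar>of_int L\<bar> = X" unfolding X_def L_def by simp
          then show ?thesis using power_increasing[OF j X] D by (simp add: mult_right_mono)
        qed
        ultimately show ?thesis unfolding norm_mult using B by (intro mult_mono) auto
      qed
      then have "norm (\<Sum>j\<le>n. q j * th j fM i) \<le> real (card {..n}) * ((1 + real n * B) ^ n * (X ^ n * D))"
        by (intro sum_norm_bound) auto
      moreover have "norm ((- ((-1) ^ n)) * fM (i + int n)) \<le> D" using fMD by (simp add: norm_mult norm_power)
      ultimately show ?thesis unfolding r_def Rb_def by (intro order_trans[OF norm_triangle_ineq] add_mono) auto
    qed
    have big: "\<bar>S0\<bar> \<le> Re t" "Re t > real n + real M" "norm t \<ge> 4 * (real n + real M + 1) + 2 * (norm a + real M + real n)" "norm t \<ge> 4"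
      "Re t > real n * B" if "Re t \<ge> S" for t
      using that complex_Re_le_cmod[of t] B mult_nonneg_nonneg[of "real n" B] norm_ge_zero[of a] unfolding S_def by (linarith | auto)+
    have z: "Re (t + a - of_int i) > 0" "norm (t + a - of_int i) \<ge> norm t / 2" "norm (t + a - of_int i) \<ge> 2 * (real (n + M) + 1)"
      "norm (t + a - of_int i) \<le> 2 * norm t"
      if t: "Re t \<ge> S" and i: "\<bar>i\<bar> \<le> int M + int n" "i \<le> int M" for t i
    proof -
      have "Re (t + a - of_int i) = Re t - (real n - 1) / 2 - real_of_int i"
        unfolding minus_complex.simps plus_complex.simps Ra(1) complex_Re_of_int by (simp add: field_simps)
      moreover have "real_of_int i \<le> real M" using i by linarith
      ultimately show "Re (t + a - of_int i) > 0" using big(2)[OF t] n by (simp add: field_simps)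
      have "norm (a - of_int i) \<le> norm a + (real M + real n)"
        using i norm_triangle_ineq4[of a "of_int i"] by simp
      then have x: "norm (a - of_int i) \<le> norm t / 2" "2 * norm (a - of_int i) + 4 * (real n + real M + 1) \<le> norm t" using big(3)[OF t] n by auto
      have "norm t - norm (a - of_int i) \<le> norm (t + (a - of_int i))" by (metis norm_diff_ineq)
      then have y: "norm t - norm (a - of_int i) \<le> norm (t + a - of_int i)" by (simp add: algebra_simps)
      show "norm (t + a - of_int i) \<ge> norm t / 2" using x y by linarith
      show "norm (t + a - of_int i) \<ge> 2 * (real (n + M) + 1)" using x y norm_ge_zero[of "a - of_int i"] unfolding of_nat_add by linarith
      have "norm (t + (a - of_int i)) \<le> norm t + norm (a - of_int i)" by (rule norm_triangle_ineq)
      then show "norm (t + a - of_int i) \<le> 2 * norm t" using x norm_ge_zero[of t] unfolding add_diff_eq by linarith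
    qed
    have pole: "t / of_nat CARD('a) - \<nu> k \<notin> \<int>\<^sub>\<le>\<^sub>0" if t: "Re t \<ge> S" for t k
    proof -
      have "Re t / real n > B" using big(5)[OF t] n by (simp add: pos_less_divide_eq mult.commute)
      moreover have "Re (\<nu> k) \<le> B" using \<nu>(2) complex_Re_le_cmod[of "\<nu> k"] by (meson order_trans)
      ultimately have "Re (t / of_nat n - \<nu> k) > 0" by (simp add: Re_divide_of_nat)
      then show ?thesis unfolding n_def by (rule not_nonpos_Ints_if_Re_pos)
    qed
    have diff: "norm (\<Psi> (t + of_nat n) - (\<Prod>k\<in>UNIV. t - of_nat n * \<nu> k) * \<Psi> t) \<le>
        real n * (Rb * 4 ^ (M + 1)) / norm t ^ (M + 1) * norm (Gamma (t + of_nat n + a))" if t: "Re t \<ge> S" for t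
    proof -
      have Rt: "Re (t + a) > of_int (int M)" using z(1)[OF t, of "int M"] by simp
      have fth: "finite {i. th j fM i \<noteq> 0}" "gamma_series a (th j fM) t = (- t) ^ j * \<Psi> t" for j
        using gamma_series_formal_theta_power[OF fin fMz Rt, of j] unfolding th_def \<Psi>_def by auto
      have fq: "finite {i. q j * th j fM i \<noteq> 0}" for j by (rule finite_subset[OF _ fth(1)[of j]]) auto
      have fs: "finite {i. - ((-1) ^ n) * fM (i + int n) \<noteq> 0}"
        using finite_support_shift[OF fin, of "int n"] by simp
      have "gamma_series a r t = (\<Sum>j\<le>n. q j * ((- t) ^ j * \<Psi> t)) + - ((-1) ^ n) * \<Psi> (t + of_nat n)"
      proof -
        have "gamma_series a r t = gamma_series a (\<lambda>i. \<Sum>j\<le>n. q j * th j fM i) t + gamma_series a (\<lambda>i. - ((-1) ^ n) * fM (i + int n)) t"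
          unfolding r_def[abs_def] by (rule gamma_series_add) (use gamma_series_sum[of "{..n}"] fq fs in auto)
        also have "gamma_series a (\<lambda>i. \<Sum>j\<le>n. q j * th j fM i) t = (\<Sum>j\<le>n. q j * ((- t) ^ j * \<Psi> t))"
          using gamma_series_sum[of "{..n}" "\<lambda>j i. q j * th j fM i" a t] fq by (simp add: gamma_series_cmult fth)
        also have "gamma_series a (\<lambda>i. - ((-1) ^ n) * fM (i + int n)) t = - ((-1) ^ n) * \<Psi> (t + of_nat n)"
          unfolding gamma_series_cmult gamma_series_shift \<Psi>_def by simp
        finally show ?thesis .
      qed
      also have "(\<Sum>j\<le>n. q j * ((- t) ^ j * \<Psi> t)) = poly (index_poly \<nu>) (- t) * \<Psi> t"
        unfolding poly_altdef degree_index_poly q_def n_def sum_distrib_right mult.assoc ..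
      also have "poly (index_poly \<nu>) (- t) = (-1) ^ n * (\<Prod>k\<in>UNIV. t - of_nat n * \<nu> k)"
        unfolding poly_index_poly n_def ..
      finally have "gamma_series a r t = - ((-1) ^ n) * (\<Psi> (t + of_nat n) - (\<Prod>k\<in>UNIV. t - of_nat n * \<nu> k) * \<Psi> t)"
        by (simp add: algebra_simps)
      then have "norm (\<Psi> (t + of_nat n) - (\<Prod>k\<in>UNIV. t - of_nat n * \<nu> k) * \<Psi> t) = norm (gamma_series a r t)"
        by (simp add: norm_mult norm_power)
      also have "gamma_series a r t = (\<Sum>i\<in>{int M - int n<..<int M}. r i * Gamma (t + a - of_int i))"
      proof (rule gamma_series_superset)
        show "{i. r i \<noteq> 0} \<subseteq> {int M - int n<..<int M}" by (auto simp: not_le[symmetric] dest: r_lo r_hi)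
      qed simp
      also have "norm \<dots> \<le> real (card {int M - int n<..<int M}) * (Rb * ((4 / norm t) ^ (M + 1) * norm (Gamma (t + of_nat n + a))))"
      proof (rule sum_norm_bound)
        fix i assume i: "i \<in> {int M - int n<..<int M}"
        define z where "z = t + a - of_int i"
        \<comment> \<open>As i > M - n, the argument t + a - i lies m >= M + 1 steps below t + n +
          a; these steps give the factor |t|^(-(M + 1)).\<close>
        define m where "m = nat (int n + i)"
        have m: "M + 1 \<le> m" "m \<le> n + M" "of_nat m = (of_nat n + of_int i :: complex)" using i unfolding m_def by auto
        have iM: "\<bar>i\<bar> \<le> int M + int n" "i \<le> int M" using i by auto
        have z1: "Re z > 0" "norm z \<ge> norm t / 2" "norm z \<ge> 2 * (real m + 1)"
          using z[OF t iM] m(2) unfolding z_def by auto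
        have "(norm t / 4) ^ (M + 1) * norm (Gamma z) \<le> (norm z / 2) ^ m * norm (Gamma z)"
        proof (rule mult_right_mono)
          have "(norm t / 4) ^ (M + 1) \<le> (norm t / 4) ^ m" using m big(4)[OF t] by (intro power_increasing) auto
          also have "\<dots> \<le> (norm z / 2) ^ m" using z1 by (intro power_mono) auto
          finally show "(norm t / 4) ^ (M + 1) \<le> (norm z / 2) ^ m" .
        qed simp
        also have "\<dots> \<le> norm (Gamma (z + of_nat m))" using z1 by (intro Gamma_shift_bounds) auto
        also have "z + of_nat m = t + of_nat n + a" unfolding z_def m(3) by simp
        finally have le: "(norm t / 4) ^ (M + 1) * norm (Gamma z) \<le> norm (Gamma (t + of_nat n + a))" .
        have "(norm t / 4) ^ (M + 1) > 0" using big(4)[OF t] by (intro zero_less_power) auto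
        with le have "norm (Gamma z) \<le> norm (Gamma (t + of_nat n + a)) / (norm t / 4) ^ (M + 1)"
          by (simp only: pos_le_divide_eq mult.commute)
        also have "\<dots> = (4 / norm t) ^ (M + 1) * norm (Gamma (t + of_nat n + a))" by (simp add: power_divide)
        finally have "norm (Gamma z) \<le> (4 / norm t) ^ (M + 1) * norm (Gamma (t + of_nat n + a))" .
        then show "norm (r i * Gamma (t + a - of_int i)) \<le> Rb * ((4 / norm t) ^ (M + 1) * norm (Gamma (t + of_nat n + a)))"
          unfolding norm_mult z_def[symmetric] using r_bd[of i] i Rb by (intro mult_mono) auto
      qed
      also have "\<dots> \<le> real n * (Rb * ((4 / norm t) ^ (M + 1) * norm (Gamma (t + of_nat n + a))))"
        using Rb by (intro mult_right_mono) auto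
      finally show ?thesis by (simp add: power_divide mult_ac)
    qed
    define Q where "Q t = \<Psi> t / gamma_Phi \<nu> t" for t
    have gQ: "norm (gamma_ratio \<nu> t) \<le> c1'" "c0 \<le> norm (gamma_ratio \<nu> t)" if "Re t \<ge> S" for t
      using g(2)[of \<nu> t] \<nu> big(1)[OF that] unfolding c1'_def by force+
    have Phi0: "gamma_Phi \<nu> t \<noteq> 0" if "Re t \<ge> S" for t by (rule gamma_Phi_nonzero) (rule pole[OF that])
    have step: "norm (Q (t + of_nat n) - Q t) \<le> E / norm t ^ (M + 1)" if t: "Re t \<ge> S" for t
    proof -
      have t': "Re (t + of_nat n) \<ge> S" using t by simp
      have Ph: "gamma_Phi \<nu> (t + of_nat n) = (\<Prod>k\<in>UNIV. t - of_nat n * \<nu> k) * gamma_Phi \<nu> t"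
        unfolding n_def by (rule gamma_Phi_step) (rule pole[OF t])
      have "Q (t + of_nat n) - Q t = (\<Psi> (t + of_nat n) - (\<Prod>k\<in>UNIV. t - of_nat n * \<nu> k) * \<Psi> t) / gamma_Phi \<nu> (t + of_nat n)"
        using Phi0[OF t'] Phi0[OF t] unfolding Q_def Ph by (simp add: diff_divide_distrib)
      also have "norm \<dots> \<le> (real n * (Rb * 4 ^ (M + 1)) / norm t ^ (M + 1) * norm (Gamma (t + of_nat n + a))) / norm (gamma_Phi \<nu> (t + of_nat n))"
        unfolding norm_divide using diff[OF t] by (rule divide_right_mono) simp
      also have "\<dots> = real n * (Rb * 4 ^ (M + 1)) / norm t ^ (M + 1) * norm (gamma_ratio \<nu> (t + of_nat n))"
        unfolding gamma_ratio_def n_def[symmetric] a_def[symmetric] by (simp add: norm_divide)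
      also have "\<dots> \<le> real n * (Rb * 4 ^ (M + 1)) / norm t ^ (M + 1) * c1'"
        using gQ(1)[OF t'] Rb by (intro mult_left_mono) auto
      also have "\<dots> = E / norm t ^ (M + 1)" unfolding E_def by simp
      finally show ?thesis .
    qed
    \<comment> \<open>Since f 0 = 1, the leading term of \<Psi> is Gamma(t + a). So Q and
      \<open>gamma_ratio\<close> differ by O(1/|t|) and share the limit K.\<close>
    have near: "norm (Q t - gamma_ratio \<nu> t) \<le> real M * (D * (4 / norm t * c1'))" if t: "Re t \<ge> S" for t
    proof -
      have ins: "{..<M} = insert 0 {1..<M}" using M by auto
      have "\<Psi> t = Gamma (t + a) + (\<Sum>i\<in>{1..<M}. f (int i) * Gamma (t + a - of_nat i))"
        unfolding \<Psi> ins using f(2) by simp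
      then have "Q t - gamma_ratio \<nu> t = (\<Sum>i\<in>{1..<M}. f (int i) * (Gamma (t + a - of_nat i) / gamma_Phi \<nu> t))"
        unfolding Q_def gamma_ratio_def n_def[symmetric] a_def[symmetric] by (simp add: add_divide_distrib sum_divide_distrib)
      also have "norm \<dots> \<le> real (card {1..<M}) * (D * (4 / norm t * c1'))"
      proof (rule sum_norm_bound)
        fix i assume i: "i \<in> {1..<M}"
        define z where "z = t + a - of_nat i"
        have z1: "Re z > 0" "norm z \<ge> norm t / 2" "norm z \<ge> 2 * (real i + 1)"
          using z[OF t, of "int i"] i unfolding z_def by auto
        have "norm t / 4 * norm (Gamma z) \<le> (norm z / 2) ^ i * norm (Gamma z)"
        proof (rule mult_right_mono)
          have "norm t / 4 \<le> (norm t / 4) ^ i" using i big(4)[OF t] by (intro self_le_power) auto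
          also have "\<dots> \<le> (norm z / 2) ^ i" using z1 by (intro power_mono) auto
          finally show "norm t / 4 \<le> (norm z / 2) ^ i" .
        qed simp
        also have "\<dots> \<le> norm (Gamma (z + of_nat i))" using z1 by (intro Gamma_shift_bounds) auto
        finally have le: "norm t / 4 * norm (Gamma z) \<le> norm (Gamma (t + a))" unfolding z_def by simp
        have "norm t / 4 > 0" using big(4)[OF t] by linarith
        with le have "norm (Gamma z) \<le> norm (Gamma (t + a)) / (norm t / 4)"
          by (simp only: pos_le_divide_eq mult.commute)
        then have "norm (Gamma z) \<le> 4 / norm t * norm (Gamma (t + a))" by (simp add: mult.commute)
        then have "norm (Gamma z) / norm (gamma_Phi \<nu> t) \<le> 4 / norm t * norm (Gamma (t + a)) / norm (gamma_Phi \<nu> t)"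
          by (rule divide_right_mono) simp
        also have "\<dots> = 4 / norm t * norm (gamma_ratio \<nu> t)"
          unfolding gamma_ratio_def n_def[symmetric] a_def[symmetric] by (simp add: norm_divide)
        also have "\<dots> \<le> 4 / norm t * c1'" using gQ(1)[OF t] by (intro mult_left_mono) auto
        finally show "norm (f (int i) * (Gamma (t + a - of_nat i) / gamma_Phi \<nu> t)) \<le> D * (4 / norm t * c1')"
          unfolding norm_mult norm_divide z_def[symmetric] using f(3) i D by (intro mult_mono) auto
      qed
      also have "\<dots> \<le> real M * (D * (4 / norm t * c1'))" using D by (intro mult_right_mono) (auto simp: c1'_def)
      finally show ?thesis .
    qed
    define t where "t N = s + of_nat n * of_nat N" for N
    have tS: "Re (t N) \<ge> S" for N using s unfolding t_def by (simp add: add_increasing2)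
    have tN: "real N \<le> norm (t N)" for N
    proof -
      have "real N \<le> real n * real N" using n by (simp add: mult_le_cancel_right1)
      also have "\<dots> \<le> Re (t N)" using big(2)[OF s] unfolding t_def by simp
      finally show ?thesis using complex_Re_le_cmod[of "t N"] by linarith
    qed
    have ratio_lim: "(\<lambda>N. gamma_ratio \<nu> (t N)) \<longlonglongrightarrow> of_real K"
      unfolding t_def n_def K_def
    proof (rule gamma_ratio_tendsto)
      show "s + bessel_exponent CARD('a) + of_nat CARD('a) - 1 \<notin> \<int>\<^sub>\<le>\<^sub>0"
      proof (rule not_nonpos_Ints_if_Re_pos)
        have "Re (s + a) > 0" using z(1)[OF s, of 0] by simp
        moreover have "real n \<ge> 1" using n by simp
        moreover have "Re (s + a + of_nat n - 1) = Re (s + a) + real n - 1" by simp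
        ultimately show "Re (s + bessel_exponent CARD('a) + of_nat CARD('a) - 1) > 0"
          unfolding a_def n_def by linarith
      qed
    qed (use pole[OF s] \<nu> in auto)
    have "(\<lambda>N. Q (t N) - gamma_ratio \<nu> (t N)) \<longlonglongrightarrow> 0"
    proof (rule Lim_null_comparison)
      show "eventually (\<lambda>N. norm (Q (t N) - gamma_ratio \<nu> (t N)) \<le> real M * (D * (4 / real N * c1'))) sequentially"
        using eventually_gt_at_top[of 0]
      proof eventually_elim
        case (elim N)
        have "norm (t N) > 0" using tN[of N] elim by linarith
        then have "4 / norm (t N) \<le> 4 / real N" using tN[of N] elim by (intro divide_left_mono) auto
        then have "real M * (D * (4 / norm (t N) * c1')) \<le> real M * (D * (4 / real N * c1'))"
          using D by (intro mult_left_mono mult_right_mono) (auto simp: c1'_def)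
        then show ?case using near[OF tS[of N]] by linarith
      qed
      show "(\<lambda>N. real M * (D * (4 / real N * c1'))) \<longlonglongrightarrow> 0" by real_asymp
    qed
    then have "(\<lambda>N. (Q (t N) - gamma_ratio \<nu> (t N)) + gamma_ratio \<nu> (t N)) \<longlonglongrightarrow> 0 + of_real K"
      using ratio_lim by (rule tendsto_add)
    then have Qlim: "(\<lambda>N. Q (t N)) \<longlonglongrightarrow> of_real K" by simp
    have s1: "Re s \<ge> 1" using big(2)[OF s] n M by linarith
    have QN: "norm (Q (t N) - Q s) \<le> 4 * E / norm s ^ M" for N
    proof -
      have "norm (Q (t N) - Q (t 0)) \<le> (\<Sum>j<N. E / norm (t j) ^ (M + 1))"
      proof (induction N)
        case (Suc N)
        have "norm (Q (t (Suc N)) - Q (t N)) \<le> E / norm (t N) ^ (M + 1)"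
          using step[OF tS[of N]] unfolding t_def by (simp add: algebra_simps)
        then show ?case using Suc norm_triangle_ineq[of "Q (t (Suc N)) - Q (t N)" "Q (t N) - Q (t 0)"] by simp
      qed simp
      also have "\<dots> = E * (\<Sum>j<N. 1 / norm (t j) ^ (M + 1))" by (simp add: sum_distrib_left)
      also have "\<dots> \<le> E * (4 / norm s ^ M)"
        unfolding t_def by (intro mult_left_mono tail_sum_bound s1 n M E)
      finally show ?thesis unfolding t_def by (simp add: mult.commute)
    qed
    have "(\<lambda>N. norm (Q (t N) - Q s)) \<longlonglongrightarrow> norm (of_real K - Q s)" by (intro tendsto_intros Qlim)
    then have KQ: "norm (of_real K - Q s) \<le> 4 * E / norm s ^ M"
      by (rule LIMSEQ_le_const2) (use QN in blast)
    have "of_real K * gamma_Phi \<nu> s - \<Psi> s = (of_real K - Q s) * gamma_Phi \<nu> s"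
      unfolding Q_def using Phi0[OF s] by (simp add: algebra_simps)
    then have b1: "norm (of_real K * gamma_Phi \<nu> s - \<Psi> s) \<le> 4 * E / norm s ^ M * norm (gamma_Phi \<nu> s)"
      using KQ by (simp only: norm_mult) (rule mult_right_mono, auto)
    have b2: "norm (gamma_Phi \<nu> s) \<le> norm (Gamma (s + a)) / c0"
    proof -
      have "c0 * norm (gamma_Phi \<nu> s) \<le> norm (gamma_ratio \<nu> s) * norm (gamma_Phi \<nu> s)"
        using gQ(2)[OF s] by (rule mult_right_mono) simp
      also have "\<dots> = norm (Gamma (s + a))"
        unfolding gamma_ratio_def n_def[symmetric] a_def[symmetric] using Phi0[OF s] by (simp add: norm_divide)
      finally show ?thesis using g(1) by (simp add: pos_le_divide_eq mult.commute)
    qed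
    have b3: "norm (Gamma (s + a)) \<le> (4 * norm s) ^ M * norm (Gamma (s + a - of_nat M))"
    proof -
      define z where "z = s + a - of_nat M"
      have z1: "Re z > 0" "norm z \<le> 2 * norm s" "norm z \<ge> 2 * (real M + 1)"
        using z[OF s, of "int M"] unfolding z_def by auto
      have "norm (Gamma (z + of_nat M)) \<le> (2 * norm z) ^ M * norm (Gamma z)"
        using z1 by (intro Gamma_shift_bounds) auto
      also have "\<dots> \<le> (4 * norm s) ^ M * norm (Gamma z)" using z1 by (intro mult_right_mono power_mono) auto
      finally show ?thesis unfolding z_def by simp
    qed
    have "norm s > 0" using big(4)[OF s] by linarith
    have "norm (of_real K * gamma_Phi \<nu> s - \<Psi> s) \<le> 4 * E / norm s ^ M * (norm (Gamma (s + a)) / c0)"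
      using b1 by (rule order_trans) (rule mult_left_mono[OF b2], use E in simp)
    also have "\<dots> \<le> 4 * E / norm s ^ M * ((4 * norm s) ^ M * norm (Gamma (s + a - of_nat M)) / c0)"
      by (rule mult_left_mono[OF divide_right_mono[OF b3]]) (use E g(1) in auto)
    also have "\<dots> = (4 * E * 4 ^ M / c0) * norm (Gamma (s + a - of_nat M))"
      using \<open>norm s > 0\<close> by (simp add: power_mult_distrib)
    finally show ?thesis unfolding \<Psi> .
  qed
  moreover have "4 * E * 4 ^ M / c0 \<ge> 0" using E g(1) by simp
  ultimately show ?thesis unfolding K_def n_def a_def by blast
qed

section \<open>Asymptotic expansion of the residue sum\<close>

lemma vertical_integral_scale:
  assumes "m > 0"
  shows "vertical_integral c T (\<lambda>s. F (s / of_real m)) = of_real m * vertical_integral (c / m) (T / m) F"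
proof -
  have "contour_integral (linepath p q) (\<lambda>s. F (s / of_real m)) =
      of_real m * contour_integral (linepath (p / of_real m) (q / of_real m)) F" for p q
  proof -
    have lp: "linepath p q x / of_real m = linepath (p / of_real m) (q / of_real m) x" for x
      unfolding linepath_def by (simp add: add_divide_distrib scaleR_conv_of_real)
    show ?thesis
      using assms unfolding contour_integral_integral
      by (simp add: lp diff_divide_distrib[symmetric] mult.commute)
  qed
  moreover have "Complex x y / of_real m = Complex (x / m) (y / m)" for x y
    by (simp add: complex_eq_iff)
  ultimately show ?thesis unfolding vertical_integral_def by simp
qed

lemma contour_integrable_vertical:
  assumes "continuous_on {z. Re z = c} F"
  shows "F contour_integrable_on linepath (Complex c (-T)) (Complex c T)"
  by (intro contour_integrable_continuous_linepath continuous_on_subset[OF assms])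
     (auto simp: closed_segment_same_Re)

definition barnes_sum :: "('a::finite \<Rightarrow> complex) \<Rightarrow> complex \<Rightarrow> complex" where
  "barnes_sum \<nu> w = (\<Sum>l\<in>UNIV. \<Sum>m. barnes_term \<nu> w l m)"

text \<open>For a single index the residue sum is an exponential series: it inverts the Mellin
  transform Gamma(s - b). The terms of the expansion are thus the case of index type
  \<open>unit\<close> of the same contour theorem.\<close>

lemma barnes_sum_unit: "barnes_sum (\<lambda>_::unit. b) v = exp (- b * v - exp v)"
proof -
  have "barnes_term (\<lambda>_::unit. b) v () j = exp (- b * v) * (1 / fact j * (- exp v) ^ j)" for j
  proof -
    have "exp (- (of_nat CARD(unit) * (b - of_nat j) * v)) = exp (- b * v) * exp v ^ j"
      unfolding exp_of_nat_mult[symmetric] exp_add[symmetric] by (simp add: algebra_simps)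
    moreover have "UNIV - {()} = ({} :: unit set)" by auto
    ultimately show ?thesis unfolding barnes_term_def by (simp only: power_minus[of "exp v"]) simp
  qed
  moreover have "(\<lambda>j. 1 / fact j * (- exp v) ^ j) sums exp (- exp v)"
    using exp_converges[of "- exp v"] by (simp add: scaleR_conv_of_real divide_inverse)
  then have "(\<lambda>j. exp (- b * v) * (1 / fact j * (- exp v) ^ j)) sums (exp (- b * v) * exp (- exp v))"
    by (rule sums_mult)
  ultimately have "(\<Sum>m. barnes_term (\<lambda>_::unit. b) v () m) = exp (- b * v) * exp (- exp v)"
    by (simp add: sums_iff)
  then show ?thesis unfolding barnes_sum_def by (simp add: UNIV_unit exp_add[symmetric] exp_diff exp_minus divide_inverse)
qed

lemma real_le_exp_powr_bound:
  fixes x :: real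
  assumes "x \<ge> 0" "m \<le> k"
  shows "exp (- real k * x) \<le> exp (- real m * x)"
  using assms by (auto intro: mult_right_mono)

text \<open>The line runs near the saddle point of Gamma(s) y^(-s), at Re s close to Re y for y =
  exp v. There \<open>norm_Gamma_rotated\<close> and \<open>Gamma_real_upper_bound\<close> together
  reproduce |exp(-y)| up to a power of |y|. Two of the M powers are spent on integrability along the
  line.\<close>

lemma barnes_sum_remainder:
  fixes B D \<delta> :: real and M :: nat
  assumes B: "B \<ge> 0" and D: "D \<ge> 0" and M: "M \<ge> 1" and \<delta>: "0 \<le> \<delta>" "\<delta> < pi/2"
  shows "\<exists>C X. \<forall>(\<nu> :: 'a::finite \<Rightarrow> complex) f v. (\<Sum>k\<in>UNIV. \<nu> k) = 0 \<and> (\<forall>k. norm (\<nu> k) \<le> B) \<and>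
     (\<forall>k l. k \<noteq> l \<longrightarrow> \<nu> k - \<nu> l \<notin> \<int>) \<and>
     formal_normal_solution \<nu> f \<and> f 0 = 1 \<and> (\<forall>i<M. norm (f (int i)) \<le> D) \<and> \<bar>Im v\<bar> \<le> \<delta> \<and> Re v \<ge> X \<longrightarrow>
     norm (of_nat CARD('a) * of_real (gamma_ratio_limit CARD('a)) * barnes_sum \<nu> (v - of_real (ln (real CARD('a))))
       / exp (bessel_exponent CARD('a) * v - exp v) - (\<Sum>i<M. f (int i) * exp (- of_nat i * v)))
       \<le> C * exp ((2 - real M) * Re v)"
proof -
  define n where "n = CARD('a)"
  have n: "n > 0" unfolding n_def by simp
  define a where "a = bessel_exponent n"
  define \<alpha> where "\<alpha> = - (real n - 1) / 2"
  have a: "a = of_real \<alpha>" unfolding a_def bessel_exponent_def \<alpha>_def by simp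
  have \<alpha>: "\<alpha> \<le> 0" using n unfolding \<alpha>_def by simp
  define K where "K = gamma_ratio_limit n"
  obtain C1 S where C1: "C1 \<ge> 0" and exp0: "\<forall>(\<nu> :: 'a \<Rightarrow> complex) f s. (\<Sum>k\<in>UNIV. \<nu> k) = 0 \<and> (\<forall>k. norm (\<nu> k) \<le> B) \<and>
     formal_normal_solution \<nu> f \<and> f 0 = 1 \<and> (\<forall>i<M. norm (f (int i)) \<le> D) \<and> Re s \<ge> S \<longrightarrow>
     norm (of_real K * gamma_Phi \<nu> s - (\<Sum>i<M. f (int i) * Gamma (s + a - of_nat i)))
       \<le> C1 * norm (Gamma (s + a - of_nat M))"
    using gamma_Phi_expansion[OF B D M, where 'a='a] unfolding n_def K_def a_def by (elim exE conjE)
  obtain G where G: "G > 0" "\<And>c. c \<ge> 1 \<Longrightarrow> Gamma (c::real) \<le> G * c powr c * exp (- c)"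
    using Gamma_real_upper_bound by blast
  have cd: "cos \<delta> > 0" using \<delta> by (intro cos_gt_zero_pi) auto
  \<comment> \<open>The condition Re v >= ln (Y / cos \<delta>) gives Re (exp v) >= Y; this puts the
    line to the right of S and of all poles and leaves room for two downward steps of Gamma.\<close>
  define Y where "Y = \<bar>S\<bar> + real n * B + 4"
  have Y: "Y \<ge> 4" unfolding Y_def using B by simp
  have "norm (of_nat n * of_real K * barnes_sum \<nu> (v - of_real (ln (real n)))
       / exp (a * v - exp v) - (\<Sum>i<M. f (int i) * exp (- of_nat i * v))) \<le> (C1 * G / 2) * exp ((2 - real M) * Re v)"
    if \<nu>: "(\<Sum>k\<in>UNIV. \<nu> k) = 0" "\<forall>k. norm (\<nu> k) \<le> B" "\<forall>k l. k \<noteq> l \<longrightarrow> \<nu> k - \<nu> l \<notin> \<int>"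
      and f: "formal_normal_solution \<nu> f" "f 0 = 1" "\<forall>i<M. norm (f (int i)) \<le> D"
      and v: "\<bar>Im v\<bar> \<le> \<delta>" "Re v \<ge> ln (Y / cos \<delta>)" for \<nu> :: "'a \<Rightarrow> complex" and f v
  proof -
    define w where "w = v - of_real (ln (real n))"
    define \<theta> where "\<theta> = Im v"
    have \<theta>: "\<bar>\<theta>\<bar> < pi/2" using v \<delta> unfolding \<theta>_def by simp
    then have ct: "cos \<theta> > 0" by (intro cos_gt_zero_pi) auto
    define c' where "c' = Re (exp v)"
    have c'_eq: "c' = exp (Re v) * cos \<theta>" unfolding c'_def \<theta>_def by (simp add: Re_exp)
    have "Y / cos \<delta> \<le> exp (Re v)"
    proof -
      have "exp (ln (Y / cos \<delta>)) \<le> exp (Re v)" using v(2) by simp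
      then show ?thesis using Y cd by simp
    qed
    moreover have "cos \<delta> \<le> cos \<theta>"
      using v(1) \<delta> cos_monotone_0_pi_le[of "\<bar>\<theta>\<bar>" \<delta>] unfolding \<theta>_def by simp
    ultimately have "Y / cos \<delta> * cos \<delta> \<le> exp (Re v) * cos \<theta>" using cd by (intro mult_mono) auto
    then have c': "c' \<ge> Y" unfolding c'_eq using cd by simp
    \<comment> \<open>Chosen so that s + a - M + 2 has real part exactly c' on the line.\<close>
    define c where "c = c' - \<alpha> + real M - 2"
    have c: "c \<ge> S" "c > real n * B" "c > 0"
    proof -
      have "real M \<ge> 1" "real n * B \<ge> 0" using M B by auto
      then show "c \<ge> S" "c > real n * B" "c > 0" using c' \<alpha> unfolding c_def Y_def by linarith+
    qed
    define P where "P s = gamma_Phi \<nu> s * exp (- (s * v))" for s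
    define U where "U i s = Gamma (s + a - of_nat i) * exp (- (s * v))" for i :: nat and s
    have P: "P s = barnes \<nu> w (s / of_real (real n))" for s
    proof -
      have "exp (s * of_real (ln (real n))) * exp (- (s * v)) = exp (- (of_nat n * (s / of_nat n) * w))"
        unfolding exp_add[symmetric] w_def using n by (simp add: algebra_simps)
      then show ?thesis unfolding P_def gamma_Phi_def barnes_def n_def[symmetric] by (simp add: mult_ac)
    qed
    have U: "U i = barnes (\<lambda>_::unit. of_nat i - a) v" for i
      unfolding U_def barnes_def gamma_prod_def by (simp add: fun_eq_iff UNIV_unit algebra_simps)
    have Re\<nu>: "Re (\<nu> k) < c / real n" for k
    proof -
      have "Re (\<nu> k) \<le> B" using \<nu>(2) complex_Re_le_cmod[of "\<nu> k"] by (meson order_trans)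
      moreover have "B < c / real n" using c n by (simp add: pos_less_divide_eq mult.commute)
      ultimately show ?thesis by linarith
    qed
    have ReU: "Re (of_nat i - a) < c" if "i < M" for i
      using that c' Y unfolding c_def a by simp
    have contP: "continuous_on {z. Re z = c} P"
    proof -
      have "continuous_on {z. Re z = c / real n} (barnes \<nu> w)"
        using Re\<nu> by (intro barnes_continuous not_nonpos_Ints_if_Re_pos) auto
      then have "continuous_on {z. Re z = c} (\<lambda>s. barnes \<nu> w (s / of_real (real n)))"
        by (rule continuous_on_compose2) (use n in \<open>auto intro!: continuous_intros simp: Re_divide_of_nat\<close>)
      then show ?thesis unfolding P[abs_def] .
    qed
    have contU: "continuous_on {z. Re z = c} (U i)" if "i < M" for i
      unfolding U using ReU[OF that] by (intro barnes_continuous not_nonpos_Ints_if_Re_pos) auto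
    have wIm: "\<bar>Im w\<bar> < pi/2" "\<bar>Im v\<bar> < pi/2" using \<theta> unfolding w_def \<theta>_def by auto
    have limP: "((\<lambda>T. vertical_integral c T P) \<longlongrightarrow> of_nat n * (2 * pi * \<i> * barnes_sum \<nu> w)) at_top"
    proof -
      have "((\<lambda>T. vertical_integral (c / real n) T (barnes \<nu> w)) \<longlongrightarrow> 2 * pi * \<i> * barnes_sum \<nu> w) at_top"
        unfolding barnes_sum_def by (rule barnes_vertical_integral) (use \<nu> wIm Re\<nu> in auto)
      moreover have "filterlim (\<lambda>T. T / real n) at_top at_top" using n by real_asymp
      ultimately have "((\<lambda>T. vertical_integral (c / real n) (T / real n) (barnes \<nu> w)) \<longlongrightarrow> 2 * pi * \<i> * barnes_sum \<nu> w) at_top"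
        by (rule filterlim_compose)
      then have "((\<lambda>T. of_real (real n) * vertical_integral (c / real n) (T / real n) (barnes \<nu> w)) \<longlongrightarrow> of_real (real n) * (2 * pi * \<i> * barnes_sum \<nu> w)) at_top"
        by (intro tendsto_intros)
      moreover have "of_real (real n) * vertical_integral (c / real n) (T / real n) (barnes \<nu> w) = vertical_integral c T P" for T
        unfolding P[abs_def] using n by (subst vertical_integral_scale) auto
      ultimately show ?thesis by simp
    qed
    have limU: "((\<lambda>T. vertical_integral c T (U i)) \<longlongrightarrow> 2 * pi * \<i> * exp (- (of_nat i - a) * v - exp v)) at_top" if "i < M" for i
      unfolding U barnes_sum_unit[symmetric] unfolding barnes_sum_def
      by (rule barnes_vertical_integral) (use wIm ReU[OF that] in auto)
    \<comment> \<open>The integrals of P and of the U i over this line are known, so the remainder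
      of the expansion is the single integral of F.\<close>
    define F where "F s = of_real K * P s - (\<Sum>i<M. f (int i) * U i s)" for s
    have vF: "vertical_integral c T F = of_real K * vertical_integral c T P - (\<Sum>i<M. f (int i) * vertical_integral c T (U i))" for T
    proof -
      note ci = contour_integrable_vertical[OF contP, of T] contour_integrable_vertical[OF contU, of _ T]
      have "contour_integral (linepath (Complex c (-T)) (Complex c T)) (\<lambda>s. \<Sum>i<M. f (int i) * U i s) =
          (\<Sum>i<M. contour_integral (linepath (Complex c (-T)) (Complex c T)) (\<lambda>s. f (int i) * U i s))"
        using ci by (intro contour_integral_sum contour_integrable_lmul) auto
      also have "\<dots> = (\<Sum>i<M. f (int i) * contour_integral (linepath (Complex c (-T)) (Complex c T)) (U i))"
        using ci by (intro sum.cong refl contour_integral_lmul) auto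
      finally show ?thesis unfolding F_def[abs_def] vertical_integral_def using ci
        by (subst contour_integral_diff)
           (auto intro!: contour_integrable_lmul contour_integrable_sum simp: contour_integral_lmul)
    qed
    have "((\<lambda>T. vertical_integral c T F) \<longlongrightarrow> of_real K * (of_nat n * (2 * pi * \<i> * barnes_sum \<nu> w)) -
        (\<Sum>i<M. f (int i) * (2 * pi * \<i> * exp (- (of_nat i - a) * v - exp v)))) at_top"
      unfolding vF by (intro tendsto_intros limP limU) auto
    also have "of_real K * (of_nat n * (2 * pi * \<i> * barnes_sum \<nu> w)) -
        (\<Sum>i<M. f (int i) * (2 * pi * \<i> * exp (- (of_nat i - a) * v - exp v))) =
        2 * pi * \<i> * exp (a * v - exp v) * (of_nat n * of_real K * barnes_sum \<nu> w
       / exp (a * v - exp v) - (\<Sum>i<M. f (int i) * exp (- of_nat i * v)))" (is "_ = _ * ?R")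
    proof -
      have "exp (- (of_nat i - a) * v - exp v) = exp (a * v - exp v) * exp (- of_nat i * v)" for i
        unfolding exp_add[symmetric] by (simp add: algebra_simps)
      then show ?thesis by (simp add: algebra_simps sum_distrib_left)
    qed
    finally have lim: "((\<lambda>T. norm (vertical_integral c T F)) \<longlongrightarrow> norm (2 * pi * \<i> * exp (a * v - exp v) * ?R)) at_top"
      by (rule tendsto_norm)
    define A where "A = C1 * (G * exp (\<alpha> * Re v - c' + (2 - real M) * Re v))"
    have A: "A \<ge> 0" unfolding A_def using C1 G by simp
    have Fb: "norm (F (Complex c t)) \<le> A / (1 + t\<^sup>2)" for t
    proof -
      define s where "s = Complex c t"
      define z where "z = s + a - of_nat M + 2"
      have z: "Re z = c'" "Im z = t" unfolding z_def s_def a c_def by auto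
      have "norm (of_real K * gamma_Phi \<nu> s - (\<Sum>i<M. f (int i) * Gamma (s + a - of_nat i)))
         \<le> C1 * norm (Gamma (s + a - of_nat M))"
        by (rule exp0[rule_format]) (use \<nu> f c in \<open>auto simp: s_def\<close>)
      moreover have "F s = (of_real K * gamma_Phi \<nu> s - (\<Sum>i<M. f (int i) * Gamma (s + a - of_nat i))) * exp (- (s * v))"
        unfolding F_def P_def U_def by (simp add: algebra_simps sum_distrib_left)
      ultimately have 1: "norm (F s) \<le> C1 * norm (Gamma (s + a - of_nat M)) * norm (exp (- (s * v)))"
        by (simp only: norm_mult) (rule mult_right_mono, auto)
      have zz: "s + a - of_nat M = z - 2" unfolding z_def by simp
      \<comment> \<open>Two steps of the functional equation produce the integrable factor 1 / (1 +
        t^2); they account for the 2 in the exponent of the error.\<close>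
      have g2: "norm (Gamma (z - 2)) * (1 + t^2) \<le> norm (Gamma z)"
      proof -
        have "z - 2 \<notin> \<int>\<^sub>\<le>\<^sub>0" using z c' Y by (intro not_nonpos_Ints_if_Re_pos) auto
        then have "Gamma (z - 2 + of_nat 2) = pochhammer (z - 2) 2 * Gamma (z - 2)"
          using pochhammer_Gamma[of "z - 2" 2] by (simp add: Gamma_eq_zero_iff)
        also have "pochhammer (z - 2) 2 = (z - 2) * (z - 1)" by (simp add: numeral_2_eq_2 pochhammer_Suc)
        finally have e: "Gamma z = (z - 2) * (z - 1) * Gamma (z - 2)" by simp
        have "1 + t^2 \<le> norm (z - 2) ^ 2" unfolding cmod_power2 using z c' Y by (auto intro!: one_le_power)
        also have "\<dots> \<le> norm (z - 2) * norm (z - 1)"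
        proof -
          have "norm (z - 2) ^ 2 \<le> norm (z - 1) ^ 2" unfolding cmod_power2 using z c' Y by (auto intro!: power_mono)
          then have "norm (z - 2) \<le> norm (z - 1)" by (rule power2_le_imp_le) simp
          then show ?thesis unfolding power2_eq_square by (intro mult_left_mono) auto
        qed
        finally have "1 + t^2 \<le> norm (z - 2) * norm (z - 1)" .
        then have "(1 + t^2) * norm (Gamma (z - 2)) \<le> norm (z - 2) * norm (z - 1) * norm (Gamma (z - 2))"
          by (rule mult_right_mono) simp
        then show ?thesis unfolding e norm_mult by (simp add: mult_ac)
      qed
      have ne: "norm (exp (- (s * v))) = exp (- c * Re v) * exp (t * \<theta>)"
        unfolding norm_exp_eq_Re s_def \<theta>_def exp_add[symmetric] by simp
      have "norm (Gamma (z - 2)) * (1 + t^2) * exp (t * \<theta>) \<le> norm (Gamma z) * exp (Im z * \<theta>)"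
        unfolding z using g2 by (intro mult_right_mono) auto
      also have "\<dots> \<le> Gamma c' * cos \<theta> powr (- c')"
        using norm_Gamma_rotated[of z \<theta>] z c' Y \<theta> by simp
      also have "\<dots> \<le> (G * c' powr c' * exp (- c')) * cos \<theta> powr (- c')"
        using G(2)[of c'] c' Y by (intro mult_right_mono) auto
      \<comment> \<open>As c' = |y| cos \<theta>, this power of cos \<theta> cancels the one from
        the rotated bound, and nothing is lost away from the positive axis.\<close>
      also have "c' powr c' = exp (c' * Re v) * cos \<theta> powr c'"
      proof -
        have "c' powr c' = exp (Re v) powr c' * cos \<theta> powr c'"
          unfolding c'_eq using ct by (subst powr_mult) auto
        then show ?thesis by (simp add: powr_def mult.commute)
      qed
      also have "G * (exp (c' * Re v) * cos \<theta> powr c') * exp (- c') * cos \<theta> powr (- c') = G * exp (c' * Re v - c')"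
        using ct by (simp add: powr_minus exp_diff exp_minus field_simps)
      finally have "norm (Gamma (z - 2)) * (1 + t^2) * exp (t * \<theta>) * exp (- c * Re v) \<le> G * exp (c' * Re v - c') * exp (- c * Re v)"
        by (rule mult_right_mono) simp
      also have "\<dots> = G * exp (\<alpha> * Re v - c' + (2 - real M) * Re v)"
        unfolding mult.assoc exp_add[symmetric] c_def by (simp add: algebra_simps)
      finally have "C1 * (norm (Gamma (z - 2)) * (1 + t^2) * exp (t * \<theta>) * exp (- c * Re v)) \<le> A"
        unfolding A_def using C1 by (rule mult_left_mono)
      then have "C1 * norm (Gamma (z - 2)) * norm (exp (- (s * v))) * (1 + t^2) \<le> A" unfolding ne by (simp add: mult_ac)
      then have "norm (F s) * (1 + t^2) \<le> A"
        using mult_right_mono[OF 1, of "1 + t^2"] unfolding zz by (simp add: add_nonneg_nonneg)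
      then show ?thesis unfolding s_def by (simp add: pos_le_divide_eq add_pos_nonneg)
    qed
    have contF: "continuous_on {z. Re z = c} F" unfolding F_def[abs_def]
      by (intro continuous_intros contP contU) auto
    have "norm (2 * pi * \<i> * exp (a * v - exp v) * ?R) \<le> A * pi"
    proof (rule tendsto_upperbound[OF lim])
      show "eventually (\<lambda>T. norm (vertical_integral c T F) \<le> A * pi) at_top"
        using eventually_gt_at_top[of 0] by eventually_elim (intro norm_vertical_integral_le A contF Fb)
    qed simp
    moreover have "norm (exp (a * v - exp v)) = exp (\<alpha> * Re v - c')"
      unfolding norm_exp_eq_Re a c'_def by simp
    ultimately have "2 * pi * exp (\<alpha> * Re v - c') * norm ?R \<le> A * pi" by (simp add: norm_mult)
    also have "A = exp (\<alpha> * Re v - c') * (C1 * G * exp ((2 - real M) * Re v))"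
      unfolding A_def by (simp add: exp_add)
    finally have "(exp (\<alpha> * Re v - c') * pi) * (2 * norm ?R) \<le> (exp (\<alpha> * Re v - c') * pi) * (C1 * G * exp ((2 - real M) * Re v))"
      by (simp add: mult_ac)
    then have "2 * norm ?R \<le> C1 * G * exp ((2 - real M) * Re v)" by (subst (asm) mult_le_cancel_left_pos) auto
    then show ?thesis unfolding w_def by simp
  qed
  then show ?thesis unfolding n_def a_def K_def by blast
qed

text \<open>Expanding two terms further recovers the two lost powers; the terms of index M and M + 1
  then go into the error, which is why M + 2 coefficients have to be bounded.\<close>

theorem barnes_sum_expansion:
  fixes B D \<delta> :: real and M :: nat
  assumes B: "B \<ge> 0" and D: "D \<ge> 0" and \<delta>: "0 \<le> \<delta>" "\<delta> < pi/2"
  shows "\<exists>C X. \<forall>(\<nu> :: 'a::finite \<Rightarrow> complex) f v. (\<Sum>k\<in>UNIV. \<nu> k) = 0 \<and> (\<forall>k. norm (\<nu> k) \<le> B) \<and>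
     (\<forall>k l. k \<noteq> l \<longrightarrow> \<nu> k - \<nu> l \<notin> \<int>) \<and>
     formal_normal_solution \<nu> f \<and> f 0 = 1 \<and> (\<forall>i<M + 2. norm (f (int i)) \<le> D) \<and> \<bar>Im v\<bar> \<le> \<delta> \<and> Re v \<ge> X \<longrightarrow>
     norm (of_nat CARD('a) * of_real (gamma_ratio_limit CARD('a)) * barnes_sum \<nu> (v - of_real (ln (real CARD('a))))
       / exp (bessel_exponent CARD('a) * v - exp v) - (\<Sum>i<M. f (int i) * exp (- of_nat i * v)))
       \<le> C * exp (- real M * Re v)"
proof -
  let ?L = "\<lambda>\<nu> v. of_nat CARD('a) * of_real (gamma_ratio_limit CARD('a)) * barnes_sum (\<nu> :: 'a \<Rightarrow> complex) (v - of_real (ln (real CARD('a))))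
       / exp (bessel_exponent CARD('a) * v - exp v)"
  obtain C X where CX: "\<forall>(\<nu> :: 'a \<Rightarrow> complex) f v. (\<Sum>k\<in>UNIV. \<nu> k) = 0 \<and> (\<forall>k. norm (\<nu> k) \<le> B) \<and>
     (\<forall>k l. k \<noteq> l \<longrightarrow> \<nu> k - \<nu> l \<notin> \<int>) \<and>
     formal_normal_solution \<nu> f \<and> f 0 = 1 \<and> (\<forall>i<M + 2. norm (f (int i)) \<le> D) \<and> \<bar>Im v\<bar> \<le> \<delta> \<and> Re v \<ge> X \<longrightarrow>
     norm (?L \<nu> v - (\<Sum>i<M+2. f (int i) * exp (- of_nat i * v))) \<le> C * exp ((2 - real (M + 2)) * Re v)"
  proof -
    have "1 \<le> M + 2" by simp
    from barnes_sum_remainder[OF B D this \<delta>, where 'a='a] show ?thesis using that by (elim exE)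
  qed
  have "norm (?L \<nu> v - (\<Sum>i<M. f (int i) * exp (- of_nat i * v))) \<le> (C + D + D) * exp (- real M * Re v)"
    if \<nu>: "(\<Sum>k\<in>UNIV. \<nu> k) = 0" "\<forall>k. norm (\<nu> k) \<le> B" "\<forall>k l. k \<noteq> l \<longrightarrow> \<nu> k - \<nu> l \<notin> \<int>"
      and f: "formal_normal_solution \<nu> f" "f 0 = 1" "\<forall>i<M+2. norm (f (int i)) \<le> D"
      and v: "\<bar>Im v\<bar> \<le> \<delta>" "Re v \<ge> max X 0" for \<nu> :: "'a \<Rightarrow> complex" and f v
  proof -
    have "norm (?L \<nu> v - (\<Sum>i<M+2. f (int i) * exp (- of_nat i * v))) \<le> C * exp ((2 - real (M + 2)) * Re v)"
      by (rule CX[rule_format]) (use \<nu> f v in auto)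
    then have 1: "norm (?L \<nu> v - (\<Sum>i<M+2. f (int i) * exp (- of_nat i * v))) \<le> C * exp (- real M * Re v)" by simp
    have 2: "norm (f (int i) * exp (- of_nat i * v)) \<le> D * exp (- real M * Re v)" if "i < M + 2" "M \<le> i" for i
    proof -
      have "norm (exp (- of_nat i * v)) = exp (- real i * Re v)" by (simp add: norm_exp_eq_Re)
      also have "\<dots> \<le> exp (- real M * Re v)" using v that by (intro real_le_exp_powr_bound) auto
      finally show ?thesis unfolding norm_mult using f(3) that D by (intro mult_mono) auto
    qed
    have "?L \<nu> v - (\<Sum>i<M. f (int i) * exp (- of_nat i * v)) = (?L \<nu> v - (\<Sum>i<M+2. f (int i) * exp (- of_nat i * v)))
        + f (int M) * exp (- of_nat M * v) + f (int (M + 1)) * exp (- of_nat (M + 1) * v)"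
    proof -
      have "x - sum g {..<M} = (x - sum g {..<M+2}) + g M + g (M + 1)" for x and g :: "nat \<Rightarrow> complex" by simp
      then show ?thesis .
    qed
    also have "norm \<dots> \<le> C * exp (- real M * Re v) + D * exp (- real M * Re v) + D * exp (- real M * Re v)"
      by (intro order_trans[OF norm_triangle_ineq] add_mono 1 2) auto
    finally show ?thesis by (simp add: algebra_simps)
  qed
  then show ?thesis by blast
qed

section \<open>The Bessel equation in the logarithmic coordinate\<close>

text \<open>Stirling numbers of the second kind S(N, j), in the explicit form in which they occur in
  \<open>bessel_A\<close>. They are the coefficients of z^j d^j/dz^j in (z d/dz)^N.\<close>

definition stirling_number :: "nat \<Rightarrow> nat \<Rightarrow> complex" where
  "stirling_number N j = (\<Sum>r\<le>j. (-1) ^ (j - r) * of_nat r ^ N / (fact r * fact (j - r)))"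

lemma stirling_number_Suc_0: "stirling_number (Suc N) 0 = 0"
  by (simp add: stirling_number_def)

lemma stirling_number_Suc_Suc:
  "stirling_number (Suc N) (Suc j) = of_nat (Suc j) * stirling_number N (Suc j) + stirling_number N j"
proof -
  have "(-1) ^ (Suc j - r) * of_nat r ^ Suc N / (fact r * fact (Suc j - r)) =
     of_nat (Suc j) * ((-1) ^ (Suc j - r) * of_nat r ^ N / (fact r * fact (Suc j - r))) +
     (-1) ^ (j - r) * of_nat r ^ N / (fact r * fact (j - r) :: complex)" if "r \<le> j" for r
  proof -
    define d where "d = j - r"
    have d: "Suc j - r = Suc d" "of_nat r = (of_nat (Suc j) - of_nat (Suc d) :: complex)"
      using that unfolding d_def by (auto simp: of_nat_diff)
    have "(of_nat (Suc d) :: complex) \<noteq> 0" by (rule of_nat_neq_0)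
    then have "of_nat (Suc d) / (fact (Suc d) :: complex) = 1 / fact d" by (simp del: of_nat_Suc)
    moreover have "(-1) ^ Suc d * of_nat r ^ Suc N / (fact r * fact (Suc d)) =
       of_nat (Suc j) * ((-1) ^ Suc d * of_nat r ^ N / (fact r * fact (Suc d))) +
       (-1) ^ d * of_nat r ^ N / fact r * (of_nat (Suc d) / (fact (Suc d) :: complex))"
    proof -
      have "(of_nat r :: complex) ^ Suc N = (of_nat (Suc j) - of_nat (Suc d)) * of_nat r ^ N" using d(2) by (simp del: of_nat_Suc)
      then show ?thesis by (simp only:) (simp add: algebra_simps add_divide_distrib diff_divide_distrib del: of_nat_Suc fact_Suc)
    qed
    ultimately show ?thesis unfolding d(1) d_def[symmetric] by simp
  qed
  then have "(\<Sum>r\<le>j. (-1) ^ (Suc j - r) * of_nat r ^ Suc N / (fact r * fact (Suc j - r))) =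
     of_nat (Suc j) * (\<Sum>r\<le>j. (-1) ^ (Suc j - r) * of_nat r ^ N / (fact r * fact (Suc j - r))) + stirling_number N j"
    unfolding stirling_number_def sum_distrib_left sum.distrib[symmetric] by (intro sum.cong refl) auto
  then show ?thesis unfolding stirling_number_def[of _ "Suc j"] sum.atMost_Suc distrib_left
    by (simp add: algebra_simps del: of_nat_Suc fact_Suc)
qed

lemma stirling_number_0_Suc: "stirling_number 0 (Suc j) = 0"
proof -
  have "fact (Suc j) * stirling_number 0 (Suc j) = (\<Sum>r\<le>Suc j. of_nat (Suc j choose r) * (-1) ^ (Suc j - r))"
    unfolding stirling_number_def sum_distrib_left
    by (intro sum.cong refl) (simp add: binomial_fact field_simps del: fact_Suc)
  also have "\<dots> = (1 + (-1)) ^ Suc j" unfolding binomial_ring by simp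
  finally show ?thesis by (simp del: fact_Suc)
qed

lemma stirling_number_eq_0: "j > N \<Longrightarrow> stirling_number N j = 0"
proof (induction N arbitrary: j)
  case 0 then show ?case by (cases j) (auto simp: stirling_number_0_Suc)
next
  case (Suc N)
  then obtain i where "j = Suc i" "i > N" by (cases j) auto
  then show ?case using Suc by (simp add: stirling_number_Suc_Suc)
qed

lemma bessel_A_eq: "bessel_A j m = stirling_number (m + j) j"
proof (cases j)
  case (Suc i)
  have "{..j} = insert 0 {1..j}" by auto
  then show ?thesis unfolding bessel_A_def stirling_number_def using Suc by simp
qed (simp add: bessel_A_def stirling_number_def)

text \<open>\<open>X j\<close> stands for \<open>z\<^sup>j \<partial>\<^sup>j\<close> applied to a function or formal series, \<open>T\<close> for \<open>z \<partial>\<close>.\<close>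

lemma stirling_expansion:
  fixes T :: "('x \<Rightarrow> complex) \<Rightarrow> 'x \<Rightarrow> complex" and X :: "nat \<Rightarrow> 'x \<Rightarrow> complex"
  assumes lin: "\<And>N c. T (\<lambda>x. \<Sum>j\<le>N. c j * X j x) = (\<lambda>x. \<Sum>j\<le>N. c j * T (X j) x)"
    and step: "\<And>j x. T (X j) x = of_nat j * X j x + X (Suc j) x"
  shows "(T ^^ N) (X 0) = (\<lambda>x. \<Sum>j\<le>N. stirling_number N j * X j x)"
proof (induction N)
  case 0 show ?case by (simp add: stirling_number_def)
next
  case (Suc N)
  have "(T ^^ Suc N) (X 0) = (\<lambda>x. \<Sum>j\<le>N. stirling_number N j * (of_nat j * X j x + X (Suc j) x))"
    unfolding funpow.simps o_apply Suc lin step ..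
  also have "\<dots> = (\<lambda>x. \<Sum>j\<le>Suc N. stirling_number (Suc N) j * X j x)"
  proof
    fix x
    have "(\<Sum>j\<le>N. stirling_number N j * (of_nat j * X j x + X (Suc j) x)) =
       (\<Sum>j\<le>Suc N. of_nat j * stirling_number N j * X j x) + (\<Sum>j\<le>N. stirling_number N j * X (Suc j) x)"
      using stirling_number_eq_0[of N "Suc N"] by (simp add: ring_distribs sum.distrib mult_ac)
    also have "(\<Sum>j\<le>Suc N. of_nat j * stirling_number N j * X j x) = (\<Sum>j\<le>N. of_nat (Suc j) * stirling_number N (Suc j) * X (Suc j) x)"
      by (subst sum.atMost_Suc_shift) simp
    also have "\<dots> + (\<Sum>j\<le>N. stirling_number N j * X (Suc j) x) = (\<Sum>j\<le>N. stirling_number (Suc N) (Suc j) * X (Suc j) x)"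
      unfolding sum.distrib[symmetric] stirling_number_Suc_Suc by (simp add: ring_distribs)
    also have "\<dots> = (\<Sum>j\<le>Suc N. stirling_number (Suc N) j * X j x)"
      by (subst sum.atMost_Suc_shift) (simp add: stirling_number_Suc_0)
    finally show "(\<Sum>j\<le>N. stirling_number N j * (of_nat j * X j x + X (Suc j) x)) = (\<Sum>j\<le>Suc N. stirling_number (Suc N) j * X j x)" .
  qed
  finally show ?case .
qed

section \<open>The Bessel operator as a polynomial in z d/dz\<close>

lemma coeff_index_poly:
  fixes \<mu> :: "complex ^ 'n"
  assumes "m \<le> CARD('n)"
  shows "coeff (index_poly (($) \<mu>)) (CARD('n) - m) = of_nat CARD('n) ^ m * elem_sym m \<mu>"
proof -
  have "index_poly (($) \<mu>) = (\<Prod>k\<in>UNIV. [:of_nat CARD('n) * \<mu> $ k:] + [:0, 1:])"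
    unfolding index_poly_def by simp
  also have "\<dots> = (\<Sum>X\<in>Pow UNIV. (\<Prod>k\<in>X. [:of_nat CARD('n) * \<mu> $ k:]) * (\<Prod>k\<in>UNIV-X. [:0, 1:]))"
    by (rule prod_add) simp
  also have "\<dots> = (\<Sum>X\<in>UNIV. monom (\<Prod>k\<in>X. of_nat CARD('n) * \<mu> $ k) (CARD('n) - card X))"
  proof (intro sum.cong)
    fix X :: "'n set"
    have "(\<Prod>k\<in>X. [:of_nat CARD('n) * \<mu> $ k:]) = [:\<Prod>k\<in>X. of_nat CARD('n) * \<mu> $ k:]"
      by (induction X rule: infinite_finite_induct) (auto simp: one_pCons)
    moreover have "(\<Prod>k\<in>UNIV-X. [:0, 1:]) = (monom 1 (CARD('n) - card X) :: complex poly)"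
      by (simp add: card_Diff_subset monom_altdef)
    ultimately show "(\<Prod>k\<in>X. [:of_nat CARD('n) * \<mu> $ k:]) * (\<Prod>k\<in>UNIV-X. [:0, 1:]) = monom (\<Prod>k\<in>X. of_nat CARD('n) * \<mu> $ k) (CARD('n) - card X)"
      by (simp add: smult_monom)
  qed simp
  finally have "coeff (index_poly (($) \<mu>)) (CARD('n) - m) =
     (\<Sum>X\<in>UNIV. if CARD('n) - card X = CARD('n) - m then (\<Prod>k\<in>X. of_nat CARD('n) * \<mu> $ k) else 0)"
    by (simp add: coeff_sum)
  also have "\<dots> = (\<Sum>X\<in>UNIV. if card X = m then (\<Prod>k\<in>X. of_nat CARD('n) * \<mu> $ k) else 0)"
  proof (intro sum.cong refl if_cong)
    fix X :: "'n set"
    have "card X \<le> CARD('n)" by (intro card_mono) auto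
    then show "(CARD('n) - card X = CARD('n) - m) = (card X = m)" using assms by auto
  qed
  also have "\<dots> = (\<Sum>X\<in>{X. card X = m}. \<Prod>k\<in>X. of_nat CARD('n) * \<mu> $ k)"
    by (simp add: sum.If_cases)
  also have "\<dots> = of_nat CARD('n) ^ m * elem_sym m \<mu>"
    unfolding elem_sym_def sum_distrib_left by (intro sum.cong refl) (auto simp: prod.distrib)
  finally show ?thesis .
qed

text \<open>Each \<open>bessel_V \<mu> j\<close> collects the coefficients of the index polynomial
  weighted by S(i, j). With X j in the role of z^j d^j/dz^j applied to a function, the right-hand
  side is the index polynomial evaluated at z d/dz.\<close>

lemma bessel_V_sum:
  fixes \<mu> :: "complex ^ 'n" and X :: "nat \<Rightarrow> complex"
  shows "(\<Sum>j\<le>CARD('n). bessel_V \<mu> j * X j) =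
     (\<Sum>i\<le>CARD('n). coeff (index_poly (($) \<mu>)) i * (\<Sum>j\<le>i. stirling_number i j * X j))"
proof -
  define n where "n = CARD('n)"
  have V: "bessel_V \<mu> j = (\<Sum>i\<in>{j..n}. coeff (index_poly (($) \<mu>)) i * stirling_number i j)" if "j \<le> n" for j
  proof -
    have "bessel_V \<mu> j = (\<Sum>m\<in>{0..n - j}. coeff (index_poly (($) \<mu>)) (n - m) * stirling_number (n - m) j)"
      unfolding bessel_V_def n_def[symmetric]
    proof (intro sum.cong refl)
      fix m assume m: "m \<in> {0..n - j}"
      then have "n - j - m + j = n - m" using that by auto
      then show "bessel_A j (n - j - m) * of_nat n ^ m * elem_sym m \<mu> = coeff (index_poly (($) \<mu>)) (n - m) * stirling_number (n - m) j"
        using m coeff_index_poly[of m \<mu>] by (simp add: bessel_A_eq n_def)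
    qed
    also have "\<dots> = (\<Sum>i\<in>{j..n}. coeff (index_poly (($) \<mu>)) i * stirling_number i j)"
      by (rule sum.reindex_bij_witness[of _ "\<lambda>i. n - i" "\<lambda>i. n - i"]) (use that in auto)
    finally show ?thesis .
  qed
  have "(\<Sum>j\<le>n. bessel_V \<mu> j * X j) = (\<Sum>j\<le>n. \<Sum>i\<in>{j..n}. coeff (index_poly (($) \<mu>)) i * (stirling_number i j * X j))"
    by (intro sum.cong refl) (simp add: V sum_distrib_right mult.assoc)
  also have "\<dots> = (\<Sum>j\<le>n. \<Sum>i | i \<le> n \<and> j \<le> i. coeff (index_poly (($) \<mu>)) i * (stirling_number i j * X j))"
    by (intro sum.cong refl) auto
  also have "\<dots> = (\<Sum>i\<le>n. \<Sum>j | j \<le> n \<and> j \<le> i. coeff (index_poly (($) \<mu>)) i * (stirling_number i j * X j))"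
    using sum.swap_restrict[of "{..n}" "{..n}" "\<lambda>j i. coeff (index_poly (($) \<mu>)) i * (stirling_number i j * X j)" "\<lambda>j i. j \<le> i"] by simp
  also have "\<dots> = (\<Sum>i\<le>n. coeff (index_poly (($) \<mu>)) i * (\<Sum>j\<le>i. stirling_number i j * X j))"
    unfolding sum_distrib_left by (intro sum.cong refl) auto
  finally show ?thesis unfolding n_def .
qed

lemma formal_deriv_nth: "fls_nth (formal_deriv c a f) i = c * fls_nth f i + (a - of_int (i - 1)) * fls_nth f (i - 1)"
proof -
  have "fls_nth (fls_const a * fls_X * f) i = a * fls_nth f (i - 1)"
    by (subst mult.assoc, subst fls_X_times_conv_shift) simp
  moreover have "fls_nth (fls_X ^ 2 * fls_deriv f) i = of_int (i - 1) * fls_nth f (i - 1)"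
  proof -
    have "fls_X ^ 2 * fls_deriv f = fls_shift (-1) (fls_shift (-1) (fls_deriv f))"
      unfolding power2_eq_square mult.assoc fls_X_times_conv_shift(1)[of "fls_deriv f"]
      by (rule fls_X_times_conv_shift(1))
    then show ?thesis by simp
  qed
  ultimately show ?thesis unfolding formal_deriv_def by (simp add: left_diff_distrib)
qed

lemma fls_nth_const_times_X_inv_power:
  "fls_nth (fls_const b * fls_X_inv ^ j * g) i = b * fls_nth g (i + int j)"
  by (subst mult.assoc, subst fls_X_inv_power_times_conv_shift) simp

text \<open>On coefficients z d/dz acts as \<open>formal_theta\<close> and multiplication by z^j as
  a shift by j, so the Stirling expansion applies to formal series.\<close>

lemma bessel_formal_solution_iff:
  fixes \<mu> :: "complex ^ 'n"
  shows "bessel_formal_solution \<sigma> \<mu> c a f \<longleftrightarrow>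
    (\<forall>i. (\<Sum>j\<le>CARD('n). coeff (index_poly (($) \<mu>)) j * (formal_theta c a ^^ j) (fls_nth f) i) =
         \<sigma> * (\<i> * of_nat CARD('n)) ^ CARD('n) * fls_nth f (i + int CARD('n)))"
proof -
  define n where "n = CARD('n)"
  define X where "X j = fls_nth (fls_X_inv ^ j * (formal_deriv c a ^^ j) f)" for j
  have X: "X j i = fls_nth ((formal_deriv c a ^^ j) f) (i + int j)" for j i
    unfolding X_def by (simp add: fls_X_inv_power_times_conv_shift)
  have "(formal_theta c a ^^ i) (X 0) = (\<lambda>x. \<Sum>j\<le>i. stirling_number i j * X j x)" for i
  proof (rule stirling_expansion)
    show "formal_theta c a (\<lambda>x. \<Sum>j\<le>N. d j * X j x) = (\<lambda>x. \<Sum>j\<le>N. d j * formal_theta c a (X j) x)" for N d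
      by (auto simp: fun_eq_iff formal_theta_def sum_distrib_left sum.distrib[symmetric] algebra_simps)
    show "formal_theta c a (X j) x = of_nat j * X j x + X (Suc j) x" for j x
      unfolding formal_theta_def X funpow.simps o_apply formal_deriv_nth by (simp add: algebra_simps)
  qed
  moreover have "X 0 = fls_nth f" unfolding X_def by simp
  ultimately have th: "(formal_theta c a ^^ i) (fls_nth f) x = (\<Sum>j\<le>i. stirling_number i j * X j x)" for i x by simp
  have nz: "n > 0" unfolding n_def by simp
  have set: "{..n} = insert 0 {1..n}" by auto
  define LHS where "LHS = (\<Sum>j=1..n. fls_const (bessel_V \<mu> j) * fls_X_inv ^ j * (formal_deriv c a ^^ j) f) +
     (fls_const (bessel_V \<mu> 0) -
        fls_const (\<sigma> * (\<i> * of_nat n) ^ n) * fls_X_inv ^ n) * f"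
  have "fls_nth LHS i = (\<Sum>j\<le>n. bessel_V \<mu> j * X j i) - \<sigma> * (\<i> * of_nat n) ^ n * fls_nth f (i + int n)" for i
  proof -
    have "fls_nth LHS i = (\<Sum>j=1..n. bessel_V \<mu> j * X j i) + (bessel_V \<mu> 0 * fls_nth f i - (\<sigma> * (\<i> * of_nat n) ^ n) * fls_nth f (i + int n))"
      unfolding LHS_def X left_diff_distrib fls_plus_nth fls_minus_nth fls_nth_sum fls_nth_const_times_X_inv_power
      by simp
    moreover have "X 0 i = fls_nth f i" unfolding X_def by simp
    ultimately show ?thesis unfolding set by simp
  qed
  then have "fls_nth LHS i = (\<Sum>j\<le>n. coeff (index_poly (($) \<mu>)) j * (formal_theta c a ^^ j) (fls_nth f) i) - \<sigma> * (\<i> * of_nat n) ^ n * fls_nth f (i + int n)" for i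
    unfolding th n_def bessel_V_sum by simp
  then have "LHS = 0 \<longleftrightarrow> (\<forall>i. (\<Sum>j\<le>n. coeff (index_poly (($) \<mu>)) j * (formal_theta c a ^^ j) (fls_nth f) i) = \<sigma> * (\<i> * of_nat n) ^ n * fls_nth f (i + int n))"
    by (simp add: fls_eq_iff)
  then show ?thesis unfolding bessel_formal_solution_def LHS_def n_def .
qed

text \<open>In the coordinate log z the operator z d/dz is the ordinary derivative; the equation has
  constant coefficients except for the term in exp (n z).\<close>

lemma bessel_solution_iff:
  fixes \<mu> :: "complex ^ 'n"
  shows "bessel_solution \<sigma> \<mu> w \<longleftrightarrow> w holomorphic_on UNIV \<and>
    (\<forall>z. (\<Sum>j\<le>CARD('n). coeff (index_poly (($) \<mu>)) j * (deriv ^^ j) w z) =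
         \<sigma> * (\<i> * of_nat CARD('n)) ^ CARD('n) * exp (of_nat CARD('n) * z) * w z)"
proof (cases "w holomorphic_on UNIV")
  case False
  then show ?thesis unfolding bessel_solution_def by simp
next
  case hol: True
  define n where "n = CARD('n)"
  define X where "X j z = exp z ^ j * (uderiv ^^ j) w z" for j z
  have holu: "(uderiv ^^ j) w holomorphic_on UNIV" for j
  proof (induction j)
    case (Suc j)
    then have "deriv ((uderiv ^^ j) w) holomorphic_on UNIV" by (intro holomorphic_deriv) auto
    then have "(\<lambda>z. deriv ((uderiv ^^ j) w) z / exp z) holomorphic_on UNIV"
      by (intro holomorphic_on_divide) (auto intro: holomorphic_on_exp)
    moreover have "(uderiv ^^ Suc j) w = (\<lambda>z. deriv ((uderiv ^^ j) w) z / exp z)"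
      by (simp add: fun_eq_iff uderiv_def[of "(uderiv ^^ j) w"] uproj_def)
    ultimately show ?case by simp
  qed (use hol in simp)
  have holX: "X j holomorphic_on UNIV" for j unfolding X_def[abs_def] by (intro holomorphic_intros holu)
  have dX: "X j field_differentiable at z" for j z
    using holX[of j] holomorphic_on_imp_differentiable_at by blast
  have "(deriv ^^ i) (X 0) = (\<lambda>x. \<Sum>j\<le>i. stirling_number i j * X j x)" for i
  proof (rule stirling_expansion)
    show "deriv (\<lambda>x. \<Sum>j\<le>N. d j * X j x) = (\<lambda>x. \<Sum>j\<le>N. d j * deriv (X j) x)" for N d
    proof
      fix x
      have "((\<lambda>x. \<Sum>j\<le>N. d j * X j x) has_field_derivative (\<Sum>j\<le>N. d j * deriv (X j) x)) (at x)"
        using dX by (intro DERIV_sum DERIV_cmult) (simp add: DERIV_deriv_iff_field_differentiable)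
      then show "deriv (\<lambda>x. \<Sum>j\<le>N. d j * X j x) x = (\<Sum>j\<le>N. d j * deriv (X j) x)" by (rule DERIV_imp_deriv)
    qed
    show "deriv (X j) x = of_nat j * X j x + X (Suc j) x" for j x
    proof -
      define g where "g = (uderiv ^^ j) w"
      have "(g has_field_derivative deriv g x) (at x)"
        using holu[of j] unfolding g_def by (auto simp: DERIV_deriv_iff_field_differentiable holomorphic_on_def)
      moreover have "((\<lambda>x. exp (of_nat j * x)) has_field_derivative of_nat j * exp x ^ j) (at x)"
      proof (rule derivative_eq_intros)
        show "((*) (of_nat j) has_field_derivative of_nat j) (at x)" by (auto intro!: derivative_eq_intros)
      qed (simp add: exp_of_nat_mult)
      then have "((\<lambda>x. exp x ^ j) has_field_derivative of_nat j * exp x ^ j) (at x)" by (simp add: exp_of_nat_mult)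
      ultimately have "((\<lambda>x. exp x ^ j * g x) has_field_derivative (of_nat j * exp x ^ j * g x + exp x ^ j * deriv g x)) (at x)"
        by (auto dest: DERIV_mult simp: mult_ac)
      then have "deriv (\<lambda>x. exp x ^ j * g x) x = of_nat j * exp x ^ j * g x + exp x ^ j * deriv g x"
        by (rule DERIV_imp_deriv)
      moreover have "X (Suc j) x = exp x ^ j * deriv g x"
        unfolding X_def g_def by (simp add: uderiv_def[of "(uderiv ^^ j) w"] uproj_def)
      ultimately show ?thesis unfolding X_def[abs_def] g_def[symmetric] by (simp add: mult.assoc)
    qed
  qed
  moreover have "X 0 = w" unfolding X_def by (simp add: fun_eq_iff)
  ultimately have th: "(deriv ^^ i) w x = (\<Sum>j\<le>i. stirling_number i j * X j x)" for i x by simp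
  have set: "{..n} = insert 0 {1..n}" by auto
  have "(\<Sum>j=1..n. bessel_V \<mu> j * uproj z ^ j * (uderiv ^^ j) w z) +
          (bessel_V \<mu> 0 - \<sigma> * (\<i> * of_nat n) ^ n * uproj z ^ n) * w z =
      (\<Sum>j\<le>n. coeff (index_poly (($) \<mu>)) j * (deriv ^^ j) w z) - \<sigma> * (\<i> * of_nat n) ^ n * exp (of_nat n * z) * w z" for z
  proof -
    have "(\<Sum>j\<le>n. coeff (index_poly (($) \<mu>)) j * (deriv ^^ j) w z) = (\<Sum>j\<le>n. bessel_V \<mu> j * X j z)"
      unfolding th n_def bessel_V_sum ..
    also have "\<dots> = bessel_V \<mu> 0 * w z + (\<Sum>j=1..n. bessel_V \<mu> j * uproj z ^ j * (uderiv ^^ j) w z)"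
      unfolding set X_def by (simp add: uproj_def mult.assoc)
    finally show ?thesis
      unfolding exp_of_nat_mult by (simp add: uproj_def left_diff_distrib del: sum.atLeast1_atMost_eq)
  qed
  then show ?thesis using hol unfolding bessel_solution_def n_def by simp
qed

section \<open>Formal solutions\<close>

text \<open>The coefficient of f (i + r) in the j-th power of \<open>formal_theta (-1) a\<close>,
  evaluated at i.\<close>

fun theta_coeff :: "complex \<Rightarrow> nat \<Rightarrow> nat \<Rightarrow> int \<Rightarrow> complex" where
  "theta_coeff a 0 r i = (if r = 0 then 1 else 0)"
| "theta_coeff a (Suc j) r i = (a - of_int i) * theta_coeff a j r i - (if r = 0 then 0 else theta_coeff a j (r - 1) (i + 1))"

lemma theta_coeff_eq_0: "r > j \<Longrightarrow> theta_coeff a j r i = 0"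
  by (induction a j r i rule: theta_coeff.induct) auto

lemma theta_coeff_top: "theta_coeff a j j i = (-1) ^ j"
  by (induction j arbitrary: i) (auto simp: theta_coeff_eq_0)

text \<open>The highest shift will cancel against (-1)^n f (i + n) in the formal equation, so this
  second highest one becomes the pivot of the recurrence.\<close>

lemma theta_coeff_subtop:
  "theta_coeff a (Suc j) j i = (-1) ^ j * (of_nat (Suc j) * (a - of_int i) - of_nat j * of_nat (Suc j) / 2)"
proof (induction j arbitrary: i)
  case (Suc j)
  have "theta_coeff a (Suc (Suc j)) (Suc j) i = (a - of_int i) * (-1) ^ Suc j - theta_coeff a (Suc j) j (i + 1)"
    by (subst theta_coeff.simps) (simp add: theta_coeff_top[of a "Suc j", unfolded theta_coeff.simps] del: theta_coeff.simps add: theta_coeff_top)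
  then show ?case unfolding Suc by (simp add: field_simps)
qed simp

lemma formal_theta_power_expansion:
  assumes "j \<le> N"
  shows "(formal_theta (-1) a ^^ j) f i = (\<Sum>r\<le>N. theta_coeff a j r i * f (i + int r))"
  using assms
proof (induction j arbitrary: i)
  case 0
  have "(\<Sum>r\<le>N. theta_coeff a 0 r i * f (i + int r)) = (\<Sum>r\<le>N. if r = 0 then f i else 0)"
    by (intro sum.cong) auto
  then show ?case by simp
next
  case (Suc j)
  have IH: "(formal_theta (-1) a ^^ j) f i = (\<Sum>r\<le>N. theta_coeff a j r i * f (i + int r))" for i
    by (rule Suc.IH) (use Suc.prems in simp)
  obtain N' where N': "N = Suc N'" using Suc.prems by (cases N) auto
  have top: "theta_coeff a j N i = 0" for i using Suc.prems by (intro theta_coeff_eq_0) simp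
  have "(\<Sum>r\<le>N. (if r = 0 then 0 else theta_coeff a j (r - 1) (i + 1)) * f (i + int r)) =
     (\<Sum>r\<le>N'. theta_coeff a j r (i + 1) * f (i + 1 + int r))"
    unfolding N' by (subst sum.atMost_Suc_shift) (simp add: add_ac)
  also have "\<dots> = (\<Sum>r\<le>N. theta_coeff a j r (i + 1) * f (i + 1 + int r))"
    using top unfolding N' by simp
  finally have "(\<Sum>r\<le>N. theta_coeff a (Suc j) r i * f (i + int r)) =
     (a - of_int i) * (\<Sum>r\<le>N. theta_coeff a j r i * f (i + int r)) - (\<Sum>r\<le>N. theta_coeff a j r (i + 1) * f (i + 1 + int r))"
    by (simp add: left_diff_distrib sum_subtractf sum_distrib_left mult.assoc)
  then show ?case unfolding formal_theta_Suc IH by simp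
qed

definition recurrence_coeff :: "complex poly \<Rightarrow> nat \<Rightarrow> int \<Rightarrow> complex" where
  "recurrence_coeff Q r i = (\<Sum>j\<le>degree Q. coeff Q j * theta_coeff (bessel_exponent (degree Q)) j r i)"

text \<open>With a = -(n - 1)/2 and a vanishing subleading coefficient of Q, the coefficient of f (i
  + n') is a nonzero constant times i + n'. It vanishes only at i = - n', so that f 0 is free and
  every later coefficient is determined.\<close>

lemma formal_equation_iff:
  fixes Q :: "complex poly"
  assumes n: "degree Q = Suc n'" and lead: "coeff Q (Suc n') = 1" "coeff Q n' = 0"
  shows "(\<Sum>j\<le>Suc n'. coeff Q j * (formal_theta (-1) (bessel_exponent (Suc n')) ^^ j) f i) = (-1) ^ Suc n' * f (i + int (Suc n'))
    \<longleftrightarrow> (-1) ^ Suc n' * of_nat (Suc n') * (of_int i + of_nat n') * f (i + int n') + (\<Sum>r<n'. recurrence_coeff Q r i * f (i + int r)) = 0"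
proof -
  let ?a = "bessel_exponent (Suc n')"
  have "(\<Sum>j\<le>Suc n'. coeff Q j * (formal_theta (-1) ?a ^^ j) f i) =
     (\<Sum>j\<le>Suc n'. \<Sum>r\<le>Suc n'. coeff Q j * (theta_coeff ?a j r i * f (i + int r)))"
    by (intro sum.cong refl) (simp add: formal_theta_power_expansion[of _ "Suc n'"] sum_distrib_left del: sum.atMost_Suc)
  also have "\<dots> = (\<Sum>r\<le>Suc n'. recurrence_coeff Q r i * f (i + int r))"
    unfolding recurrence_coeff_def n by (subst sum.swap) (simp add: sum_distrib_right mult.assoc del: sum.atMost_Suc)
  also have "\<dots> = (\<Sum>r<n'. recurrence_coeff Q r i * f (i + int r)) + recurrence_coeff Q n' i * f (i + int n')
      + recurrence_coeff Q (Suc n') i * f (i + int (Suc n'))"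
    by (simp add: lessThan_Suc_atMost[symmetric])
  also have "recurrence_coeff Q (Suc n') i = (-1) ^ Suc n'"
  proof -
    have "(\<Sum>j\<le>Suc n'. coeff Q j * theta_coeff ?a j (Suc n') i) = (\<Sum>j\<le>n'. coeff Q j * theta_coeff ?a j (Suc n') i) + coeff Q (Suc n') * theta_coeff ?a (Suc n') (Suc n') i"
      by (rule sum.atMost_Suc)
    moreover have "(\<Sum>j\<le>n'. coeff Q j * theta_coeff ?a j (Suc n') i) = 0"
      by (intro sum.neutral) (auto simp: theta_coeff_eq_0)
    ultimately show ?thesis unfolding recurrence_coeff_def n theta_coeff_top lead by simp
  qed
  also have "recurrence_coeff Q n' i = (-1) ^ Suc n' * of_nat (Suc n') * (of_int i + of_nat n')"
  proof -
    have "{..Suc n'} = insert (Suc n') (insert n' {..<n'})" by auto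
    then have "(\<Sum>j\<le>Suc n'. coeff Q j * theta_coeff ?a j n' i) =
       coeff Q (Suc n') * theta_coeff ?a (Suc n') n' i + (coeff Q n' * theta_coeff ?a n' n' i + (\<Sum>j<n'. coeff Q j * theta_coeff ?a j n' i))"
      by (simp del: theta_coeff.simps)
    also have "(\<Sum>j<n'. coeff Q j * theta_coeff ?a j n' i) = 0"
      by (intro sum.neutral) (auto simp: theta_coeff_eq_0)
    finally have "recurrence_coeff Q n' i = theta_coeff ?a (Suc n') n' i"
      unfolding recurrence_coeff_def n lead by (simp del: theta_coeff.simps)
    also have "\<dots> = (-1) ^ Suc n' * of_nat (Suc n') * (of_int i + of_nat n')"
      unfolding theta_coeff_subtop bessel_exponent_def by (simp add: field_simps)
    finally show ?thesis .
  qed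
  finally have eq: "(\<Sum>j\<le>Suc n'. coeff Q j * (formal_theta (-1) ?a ^^ j) f i) =
     (\<Sum>r<n'. recurrence_coeff Q r i * f (i + int r)) + (-1) ^ Suc n' * of_nat (Suc n') * (of_int i + of_nat n') * f (i + int n')
      + (-1) ^ Suc n' * f (i + int (Suc n'))" .
  have "A + B + C = C \<longleftrightarrow> B + A = 0" for A B C :: complex by (simp add: add.commute[of A B])
  then show ?thesis unfolding eq .
qed

text \<open>The recurrence solved for its pivot. Summing over all p < m under a condition, rather
  than over the n - 1 preceding indices, makes termination evident and keeps the subtraction of
  naturals in its proper range.\<close>

function normal_coeff :: "complex poly \<Rightarrow> nat \<Rightarrow> complex" where
  "normal_coeff Q m = (if m = 0 then 1 else
     - ((-1) ^ degree Q) / (of_nat (degree Q) * of_nat m) *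
       (\<Sum>p<m. (if m < p + degree Q then recurrence_coeff Q (p + degree Q - 1 - m) (int m - int (degree Q) + 1) else 0) * normal_coeff Q p))"
  by auto
termination by (relation "Wellfounded.measure snd") auto

declare normal_coeff.simps [simp del]

lemma normal_coeff_0 [simp]: "normal_coeff Q 0 = 1"
  by (simp add: normal_coeff.simps)

lemma recurrence_sum_reindex:
  fixes f :: "int \<Rightarrow> complex"
  assumes n: "degree Q = Suc n'" and neg: "\<And>i. i < 0 \<Longrightarrow> f i = 0"
  shows "(\<Sum>r<n'. recurrence_coeff Q r (int m - int n') * f (int m - int n' + int r)) =
     (\<Sum>p<m. (if m < p + degree Q then recurrence_coeff Q (p + degree Q - 1 - m) (int m - int (degree Q) + 1) else 0) * f (int p))"
proof -
  have i: "int m - int (degree Q) + 1 = int m - int n'" using n by simp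
  have e: "int m - int n' + int a = int (m + a - n')" if "n' \<le> m + a" for a using that by simp
  have "(\<Sum>r<n'. recurrence_coeff Q r (int m - int n') * f (int m - int n' + int r)) =
     (\<Sum>r\<in>{r. r < n' \<and> n' \<le> m + r}. recurrence_coeff Q r (int m - int n') * f (int m - int n' + int r))"
    by (rule sum.mono_neutral_right) (auto intro: neg)
  also have "\<dots> = (\<Sum>p\<in>{p. p < m \<and> m < p + Suc n'}. recurrence_coeff Q (p + n' - m) (int m - int n') * f (int p))"
    by (rule sum.reindex_bij_witness[of _ "\<lambda>p. p + n' - m" "\<lambda>r. m + r - n'"]) (auto simp: e simp del: of_nat_diff)
  also have "\<dots> = (\<Sum>p<m. (if m < p + Suc n' then recurrence_coeff Q (p + n' - m) (int m - int n') else 0) * f (int p))"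
    by (rule sum.mono_neutral_cong_left) auto
  finally have "(\<Sum>r<n'. recurrence_coeff Q r (int m - int n') * f (int m - int n' + int r)) =
     (\<Sum>p<m. (if m < p + Suc n' then recurrence_coeff Q (p + n' - m) (int m - int n') else 0) * f (int p))" .
  moreover have "p + Suc n' - 1 - m = p + n' - m" for p by simp
  ultimately show ?thesis unfolding i by (simp only: n)
qed

text \<open>The equation at i - n' has pivot i * f i: for i < 0 all its terms vanish, at i = 0 it is
  void, and for i > 0 it is the recursion of \<open>normal_coeff\<close>.\<close>

lemma formal_normal_iff:
  fixes Q :: "complex poly"
  assumes n: "degree Q = Suc n'" and lead: "coeff Q (Suc n') = 1" "coeff Q n' = 0"
    and f: "\<And>i. i < 0 \<Longrightarrow> f i = 0" "f 0 = 1"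
  shows "(\<forall>i. (\<Sum>j\<le>Suc n'. coeff Q j * (formal_theta (-1) (bessel_exponent (Suc n')) ^^ j) f i) = (-1) ^ Suc n' * f (i + int (Suc n')))
    \<longleftrightarrow> (\<forall>m. f (int m) = normal_coeff Q m)"
proof -
  let ?R = "\<lambda>m. \<Sum>p<m. (if m < p + degree Q then recurrence_coeff Q (p + degree Q - 1 - m) (int m - int (degree Q) + 1) else 0) * f (int p)"
  have reindex: "(\<Sum>r<n'. recurrence_coeff Q r (int m - int n') * f (int m - int n' + int r)) = ?R m" for m
    by (rule recurrence_sum_reindex[OF n]) (rule f(1))
  have "(\<forall>i. (\<Sum>j\<le>Suc n'. coeff Q j * (formal_theta (-1) (bessel_exponent (Suc n')) ^^ j) f i) = (-1) ^ Suc n' * f (i + int (Suc n')))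
    \<longleftrightarrow> (\<forall>i. (-1) ^ Suc n' * of_nat (Suc n') * (of_int i + of_nat n') * f (i + int n') + (\<Sum>r<n'. recurrence_coeff Q r i * f (i + int r)) = 0)"
    unfolding formal_equation_iff[OF n lead] ..
  also have "\<dots> \<longleftrightarrow> (\<forall>i. (-1) ^ Suc n' * of_nat (Suc n') * of_int i * f i + (\<Sum>r<n'. recurrence_coeff Q r (i - int n') * f (i - int n' + int r)) = 0)"
  proof (intro iffI allI)
    fix i assume "\<forall>i. (-1) ^ Suc n' * of_nat (Suc n') * (of_int i + of_nat n') * f (i + int n') + (\<Sum>r<n'. recurrence_coeff Q r i * f (i + int r)) = 0"
    from this[rule_format, of "i - int n'"]
    show "(-1) ^ Suc n' * of_nat (Suc n') * of_int i * f i + (\<Sum>r<n'. recurrence_coeff Q r (i - int n') * f (i - int n' + int r)) = 0" by simp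
  next
    fix i assume "\<forall>i. (-1) ^ Suc n' * of_nat (Suc n') * of_int i * f i + (\<Sum>r<n'. recurrence_coeff Q r (i - int n') * f (i - int n' + int r)) = 0"
    from this[rule_format, of "i + int n'"]
    show "(-1) ^ Suc n' * of_nat (Suc n') * (of_int i + of_nat n') * f (i + int n') + (\<Sum>r<n'. recurrence_coeff Q r i * f (i + int r)) = 0" by simp
  qed
  also have "\<dots> \<longleftrightarrow> (\<forall>m. (-1) ^ Suc n' * of_nat (Suc n') * of_nat m * f (int m) + ?R m = 0)"
  proof (intro iffI allI)
    fix m assume "\<forall>i. (-1) ^ Suc n' * of_nat (Suc n') * of_int i * f i + (\<Sum>r<n'. recurrence_coeff Q r (i - int n') * f (i - int n' + int r)) = 0"
    from this[rule_format, of "int m"]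
    show "(-1) ^ Suc n' * of_nat (Suc n') * of_nat m * f (int m) + ?R m = 0"
      unfolding reindex[symmetric] by (simp only: of_int_of_nat_eq)
  next
    fix i assume *: "\<forall>m. (-1) ^ Suc n' * of_nat (Suc n') * of_nat m * f (int m) + ?R m = 0"
    show "(-1) ^ Suc n' * of_nat (Suc n') * of_int i * f i + (\<Sum>r<n'. recurrence_coeff Q r (i - int n') * f (i - int n' + int r)) = 0"
    proof (cases "i < 0")
      case True
      then have "(\<Sum>r<n'. recurrence_coeff Q r (i - int n') * f (i - int n' + int r)) = 0"
        by (intro sum.neutral) (auto intro!: f)
      then show ?thesis using True f by simp
    next
      case False
      then obtain m where m: "i = int m" by (metis nonneg_int_cases not_less)
      show ?thesis using *[rule_format, of m]
        unfolding m reindex[symmetric] by (simp only: of_int_of_nat_eq)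
    qed
  qed
  also have "\<dots> \<longleftrightarrow> (\<forall>m. f (int m) = normal_coeff Q m)"
  proof
    assume *: "\<forall>m. (-1) ^ Suc n' * of_nat (Suc n') * of_nat m * f (int m) + ?R m = 0"
    show "\<forall>m. f (int m) = normal_coeff Q m"
    proof
      fix m show "f (int m) = normal_coeff Q m"
      proof (induction m rule: less_induct)
        case (less m)
        show ?case
        proof (cases "m = 0")
          case False
          have R: "?R m = (\<Sum>p<m. (if m < p + degree Q then recurrence_coeff Q (p + degree Q - 1 - m) (int m - int (degree Q) + 1) else 0) * normal_coeff Q p)"
            by (intro sum.cong refl) (simp add: less)
          have "(-1 :: complex) ^ Suc n' * (-1) ^ Suc n' = 1" by (simp add: power_mult_distrib[symmetric])
          moreover have "(-1) ^ Suc n' * (of_nat (Suc n') * of_nat m * f (int m)) = - ?R m"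
            using *[rule_format, of m] by (simp add: eq_neg_iff_add_eq_0 mult.assoc del: of_nat_Suc power_Suc)
          ultimately have "of_nat (Suc n') * of_nat m * f (int m) = - ((-1) ^ Suc n') * ?R m"
            by (metis (no_types, lifting) mult.assoc mult_1_left mult_minus_left mult_minus_right)
          then have "f (int m) = - ((-1) ^ Suc n') / (of_nat (Suc n') * of_nat m) * ?R m"
            using False by (simp add: field_simps del: of_nat_Suc power_Suc)
          then show ?thesis unfolding R by (subst normal_coeff.simps) (use False n in simp)
        qed (use f in simp)
      qed
    qed
  next
    assume *: "\<forall>m. f (int m) = normal_coeff Q m"
    show "\<forall>m. (-1) ^ Suc n' * of_nat (Suc n') * of_nat m * f (int m) + ?R m = 0"
    proof
      fix m
      show "(-1) ^ Suc n' * of_nat (Suc n') * of_nat m * f (int m) + ?R m = 0"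
      proof (cases "m = 0")
        case False
        have R: "?R m = (\<Sum>p<m. (if m < p + degree Q then recurrence_coeff Q (p + degree Q - 1 - m) (int m - int (degree Q) + 1) else 0) * normal_coeff Q p)"
          using * by (intro sum.cong refl) simp
        have "f (int m) = - ((-1) ^ Suc n') / (of_nat (Suc n') * of_nat m) * ?R m"
          unfolding R using * False n by (simp add: normal_coeff.simps[of Q m])
        moreover have "(-1) ^ Suc n' * N * (- ((-1) ^ Suc n') / N * S) + S = 0" if "N \<noteq> 0" for N S :: complex
        proof -
          have "(-1 :: complex) ^ Suc n' * (-1) ^ Suc n' = 1" by (simp add: power_mult_distrib[symmetric])
          then show ?thesis using that by (simp add: mult.assoc[symmetric] del: power_Suc)
        qed
        ultimately show ?thesis using False by (simp add: mult.assoc[symmetric] del: of_nat_Suc power_Suc)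
      qed simp
    qed
  qed
  finally show ?thesis .
qed

section \<open>Symmetric polynomial dependence on the indices\<close>

definition poly_expr :: "(complex ^ 'n \<Rightarrow> complex) \<Rightarrow> bool" where
  "poly_expr p \<longleftrightarrow> (\<exists>(E :: ('n \<Rightarrow> nat) set) c. finite E \<and>
        (\<forall>\<mu>. p \<mu> = (\<Sum>\<alpha>\<in>E. c \<alpha> * (\<Prod>k\<in>UNIV. (\<mu> $ k) ^ \<alpha> k))))"

lemma symmetric_polynomial_iff:
  "symmetric_polynomial p \<longleftrightarrow> poly_expr p \<and> (\<forall>\<pi>. bij \<pi> \<longrightarrow> (\<forall>\<mu>. p (\<chi> k. \<mu> $ \<pi> k) = p \<mu>))"
  unfolding symmetric_polynomial_def poly_expr_def by blast

lemma poly_expr_monomial: "poly_expr (\<lambda>\<mu>. c * (\<Prod>k\<in>UNIV. (\<mu> $ k) ^ \<alpha> k))"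
  unfolding poly_expr_def by (intro exI[of _ "{\<alpha>}"] exI[of _ "\<lambda>_. c"]) simp

lemma poly_expr_add:
  assumes "poly_expr p" "poly_expr q"
  shows "poly_expr (\<lambda>\<mu>. p \<mu> + q \<mu>)"
proof -
  obtain E c where E: "finite E" "\<And>\<mu>. p \<mu> = (\<Sum>\<alpha>\<in>E. c \<alpha> * (\<Prod>k\<in>UNIV. (\<mu> $ k) ^ \<alpha> k))"
    using assms(1) unfolding poly_expr_def by blast
  obtain F d where F: "finite F" "\<And>\<mu>. q \<mu> = (\<Sum>\<alpha>\<in>F. d \<alpha> * (\<Prod>k\<in>UNIV. (\<mu> $ k) ^ \<alpha> k))"
    using assms(2) unfolding poly_expr_def by blast
  have ext: "(\<Sum>\<alpha>\<in>A. g \<alpha> * M \<alpha>) = (\<Sum>\<alpha>\<in>E \<union> F. (if \<alpha> \<in> A then g \<alpha> else 0) * M \<alpha>)"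
    if "A \<subseteq> E \<union> F" for A and g M :: "('a \<Rightarrow> nat) \<Rightarrow> complex"
    using that E(1) F(1) by (intro sum.mono_neutral_cong_left) auto
  have "p \<mu> + q \<mu> = (\<Sum>\<alpha>\<in>E \<union> F. ((if \<alpha> \<in> E then c \<alpha> else 0) + (if \<alpha> \<in> F then d \<alpha> else 0)) * (\<Prod>k\<in>UNIV. (\<mu> $ k) ^ \<alpha> k))" for \<mu>
    unfolding E F distrib_right sum.distrib by (subst (1 2) ext) auto
  then show ?thesis unfolding poly_expr_def using E F
    by (intro exI[of _ "E \<union> F"] exI[of _ "\<lambda>\<alpha>. (if \<alpha> \<in> E then c \<alpha> else 0) + (if \<alpha> \<in> F then d \<alpha> else 0)"]) auto
qed

lemma poly_expr_sum:
  assumes "\<And>i. i \<in> I \<Longrightarrow> poly_expr (p i)"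
  shows "poly_expr (\<lambda>\<mu>. \<Sum>i\<in>I. p i \<mu>)"
  using assms
proof (induction I rule: infinite_finite_induct)
  case (insert x I)
  then show ?case by (simp add: poly_expr_add)
qed (use poly_expr_monomial[of 0] in auto)

lemma poly_expr_mult:
  assumes "poly_expr p" "poly_expr q"
  shows "poly_expr (\<lambda>\<mu>. p \<mu> * q \<mu>)"
proof -
  obtain E c where E: "finite E" "\<And>\<mu>. p \<mu> = (\<Sum>\<alpha>\<in>E. c \<alpha> * (\<Prod>k\<in>UNIV. (\<mu> $ k) ^ \<alpha> k))"
    using assms(1) unfolding poly_expr_def by blast
  obtain F d where F: "finite F" "\<And>\<mu>. q \<mu> = (\<Sum>\<alpha>\<in>F. d \<alpha> * (\<Prod>k\<in>UNIV. (\<mu> $ k) ^ \<alpha> k))"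
    using assms(2) unfolding poly_expr_def by blast
  have "p \<mu> * q \<mu> = (\<Sum>\<alpha>\<in>E. \<Sum>\<beta>\<in>F. (c \<alpha> * d \<beta>) * (\<Prod>k\<in>UNIV. (\<mu> $ k) ^ (\<alpha> k + \<beta> k)))" for \<mu>
    unfolding E F sum_product by (intro sum.cong refl) (simp add: power_add prod.distrib)
  moreover have "poly_expr (\<lambda>\<mu>. \<Sum>\<alpha>\<in>E. \<Sum>\<beta>\<in>F. (c \<alpha> * d \<beta>) * (\<Prod>k\<in>UNIV. (\<mu> $ k) ^ (\<alpha> k + \<beta> k)))"
    by (intro poly_expr_sum poly_expr_monomial)
  ultimately show ?thesis by simp
qed

lemma symmetric_polynomial_const: "symmetric_polynomial (\<lambda>_. c)"
  unfolding symmetric_polynomial_iff using poly_expr_monomial[of c "\<lambda>_. 0"] by simp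

lemma symmetric_polynomial_mult:
  "symmetric_polynomial p \<Longrightarrow> symmetric_polynomial q \<Longrightarrow> symmetric_polynomial (\<lambda>\<mu>. p \<mu> * q \<mu>)"
  unfolding symmetric_polynomial_iff by (auto intro: poly_expr_mult)

lemma symmetric_polynomial_sum:
  "(\<And>i. i \<in> I \<Longrightarrow> symmetric_polynomial (p i)) \<Longrightarrow> symmetric_polynomial (\<lambda>\<mu>. \<Sum>i\<in>I. p i \<mu>)"
  unfolding symmetric_polynomial_iff by (auto intro: poly_expr_sum)

lemma symmetric_polynomial_elem_sym: "symmetric_polynomial (elem_sym m :: complex ^ 'n \<Rightarrow> complex)"
  unfolding symmetric_polynomial_iff
proof (intro conjI allI impI)
  have "(\<Prod>k\<in>S. \<mu> $ k) = 1 * (\<Prod>k\<in>UNIV. (\<mu> $ k) ^ (if k \<in> S then 1 else 0))" for S and \<mu> :: "complex ^ 'n"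
    by (simp add: if_distrib[of "power _"] prod.If_cases cong: if_cong)
  then have eq: "(\<lambda>\<mu> :: complex ^ 'n. \<Prod>k\<in>S. \<mu> $ k) = (\<lambda>\<mu>. 1 * (\<Prod>k\<in>UNIV. (\<mu> $ k) ^ (if k \<in> S then 1 else 0)))" for S
    by (rule ext)
  have "poly_expr (\<lambda>\<mu> :: complex ^ 'n. \<Prod>k\<in>S. \<mu> $ k)" for S
    unfolding eq by (rule poly_expr_monomial)
  then show "poly_expr (elem_sym m :: complex ^ 'n \<Rightarrow> complex)"
    unfolding elem_sym_def[abs_def] by (intro poly_expr_sum)
next
  fix \<pi> :: "'n \<Rightarrow> 'n" and \<mu> :: "complex ^ 'n"
  assume \<pi>: "bij \<pi>"
  have inj: "inj_on \<pi> S" for S using \<pi> by (meson bij_is_inj inj_on_subset subset_UNIV)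
  have "elem_sym m (\<chi> k. \<mu> $ \<pi> k) = (\<Sum>S\<in>{S. card S = m}. \<Prod>k\<in>\<pi> ` S. \<mu> $ k)"
    unfolding elem_sym_def by (intro sum.cong refl) (simp add: prod.reindex[OF inj])
  also have "\<dots> = (\<Sum>S\<in>{S. card S = m}. \<Prod>k\<in>S. \<mu> $ k)"
  proof (rule sum.reindex_bij_witness[of _ "\<lambda>S. inv \<pi> ` S" "\<lambda>S. \<pi> ` S"])
    have i2: "inj_on (inv \<pi>) S" for S using bij_imp_bij_inv[OF \<pi>] by (meson bij_is_inj inj_on_subset subset_UNIV)
    fix S :: "'n set"
    show "\<pi> ` inv \<pi> ` S = S" "inv \<pi> ` \<pi> ` S = S"
      using \<pi> by (simp_all add: image_comp bij_is_surj bij_is_inj image_f_inv_f image_inv_f_f flip: image_comp)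
    show "S \<in> {S. card S = m} \<Longrightarrow> \<pi> ` S \<in> {S. card S = m}" "S \<in> {S. card S = m} \<Longrightarrow> inv \<pi> ` S \<in> {S. card S = m}"
      by (simp_all add: card_image[OF inj] card_image[OF i2])
  qed simp
  finally show "elem_sym m (\<chi> k. \<mu> $ \<pi> k) = elem_sym m \<mu>" unfolding elem_sym_def .
qed

lemma symmetric_polynomial_coeff_index_poly:
  "symmetric_polynomial (\<lambda>\<mu> :: complex ^ 'n. coeff (index_poly (($) \<mu>)) j)"
proof (cases "j \<le> CARD('n)")
  case True
  then have "coeff (index_poly (($) \<mu>)) j = of_nat CARD('n) ^ (CARD('n) - j) * elem_sym (CARD('n) - j) \<mu>" for \<mu> :: "complex ^ 'n"
    using coeff_index_poly[of "CARD('n) - j" \<mu>] by simp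
  then show ?thesis by (simp only:) (intro symmetric_polynomial_mult symmetric_polynomial_const symmetric_polynomial_elem_sym)
next
  case False
  then have "coeff (index_poly (($) \<mu>)) j = 0" for \<mu> :: "complex ^ 'n"
    by (intro coeff_eq_0) (simp add: degree_index_poly)
  then show ?thesis by (simp add: symmetric_polynomial_const)
qed

text \<open>The indices enter the recursion only through the coefficients of the index polynomial,
  which are elementary symmetric up to powers of n.\<close>

lemma symmetric_polynomial_normal_coeff:
  "symmetric_polynomial (\<lambda>\<mu> :: complex ^ 'n. normal_coeff (index_poly (($) \<mu>)) m)"
proof (induction m rule: less_induct)
  case (less m)
  have rc: "symmetric_polynomial (\<lambda>\<mu> :: complex ^ 'n. recurrence_coeff (index_poly (($) \<mu>)) r i)" for r i
    unfolding recurrence_coeff_def degree_index_poly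
    by (intro symmetric_polynomial_sum symmetric_polynomial_mult symmetric_polynomial_const symmetric_polynomial_coeff_index_poly)
  have ifc: "symmetric_polynomial (\<lambda>\<mu> :: complex ^ 'n. if P then recurrence_coeff (index_poly (($) \<mu>)) r i else 0)" for P r i
    by (cases P) (simp_all add: rc symmetric_polynomial_const)
  show ?case
  proof (cases "m = 0")
    case False
    then show ?thesis
      by (subst normal_coeff.simps)
         (simp only: degree_index_poly if_False, intro symmetric_polynomial_sum symmetric_polynomial_mult symmetric_polynomial_const ifc less, simp)
  qed (simp add: symmetric_polynomial_const)
qed

text \<open>The point where the zero component-sum enters the formal theory: the subleading
  coefficient is n times that sum.\<close>

lemma coeff_index_poly_subtop:
  fixes \<mu> :: "complex ^ 'n"
  assumes "\<mu> \<in> zero_sum" "CARD('n) = Suc n'"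
  shows "coeff (index_poly (($) \<mu>)) n' = 0"
proof -
  have "{S :: 'n set. card S = 1} = range (\<lambda>k. {k})" by (auto simp: card_1_singleton_iff)
  then have "elem_sym 1 \<mu> = (\<Sum>k\<in>UNIV. \<mu> $ k)"
    unfolding elem_sym_def by (simp add: sum.reindex inj_on_def)
  then have "elem_sym 1 \<mu> = 0" using assms(1) unfolding zero_sum_def by simp
  then show ?thesis using coeff_index_poly[of 1 \<mu>] assms(2) by simp
qed

definition normal_series :: "complex ^ 'n \<Rightarrow> int \<Rightarrow> complex" where
  "normal_series \<mu> i = (if i < 0 then 0 else normal_coeff (index_poly (($) \<mu>)) (nat i))"

lemma formal_normal_solution_iff:
  fixes \<mu> :: "complex ^ 'n"
  assumes "\<mu> \<in> zero_sum" and f: "\<And>i. i < 0 \<Longrightarrow> f i = 0" "f 0 = 1"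
  shows "formal_normal_solution (($) \<mu>) f \<longleftrightarrow> (\<forall>m. f (int m) = normal_coeff (index_poly (($) \<mu>)) m)"
proof -
  obtain n' where n': "CARD('n) = Suc n'" by (metis not0_implies_Suc zero_less_card_finite less_not_refl)
  have d: "degree (index_poly (($) \<mu>)) = Suc n'" by (simp add: degree_index_poly n')
  have "coeff (index_poly (($) \<mu>)) (Suc n') = 1" using lead_coeff_index_poly[of "($) \<mu>"] n' by simp
  from formal_normal_iff[OF d this coeff_index_poly_subtop[OF assms(1) n'], of f] f
  show ?thesis unfolding formal_normal_solution_def n' by auto
qed

lemma formal_normal_solution_normal_series:
  fixes \<mu> :: "complex ^ 'n"
  assumes "\<mu> \<in> zero_sum"
  shows "formal_normal_solution (($) \<mu>) (normal_series \<mu>)"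
  using formal_normal_solution_iff[OF assms, of "normal_series \<mu>"] by (auto simp: normal_series_def)

section \<open>From the variable y back to z\<close>

lemma formal_theta_rescale:
  assumes "\<kappa> \<noteq> 0"
  shows "(formal_theta (-1) a ^^ j) (\<lambda>i. \<kappa> powi i * f i) i = \<kappa> powi i * (formal_theta (- \<kappa>) a ^^ j) f i"
proof (induction j arbitrary: i)
  case (Suc j)
  show ?case unfolding formal_theta_Suc Suc using assms by (simp add: power_int_add algebra_simps)
qed simp

text \<open>The substitution y = \<kappa> z with \<kappa> = - i n x turns the exponential factor
  into exp(-y) and multiplies the m-th coefficient by \<kappa>^m; the terms in z^n agree because
  (-\<kappa>)^n = \<sigma> (i n)^n.\<close>

lemma bessel_formal_solution_normal_iff:
  fixes \<mu> :: "complex ^ 'n"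
  assumes \<mu>: "\<mu> \<in> zero_sum" and x: "x ^ CARD('n) = \<sigma>" "\<sigma> \<noteq> 0" and f0: "b 0 = 1"
  shows "bessel_formal_solution \<sigma> \<mu> (\<i> * of_nat CARD('n) * x) (- (of_nat CARD('n) - 1) / 2) (fps_to_fls (Abs_fps b))
    \<longleftrightarrow> (\<forall>m. (- \<i> * of_nat CARD('n) * x) ^ m * b m = normal_coeff (index_poly (($) \<mu>)) m)"
proof -
  define n where "n = CARD('n)"
  have n: "n > 0" unfolding n_def by simp
  define \<kappa> where "\<kappa> = - \<i> * of_nat n * x"
  have "x \<noteq> 0" using x n unfolding n_def by auto
  then have k0: "\<kappa> \<noteq> 0" unfolding \<kappa>_def using n by simp
  define f where "f = fls_nth (fps_to_fls (Abs_fps b))"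
  have f: "f i = (if i < 0 then 0 else b (nat i))" for i unfolding f_def by simp
  define g where "g i = \<kappa> powi i * f i" for i
  have kn: "\<kappa> ^ n * (\<sigma> * (\<i> * of_nat n) ^ n) = (-1) ^ n * (\<kappa> ^ n * \<kappa> ^ n)"
  proof -
    have "\<kappa> ^ n = (-1) ^ n * ((\<i> * of_nat n) ^ n * \<sigma>)"
      unfolding \<kappa>_def x(1)[symmetric] n_def[symmetric] power_mult_distrib[symmetric] by simp
    moreover have "(-1 :: complex) ^ n * (-1) ^ n = 1" by (simp add: power_mult_distrib[symmetric])
    ultimately show ?thesis by (simp add: mult_ac)
  qed
  then have kn: "\<sigma> * (\<i> * of_nat n) ^ n = (-1) ^ n * \<kappa> ^ n" using k0 by (simp add: mult.left_commute)
  have c: "\<i> * of_nat n * x = - \<kappa>" "- (of_nat n - 1) / 2 = bessel_exponent n"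
    unfolding \<kappa>_def bessel_exponent_def by simp_all
  have "bessel_formal_solution \<sigma> \<mu> (\<i> * of_nat n * x) (- (of_nat n - 1) / 2) (fps_to_fls (Abs_fps b)) \<longleftrightarrow>
    (\<forall>i. (\<Sum>j\<le>n. coeff (index_poly (($) \<mu>)) j * (formal_theta (- \<kappa>) (bessel_exponent n) ^^ j) f i) =
         \<sigma> * (\<i> * of_nat n) ^ n * f (i + int n))"
    unfolding bessel_formal_solution_iff c f_def by (simp only: n_def)
  also have "\<dots> \<longleftrightarrow> (\<forall>i. (\<Sum>j\<le>n. coeff (index_poly (($) \<mu>)) j * (formal_theta (-1) (bessel_exponent n) ^^ j) g i) = (-1) ^ n * g (i + int n))"
  proof (intro all_cong1)
    fix i
    have "(\<Sum>j\<le>n. coeff (index_poly (($) \<mu>)) j * (formal_theta (-1) (bessel_exponent n) ^^ j) g i) =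
       \<kappa> powi i * (\<Sum>j\<le>n. coeff (index_poly (($) \<mu>)) j * (formal_theta (- \<kappa>) (bessel_exponent n) ^^ j) f i)"
      unfolding g_def[abs_def] formal_theta_rescale[OF k0] by (simp add: sum_distrib_left mult_ac)
    moreover have "(-1) ^ n * g (i + int n) = \<kappa> powi i * (\<sigma> * (\<i> * of_nat n) ^ n * f (i + int n))"
      unfolding g_def kn using k0 by (simp add: power_int_add mult_ac)
    moreover have "\<kappa> powi i \<noteq> 0" using k0 by simp
    ultimately show "((\<Sum>j\<le>n. coeff (index_poly (($) \<mu>)) j * (formal_theta (- \<kappa>) (bessel_exponent n) ^^ j) f i) =
         \<sigma> * (\<i> * of_nat n) ^ n * f (i + int n)) \<longleftrightarrow>
       ((\<Sum>j\<le>n. coeff (index_poly (($) \<mu>)) j * (formal_theta (-1) (bessel_exponent n) ^^ j) g i) = (-1) ^ n * g (i + int n))"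
      by (simp only: mult_cancel_left) blast
  qed
  also have "\<dots> \<longleftrightarrow> formal_normal_solution (($) \<mu>) g"
    unfolding formal_normal_solution_def n_def by (auto simp: g_def f)
  also have "\<dots> \<longleftrightarrow> (\<forall>m. g (int m) = normal_coeff (index_poly (($) \<mu>)) m)"
    by (rule formal_normal_solution_iff[OF \<mu>]) (auto simp: g_def f f0)
  also have "\<dots> \<longleftrightarrow> (\<forall>m. \<kappa> ^ m * b m = normal_coeff (index_poly (($) \<mu>)) m)"
    by (simp add: g_def f)
  finally show ?thesis unfolding \<kappa>_def n_def .
qed

text \<open>The value is pinned down by the formal equation at \<mu> alone. The symmetric
  polynomials required for existence are the rescaled \<open>normal_coeff\<close>.\<close>

lemma bessel_B_eq:
  fixes \<mu> :: "complex ^ 'n"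
  assumes \<mu>: "\<mu> \<in> zero_sum"
  shows "bessel_B \<xi> m \<mu> = normal_coeff (index_poly (($) \<mu>)) m / (- \<i> * of_nat CARD('n) * uproj \<xi>) ^ m"
proof -
  define \<kappa> where "\<kappa> = - \<i> * of_nat CARD('n) * uproj \<xi>"
  have k0: "\<kappa> \<noteq> 0" unfolding \<kappa>_def uproj_def by simp
  have s0: "uproj \<xi> ^ CARD('n) \<noteq> 0" unfolding uproj_def by simp
  note iff = bessel_formal_solution_normal_iff[OF _ refl s0, folded \<kappa>_def]
  define B where "B i \<nu> = normal_coeff (index_poly (($) \<nu>)) i / \<kappa> ^ i" for i and \<nu> :: "complex ^ 'n"
  show ?thesis unfolding bessel_B_def \<kappa>_def[symmetric]
  proof (rule the_equality)
    have "symmetric_polynomial (B i)" for i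
    proof -
      have "B i = (\<lambda>\<nu>. (1 / \<kappa> ^ i) * normal_coeff (index_poly (($) \<nu>)) i)" by (simp add: B_def fun_eq_iff)
      then show ?thesis by (simp only:) (intro symmetric_polynomial_mult symmetric_polynomial_const symmetric_polynomial_normal_coeff)
    qed
    moreover have "B 0 = (\<lambda>_. 1)" by (simp add: B_def fun_eq_iff)
    moreover have "bessel_formal_solution (uproj \<xi> ^ CARD('n)) \<nu> (\<i> * of_nat CARD('n) * uproj \<xi>) (- (of_nat CARD('n) - 1) / 2)
        (fps_to_fls (Abs_fps (\<lambda>i. B i \<nu>)))" if "\<nu> \<in> zero_sum" for \<nu>
      by (subst iff[OF that]) (use k0 in \<open>simp_all add: B_def\<close>)
    moreover have "normal_coeff (index_poly (($) \<mu>)) m / \<kappa> ^ m = B m \<mu>" by (simp add: B_def)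
    ultimately show "\<exists>B :: nat \<Rightarrow> complex ^ 'n \<Rightarrow> complex.
        (\<forall>i. symmetric_polynomial (B i)) \<and> B 0 = (\<lambda>_. 1) \<and>
        (\<forall>\<nu>\<in>zero_sum. bessel_formal_solution (uproj \<xi> ^ CARD('n)) \<nu>
            (\<i> * of_nat CARD('n) * uproj \<xi>) (- (of_nat CARD('n) - 1) / 2)
            (fps_to_fls (Abs_fps (\<lambda>i. B i \<nu>)))) \<and>
        normal_coeff (index_poly (($) \<mu>)) m / \<kappa> ^ m = B m \<mu>" by blast
  next
    fix b assume "\<exists>B :: nat \<Rightarrow> complex ^ 'n \<Rightarrow> complex.
        (\<forall>i. symmetric_polynomial (B i)) \<and> B 0 = (\<lambda>_. 1) \<and>
        (\<forall>\<nu>\<in>zero_sum. bessel_formal_solution (uproj \<xi> ^ CARD('n)) \<nu>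
            (\<i> * of_nat CARD('n) * uproj \<xi>) (- (of_nat CARD('n) - 1) / 2)
            (fps_to_fls (Abs_fps (\<lambda>i. B i \<nu>)))) \<and> b = B m \<mu>"
    then obtain B :: "nat \<Rightarrow> complex ^ 'n \<Rightarrow> complex" where B: "B 0 = (\<lambda>_. 1)" "b = B m \<mu>"
      "bessel_formal_solution (uproj \<xi> ^ CARD('n)) \<mu>
            (\<i> * of_nat CARD('n) * uproj \<xi>) (- (of_nat CARD('n) - 1) / 2)
            (fps_to_fls (Abs_fps (\<lambda>i. B i \<mu>)))" using \<mu> by blast
    have "\<forall>m. \<kappa> ^ m * B m \<mu> = normal_coeff (index_poly (($) \<mu>)) m"
      using iff[OF \<mu>, of "\<lambda>i. B i \<mu>"] B by simp
    then show "b = normal_coeff (index_poly (($) \<mu>)) m / \<kappa> ^ m"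
      using k0 B(2) by (simp add: field_simps)
  qed
qed

section \<open>Uniqueness of the subdominant solution\<close>

text \<open>In the coordinate \<open>s\<close> with \<open>exp s = y\<close> the Bessel equation becomes \<open>Q(d/ds) u = (-y)\<^sup>n u\<close>.\<close>

definition normal_solution :: "complex poly \<Rightarrow> (complex \<Rightarrow> complex) \<Rightarrow> bool" where
  "normal_solution Q u \<longleftrightarrow> u holomorphic_on UNIV \<and>
     (\<forall>s. (\<Sum>j\<le>degree Q. coeff Q j * (deriv ^^ j) u s) = (-1) ^ degree Q * exp (of_nat (degree Q) * s) * u s)"

lemma gronwall_lower:
  fixes f :: "real \<Rightarrow> real"
  assumes "a \<le> b" and d: "\<And>t. a \<le> t \<Longrightarrow> t \<le> b \<Longrightarrow> (f has_real_derivative f' t) (at t)"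
    and le: "\<And>t. a \<le> t \<Longrightarrow> t \<le> b \<Longrightarrow> f' t \<ge> - C * f t"
  shows "f a * exp (C * a) \<le> f b * exp (C * b)"
proof (rule DERIV_nonneg_imp_nondecreasing[OF assms(1)])
  fix t assume t: "a \<le> t" "t \<le> b"
  have "((\<lambda>t. f t * exp (C * t)) has_real_derivative (f' t + C * f t) * exp (C * t)) (at t)"
    by (rule derivative_eq_intros d t refl | simp add: algebra_simps)+
  moreover have "(f' t + C * f t) * exp (C * t) \<ge> 0" using le[OF t] by (intro mult_nonneg_nonneg) auto
  ultimately show "\<exists>y. ((\<lambda>t. f t * exp (C * t)) has_real_derivative y) (at t) \<and> 0 \<le> y" by blast
qed

lemma gronwall_upper:
  fixes f :: "real \<Rightarrow> real"
  assumes "a \<le> b" and d: "\<And>t. a \<le> t \<Longrightarrow> t \<le> b \<Longrightarrow> (f has_real_derivative f' t) (at t)"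
    and le: "\<And>t. a \<le> t \<Longrightarrow> t \<le> b \<Longrightarrow> f' t \<le> C * f t"
  shows "f b * exp (- C * b) \<le> f a * exp (- C * a)"
  using gronwall_lower[of a b "\<lambda>t. - f t" "\<lambda>t. - f' t" "- C"] assms by (auto intro: DERIV_minus)

lemma higher_deriv_DERIV:
  assumes "u holomorphic_on UNIV"
  shows "((deriv ^^ k) u has_field_derivative (deriv ^^ Suc k) u s) (at s)"
proof -
  have "(deriv ^^ k) u holomorphic_on UNIV" using assms by (intro holomorphic_higher_deriv) auto
  then show ?thesis by (simp add: holomorphic_derivI)
qed

lemma norm_sum_squares_DERIV:
  fixes p :: "'i \<Rightarrow> complex \<Rightarrow> complex"
  assumes "\<And>m. m \<in> I \<Longrightarrow> (p m has_field_derivative p' m) (at (of_real t))"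
  shows "((\<lambda>t. \<Sum>m\<in>I. (norm (p m (of_real t)))\<^sup>2) has_real_derivative (\<Sum>m\<in>I. 2 * (p m (of_real t) \<bullet> p' m))) (at t)"
proof (rule DERIV_sum)
  fix m assume "m \<in> I"
  then have "((\<lambda>t. p m (of_real t)) has_vector_derivative p' m) (at t)"
    by (intro has_vector_derivative_real_field assms)
  from bounded_bilinear.has_vector_derivative[OF bounded_bilinear_inner this this]
  show "((\<lambda>t. (norm (p m (of_real t)))\<^sup>2) has_real_derivative 2 * (p m (of_real t) \<bullet> p' m)) (at t)"
    by (simp add: has_real_derivative_iff_has_vector_derivative power2_norm_eq_inner inner_commute)
qed

lemma sum_norm_squared_le:
  fixes v :: "'i \<Rightarrow> complex"
  assumes "finite I"
  shows "(\<Sum>i\<in>I. norm (v i)) ^ 2 \<le> real (card I) * (\<Sum>i\<in>I. (norm (v i))\<^sup>2)"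
  using Cauchy_Schwarz_ineq_sum[of "\<lambda>_. 1" "\<lambda>i. norm (v i)" I] by simp

text \<open>For the compactness argument a bound near one point has to spread over the plane with a
  constant depending only on the size of the coefficients. Along a segment the squared norm of the
  first n derivatives satisfies a linear differential inequality.\<close>

lemma normal_solution_local_bound:
  fixes A :: real
  assumes "A \<ge> 0" "n > 0" "R \<ge> 0"
  shows "\<exists>C. \<forall>Q u s0 \<zeta> D. normal_solution Q u \<and> degree Q = n \<and> coeff Q n = 1 \<and> (\<forall>j. norm (coeff Q j) \<le> A) \<and>
     norm s0 \<le> R \<and> norm \<zeta> \<le> R \<and> (\<forall>k<n. norm ((deriv ^^ k) u s0) \<le> D) \<longrightarrow> norm (u (s0 + \<zeta>)) \<le> C * D"
proof -
  \<comment> \<open>Bounds the n-th derivative by the lower ones for |s| <= 2 R, where the segment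
    from s0 to s0 + \<zeta> lies; the summand 1 covers the rows of the system that only name the
    next derivative.\<close>
  define QQ where "QQ = exp (real n * (2 * R)) + A + 1"
  have QQ: "QQ \<ge> 1" unfolding QQ_def using assms by simp
  define C where "C = 2 * R * QQ * real n"
  have "norm (u (s0 + \<zeta>)) \<le> sqrt (exp C * real n) * D"
    if sol: "normal_solution Q u" and Q: "degree Q = n" "coeff Q n = 1" "\<forall>j. norm (coeff Q j) \<le> A"
      and s0: "norm s0 \<le> R" "norm \<zeta> \<le> R" and D: "\<forall>k<n. norm ((deriv ^^ k) u s0) \<le> D" for Q u s0 \<zeta> D
  proof -
    have hol: "u holomorphic_on UNIV" using sol unfolding normal_solution_def by auto
    have D0: "D \<ge> 0" using D assms(2) order_trans[OF norm_ge_zero] by blast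
    define p where "p k \<tau> = (deriv ^^ k) u (s0 + \<tau> * \<zeta>)" for k \<tau>
    have dp: "(p k has_field_derivative p (Suc k) \<tau> * \<zeta>) (at \<tau>)" for k \<tau>
    proof -
      have "((\<lambda>\<tau>. s0 + \<tau> * \<zeta>) has_field_derivative \<zeta>) (at \<tau>)" by (auto intro!: derivative_eq_intros)
      from DERIV_chain2[OF higher_deriv_DERIV[OF hol] this, of k] show ?thesis unfolding p_def[abs_def] by simp
    qed
    define E where "E t = (\<Sum>k<n. (norm (p k (of_real t)))\<^sup>2)" for t :: real
    define E' where "E' t = (\<Sum>k<n. 2 * (p k (of_real t) \<bullet> (p (Suc k) (of_real t) * \<zeta>)))" for t :: real
    have dE: "(E has_real_derivative E' t) (at t)" for t
      unfolding E_def[abs_def] E'_def by (rule norm_sum_squares_DERIV) (rule dp)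
    have le: "E' t \<le> C * E t" if t: "0 \<le> t" "t \<le> 1" for t
    proof -
      define S where "S = (\<Sum>k<n. norm (p k (of_real t)))"
      have pk: "norm (p k (of_real t)) \<le> S" if "k < n" for k
        unfolding S_def using that by (intro member_le_sum) auto
      have S0: "S \<ge> 0" unfolding S_def by (intro sum_nonneg) auto
      have pS: "norm (p (Suc k) (of_real t)) \<le> QQ * S" if "k < n" for k
      proof (cases "Suc k < n")
        case True
        then show ?thesis using pk[OF True] QQ S0 mult_right_mono[OF QQ S0] by linarith
      next
        case False
        then have k: "Suc k = n" using that by simp
        define s where "s = s0 + of_real t * \<zeta>"
        have "norm s \<le> norm s0 + t * norm \<zeta>" unfolding s_def using t by (intro norm_triangle_le) (simp add: norm_mult)
        also have "\<dots> \<le> R + 1 * R" using s0 t assms by (intro add_mono mult_mono) auto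
        finally have ns: "norm s \<le> 2 * R" by simp
        have "(\<Sum>j\<le>n. coeff Q j * (deriv ^^ j) u s) = (-1) ^ n * exp (of_nat n * s) * u s"
          using sol Q unfolding normal_solution_def by auto
        then have "(deriv ^^ n) u s = (-1) ^ n * exp (of_nat n * s) * u s - (\<Sum>j<n. coeff Q j * (deriv ^^ j) u s)"
          using Q(2) by (simp add: lessThan_Suc_atMost[symmetric] algebra_simps)
        then have "norm ((deriv ^^ n) u s) \<le> norm (exp (of_nat n * s)) * norm (u s) + (\<Sum>j<n. norm (coeff Q j) * norm ((deriv ^^ j) u s))"
          using norm_triangle_ineq4[of "(-1) ^ n * exp (of_nat n * s) * u s" "\<Sum>j<n. coeff Q j * (deriv ^^ j) u s"]
            norm_sum[of "\<lambda>j. coeff Q j * (deriv ^^ j) u s" "{..<n}"]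
          by (simp add: norm_mult norm_power)
        also have "\<dots> \<le> exp (real n * (2 * R)) * S + A * S"
        proof (intro add_mono mult_mono)
          have "real n * Re s \<le> real n * (2 * R)" using ns complex_Re_le_cmod[of s] by (intro mult_left_mono) auto
          then show "norm (exp (of_nat n * s)) \<le> exp (real n * (2 * R))" by (simp add: norm_exp_eq_Re)
          show "norm (u s) \<le> S" using pk[of 0] assms(2) unfolding p_def s_def by simp
          have "(\<Sum>j<n. norm (coeff Q j) * norm ((deriv ^^ j) u s)) \<le> (\<Sum>j<n. A * norm ((deriv ^^ j) u s))"
            using Q(3) by (intro sum_mono mult_right_mono) auto
          then show "(\<Sum>j<n. norm (coeff Q j) * norm ((deriv ^^ j) u s)) \<le> A * S"
            unfolding S_def p_def s_def by (simp add: sum_distrib_left)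
        qed auto
        also have "\<dots> \<le> QQ * S" unfolding QQ_def using S0 by (simp add: algebra_simps)
        finally show ?thesis unfolding k p_def s_def .
      qed
      have "E' t \<le> (\<Sum>k<n. 2 * (norm (p k (of_real t)) * ((QQ * S) * R)))"
        unfolding E'_def
      proof (rule sum_mono)
        fix k assume "k \<in> {..<n}"
        then have "norm (p (Suc k) (of_real t) * \<zeta>) \<le> (QQ * S) * R"
          unfolding norm_mult using pS[of k] s0 QQ S0 by (intro mult_mono) auto
        then have "p k (of_real t) \<bullet> (p (Suc k) (of_real t) * \<zeta>) \<le> norm (p k (of_real t)) * ((QQ * S) * R)"
          by (intro order_trans[OF norm_cauchy_schwarz] mult_left_mono) auto
        then show "2 * (p k (of_real t) \<bullet> (p (Suc k) (of_real t) * \<zeta>)) \<le> 2 * (norm (p k (of_real t)) * ((QQ * S) * R))" by simp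
      qed
      also have "\<dots> = 2 * R * QQ * S\<^sup>2"
        unfolding S_def by (simp add: sum_distrib_left sum_distrib_right power2_eq_square mult_ac)
      also have "\<dots> \<le> 2 * R * QQ * (real n * E t)"
      proof (rule mult_left_mono)
        show "S\<^sup>2 \<le> real n * E t" unfolding S_def E_def using sum_norm_squared_le[of "{..<n}"] by simp
      qed (use assms QQ in auto)
      finally show ?thesis unfolding C_def by (simp add: mult_ac)
    qed
    have "E 1 * exp (- C * 1) \<le> E 0 * exp (- C * 0)"
      by (rule gronwall_upper) (use dE le in auto)
    then have "E 1 \<le> exp C * E 0" by (simp add: exp_minus field_simps)
    also have "E 0 \<le> real n * D\<^sup>2"
    proof -
      have "E 0 \<le> (\<Sum>k<n. D\<^sup>2)" unfolding E_def p_def using D by (intro sum_mono power_mono) auto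
      then show ?thesis by simp
    qed
    finally have "E 1 \<le> exp C * (real n * D\<^sup>2)" by simp
    moreover have "(norm (u (s0 + \<zeta>)))\<^sup>2 \<le> E 1"
    proof -
      have "(norm (p 0 1))\<^sup>2 \<le> (\<Sum>k<n. (norm (p k 1))\<^sup>2)" using assms(2) by (intro member_le_sum) auto
      then show ?thesis unfolding E_def p_def by simp
    qed
    ultimately have "(norm (u (s0 + \<zeta>)))\<^sup>2 \<le> (sqrt (exp C * real n) * D)\<^sup>2"
      by (simp add: power_mult_distrib mult_ac)
    then show ?thesis by (rule power2_le_imp_le) (use D0 in simp)
  qed
  then show ?thesis by blast
qed

lemma normal_solution_subdominant_unique:
  assumes sol: "normal_solution Q u" and n: "degree Q > 0" "lead_coeff Q = 1"
    and decay: "\<And>M k. k < degree Q \<Longrightarrow> \<exists>C T. \<forall>t\<ge>T. norm ((deriv ^^ k) u (of_real t)) \<le> C * exp (- exp t - M * t)"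
  shows "u s = 0"
proof -
  define n where "n = degree Q"
  have n0: "n > 0" and qn: "coeff Q n = 1" using n unfolding n_def by auto
  have hol: "u holomorphic_on UNIV" using sol unfolding normal_solution_def by auto
  \<comment> \<open>Removing exp(-y) and rescaling the k-th derivative by y^(-k), with y = exp s,
    makes the leading part of the system exp s times a constant matrix: the identity plus a cyclic
    shift twisted by (-1)^n.\<close>
  define V where "V k s = exp (exp s - of_nat k * s) * (deriv ^^ k) u s" for k s
  have dV: "(V k has_field_derivative (exp s - of_nat k) * V k s + exp s * V (Suc k) s) (at s)" for k s
  proof -
    have "((\<lambda>s. exp (exp s - of_nat k * s)) has_field_derivative (exp s - of_nat k) * exp (exp s - of_nat k * s)) (at s)"
      by (auto intro!: derivative_eq_intros)
    from DERIV_mult[OF this higher_deriv_DERIV[OF hol, of k s]]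
    have "(V k has_field_derivative (exp s - of_nat k) * exp (exp s - of_nat k * s) * (deriv ^^ k) u s +
       (deriv ^^ Suc k) u s * exp (exp s - of_nat k * s)) (at s)" unfolding V_def[abs_def] .
    moreover have "exp (exp s - of_nat k * s) = exp s * exp (exp s - of_nat (Suc k) * s)"
      unfolding exp_add[symmetric] by (simp add: algebra_simps)
    ultimately show ?thesis unfolding V_def by (simp add: mult_ac)
  qed
  have Vn: "V n s = (-1) ^ n * V 0 s - (\<Sum>j<n. coeff Q j * exp (- of_nat (n - j) * s) * V j s)" for s
  proof -
    have "(\<Sum>j\<le>n. coeff Q j * (deriv ^^ j) u s) = (-1) ^ n * exp (of_nat n * s) * u s"
      using sol unfolding normal_solution_def n_def by auto
    then have "(deriv ^^ n) u s = (-1) ^ n * exp (of_nat n * s) * u s - (\<Sum>j<n. coeff Q j * (deriv ^^ j) u s)"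
      using qn by (simp add: lessThan_Suc_atMost[symmetric] algebra_simps)
    then have "V n s = exp (exp s - of_nat n * s) * ((-1) ^ n * exp (of_nat n * s) * u s - (\<Sum>j<n. coeff Q j * (deriv ^^ j) u s))"
      unfolding V_def by simp
    then have "V n s = (-1) ^ n * (exp (exp s - of_nat n * s) * exp (of_nat n * s)) * u s - (\<Sum>j<n. coeff Q j * exp (exp s - of_nat n * s) * (deriv ^^ j) u s)"
      unfolding right_diff_distrib sum_distrib_left by (simp only: mult_ac)
    also have "exp (exp s - of_nat n * s) * exp (of_nat n * s) = exp (exp s)" unfolding exp_add[symmetric] by simp
    also have "(\<Sum>j<n. coeff Q j * exp (exp s - of_nat n * s) * (deriv ^^ j) u s) = (\<Sum>j<n. coeff Q j * exp (- of_nat (n - j) * s) * V j s)"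
    proof (intro sum.cong refl)
      fix j assume "j \<in> {..<n}"
      then have "exp (exp s - of_nat n * s) = exp (- of_nat (n - j) * s) * exp (exp s - of_nat j * s)"
        unfolding exp_add[symmetric] by (simp add: of_nat_diff algebra_simps)
      then show "coeff Q j * exp (exp s - of_nat n * s) * (deriv ^^ j) u s = coeff Q j * exp (- of_nat (n - j) * s) * V j s"
        unfolding V_def by (simp add: mult_ac)
    qed
    finally show ?thesis unfolding V_def by simp
  qed
  \<comment> \<open>\<open>P m\<close> are eigencoordinates of the leading part: on the real axis \<open>P m\<close> has growth rate
    \<open>exp t * (1 + \<kappa> m)\<close>, whose real part is nonnegative, up to a bounded perturbation.\<close>
  define w where "w m = cis (2 * pi * real m / real n)" for m
  have winj: "inj_on w {..<n}" and wn: "w m ^ n = 1" if "m < n" for m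
    using Complex.bij_betw_roots_unity[OF n0] that unfolding bij_betw_def w_def by blast+
  have winj: "inj_on w {..<n}" using winj[OF n0] .
  have wpow: "w m ^ k = w k ^ m" for m k unfolding w_def Complex.DeMoivre by (simp add: mult_ac)
  have w0: "w m \<noteq> 0" "norm (w m) = 1" for m unfolding w_def by auto
  define \<kappa> where "\<kappa> m = - w m" for m
  have \<kappa>: "\<kappa> m \<noteq> 0" "norm (\<kappa> m) = 1" for m unfolding \<kappa>_def using w0 by auto
  have \<kappa>n: "\<kappa> m ^ n = (-1) ^ n" if "m < n" for m
    unfolding \<kappa>_def power_minus[of "w m"] using wn[OF that] by simp
  define l where "l m = inverse (\<kappa> m)" for m
  have l: "norm (l m) = 1" "\<kappa> m * l m = 1" for m unfolding l_def using \<kappa>[of m] by (auto simp: norm_inverse)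
  define P where "P m s = (\<Sum>k<n. l m ^ k * V k s)" for m s
  define Rr where "Rr m s = - (\<Sum>k<n. of_nat k * l m ^ k * V k s) - exp s * \<kappa> m * (-1) ^ n * (\<Sum>j<n. coeff Q j * exp (- of_nat (n - j) * s) * V j s)" for m s
  have dP: "(P m has_field_derivative exp s * (1 + \<kappa> m) * P m s + Rr m s) (at s)" if m: "m < n" for m s
  proof -
    have "(P m has_field_derivative (\<Sum>k<n. l m ^ k * ((exp s - of_nat k) * V k s + exp s * V (Suc k) s))) (at s)"
      unfolding P_def[abs_def] by (intro DERIV_sum DERIV_cmult dV)
    also have "(\<Sum>k<n. l m ^ k * ((exp s - of_nat k) * V k s + exp s * V (Suc k) s)) =
       exp s * P m s - (\<Sum>k<n. of_nat k * l m ^ k * V k s) + exp s * (\<Sum>k<n. l m ^ k * V (Suc k) s)"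
      unfolding P_def by (simp add: algebra_simps sum.distrib sum_subtractf sum_distrib_left)
    also have "(\<Sum>k<n. l m ^ k * V (Suc k) s) = \<kappa> m * (P m s - V 0 s + l m ^ n * V n s)"
    proof -
      have "(\<Sum>k<n. l m ^ k * V (Suc k) s) = \<kappa> m * (\<Sum>k<n. l m ^ Suc k * V (Suc k) s)"
      proof -
        have "\<kappa> m * (l m ^ Suc k * V (Suc k) s) = l m ^ k * V (Suc k) s" for k
        proof -
          have "\<kappa> m * (l m ^ Suc k * V (Suc k) s) = (\<kappa> m * l m) * (l m ^ k * V (Suc k) s)"
            by (simp only: power_Suc mult_ac)
          then show ?thesis unfolding l(2) by simp
        qed
        then show ?thesis unfolding sum_distrib_left by (intro sum.cong refl) (rule sym)
      qed
      also have "(\<Sum>k<n. l m ^ Suc k * V (Suc k) s) = P m s - V 0 s + l m ^ n * V n s"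
      proof -
        have "P m s + l m ^ n * V n s = V 0 s + (\<Sum>k<n. l m ^ Suc k * V (Suc k) s)"
          using sum.lessThan_Suc_shift[of "\<lambda>k. l m ^ k * V k s" n] unfolding P_def by simp
        then show ?thesis by (metis (no_types) add_diff_cancel_left' add_diff_eq diff_add_eq)
      qed
      finally show ?thesis .
    qed
    also have "l m ^ n * V n s = V 0 s - (-1) ^ n * (\<Sum>j<n. coeff Q j * exp (- of_nat (n - j) * s) * V j s)"
    proof -
      have "l m ^ n = (-1) ^ n" unfolding l_def power_inverse \<kappa>n[OF m] by (simp add: power_inverse[symmetric])
      moreover have "(-1 :: complex) ^ n * (-1) ^ n = 1" by (simp add: power_mult_distrib[symmetric])
      ultimately show ?thesis unfolding Vn by (simp add: right_diff_distrib mult.assoc[symmetric])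
    qed
    finally show ?thesis unfolding Rr_def by (simp add: algebra_simps)
  qed
  \<comment> \<open>Discrete Fourier inversion: orthogonality of the n-th roots of unity recovers V
    from the eigencoordinates.\<close>
  have inv: "of_nat n * V k s = (\<Sum>m<n. \<kappa> m ^ k * P m s)" if k: "k < n" for k s
  proof -
    have orth: "(\<Sum>m<n. \<kappa> m ^ k * l m ^ j) = (if j = k then of_nat n else 0)" if j: "j < n" for j
    proof (cases "j = k")
      case True
      then show ?thesis using l(2) by (simp add: power_mult_distrib[symmetric])
    next
      case False
      define \<zeta> where "\<zeta> = w k / w j"
      have "\<zeta> \<noteq> 1" unfolding \<zeta>_def using winj False k j w0 by (auto simp: inj_on_def)
      moreover have "\<zeta> ^ n = 1" unfolding \<zeta>_def power_divide using wn k j by simp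
      ultimately have "(\<Sum>m<n. \<zeta> ^ m) = 0" using geometric_sum[of \<zeta> n] by simp
      moreover have "\<kappa> m ^ k * l m ^ j = (-1) ^ k * (-1) ^ j * \<zeta> ^ m" for m
      proof -
        have "\<kappa> m ^ k * l m ^ j = (-1) ^ k * (-1) ^ j * (w m ^ k / w m ^ j)"
          unfolding \<kappa>_def l_def inverse_minus_eq power_minus[of "w m"] power_minus[of "inverse (w m)"]
          by (simp add: power_inverse divide_inverse)
        then show ?thesis unfolding \<zeta>_def power_divide wpow[of m] .
      qed
      ultimately show ?thesis using False by (simp add: sum_distrib_left[symmetric])
    qed
    have "(\<Sum>m<n. \<kappa> m ^ k * P m s) = (\<Sum>m<n. \<Sum>j<n. \<kappa> m ^ k * l m ^ j * V j s)"
      unfolding P_def by (simp add: sum_distrib_left mult.assoc)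
    also have "\<dots> = (\<Sum>j<n. (\<Sum>m<n. \<kappa> m ^ k * l m ^ j) * V j s)"
      by (subst sum.swap) (simp add: sum_distrib_right)
    also have "\<dots> = (\<Sum>j<n. (if j = k then of_nat n else 0) * V j s)"
      by (intro sum.cong refl) (simp add: orth)
    also have "\<dots> = (\<Sum>j<n. if j = k then of_nat n * V j s else 0)" by (intro sum.cong refl) auto
    also have "\<dots> = of_nat n * V k s" using k by simp
    finally show ?thesis by simp
  qed
  define E where "E t = (\<Sum>m<n. (norm (P m (of_real t)))\<^sup>2)" for t :: real
  define E' where "E' t = (\<Sum>m<n. 2 * (P m (of_real t) \<bullet> (exp (of_real t) * (1 + \<kappa> m) * P m (of_real t) + Rr m (of_real t))))" for t :: real
  have dE: "(E has_real_derivative E' t) (at t)" for t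
    unfolding E_def[abs_def] E'_def by (rule norm_sum_squares_DERIV) (use dP in auto)
  define QQ where "QQ = (\<Sum>k<n. real k) + (\<Sum>j<n. norm (coeff Q j))"
  have QQ: "QQ \<ge> 0" unfolding QQ_def by (intro add_nonneg_nonneg sum_nonneg) auto
  define C where "C = 2 * QQ * real n"
  \<comment> \<open>The leading part cannot lower the energy, and the perturbation is bounded for t
    >= 0 because exp(-(n - j) t) with j < n compensates the factor exp t.\<close>
  have le: "E' t \<ge> - C * E t" if t: "t \<ge> 0" for t
  proof -
    define S where "S = (\<Sum>m<n. norm (P m (of_real t)))"
    have S0: "S \<ge> 0" unfolding S_def by (intro sum_nonneg) auto
    have VS: "norm (V k (of_real t)) \<le> S" if k: "k < n" for k
    proof -
      have "real n * norm (V k (of_real t)) = norm (of_nat n * V k (of_real t))" by (simp add: norm_mult)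
      also have "\<dots> \<le> (\<Sum>m<n. norm (\<kappa> m ^ k * P m (of_real t)))" unfolding inv[OF k] by (rule norm_sum)
      also have "\<dots> = S" unfolding S_def by (simp add: norm_mult norm_power \<kappa>)
      also have "\<dots> \<le> real n * S" using n0 S0 by (simp add: mult_le_cancel_right1)
      finally show ?thesis using n0 by simp
    qed
    have R: "norm (Rr m (of_real t)) \<le> QQ * S" for m
    proof -
      have "norm (Rr m (of_real t)) \<le> norm (\<Sum>k<n. of_nat k * l m ^ k * V k (of_real t)) +
         norm (exp (of_real t) * \<kappa> m * (-1) ^ n * (\<Sum>j<n. coeff Q j * exp (- of_nat (n - j) * of_real t) * V j (of_real t)))"
        unfolding Rr_def by (rule order_trans[OF norm_triangle_ineq4]) simp
      also have "norm (\<Sum>k<n. of_nat k * l m ^ k * V k (of_real t)) \<le> (\<Sum>k<n. real k) * S"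
        unfolding sum_distrib_right
        by (rule order_trans[OF norm_sum], rule sum_mono) (use VS in \<open>auto simp: norm_mult norm_power l intro!: mult_left_mono\<close>)
      also have "norm (exp (of_real t) * \<kappa> m * (-1) ^ n * (\<Sum>j<n. coeff Q j * exp (- of_nat (n - j) * of_real t) * V j (of_real t))) \<le> (\<Sum>j<n. norm (coeff Q j)) * S"
      proof -
        have "exp (of_real t) * \<kappa> m * (-1) ^ n * (\<Sum>j<n. coeff Q j * exp (- of_nat (n - j) * of_real t) * V j (of_real t)) =
          \<kappa> m * (-1) ^ n * (\<Sum>j<n. coeff Q j * (exp (of_real t) * exp (- of_nat (n - j) * of_real t)) * V j (of_real t))"
          by (simp add: sum_distrib_left mult_ac)
        also have "norm \<dots> = norm (\<Sum>j<n. coeff Q j * (exp (of_real t) * exp (- of_nat (n - j) * of_real t)) * V j (of_real t))"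
          by (simp add: norm_mult norm_power \<kappa>)
        also have "\<dots> \<le> (\<Sum>j<n. norm (coeff Q j)) * S"
          unfolding sum_distrib_right
        proof (rule order_trans[OF norm_sum], rule sum_mono)
          fix j assume j: "j \<in> {..<n}"
          have "t - real (n - j) * t \<le> 0"
          proof -
            have "1 * t \<le> real (n - j) * t" using j t by (intro mult_right_mono) auto
            then show ?thesis by simp
          qed
          moreover have "Re (of_real t + - of_nat d * of_real t) = t - real d * t" for d by simp
          ultimately have e1: "norm (exp (of_real t) * exp (- of_nat (n - j) * of_real t :: complex)) \<le> 1"
            unfolding exp_add[symmetric] norm_exp_eq_Re by (simp only: exp_le_one_iff)
          have "norm (coeff Q j) * norm (exp (of_real t) * exp (- of_nat (n - j) * of_real t :: complex)) * norm (V j (of_real t)) \<le> norm (coeff Q j) * 1 * S"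
            by (intro mult_mono e1 VS order_refl mult_nonneg_nonneg) (use j in auto)
          then show "norm (coeff Q j * (exp (of_real t) * exp (- of_nat (n - j) * of_real t)) * V j (of_real t)) \<le> norm (coeff Q j) * S"
            by (simp only: norm_mult mult_1_right)
        qed
        finally show ?thesis .
      qed
      finally show ?thesis unfolding QQ_def by (simp add: algebra_simps)
    qed
    have lower: "- (norm (P m (of_real t)) * (QQ * S)) \<le> P m (of_real t) \<bullet> (exp (of_real t) * (1 + \<kappa> m) * P m (of_real t) + Rr m (of_real t))" for m
    proof -
      define c where "c = exp (of_real t) * (1 + \<kappa> m)"
      \<comment> \<open>As |\<kappa> m| = 1, the real part of 1 + \<kappa> m is nonnegative: exp(-y)
        decays fastest among the n exponentials, so removing it leaves no decaying
        direction.\<close>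
      have c: "Re c \<ge> 0"
      proof -
        have "Re (\<kappa> m) \<ge> - 1" using abs_Re_le_cmod[of "\<kappa> m"] \<kappa>(2)[of m] by simp
        then show ?thesis unfolding c_def by (simp add: Re_exp Im_exp)
      qed
      have "P m (of_real t) \<bullet> (c * P m (of_real t)) = Re c * (norm (P m (of_real t)))\<^sup>2"
        unfolding cmod_power2 inner_complex_def by (simp add: algebra_simps power2_eq_square)
      then have "P m (of_real t) \<bullet> (c * P m (of_real t)) \<ge> 0" using c by simp
      moreover have "\<bar>P m (of_real t) \<bullet> Rr m (of_real t)\<bar> \<le> norm (P m (of_real t)) * (QQ * S)"
        using R by (intro order_trans[OF Cauchy_Schwarz_ineq2] mult_left_mono) auto
      ultimately show ?thesis unfolding c_def[symmetric] inner_add_right by linarith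
    qed
    have "- C * E t \<le> - (2 * QQ * S\<^sup>2)"
    proof -
      have "S\<^sup>2 \<le> real n * E t" unfolding S_def E_def using sum_norm_squared_le[of "{..<n}"] by simp
      then have "2 * QQ * S\<^sup>2 \<le> 2 * QQ * (real n * E t)" using QQ by (intro mult_left_mono) auto
      then show ?thesis unfolding C_def by (simp add: mult_ac)
    qed
    also have "- (2 * QQ * S\<^sup>2) = (\<Sum>m<n. 2 * (- (norm (P m (of_real t)) * (QQ * S))))"
      unfolding S_def by (simp add: sum_distrib_left sum_distrib_right power2_eq_square mult_ac sum_negf)
    also have "\<dots> \<le> E' t" unfolding E'_def using lower by (intro sum_mono mult_left_mono) auto
    finally show ?thesis .
  qed
  \<comment> \<open>By Gronwall the energy decays no faster than exp(- C t); the decay hypothesis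
    with an exponent M > C makes it decay faster, so it is zero.\<close>
  have E0: "E t = 0" if t: "t \<ge> 0" for t
  proof -
    obtain M where M: "M > C" by (metis gt_ex)
    have "\<exists>B T. \<forall>s\<ge>T. norm (V k (of_real s)) \<le> B * exp (- M * s)" if k: "k < n" for k
    proof -
      obtain B T where BT: "\<And>s. s \<ge> T \<Longrightarrow> norm ((deriv ^^ k) u (of_real s)) \<le> B * exp (- exp s - (M - real k) * s)"
        using decay[of k "M - real k"] k unfolding n_def by blast
      have "norm (V k (of_real s)) \<le> B * exp (- M * s)" if "s \<ge> T" for s
      proof -
        have "norm (V k (of_real s)) = exp (exp s - real k * s) * norm ((deriv ^^ k) u (of_real s))"
          unfolding V_def norm_mult norm_exp_eq_Re by (simp add: Re_exp)
        also have "\<dots> \<le> exp (exp s - real k * s) * (B * exp (- exp s - (M - real k) * s))"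
          using BT[OF that] by (intro mult_left_mono) auto
        also have "\<dots> = B * exp (- M * s)"
          by (simp add: exp_add[symmetric] algebra_simps flip: exp_add mult.assoc)
        finally show ?thesis .
      qed
      then show ?thesis by blast
    qed
    then obtain B T where BT: "\<And>k s. k < n \<Longrightarrow> s \<ge> T k \<Longrightarrow> norm (V k (of_real s)) \<le> B k * exp (- M * s)" by metis
    define B0 where "B0 = (\<Sum>k<n. B k)"
    define T0 where "T0 = Max (insert t (T ` {..<n}))"
    have T0: "T0 \<ge> t" "\<And>k. k < n \<Longrightarrow> T0 \<ge> T k" unfolding T0_def by auto
    have EB: "E s \<le> real n * B0\<^sup>2 * exp (- 2 * M * s)" if s: "s \<ge> T0" for s
    proof -
      have Pb: "norm (P m (of_real s)) \<le> B0 * exp (- M * s)" for m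
      proof -
        have "norm (P m (of_real s)) \<le> (\<Sum>k<n. norm (l m ^ k * V k (of_real s)))" unfolding P_def by (rule norm_sum)
        also have "\<dots> \<le> (\<Sum>k<n. B k * exp (- M * s))"
        proof (rule sum_mono)
          fix k assume "k \<in> {..<n}"
          then have "k < n" "T k \<le> s" using T0(2)[of k] s by auto
          then show "norm (l m ^ k * V k (of_real s)) \<le> B k * exp (- M * s)"
            using BT[of k s] by (simp add: norm_mult norm_power l)
        qed
        finally show ?thesis unfolding B0_def by (simp add: sum_distrib_right)
      qed
      have "E s \<le> (\<Sum>m<n. (B0 * exp (- M * s))\<^sup>2)" unfolding E_def using Pb by (intro sum_mono power_mono) auto
      also have "\<dots> = real n * B0\<^sup>2 * exp (- 2 * M * s)"
        by (simp add: power_mult_distrib exp_double[symmetric] mult_ac flip: exp_double)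
      finally show ?thesis .
    qed
    have "E t * exp (C * t) \<le> real n * B0\<^sup>2 * exp ((C - 2 * M) * s)" if s: "s \<ge> T0" for s
    proof -
      have "E t * exp (C * t) \<le> E s * exp (C * s)"
        by (rule gronwall_lower[of t s E E']) (use dE le t s T0 in auto)
      also have "\<dots> \<le> real n * B0\<^sup>2 * exp (- 2 * M * s) * exp (C * s)" using EB[OF s] by (intro mult_right_mono) auto
      also have "\<dots> = real n * B0\<^sup>2 * exp ((C - 2 * M) * s)"
        unfolding mult.assoc exp_add[symmetric] by (simp add: algebra_simps)
      finally show ?thesis .
    qed
    then have ev: "eventually (\<lambda>s. E t * exp (C * t) \<le> real n * B0\<^sup>2 * exp ((C - 2 * M) * s)) at_top"
      unfolding eventually_at_top_linorder by blast
    have "((\<lambda>s. real n * B0\<^sup>2 * exp ((C - 2 * M) * s)) \<longlongrightarrow> 0) at_top"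
    proof -
      have "C - 2 * M < 0" using M QQ unfolding C_def by (smt (verit) mult_nonneg_nonneg of_nat_0_le_iff)
      then show ?thesis by real_asymp
    qed
    then have "E t * exp (C * t) \<le> 0"
      by (intro tendsto_lowerbound[OF _ ev]) auto
    then have "E t \<le> 0" by (simp add: mult_le_0_iff)
    moreover have "E t \<ge> 0" unfolding E_def by (intro sum_nonneg) auto
    ultimately show ?thesis by simp
  qed
  have u0: "u (of_real t) = 0" if "t \<ge> 0" for t
  proof -
    have "P m (of_real t) = 0" if "m < n" for m
      using E0[OF \<open>t \<ge> 0\<close>] that unfolding E_def by (subst (asm) sum_nonneg_eq_0_iff) auto
    then have "of_nat n * V 0 (of_real t) = 0" unfolding inv[OF n0] by simp
    then show ?thesis using n0 unfolding V_def by simp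
  qed
  \<comment> \<open>The identity theorem extends the vanishing from the half-line to the plane; the
    point 1 serves as accumulation point.\<close>
  have "1 islimpt (complex_of_real ` {0..})"
    unfolding islimpt_approachable
  proof (intro allI impI)
    fix e :: real assume "e > 0"
    moreover from this have "complex_of_real (1 + e / 2) \<in> complex_of_real ` {0..}" by (intro imageI) simp
    ultimately show "\<exists>x'\<in>complex_of_real ` {0..}. x' \<noteq> 1 \<and> dist x' 1 < e"
      by (elim bexI[rotated]) (auto simp: dist_norm norm_divide)
  qed
  moreover have "u z = 0" if "z \<in> complex_of_real ` {0..}" for z
    using that u0 by (elim imageE) simp
  ultimately show ?thesis
    by (rule analytic_continuation[OF hol open_UNIV connected_UNIV subset_UNIV UNIV_I _ _ UNIV_I])
qed

section \<open>The residue sum as a solution\<close>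

text \<open>Factoring out exp (\<alpha> s) leaves an everywhere convergent power series in exp (n
  s), which may be differentiated termwise.\<close>

lemma exp_series_DERIV:
  fixes c :: "nat \<Rightarrow> complex"
  assumes sm: "\<And>y. summable (\<lambda>m. c m * y ^ m)"
  shows "((\<lambda>s. \<Sum>m. c m * exp ((\<alpha> + of_nat n * of_nat m) * s)) has_field_derivative
           (\<Sum>m. (c m * (\<alpha> + of_nat n * of_nat m)) * exp ((\<alpha> + of_nat n * of_nat m) * s))) (at s)"
    and "summable (\<lambda>m. (c m * (\<alpha> + of_nat n * of_nat m)) * y ^ m)"
    and "summable (\<lambda>m. c m * exp ((\<alpha> + of_nat n * of_nat m) * s))"
proof -
  have e: "exp ((\<alpha> + of_nat n * of_nat m) * s) = exp (\<alpha> * s) * exp (of_nat n * s) ^ m" for m s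
    unfolding exp_of_nat_mult[symmetric] exp_add[symmetric] by (simp add: algebra_simps)
  have ds: "summable (\<lambda>m. diffs c m * y ^ m)" for y
    using termdiff_converges_all[OF sm] .
  have sm2: "summable (\<lambda>m. of_nat m * c m * y ^ m)" for y
  proof -
    have "summable (\<lambda>m. diffs c m * y ^ m * y)" by (intro summable_mult2 ds)
    then have "summable (\<lambda>m. of_nat (Suc m) * c (Suc m) * y ^ Suc m)" by (simp add: diffs_def mult_ac)
    then show ?thesis by (subst (asm) summable_Suc_iff)
  qed
  have val: "(\<Sum>m. diffs c m * y ^ m) * y = (\<Sum>m. of_nat m * c m * y ^ m)" for y
  proof -
    have "(\<Sum>m. diffs c m * y ^ m) * y = (\<Sum>m. diffs c m * y ^ m * y)" by (rule suminf_mult2[OF ds])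
    also have "\<dots> = (\<Sum>m. of_nat (Suc m) * c (Suc m) * y ^ Suc m)" by (simp add: diffs_def mult_ac)
    also have "\<dots> = (\<Sum>m. of_nat m * c m * y ^ m)" using suminf_split_head[OF sm2, of y] by simp
    finally show ?thesis .
  qed
  show "summable (\<lambda>m. (c m * (\<alpha> + of_nat n * of_nat m)) * y ^ m)"
  proof -
    have "summable (\<lambda>m. \<alpha> * (c m * y ^ m) + of_nat n * (of_nat m * c m * y ^ m))"
      by (intro summable_add summable_mult sm sm2)
    then show ?thesis by (simp add: algebra_simps)
  qed
  show "summable (\<lambda>m. c m * exp ((\<alpha> + of_nat n * of_nat m) * s))"
  proof -
    have "summable (\<lambda>m. exp (\<alpha> * s) * (c m * exp (of_nat n * s) ^ m))" by (intro summable_mult sm)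
    then show ?thesis unfolding e by (simp add: mult_ac)
  qed
  define g where "g y = (\<Sum>m. c m * y ^ m)" for y
  have dg: "(g has_field_derivative (\<Sum>m. diffs c m * y ^ m)) (at y)" for y
    unfolding g_def[abs_def] by (rule termdiffs_strong_converges_everywhere[OF sm])
  have f: "(\<Sum>m. c m * exp ((\<alpha> + of_nat n * of_nat m) * s)) = exp (\<alpha> * s) * g (exp (of_nat n * s))" for s
    unfolding e g_def by (subst suminf_mult[OF sm, symmetric]) (simp add: mult_ac)
  define y where "y = exp (of_nat n * s)"
  have "((\<lambda>s. exp (of_nat n * s)) has_field_derivative of_nat n * y) (at s)"
    unfolding y_def by (auto intro!: derivative_eq_intros)
  from DERIV_chain2[OF dg this]
  have "((\<lambda>s. g (exp (of_nat n * s))) has_field_derivative (\<Sum>m. diffs c m * y ^ m) * (of_nat n * y)) (at s)" unfolding y_def .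
  moreover have "((\<lambda>s. exp (\<alpha> * s)) has_field_derivative \<alpha> * exp (\<alpha> * s)) (at s)" by (auto intro!: derivative_eq_intros)
  ultimately have "((\<lambda>s. exp (\<alpha> * s) * g (exp (of_nat n * s))) has_field_derivative
      \<alpha> * exp (\<alpha> * s) * g y + (\<Sum>m. diffs c m * y ^ m) * (of_nat n * y) * exp (\<alpha> * s)) (at s)"
    unfolding y_def using DERIV_mult by blast
  also have "\<alpha> * exp (\<alpha> * s) * g y + (\<Sum>m. diffs c m * y ^ m) * (of_nat n * y) * exp (\<alpha> * s) =
     exp (\<alpha> * s) * (\<alpha> * g y + of_nat n * ((\<Sum>m. diffs c m * y ^ m) * y))" by (simp add: algebra_simps)
  also have "\<dots> = exp (\<alpha> * s) * (\<Sum>m. \<alpha> * (c m * y ^ m) + of_nat n * (of_nat m * c m * y ^ m))"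
    unfolding val g_def suminf_mult[OF sm, symmetric] suminf_mult[OF sm2, symmetric]
    by (subst suminf_add) (auto intro: summable_mult sm sm2)
  also have "\<dots> = (\<Sum>m. exp (\<alpha> * s) * (\<alpha> * (c m * y ^ m) + of_nat n * (of_nat m * c m * y ^ m)))"
    by (rule suminf_mult[symmetric]) (intro summable_add summable_mult sm sm2)
  also have "\<dots> = (\<Sum>m. (c m * (\<alpha> + of_nat n * of_nat m)) * exp ((\<alpha> + of_nat n * of_nat m) * s))"
    unfolding e y_def[symmetric] by (simp add: algebra_simps)
  finally show "((\<lambda>s. \<Sum>m. c m * exp ((\<alpha> + of_nat n * of_nat m) * s)) has_field_derivative
           (\<Sum>m. (c m * (\<alpha> + of_nat n * of_nat m)) * exp ((\<alpha> + of_nat n * of_nat m) * s))) (at s)"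
    unfolding f .
qed

lemma exp_series_higher_deriv:
  fixes c :: "nat \<Rightarrow> complex"
  assumes sm: "\<And>y. summable (\<lambda>m. c m * y ^ m)"
  shows "(deriv ^^ j) (\<lambda>s. \<Sum>m. c m * exp ((\<alpha> + of_nat n * of_nat m) * s)) =
      (\<lambda>s. \<Sum>m. (c m * (\<alpha> + of_nat n * of_nat m) ^ j) * exp ((\<alpha> + of_nat n * of_nat m) * s)) \<and>
    (\<forall>y. summable (\<lambda>m. (c m * (\<alpha> + of_nat n * of_nat m) ^ j) * y ^ m))"
proof (induction j)
  case (Suc j)
  then have sj: "\<And>y. summable (\<lambda>m. (c m * (\<alpha> + of_nat n * of_nat m) ^ j) * y ^ m)" by blast
  have "deriv (\<lambda>s. \<Sum>m. (c m * (\<alpha> + of_nat n * of_nat m) ^ j) * exp ((\<alpha> + of_nat n * of_nat m) * s)) s =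
     (\<Sum>m. (c m * (\<alpha> + of_nat n * of_nat m) ^ j * (\<alpha> + of_nat n * of_nat m)) * exp ((\<alpha> + of_nat n * of_nat m) * s))" for s
    by (rule DERIV_imp_deriv) (rule exp_series_DERIV(1)[OF sj])
  then have "(deriv ^^ Suc j) (\<lambda>s. \<Sum>m. c m * exp ((\<alpha> + of_nat n * of_nat m) * s)) =
     (\<lambda>s. \<Sum>m. (c m * (\<alpha> + of_nat n * of_nat m) ^ Suc j) * exp ((\<alpha> + of_nat n * of_nat m) * s))"
    unfolding funpow.simps o_apply conjunct1[OF Suc] power_Suc2 mult.assoc[of "c _", symmetric] by (rule ext)
  then show ?case using exp_series_DERIV(2)[OF sj, of \<alpha> n] unfolding power_Suc2 mult.assoc[of "c _", symmetric] by blast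
qed (use sm in simp)

text \<open>The method of Frobenius: \<open>init\<close> is the indicial equation and removes the
  lowest term, \<open>rec\<close> matches the remaining terms after a shift by one.\<close>

lemma exp_series_normal_solution:
  fixes c :: "nat \<Rightarrow> complex"
  assumes sm: "\<And>y. summable (\<lambda>m. c m * y ^ m)"
    and rec: "\<And>m. c (Suc m) * poly Q (\<alpha> + of_nat (degree Q) * of_nat (Suc m)) = (-1) ^ degree Q * c m"
    and init: "poly Q \<alpha> = 0"
  shows "normal_solution Q (\<lambda>s. \<Sum>m. c m * exp ((\<alpha> + of_nat (degree Q) * of_nat m) * s))"
proof -
  define n where "n = degree Q"
  define u where "u = (\<lambda>s. \<Sum>m. c m * exp ((\<alpha> + of_nat n * of_nat m) * s))"
  note hd = exp_series_higher_deriv[OF sm, of _ \<alpha> n, folded u_def]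
  have hol: "u holomorphic_on UNIV"
    unfolding holomorphic_on_def field_differentiable_def u_def using exp_series_DERIV(1)[OF sm] by auto
  have "(\<Sum>j\<le>n. coeff Q j * (deriv ^^ j) u s) = (-1) ^ n * exp (of_nat n * s) * u s" for s
  proof -
    have sj: "summable (\<lambda>m. (c m * (\<alpha> + of_nat n * of_nat m) ^ j) * exp ((\<alpha> + of_nat n * of_nat m) * s))" for j
      by (rule exp_series_DERIV(3)) (use hd in blast)
    have "(\<Sum>j\<le>n. coeff Q j * (deriv ^^ j) u s) =
       (\<Sum>j\<le>n. \<Sum>m. coeff Q j * ((c m * (\<alpha> + of_nat n * of_nat m) ^ j) * exp ((\<alpha> + of_nat n * of_nat m) * s)))"
      using hd by (intro sum.cong refl) (simp add: suminf_mult[OF sj])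
    also have "\<dots> = (\<Sum>m. \<Sum>j\<le>n. coeff Q j * ((c m * (\<alpha> + of_nat n * of_nat m) ^ j) * exp ((\<alpha> + of_nat n * of_nat m) * s)))"
      by (rule suminf_sum[symmetric]) (intro summable_mult sj)
    also have "\<dots> = (\<Sum>m. c m * poly Q (\<alpha> + of_nat n * of_nat m) * exp ((\<alpha> + of_nat n * of_nat m) * s))"
      unfolding poly_altdef n_def by (simp add: sum_distrib_left sum_distrib_right mult_ac)
    also have "\<dots> = (\<Sum>m. c (Suc m) * poly Q (\<alpha> + of_nat n * of_nat (Suc m)) * exp ((\<alpha> + of_nat n * of_nat (Suc m)) * s))"
    proof -
      have "summable (\<lambda>m. \<Sum>j\<le>n. coeff Q j * ((c m * (\<alpha> + of_nat n * of_nat m) ^ j) * exp ((\<alpha> + of_nat n * of_nat m) * s)))"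
        by (intro summable_sum summable_mult sj)
      then have "summable (\<lambda>m. c m * poly Q (\<alpha> + of_nat n * of_nat m) * exp ((\<alpha> + of_nat n * of_nat m) * s))"
        unfolding poly_altdef n_def by (simp add: sum_distrib_left sum_distrib_right mult_ac)
      from suminf_split_head[OF this] show ?thesis using init by simp
    qed
    also have "\<dots> = (\<Sum>m. (-1) ^ n * exp (of_nat n * s) * (c m * exp ((\<alpha> + of_nat n * of_nat m) * s)))"
    proof (intro arg_cong[of _ _ suminf] ext)
      fix m
      have "exp ((\<alpha> + of_nat n * of_nat (Suc m)) * s) = exp (of_nat n * s) * exp ((\<alpha> + of_nat n * of_nat m) * s)"
        unfolding exp_add[symmetric] by (simp add: algebra_simps)
      then show "c (Suc m) * poly Q (\<alpha> + of_nat n * of_nat (Suc m)) * exp ((\<alpha> + of_nat n * of_nat (Suc m)) * s) =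
         (-1) ^ n * exp (of_nat n * s) * (c m * exp ((\<alpha> + of_nat n * of_nat m) * s))"
        using rec[of m] unfolding n_def[symmetric] by (simp only: mult_ac)
    qed
    also have "\<dots> = (-1) ^ n * exp (of_nat n * s) * u s"
      unfolding u_def by (rule suminf_mult) (rule exp_series_DERIV(3)[OF sm])
    finally show ?thesis .
  qed
  then show ?thesis using hol unfolding normal_solution_def n_def u_def by blast
qed

lemma normal_solution_add:
  assumes "normal_solution Q u" "normal_solution Q v"
  shows "normal_solution Q (\<lambda>s. u s + v s)"
proof -
  have "(deriv ^^ j) (\<lambda>s. u s + v s) s = (deriv ^^ j) u s + (deriv ^^ j) v s" for j s
    using assms unfolding normal_solution_def by (intro higher_deriv_add[where S=UNIV]) auto
  then show ?thesis using assms unfolding normal_solution_def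
    by (auto intro!: holomorphic_intros simp: distrib_left sum.distrib)
qed

lemma normal_solution_cmult:
  assumes "normal_solution Q u"
  shows "normal_solution Q (\<lambda>s. c * u s)"
proof -
  have "(deriv ^^ j) (\<lambda>s. c * u s) s = c * (deriv ^^ j) u s" for j s
    using assms unfolding normal_solution_def by (intro higher_deriv_cmult[where A=UNIV]) auto
  then show ?thesis using assms unfolding normal_solution_def
    by (auto intro!: holomorphic_intros simp: mult.left_commute[of _ c] sum_distrib_left[symmetric])
qed

lemma normal_solution_sum:
  assumes "finite I" "\<And>i. i \<in> I \<Longrightarrow> normal_solution Q (u i)"
  shows "normal_solution Q (\<lambda>s. \<Sum>i\<in>I. u i s)"
  using assms
proof (induction I rule: finite_induct)
  case empty
  have "(deriv ^^ j) (\<lambda>_. 0) = (\<lambda>_. 0 :: complex)" for j by (induction j) auto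
  then show ?case unfolding normal_solution_def by simp
qed (simp add: normal_solution_add)

text \<open>Each index contributes a Frobenius series with exponent - n \<nu> l, whose recurrence is
  the functional equation of the Gamma factors.\<close>

theorem barnes_sum_normal_solution:
  fixes \<nu> :: "'a::finite \<Rightarrow> complex"
  assumes gen: "\<And>k l. k \<noteq> l \<Longrightarrow> \<nu> k - \<nu> l \<notin> \<int>"
  shows "normal_solution (index_poly \<nu>) (\<lambda>v. barnes_sum \<nu> (v - of_real (ln (real CARD('a)))))"
proof -
  define n where "n = CARD('a)"
  have n: "n > 0" unfolding n_def by simp
  have dg: "degree (index_poly \<nu>) = n" unfolding n_def by (rule degree_index_poly)
  define L where "L = complex_of_real (ln (real n))"
  have "normal_solution (index_poly \<nu>) (\<lambda>v. \<Sum>m. barnes_term \<nu> (v - L) l m)" for l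
  proof -
    define g where "g m = (\<Prod>k\<in>UNIV - {l}. Gamma (\<nu> l - \<nu> k - of_nat m))" for m
    define c where "c m = (-1) ^ m / fact m * g m * exp (of_nat n * (\<nu> l - of_nat m) * L)" for m
    define \<alpha> where "\<alpha> = - of_nat n * \<nu> l"
    have bt: "barnes_term \<nu> (v - L) l m = c m * exp ((\<alpha> + of_nat n * of_nat m) * v)" for v m
    proof -
      have "exp (- (of_nat n * (\<nu> l - of_nat m) * (v - L))) = exp (of_nat n * (\<nu> l - of_nat m) * L) * exp ((\<alpha> + of_nat n * of_nat m) * v)"
        unfolding exp_add[symmetric] \<alpha>_def by (simp add: algebra_simps)
      then show ?thesis unfolding barnes_term_def c_def g_def n_def[symmetric] by simp
    qed
    have sm: "summable (\<lambda>m. c m * y ^ m)" for y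
    proof (cases "y = 0")
      case True
      have "summable (\<lambda>m. c m * 0 ^ m)" by (rule summable_finite[of "{0}"]) auto
      then show ?thesis using True by simp
    next
      case False
      \<comment> \<open>Every nonzero y has the form exp (n v), so convergence of the power series
        follows from that of the residues.\<close>
      define v where "v = Ln y / of_nat n"
      have y: "exp (of_nat n * v) = y" unfolding v_def using n False by simp
      have "exp ((\<alpha> + of_nat n * of_nat m) * v) = exp (\<alpha> * v) * exp (of_nat n * v) ^ m" for m
        unfolding exp_of_nat_mult[symmetric] exp_add[symmetric] by (simp add: algebra_simps)
      then have "exp ((\<alpha> + of_nat n * of_nat m) * v) = exp (\<alpha> * v) * y ^ m" for m unfolding y .
      then have "barnes_term \<nu> (v - L) l m = exp (\<alpha> * v) * (c m * y ^ m)" for m unfolding bt by simp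
      then have eq: "barnes_term \<nu> (v - L) l = (\<lambda>m. exp (\<alpha> * v) * (c m * y ^ m))" by (rule ext)
      have "summable (barnes_term \<nu> (v - L) l)" by (rule barnes_term_summable) (rule gen)
      then have "summable (\<lambda>m. exp (\<alpha> * v) * (c m * y ^ m))" unfolding eq .
      from summable_mult[OF this, of "exp (- \<alpha> * v)"] show ?thesis by (simp add: mult.assoc[symmetric] exp_add[symmetric])
    qed
    have Qp: "poly (index_poly \<nu>) x = (\<Prod>k\<in>UNIV. of_nat n * \<nu> k + x)" for x
      unfolding index_poly_def poly_prod n_def by (simp add: add.commute)
    have init: "poly (index_poly \<nu>) \<alpha> = 0"
      unfolding Qp \<alpha>_def by (intro prod_zero bexI[of _ l]) auto
    have rec: "c (Suc m) * poly (index_poly \<nu>) (\<alpha> + of_nat n * of_nat (Suc m)) = (-1) ^ n * c m" for m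
    proof -
      have G: "Gamma (\<nu> l - \<nu> k - of_nat m) = (\<nu> l - \<nu> k - of_nat (Suc m)) * Gamma (\<nu> l - \<nu> k - of_nat (Suc m))" if "k \<noteq> l" for k
      proof -
        have "\<nu> l - \<nu> k - of_nat (Suc m) \<notin> \<int>"
        proof
          assume "\<nu> l - \<nu> k - of_nat (Suc m) \<in> \<int>"
          then have "\<nu> l - \<nu> k - of_nat (Suc m) + of_nat (Suc m) \<in> \<int>" by (intro Ints_add) auto
          then show False using gen[of l k] that by simp
        qed
        then have "Gamma (\<nu> l - \<nu> k - of_nat (Suc m) + 1) = (\<nu> l - \<nu> k - of_nat (Suc m)) * Gamma (\<nu> l - \<nu> k - of_nat (Suc m))"
          by (intro Gamma_plus1) (use not_in_Ints_imp_not_in_nonpos_Ints in blast)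
        moreover have "\<nu> l - \<nu> k - of_nat (Suc m) + 1 = \<nu> l - \<nu> k - of_nat m" by simp
        ultimately show ?thesis by (simp only:)
      qed
      have gm: "g m = (\<Prod>k\<in>UNIV-{l}. \<nu> l - \<nu> k - of_nat (Suc m)) * g (Suc m)"
        unfolding g_def prod.distrib[symmetric] by (intro prod.cong refl) (rule G, simp)
      have "poly (index_poly \<nu>) (\<alpha> + of_nat n * of_nat (Suc m)) = (\<Prod>k\<in>UNIV. (- of_nat n) * (\<nu> l - \<nu> k - of_nat (Suc m)))"
        unfolding Qp \<alpha>_def by (intro prod.cong refl) (simp add: algebra_simps)
      also have "\<dots> = (- of_nat n) ^ n * (\<Prod>k\<in>UNIV. \<nu> l - \<nu> k - of_nat (Suc m))"
        unfolding prod.distrib by (simp add: n_def)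
      also have "(\<Prod>k\<in>UNIV. \<nu> l - \<nu> k - of_nat (Suc m)) = - of_nat (Suc m) * (\<Prod>k\<in>UNIV-{l}. \<nu> l - \<nu> k - of_nat (Suc m))"
        by (subst prod.remove[of _ l]) auto
      finally have 1: "poly (index_poly \<nu>) (\<alpha> + of_nat n * of_nat (Suc m)) =
          (- of_nat n) ^ n * (- of_nat (Suc m) * (\<Prod>k\<in>UNIV-{l}. \<nu> l - \<nu> k - of_nat (Suc m)))" .
      have 2: "exp (of_nat n * (\<nu> l - of_nat m) * L) = exp (of_nat n * (\<nu> l - of_nat (Suc m)) * L) * of_nat n ^ n"
      proof -
        have "of_nat n ^ n = exp L ^ n" unfolding L_def using n by (simp add: exp_of_real)
        also have "\<dots> = exp (of_nat n * L)" by (rule exp_of_nat_mult[symmetric])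
        finally have e: "(of_nat n :: complex) ^ n = exp (of_nat n * L)" .
        show ?thesis unfolding e exp_add[symmetric] by (simp add: algebra_simps)
      qed
      have 3: "(-1) ^ Suc m / fact (Suc m) * of_nat (Suc m) = - ((-1) ^ m / fact m :: complex)"
        unfolding fact_Suc power_Suc using of_nat_neq_0[of m, where 'a=complex] by (simp del: of_nat_Suc)
      have "c (Suc m) * poly (index_poly \<nu>) (\<alpha> + of_nat n * of_nat (Suc m)) =
        - ((-1) ^ Suc m / fact (Suc m) * of_nat (Suc m)) * ((\<Prod>k\<in>UNIV-{l}. \<nu> l - \<nu> k - of_nat (Suc m)) * g (Suc m)) *
          (exp (of_nat n * (\<nu> l - of_nat (Suc m)) * L) * (- of_nat n) ^ n)"
        unfolding c_def 1 by (simp only: mult_ac mult_minus_left mult_minus_right)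
      also have "(- of_nat n :: complex) ^ n = (-1) ^ n * of_nat n ^ n" by (rule power_minus)
      finally show ?thesis unfolding 3 gm[symmetric] c_def 2 by (simp only: mult_ac minus_minus)
    qed
    show ?thesis unfolding bt
      using exp_series_normal_solution[OF sm, of "index_poly \<nu>" \<alpha>] rec init unfolding dg by blast
  qed
  then show ?thesis unfolding barnes_sum_def L_def[symmetric] n_def[symmetric]
    by (intro normal_solution_sum) (auto simp: L_def)
qed

section \<open>The connection formula\<close>

text \<open>A logarithm of - i n \<xi>: adding it to log z gives log y for y = - i n \<xi>
  z.\<close>

definition log_shift :: "nat \<Rightarrow> ucover \<Rightarrow> complex" where
  "log_shift n \<xi> = \<xi> - \<i> * of_real pi / 2 + of_real (ln (real n))"

text \<open>The constants are chosen so that the expansion starts with exp (a v - exp v), the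
  counterpart of B_0 = 1.\<close>

definition normal_bessel :: "('a::finite \<Rightarrow> complex) \<Rightarrow> complex \<Rightarrow> complex" where
  "normal_bessel \<nu> v = of_nat CARD('a) * of_real (gamma_ratio_limit CARD('a)) *
     barnes_sum \<nu> (v - of_real (ln (real CARD('a))))"

lemma exp_minus_half_pi_i: "exp (- (\<i> * of_real pi / 2)) = - \<i>"
  by (subst exp_eq_polar) (simp add: complex_eq_iff)

lemma exp_log_shift:
  assumes "n > 0"
  shows "exp (log_shift n \<xi>) = - \<i> * of_nat n * uproj \<xi>"
  using assms unfolding log_shift_def uproj_def diff_conv_add_uminus exp_add exp_minus_half_pi_i
  by (simp add: exp_of_real)

lemma generic_iff: "generic \<nu> \<longleftrightarrow> (\<forall>k l. k \<noteq> l \<longrightarrow> \<nu> $ k - \<nu> $ l \<notin> \<int>)"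
  by (simp add: generic_def)

lemma sin_pi_minus_of_nat: "sin (of_real pi * (x - of_nat m)) = (-1) ^ m * sin (of_real pi * x :: complex)"
proof (induction m)
  case (Suc m)
  have "of_real pi * (x - of_nat (Suc m)) = of_real pi * (x - of_nat m) - of_real pi" by (simp add: algebra_simps)
  then show ?case using Suc by (simp add: sin_diff sin_of_real[symmetric] cos_of_real[symmetric] del: of_nat_Suc)
qed simp

lemma sin_pi_nonzero:
  fixes x :: complex
  assumes "x \<notin> \<int>"
  shows "sin (of_real pi * x) \<noteq> 0"
proof
  assume "sin (of_real pi * x) = 0"
  then obtain i :: int where "of_real pi * x = of_real (of_int i * pi)" unfolding sin_eq_0 by blast
  then have "x = of_int i" by simp
  then show False using assms by simp
qed

text \<open>The reflection formula turns the n - 1 regular Gamma factors into sines and reciprocal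
  Gammas, and the factor k = l is 1/m!. The n signs (-1)^m, one from the residue and n - 1 from the
  sines, change (-i)^n into i^n.\<close>

lemma barnes_term_bessel:
  fixes \<nu> :: "complex ^ 'n"
  assumes gen: "generic \<nu>" and \<sigma>: "uproj \<xi> ^ CARD('n) = \<sigma>" and re: "Re \<xi> = 0"
  shows "barnes_term (($) \<nu>) (z + \<xi> - \<i> * of_real pi / 2) l m =
     of_real pi ^ (CARD('n) - 1) * conj_power \<nu> \<xi> l * bessel_S \<nu> l *
     ((\<sigma> * \<i> ^ CARD('n)) ^ m * upow z (of_nat CARD('n) * (- (\<nu> $ l) + of_nat m)) *
          (\<Prod>k\<in>UNIV. rGamma (\<nu> $ k - \<nu> $ l + of_nat m + 1)))"
proof -
  define n where "n = CARD('n)"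
  have n: "n > 0" unfolding n_def by simp
  have \<xi>: "\<xi> = \<i> * of_real (uarg \<xi>)" using re by (simp add: complex_eq_iff uarg_def)
  have G: "Gamma (\<nu> $ l - \<nu> $ k - of_nat m) = (of_real pi * (-1) ^ m) * (1 / sin (of_real pi * (\<nu> $ l - \<nu> $ k))) * rGamma (\<nu> $ k - \<nu> $ l + of_nat m + 1)"
    if k: "k \<noteq> l" for k
  proof -
    define x where "x = \<nu> $ l - \<nu> $ k"
    have x: "x \<notin> \<int>" using gen k unfolding x_def generic_iff by metis
    have "1 - (x - of_nat m) \<notin> \<int>\<^sub>\<le>\<^sub>0"
    proof
      assume "1 - (x - of_nat m) \<in> \<int>\<^sub>\<le>\<^sub>0"
      then have "1 - (x - of_nat m) \<in> \<int>" by (rule nonpos_Ints_Int)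
      then have "1 + of_nat m - (1 - (x - of_nat m)) \<in> \<int>" by (intro Ints_diff Ints_add) auto
      then show False using x by simp
    qed
    then have "Gamma (1 - (x - of_nat m)) \<noteq> 0" by (simp add: Gamma_eq_zero_iff)
    then have "Gamma (x - of_nat m) = (of_real pi / sin (of_real pi * (x - of_nat m))) * rGamma (1 - (x - of_nat m))"
      unfolding Gamma_reflection_complex[symmetric] rGamma_inverse_Gamma by simp
    also have "1 - (x - of_nat m) = \<nu> $ k - \<nu> $ l + of_nat m + 1" unfolding x_def by simp
    also have "of_real pi / sin (of_real pi * (x - of_nat m)) = (of_real pi * (-1) ^ m) * (1 / sin (of_real pi * x))"
      unfolding sin_pi_minus_of_nat by (cases "even m") auto
    finally show ?thesis unfolding x_def .
  qed
  have card: "card (UNIV - {l} :: 'n set) = n - 1" unfolding n_def by (simp add: card_Diff_singleton)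
  have gam: "(\<Prod>k\<in>UNIV - {l}. Gamma (\<nu> $ l - \<nu> $ k - of_nat m)) =
     of_real pi ^ (n - 1) * ((-1) ^ m) ^ (n - 1) * bessel_S \<nu> l * (\<Prod>k\<in>UNIV - {l}. rGamma (\<nu> $ k - \<nu> $ l + of_nat m + 1))"
  proof -
    have "(\<Prod>k\<in>UNIV - {l}. Gamma (\<nu> $ l - \<nu> $ k - of_nat m)) = (\<Prod>k\<in>UNIV - {l}. (of_real pi * (-1) ^ m) *
       (1 / sin (of_real pi * (\<nu> $ l - \<nu> $ k))) * rGamma (\<nu> $ k - \<nu> $ l + of_nat m + 1))"
      by (intro prod.cong refl) (rule G, simp)
    then show ?thesis unfolding bessel_S_def prod.distrib prod_constant card power_mult_distrib .
  qed
  have rgam: "(\<Prod>k\<in>UNIV. rGamma (\<nu> $ k - \<nu> $ l + of_nat m + 1)) = 1 / fact m * (\<Prod>k\<in>UNIV - {l}. rGamma (\<nu> $ k - \<nu> $ l + of_nat m + 1))"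
  proof -
    have "rGamma (of_nat m + 1) = (1 / fact m :: complex)"
      using Gamma_fact[of m, where 'a=complex] unfolding rGamma_inverse_Gamma by (simp add: add.commute divide_inverse)
    then show ?thesis by (subst prod.remove[of _ l]) auto
  qed
  have ex: "exp (- (of_nat n * (\<nu> $ l - of_nat m) * (z + \<xi> - \<i> * of_real pi / 2))) =
     upow z (of_nat n * (- (\<nu> $ l) + of_nat m)) * conj_power \<nu> \<xi> l * ((\<sigma> * (- \<i>) ^ n) ^ m)"
  proof -
    have "conj_power \<nu> \<xi> l = exp (- of_nat n * \<nu> $ l * (\<xi> - \<i> * of_real pi / 2))"
      unfolding conj_power_def n_def[symmetric] by (subst (2) \<xi>) (simp add: algebra_simps)
    moreover have "(\<sigma> * (- \<i>) ^ n) ^ m = exp (of_nat n * of_nat m * (\<xi> - \<i> * of_real pi / 2))"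
    proof -
      have "\<sigma> * (- \<i>) ^ n = exp (of_nat n * (\<xi> - \<i> * of_real pi / 2))"
        unfolding \<sigma>[symmetric] uproj_def n_def[symmetric] exp_minus_half_pi_i[symmetric] exp_of_nat_mult[symmetric] exp_add[symmetric]
        by (simp add: algebra_simps)
      then show ?thesis unfolding exp_of_nat_mult[symmetric] by (simp add: exp_of_nat_mult[symmetric] mult_ac)
    qed
    moreover have "- (of_nat n * (\<nu> $ l - of_nat m) * (z + \<xi> - \<i> * of_real pi / 2)) =
       of_nat n * (- (\<nu> $ l) + of_nat m) * z + - of_nat n * \<nu> $ l * (\<xi> - \<i> * of_real pi / 2) + of_nat n * of_nat m * (\<xi> - \<i> * of_real pi / 2)"
      by (simp add: algebra_simps)
    ultimately show ?thesis unfolding upow_def by (simp only: exp_add)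
  qed
  have sgn: "((-1) ^ m :: complex) * ((-1) ^ m) ^ (n - 1) * (\<sigma> * (- \<i>) ^ n) ^ m = (\<sigma> * \<i> ^ n) ^ m"
  proof -
    have "((-1) ^ m :: complex) * ((-1) ^ m) ^ (n - 1) = ((-1) ^ m) ^ n" using n by (simp add: power_eq_if)
    also have "\<dots> = ((-1) ^ n) ^ m" by (simp add: power_mult[symmetric] mult.commute)
    finally have "((-1) ^ m :: complex) * ((-1) ^ m) ^ (n - 1) * (\<sigma> * (- \<i>) ^ n) ^ m = ((-1) ^ n * (\<sigma> * (- \<i>) ^ n)) ^ m"
      by (simp add: power_mult_distrib)
    also have "(-1) ^ n * (\<sigma> * (- \<i>) ^ n) = \<sigma> * \<i> ^ n"
    proof -
      have "(-1 :: complex) ^ n * (- \<i>) ^ n = \<i> ^ n" unfolding power_mult_distrib[symmetric] by simp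
      then show ?thesis by (simp add: mult.left_commute)
    qed
    finally show ?thesis .
  qed
  have alg: "e1 / q * (pp * e2 * S * P) * (U * cp * t) = pp * cp * S * ((e1 * e2 * t) * U * (1 / q * P))"
    for e1 e2 q pp S P U cp t :: complex by (simp add: mult_ac)
  show ?thesis unfolding barnes_term_def n_def[symmetric] gam ex alg sgn rgam ..
qed

lemma bessel_connection:
  fixes \<nu> :: "complex ^ 'n"
  assumes gen: "generic \<nu>" and \<sigma>: "uproj \<xi> ^ CARD('n) = \<sigma>" and re: "Re \<xi> = 0"
  shows "of_real (sqrt (real CARD('n))) * connection_factor CARD('n) \<xi> *
               (\<Sum>l\<in>UNIV. conj_power \<nu> \<xi> l * bessel_S \<nu> l * bessel_first \<sigma> \<nu> l z) =
     exp (- bessel_exponent CARD('n) * log_shift CARD('n) \<xi>) * normal_bessel (($) \<nu>) (z + log_shift CARD('n) \<xi>)"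
proof -
  define n where "n = CARD('n)"
  have n: "n > 0" unfolding n_def by simp
  define w where "w = z + \<xi> - \<i> * of_real pi / 2"
  have \<xi>: "\<xi> = \<i> * of_real (uarg \<xi>)" using re by (simp add: complex_eq_iff uarg_def)
  have gen': "($) \<nu> k - ($) \<nu> l \<notin> \<int>" if "k \<noteq> l" for k l using gen that unfolding generic_iff by blast
  have "(\<Sum>m. barnes_term (($) \<nu>) w l m) = of_real pi ^ (n - 1) * (conj_power \<nu> \<xi> l * bessel_S \<nu> l * bessel_first \<sigma> \<nu> l z)" for l
  proof -
    define c where "c = of_real pi ^ (n - 1) * conj_power \<nu> \<xi> l * bessel_S \<nu> l"
    define f where "f m = (\<sigma> * \<i> ^ n) ^ m * upow z (of_nat n * (- (\<nu> $ l) + of_nat m)) *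
          (\<Prod>k\<in>UNIV. rGamma (\<nu> $ k - \<nu> $ l + of_nat m + 1))" for m
    have bt: "barnes_term (($) \<nu>) w l = (\<lambda>m. c * f m)"
      unfolding w_def c_def f_def n_def by (rule ext) (rule barnes_term_bessel[OF assms])
    \<comment> \<open>With 1/0 = 0 the factor \<open>bessel_S\<close> would vanish together with a
      sine; genericity excludes this. A nonzero c is needed to carry summability from the residues
      over to \<open>bessel_first\<close>.\<close>
    have c0: "c \<noteq> 0" unfolding c_def conj_power_def bessel_S_def using sin_pi_nonzero gen' by auto
    have "summable (barnes_term (($) \<nu>) w l)" by (rule barnes_term_summable) (rule gen')
    then have "summable f" unfolding bt by (rule summable_mult_D[OF _ c0])
    then have "(\<Sum>m. c * f m) = c * suminf f" by (rule suminf_mult)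
    moreover have "bessel_first \<sigma> \<nu> l z = suminf f" unfolding bessel_first_def f_def n_def ..
    ultimately show ?thesis unfolding bt by (simp add: c_def mult.assoc)
  qed
  then have bs: "barnes_sum (($) \<nu>) w = of_real pi ^ (n - 1) * (\<Sum>l\<in>UNIV. conj_power \<nu> \<xi> l * bessel_S \<nu> l * bessel_first \<sigma> \<nu> l z)"
    unfolding barnes_sum_def by (simp add: sum_distrib_left)
  have w': "z + log_shift n \<xi> - of_real (ln (real n)) = w" unfolding w_def log_shift_def by simp
  \<comment> \<open>With h = (n - 1)/2 the real constants combine by n^h n n^(-n/2) = n^(1/2) and (2
    pi)^(-h) pi^(2 h) = (pi/2)^h.\<close>
  have const: "of_real (sqrt (real n)) * connection_factor n \<xi> =
     exp (- bessel_exponent n * log_shift n \<xi>) * (of_nat n * of_real (gamma_ratio_limit n)) * of_real pi ^ (n - 1)"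
  proof -
    define h where "h = (real n - 1) / 2"
    have "- bessel_exponent n * log_shift n \<xi> = (of_nat n - 1) / 2 * (- (1/2) * pi * \<i> + \<i> * uarg \<xi>) + of_real (h * ln (real n))"
      unfolding bessel_exponent_def log_shift_def h_def by (subst \<xi>) (simp add: field_simps)
    then have e: "exp (- bessel_exponent n * log_shift n \<xi>) = exp ((of_nat n - 1) / 2 * (- (1/2) * pi * \<i> + \<i> * uarg \<xi>)) * of_real (real n powr h)"
      using n by (simp only: exp_add exp_of_real powr_def) simp
    have pin: "pi ^ (n - 1) = pi powr h * pi powr h"
    proof -
      have "pi ^ (n - 1) = pi powr real (n - 1)" by (simp add: powr_realpow)
      also have "real (n - 1) = h + h" unfolding h_def using n by (simp add: of_nat_diff)
      finally show ?thesis by (simp only: powr_add)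
    qed
    have "real n powr h * (real n * ((2 * pi) powr (- h) * real n powr (- real n / 2))) * (pi powr h * pi powr h) = sqrt (real n) * (pi / 2) powr h"
    proof -
      have "real n powr h * real n * real n powr (- real n / 2) = real n powr (h + 1 + (- real n / 2))"
        unfolding powr_add using n by simp
      also have "h + 1 + (- real n / 2) = 1 / 2" unfolding h_def by (simp add: field_simps)
      also have "real n powr (1/2) = sqrt (real n)" using n by (simp add: powr_half_sqrt)
      finally have 1: "real n powr h * real n * real n powr (- real n / 2) = sqrt (real n)" .
      have 2: "(2 * pi) powr (- h) * (pi powr h * pi powr h) = (pi / 2) powr h"
        by (simp add: powr_minus powr_mult powr_divide field_simps)
      show ?thesis unfolding 1[symmetric] 2[symmetric] by (simp only: mult_ac)
    qed
    moreover have "- (real n - 1) / 2 = - h" unfolding h_def by (simp add: field_simps)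
    ultimately have r: "real n powr h * (real n * gamma_ratio_limit n) * pi ^ (n - 1) = sqrt (real n) * (pi / 2) powr h"
      unfolding gamma_ratio_limit_def pin by (simp only:)
    have "of_real (sqrt (real n)) * connection_factor n \<xi> =
       of_real (sqrt (real n) * (pi / 2) powr h) * exp ((of_nat n - 1) / 2 * (- (1/2) * pi * \<i> + \<i> * uarg \<xi>))"
      unfolding connection_factor_def h_def by simp
    also have "\<dots> = exp (- bessel_exponent n * log_shift n \<xi>) * (of_nat n * of_real (gamma_ratio_limit n)) * of_real pi ^ (n - 1)"
      unfolding r[symmetric] e by (simp add: mult_ac)
    finally show ?thesis .
  qed
  show ?thesis unfolding normal_bessel_def n_def[symmetric] w' bs const by (simp only: mult_ac)
qed

section \<open>Translation to the normalised coordinate\<close>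

lemma higher_deriv_shift:
  assumes "f holomorphic_on UNIV"
  shows "(deriv ^^ j) (\<lambda>v. f (v + c)) v = (deriv ^^ j) f (v + c)"
  using higher_deriv_compose_linear'[OF assms open_UNIV open_UNIV UNIV_I, of 1 c j v] by simp

text \<open>Translation commutes with derivatives, and as \<xi>^n = \<sigma> this one changes
  \<sigma> (i n)^n exp (n z) into (-1)^n exp (n v).\<close>

lemma bessel_solution_normal_iff:
  fixes \<mu> :: "complex ^ 'n"
  assumes \<sigma>: "uproj \<xi> ^ CARD('n) = \<sigma>"
  shows "bessel_solution \<sigma> \<mu> w \<longleftrightarrow> normal_solution (index_poly (($) \<mu>)) (\<lambda>v. w (v - log_shift CARD('n) \<xi>))"
proof -
  define n where "n = CARD('n)"
  have n: "n > 0" unfolding n_def by simp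
  define \<tau> where "\<tau> = log_shift n \<xi>"
  have e: "(-1) ^ n * exp (of_nat n * (z + \<tau>)) = \<sigma> * (\<i> * of_nat n) ^ n * exp (of_nat n * z)" for z
  proof -
    have "exp \<tau> = - \<i> * of_nat n * uproj \<xi>" unfolding \<tau>_def by (rule exp_log_shift[OF n])
    then have "exp (of_nat n * (z + \<tau>)) = exp (of_nat n * z) * (- \<i> * of_nat n * uproj \<xi>) ^ n"
      by (simp add: ring_distribs exp_add exp_of_nat_mult)
    also have "(- \<i> * of_nat n * uproj \<xi>) ^ n = (-1) ^ n * ((\<i> * of_nat n) ^ n * \<sigma>)"
      unfolding \<sigma>[symmetric] n_def[symmetric] power_mult_distrib[symmetric] by simp
    finally have "(-1) ^ n * exp (of_nat n * (z + \<tau>)) = ((-1) ^ n * (-1) ^ n) * (\<sigma> * (\<i> * of_nat n) ^ n * exp (of_nat n * z))"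
      by (simp only: mult_ac)
    also have "(-1 :: complex) ^ n * (-1) ^ n = 1" by (simp add: power_mult_distrib[symmetric])
    finally show ?thesis by simp
  qed
  have hol: "(\<lambda>v. w (v - \<tau>)) holomorphic_on UNIV \<longleftrightarrow> w holomorphic_on UNIV"
  proof
    assume "w holomorphic_on UNIV"
    then show "(\<lambda>v. w (v - \<tau>)) holomorphic_on UNIV"
      by (intro holomorphic_on_compose_gen[of "\<lambda>v. v - \<tau>" _ w UNIV, unfolded o_def]) (auto intro!: holomorphic_intros)
  next
    assume "(\<lambda>v. w (v - \<tau>)) holomorphic_on UNIV"
    then have "(\<lambda>v. w (v + \<tau> - \<tau>)) holomorphic_on UNIV"
      by (intro holomorphic_on_compose_gen[of "\<lambda>v. v + \<tau>" _ "\<lambda>v. w (v - \<tau>)" UNIV, unfolded o_def]) (auto intro!: holomorphic_intros)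
    then show "w holomorphic_on UNIV" by simp
  qed
  show ?thesis
  proof (cases "w holomorphic_on UNIV")
    case True
    have d: "(deriv ^^ j) (\<lambda>v. w (v - \<tau>)) v = (deriv ^^ j) w (v - \<tau>)" for j v
      using higher_deriv_shift[OF True, of j "- \<tau>" v] by simp
    have "(\<forall>v. (\<Sum>j\<le>n. coeff (index_poly (($) \<mu>)) j * (deriv ^^ j) w (v - \<tau>)) = (-1) ^ n * exp (of_nat n * v) * w (v - \<tau>)) \<longleftrightarrow>
      (\<forall>z. (\<Sum>j\<le>n. coeff (index_poly (($) \<mu>)) j * (deriv ^^ j) w z) = \<sigma> * (\<i> * of_nat n) ^ n * exp (of_nat n * z) * w z)"
    proof (intro iffI allI)
      fix z assume "\<forall>v. (\<Sum>j\<le>n. coeff (index_poly (($) \<mu>)) j * (deriv ^^ j) w (v - \<tau>)) = (-1) ^ n * exp (of_nat n * v) * w (v - \<tau>)"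
      from this[rule_format, of "z + \<tau>"]
      show "(\<Sum>j\<le>n. coeff (index_poly (($) \<mu>)) j * (deriv ^^ j) w z) = \<sigma> * (\<i> * of_nat n) ^ n * exp (of_nat n * z) * w z"
        unfolding e by simp
    next
      fix v assume "\<forall>z. (\<Sum>j\<le>n. coeff (index_poly (($) \<mu>)) j * (deriv ^^ j) w z) = \<sigma> * (\<i> * of_nat n) ^ n * exp (of_nat n * z) * w z"
      from this[rule_format, of "v - \<tau>"] e[of "v - \<tau>"]
      show "(\<Sum>j\<le>n. coeff (index_poly (($) \<mu>)) j * (deriv ^^ j) w (v - \<tau>)) = (-1) ^ n * exp (of_nat n * v) * w (v - \<tau>)"
        by simp
    qed
    then show ?thesis using True hol
      unfolding bessel_solution_iff normal_solution_def degree_index_poly n_def[symmetric] \<tau>_def[symmetric] d by blast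
  next
    case False
    then show ?thesis using hol unfolding bessel_solution_iff normal_solution_def n_def[symmetric] \<tau>_def[symmetric] by blast
  qed
qed

text \<open>In the logarithmic coordinate a closed subsector near infinity is a half-strip and
  |z|^(-M) is exp (- M Re z). Explicit constants allow estimates uniform in the indices.\<close>

lemma bigo_sector_iff:
  fixes F :: "ucover \<Rightarrow> complex"
  shows "F \<in> O[sector_at_infinity \<phi> \<delta>](\<lambda>z. inverse (uproj z) ^ M) \<longleftrightarrow>
    (\<exists>C X. \<forall>z. \<bar>Im z - \<phi>\<bar> \<le> \<delta> \<and> Re z \<ge> X \<longrightarrow> norm (F z) \<le> C * exp (- real M * Re z))"
proof -
  have nrm: "norm (inverse (uproj z) ^ M) = exp (- real M * Re z)" for z
    by (simp add: uproj_def norm_power norm_inverse exp_minus exp_of_nat_mult[symmetric] power_inverse)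
  have ev: "eventually P (sector_at_infinity \<phi> \<delta>) \<longleftrightarrow> (\<exists>X. \<forall>z. \<bar>Im z - \<phi>\<bar> \<le> \<delta> \<and> Re z \<ge> X \<longrightarrow> P z)" for P
  proof -
    have "eventually P (sector_at_infinity \<phi> \<delta>) \<longleftrightarrow> (\<exists>N. \<forall>z. N \<le> exp (Re z) \<longrightarrow> \<bar>Im z - \<phi>\<bar> \<le> \<delta> \<longrightarrow> P z)"
      unfolding sector_at_infinity_def eventually_inf_principal eventually_filtercomap_at_top_linorder umod_def uarg_def by simp
    also have "\<dots> \<longleftrightarrow> (\<exists>X. \<forall>z. \<bar>Im z - \<phi>\<bar> \<le> \<delta> \<and> Re z \<ge> X \<longrightarrow> P z)"
    proof (intro iffI; elim exE)
      fix N assume N: "\<forall>z. N \<le> exp (Re z) \<longrightarrow> \<bar>Im z - \<phi>\<bar> \<le> \<delta> \<longrightarrow> P z"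
      have "N \<le> exp (Re z)" if "Re z \<ge> N" for z using that exp_ge_add_one_self[of "Re z"] by linarith
      then show "\<exists>X. \<forall>z. \<bar>Im z - \<phi>\<bar> \<le> \<delta> \<and> Re z \<ge> X \<longrightarrow> P z" using N by blast
    next
      fix X assume "\<forall>z. \<bar>Im z - \<phi>\<bar> \<le> \<delta> \<and> Re z \<ge> X \<longrightarrow> P z"
      then show "\<exists>N. \<forall>z. N \<le> exp (Re z) \<longrightarrow> \<bar>Im z - \<phi>\<bar> \<le> \<delta> \<longrightarrow> P z"
        by (intro exI[of _ "exp X"]) auto
    qed
    finally show ?thesis .
  qed
  show ?thesis
  proof
    assume "F \<in> O[sector_at_infinity \<phi> \<delta>](\<lambda>z. inverse (uproj z) ^ M)"
    then obtain C where "eventually (\<lambda>z. norm (F z) \<le> C * norm (inverse (uproj z) ^ M)) (sector_at_infinity \<phi> \<delta>)"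
      by (elim landau_o.bigE)
    then show "\<exists>C X. \<forall>z. \<bar>Im z - \<phi>\<bar> \<le> \<delta> \<and> Re z \<ge> X \<longrightarrow> norm (F z) \<le> C * exp (- real M * Re z)"
      unfolding ev nrm by blast
  next
    assume "\<exists>C X. \<forall>z. \<bar>Im z - \<phi>\<bar> \<le> \<delta> \<and> Re z \<ge> X \<longrightarrow> norm (F z) \<le> C * exp (- real M * Re z)"
    then obtain C where "eventually (\<lambda>z. norm (F z) \<le> C * norm (inverse (uproj z) ^ M)) (sector_at_infinity \<phi> \<delta>)"
      unfolding ev nrm by blast
    then show "F \<in> O[sector_at_infinity \<phi> \<delta>](\<lambda>z. inverse (uproj z) ^ M)" by (rule bigoI)
  qed
qed

text \<open>The asymptotic expansion in the normalised coordinate, where the exponential factor is \<open>exp (- exp v)\<close>.\<close>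

definition normal_expansion :: "complex ^ 'n \<Rightarrow> (complex \<Rightarrow> complex) \<Rightarrow> real \<Rightarrow> bool" where
  "normal_expansion \<mu> u \<rho> \<longleftrightarrow> (\<forall>\<delta><\<rho>. \<forall>M. \<exists>C X. \<forall>v. \<bar>Im v\<bar> \<le> \<delta> \<and> Re v \<ge> X \<longrightarrow>
     norm (u v / exp (bessel_exponent CARD('n) * v - exp v) - (\<Sum>m<M. normal_series \<mu> (int m) * exp (- of_nat m * v)))
       \<le> C * exp (- real M * Re v))"

text \<open>As |\<xi>| = 1, the translation moves real parts by the constant ln n, which C and X
  absorb, and rotates the sector so that it is centred at Im v = 0.\<close>

lemma has_asymp_expansion_iff:
  fixes \<mu> :: "complex ^ 'n" and \<xi> :: ucover
  assumes \<mu>: "\<mu> \<in> zero_sum" and re: "Re \<xi> = 0"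
  shows "has_asymp_expansion w (\<i> * of_nat CARD('n) * uproj \<xi>) (- (of_nat CARD('n) - 1) / 2) (\<lambda>m. bessel_B \<xi> m \<mu>)
          (pi / 2 - uarg \<xi>) \<rho> \<longleftrightarrow>
    normal_expansion \<mu> (\<lambda>v. exp (bessel_exponent CARD('n) * log_shift CARD('n) \<xi>) * w (v - log_shift CARD('n) \<xi>)) \<rho>"
proof -
  define n where "n = CARD('n)"
  have n: "n > 0" unfolding n_def by simp
  define a where "a = bessel_exponent n"
  define \<tau> where "\<tau> = log_shift n \<xi>"
  define F where "F M z = w z / (exp (\<i> * of_nat n * uproj \<xi> * uproj z) * upow z (- (of_nat n - 1) / 2)) -
      (\<Sum>m<M. bessel_B \<xi> m \<mu> * inverse (uproj z) ^ m)" for M z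
  define G where "G M v = exp (a * \<tau>) * w (v - \<tau>) / exp (a * v - exp v) - (\<Sum>m<M. normal_series \<mu> (int m) * exp (- of_nat m * v))" for M v
  have et: "exp \<tau> = - \<i> * of_nat n * uproj \<xi>"
    unfolding \<tau>_def by (rule exp_log_shift[OF n])
  have FG: "F M z = G M (z + \<tau>)" for M z
  proof -
    have "\<i> * of_nat n * uproj \<xi> * uproj z = - exp (z + \<tau>)" unfolding exp_add et uproj_def by simp
    moreover have "upow z (- (of_nat n - 1) / 2) = exp (a * z)" unfolding upow_def a_def bessel_exponent_def by simp
    moreover have "exp (a * (z + \<tau>) - exp (z + \<tau>)) = exp (- exp (z + \<tau>)) * exp (a * z) * exp (a * \<tau>)"
      unfolding exp_add[symmetric] by (simp add: algebra_simps)
    ultimately have d: "exp (\<i> * of_nat n * uproj \<xi> * uproj z) * upow z (- (of_nat n - 1) / 2) = exp (a * (z + \<tau>) - exp (z + \<tau>)) / exp (a * \<tau>)"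
      by simp
    have "bessel_B \<xi> m \<mu> * inverse (uproj z) ^ m = normal_series \<mu> (int m) * exp (- of_nat m * (z + \<tau>))" for m
    proof -
      have "exp (- of_nat m * (z + \<tau>)) = inverse (uproj z) ^ m * inverse (exp \<tau> ^ m)"
      proof -
        have "exp (- of_nat m * (z + \<tau>)) = inverse (exp (of_nat m * z)) * inverse (exp (of_nat m * \<tau>))"
          unfolding exp_minus[symmetric] exp_add[symmetric] by (simp add: algebra_simps)
        then show ?thesis by (simp add: uproj_def exp_of_nat_mult power_inverse)
      qed
      then show ?thesis unfolding bessel_B_eq[OF \<mu>] n_def[symmetric] et normal_series_def by (simp add: divide_inverse)
    qed
    then show ?thesis unfolding F_def G_def d by simp
  qed
  have reim: "Re (z + \<tau>) = Re z + ln (real n)" "Im (z + \<tau>) = Im z - (pi / 2 - uarg \<xi>)" for z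
    unfolding \<tau>_def log_shift_def uarg_def using re by simp_all
  have "(\<exists>C X. \<forall>z. \<bar>Im z - (pi / 2 - uarg \<xi>)\<bar> \<le> \<delta> \<and> Re z \<ge> X \<longrightarrow> norm (F M z) \<le> C * exp (- real M * Re z)) \<longleftrightarrow>
    (\<exists>C X. \<forall>v. \<bar>Im v\<bar> \<le> \<delta> \<and> Re v \<ge> X \<longrightarrow> norm (G M v) \<le> C * exp (- real M * Re v))" for M \<delta>
  proof (intro iffI; elim exE)
    fix C X assume *: "\<forall>z. \<bar>Im z - (pi / 2 - uarg \<xi>)\<bar> \<le> \<delta> \<and> Re z \<ge> X \<longrightarrow> norm (F M z) \<le> C * exp (- real M * Re z)"
    have "norm (G M v) \<le> (C * exp (real M * ln (real n))) * exp (- real M * Re v)" if v: "\<bar>Im v\<bar> \<le> \<delta>" "Re v \<ge> X + ln (real n)" for v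
    proof -
      have "norm (F M (v - \<tau>)) \<le> C * exp (- real M * Re (v - \<tau>))"
        using * reim[of "v - \<tau>"] v by (intro *[rule_format]) auto
      moreover have "Re (v - \<tau>) = Re v - ln (real n)" using reim(1)[of "v - \<tau>"] by simp
      ultimately show ?thesis unfolding FG mult.assoc exp_add[symmetric] by (simp add: algebra_simps)
    qed
    then show "\<exists>C X. \<forall>v. \<bar>Im v\<bar> \<le> \<delta> \<and> Re v \<ge> X \<longrightarrow> norm (G M v) \<le> C * exp (- real M * Re v)" by blast
  next
    fix C X assume *: "\<forall>v. \<bar>Im v\<bar> \<le> \<delta> \<and> Re v \<ge> X \<longrightarrow> norm (G M v) \<le> C * exp (- real M * Re v)"
    have "norm (F M z) \<le> (C * exp (- real M * ln (real n))) * exp (- real M * Re z)"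
      if z: "\<bar>Im z - (pi / 2 - uarg \<xi>)\<bar> \<le> \<delta>" "Re z \<ge> X - ln (real n)" for z
    proof -
      have "norm (G M (z + \<tau>)) \<le> C * exp (- real M * Re (z + \<tau>))"
        using reim[of z] z by (intro *[rule_format]) auto
      then show ?thesis unfolding FG reim mult.assoc exp_add[symmetric] by (simp add: algebra_simps)
    qed
    then show "\<exists>C X. \<forall>z. \<bar>Im z - (pi / 2 - uarg \<xi>)\<bar> \<le> \<delta> \<and> Re z \<ge> X \<longrightarrow> norm (F M z) \<le> C * exp (- real M * Re z)" by blast
  qed
  then show ?thesis
    unfolding has_asymp_expansion_def normal_expansion_def bigo_sector_iff n_def[symmetric] a_def[symmetric] \<tau>_def[symmetric]
      F_def[symmetric] G_def[symmetric] by simp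
qed

text \<open>Cauchy's inequality on discs of radius r0 exp (- t): exp varies by at most 1 on such a
  disc, so exp (- Re (exp x)) stays comparable to its value at the centre. The k-th derivative costs
  exp (k t), for which N provides.\<close>

lemma subdominant_higher_deriv_bound:
  assumes hol: "u holomorphic_on UNIV" and \<delta>: "\<delta> > 0"
    and dec: "\<And>M::nat. \<exists>C X. \<forall>v. \<bar>Im v\<bar> \<le> \<delta> \<and> Re v \<ge> X \<longrightarrow> norm (u v) \<le> C * exp (- Re (exp v) - real M * Re v)"
  shows "\<exists>C T. \<forall>t\<ge>T. norm ((deriv ^^ k) u (of_real t)) \<le> C * exp (- exp t - M * t)"
proof -
  define N where "N = nat \<lceil>M\<rceil> + k"
  define r0 where "r0 = min \<delta> (1/2)"
  have r0: "0 < r0" "r0 \<le> \<delta>" "r0 \<le> 1/2" using \<delta> unfolding r0_def by auto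
  obtain C X where CX: "\<And>v. \<bar>Im v\<bar> \<le> \<delta> \<Longrightarrow> Re v \<ge> X \<Longrightarrow> norm (u v) \<le> C * exp (- Re (exp v) - real N * Re v)"
    using dec[of N] by blast
  define C' where "C' = fact k * (\<bar>C\<bar> * exp (1 + real N)) / r0 ^ k"
  have "norm ((deriv ^^ k) u (of_real t)) \<le> C' * exp (- exp t - M * t)" if t: "t \<ge> max (X + 1) 0" for t
  proof -
    define r where "r = r0 * exp (- t)"
    have et: "exp (- t) \<le> 1" using t by simp
    have r: "0 < r" "r \<le> r0" unfolding r_def using r0 et mult_left_mono[OF et, of r0] by auto
    define B where "B = \<bar>C\<bar> * exp (1 + real N) * exp (- exp t - real N * t)"
    have "norm ((deriv ^^ k) u (of_real t)) \<le> fact k * B / r ^ k"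
    proof (rule Cauchy_inequality)
      show "u holomorphic_on ball (of_real t) r" "continuous_on (cball (of_real t) r) u"
        using hol by (auto intro: holomorphic_on_subset holomorphic_on_imp_continuous_on)
      fix x assume x: "norm (complex_of_real t - x) = r"
      define h where "h = x - of_real t"
      have h: "norm h = r" "x = of_real t + h" using x unfolding h_def by (auto simp: norm_minus_commute)
      have Re: "Re x \<ge> t - 1" "\<bar>Im x\<bar> \<le> \<delta>"
        using abs_Re_le_cmod[of h] abs_Im_le_cmod[of h] h r r0 by auto
      have "norm (exp h - 1) \<le> exp (norm h) * norm h"
        using Taylor_exp_field[of h 0] by simp
      also have "\<dots> \<le> 2 * r"
      proof -
        have "exp (norm h) \<le> 2" using exp_bound_half[of "norm h"] h r r0 by simp
        then show ?thesis using h r by (intro mult_mono) auto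
      qed
      finally have eh: "norm (exp h - 1) \<le> 2 * r" .
      have "norm (exp x - exp (of_real t)) = exp t * norm (exp h - 1)"
      proof -
        have "exp x - exp (of_real t) = exp (of_real t) * (exp h - 1)" unfolding h exp_add by (simp add: algebra_simps)
        then show ?thesis by (simp add: norm_mult norm_exp_eq_Re)
      qed
      also have "\<dots> \<le> exp t * (2 * r)" using eh by (intro mult_left_mono) auto
      also have "\<dots> = 2 * r0" unfolding r_def by (simp add: exp_minus)
      also have "\<dots> \<le> 1" using r0 by simp
      finally have "\<bar>Re (exp x) - exp t\<bar> \<le> 1"
        using abs_Re_le_cmod[of "exp x - exp (of_real t)"] by (simp add: Re_exp)
      then have e: "- Re (exp x) \<le> 1 - exp t" by linarith
      have m: "real N * (t - 1) \<le> real N * Re x" using Re by (intro mult_left_mono) auto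
      have "norm (u x) \<le> C * exp (- Re (exp x) - real N * Re x)" using Re t by (intro CX) auto
      also have "\<dots> \<le> \<bar>C\<bar> * exp ((1 + real N) + (- exp t - real N * t))"
        using e m by (intro mult_mono) (auto simp: algebra_simps)
      also have "\<dots> = B" unfolding B_def exp_add by simp
      finally show "norm (u x) \<le> B" .
    qed (rule r)
    also have "fact k * B / r ^ k = C' * (exp (- exp t - real N * t) * exp t ^ k)"
      unfolding C'_def B_def r_def power_mult_distrib exp_minus by (simp add: field_simps)
    also have "\<dots> \<le> C' * exp (- exp t - M * t)"
    proof (rule mult_left_mono)
      have "exp (- exp t - real N * t) * exp t ^ k = exp (- exp t - (real N - real k) * t)"
        unfolding exp_of_nat_mult[symmetric] exp_add[symmetric] by (simp add: algebra_simps)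
      also have "M \<le> real N - real k" unfolding N_def by simp linarith
      then have "M * t \<le> (real N - real k) * t" using t by (intro mult_right_mono) auto
      then have "exp (- exp t - (real N - real k) * t) \<le> exp (- exp t - M * t)" by simp
      finally show "exp (- exp t - real N * t) * exp t ^ k \<le> exp (- exp t - M * t)" .
    qed (use r0 in \<open>simp add: C'_def\<close>)
    finally show ?thesis .
  qed
  then show ?thesis by blast
qed

text \<open>The two partial sums cancel, so the difference is exp (a z - exp z) times an error of
  every order; as Re a <= 0, the factor exp (a z) may be dropped for Re z >= 0.\<close>

lemma normal_solution_expansion_unique:
  fixes \<mu> :: "complex ^ 'n"
  assumes u: "normal_solution (index_poly (($) \<mu>)) u" "normal_expansion \<mu> u \<rho>"
    and v: "normal_solution (index_poly (($) \<mu>)) v" "normal_expansion \<mu> v \<rho>" and \<rho>: "\<rho> > 0"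
  shows "u = v"
proof
  fix s
  define n where "n = CARD('n)"
  define a where "a = bessel_exponent n"
  have aR: "a = of_real (Re a)" unfolding a_def bessel_exponent_def by (simp add: complex_eq_iff)
  have Ra: "Re a \<le> 0" unfolding a_def bessel_exponent_def n_def by simp
  define d where "d s = u s + (-1) * v s" for s
  have d: "normal_solution (index_poly (($) \<mu>)) d"
    unfolding d_def[abs_def] by (intro normal_solution_add normal_solution_cmult u v)
  have "d s = 0"
  proof (rule normal_solution_subdominant_unique[OF d])
    show "degree (index_poly (($) \<mu>)) > 0" by (simp add: degree_index_poly)
    show "lead_coeff (index_poly (($) \<mu>)) = 1" using lead_coeff_index_poly[of "($) \<mu>"] by (simp add: degree_index_poly)
    fix M :: real and k
    show "\<exists>C T. \<forall>t\<ge>T. norm ((deriv ^^ k) d (of_real t)) \<le> C * exp (- exp t - M * t)"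
    proof (rule subdominant_higher_deriv_bound)
      show "d holomorphic_on UNIV" using d unfolding normal_solution_def by blast
      show "\<rho> / 2 > 0" using \<rho> by simp
      fix M :: nat
      have \<rho>2: "\<rho> / 2 < \<rho>" using \<rho> by simp
      let ?S = "\<lambda>v. \<Sum>m<M. normal_series \<mu> (int m) * exp (- of_nat m * v)"
      obtain C1 X1 where 1: "\<And>z. \<bar>Im z\<bar> \<le> \<rho> / 2 \<Longrightarrow> Re z \<ge> X1 \<Longrightarrow> norm (u z / exp (a * z - exp z) - ?S z) \<le> C1 * exp (- real M * Re z)"
        using u(2) \<rho>2 unfolding normal_expansion_def a_def n_def by blast
      obtain C2 X2 where 2: "\<And>z. \<bar>Im z\<bar> \<le> \<rho> / 2 \<Longrightarrow> Re z \<ge> X2 \<Longrightarrow> norm (v z / exp (a * z - exp z) - ?S z) \<le> C2 * exp (- real M * Re z)"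
        using v(2) \<rho>2 unfolding normal_expansion_def a_def n_def by blast
      have "norm (d z) \<le> (\<bar>C1\<bar> + \<bar>C2\<bar>) * exp (- Re (exp z) - real M * Re z)"
        if z: "\<bar>Im z\<bar> \<le> \<rho> / 2" "Re z \<ge> max 0 (max X1 X2)" for z
      proof -
        have "d z = exp (a * z - exp z) * ((u z / exp (a * z - exp z) - ?S z) - (v z / exp (a * z - exp z) - ?S z))"
          unfolding d_def by (simp add: right_diff_distrib)
        also have "norm \<dots> \<le> norm (exp (a * z - exp z)) * (C1 * exp (- real M * Re z) + C2 * exp (- real M * Re z))"
          unfolding norm_mult
        proof (rule mult_left_mono)
          have "norm (u z / exp (a * z - exp z) - ?S z) \<le> C1 * exp (- real M * Re z)" using 1[of z] z by auto
          moreover have "norm (v z / exp (a * z - exp z) - ?S z) \<le> C2 * exp (- real M * Re z)" using 2[of z] z by auto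
          ultimately show "norm ((u z / exp (a * z - exp z) - ?S z) - (v z / exp (a * z - exp z) - ?S z)) \<le> C1 * exp (- real M * Re z) + C2 * exp (- real M * Re z)"
            by (rule order_trans[OF norm_triangle_ineq4 add_mono])
        qed simp
        also have "norm (exp (a * z - exp z)) = exp (Re a * Re z) * exp (- Re (exp z))"
          unfolding norm_exp_eq_Re by (subst aR) (simp add: exp_add[symmetric])
        also have "exp (Re a * Re z) * exp (- Re (exp z)) * (C1 * exp (- real M * Re z) + C2 * exp (- real M * Re z)) \<le>
           1 * exp (- Re (exp z)) * ((\<bar>C1\<bar> + \<bar>C2\<bar>) * exp (- real M * Re z))"
        proof (rule mult_mono)
          have "Re a * Re z \<le> 0" using Ra z by (simp add: mult_nonpos_nonneg)
          then show "exp (Re a * Re z) * exp (- Re (exp z)) \<le> 1 * exp (- Re (exp z))" by (intro mult_right_mono) auto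
          have "C1 * exp (- real M * Re z) \<le> \<bar>C1\<bar> * exp (- real M * Re z)" "C2 * exp (- real M * Re z) \<le> \<bar>C2\<bar> * exp (- real M * Re z)"
            by (intro mult_right_mono; simp)+
          then show "C1 * exp (- real M * Re z) + C2 * exp (- real M * Re z) \<le> (\<bar>C1\<bar> + \<bar>C2\<bar>) * exp (- real M * Re z)"
            unfolding distrib_right by linarith
          have "0 \<le> norm (u z / exp (a * z - exp z) - ?S z)" "0 \<le> norm (v z / exp (a * z - exp z) - ?S z)" by auto
          then show "0 \<le> C1 * exp (- real M * Re z) + C2 * exp (- real M * Re z)"
            using 1[of z] 2[of z] z by (smt (verit, best) max.bounded_iff)
        qed auto
        also have "\<dots> = (\<bar>C1\<bar> + \<bar>C2\<bar>) * exp (- Re (exp z) - real M * Re z)"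
          by (simp add: exp_diff exp_minus field_simps)
        finally show ?thesis .
      qed
      then show "\<exists>C X. \<forall>v. \<bar>Im v\<bar> \<le> \<rho> / 2 \<and> Re v \<ge> X \<longrightarrow> norm (d v) \<le> C * exp (- Re (exp v) - real M * Re v)" by blast
    qed
  qed
  then show "u s = v s" unfolding d_def by simp
qed

text \<open>Evaluates the definite description. The function u is left arbitrary because at
  nongeneric indices it will be a limit of residue sums.\<close>

lemma bessel_second_eq:
  fixes \<mu> :: "complex ^ 'n"
  assumes \<mu>: "\<mu> \<in> zero_sum" and re: "Re \<xi> = 0"
    and u: "normal_solution (index_poly (($) \<mu>)) u" "normal_expansion \<mu> u (pi / CARD('n))"
  shows "bessel_second \<mu> \<xi> z = exp (- bessel_exponent CARD('n) * log_shift CARD('n) \<xi>) * u (z + log_shift CARD('n) \<xi>)"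
proof -
  define a where "a = bessel_exponent CARD('n)"
  define \<tau> where "\<tau> = log_shift CARD('n) \<xi>"
  have ee: "exp (a * \<tau>) * exp (- a * \<tau>) = 1" unfolding exp_add[symmetric] by simp
  define P where "P w \<longleftrightarrow> bessel_solution (uproj \<xi> ^ CARD('n)) \<mu> w \<and>
        has_asymp_expansion w
          (\<i> * of_nat CARD('n) * uproj \<xi>) (- (of_nat CARD('n) - 1) / 2) (\<lambda>m. bessel_B \<xi> m \<mu>)
          (pi / 2 - uarg \<xi>) (pi / CARD('n))" for w
  have P: "P w \<longleftrightarrow> normal_solution (index_poly (($) \<mu>)) (\<lambda>v. w (v - \<tau>)) \<and> normal_expansion \<mu> (\<lambda>v. exp (a * \<tau>) * w (v - \<tau>)) (pi / CARD('n))" for w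
    unfolding P_def has_asymp_expansion_iff[OF \<mu> re] bessel_solution_normal_iff[OF refl] a_def \<tau>_def ..
  define w0 where "w0 z = exp (- a * \<tau>) * u (z + \<tau>)" for z
  have "P w0"
  proof -
    have "exp (a * \<tau>) * w0 (v - \<tau>) = u v" for v
    proof -
      have "exp (a * \<tau>) * w0 (v - \<tau>) = (exp (a * \<tau>) * exp (- a * \<tau>)) * u v" unfolding w0_def by simp
      then show ?thesis unfolding ee by simp
    qed
    then have 1: "(\<lambda>v. exp (a * \<tau>) * w0 (v - \<tau>)) = u" by (rule ext)
    have 2: "(\<lambda>v. w0 (v - \<tau>)) = (\<lambda>v. exp (- a * \<tau>) * u v)" unfolding w0_def by simp
    show ?thesis unfolding P 1 2 using u normal_solution_cmult[OF u(1)] by blast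
  qed
  moreover have "w = w0" if "P w" for w
  proof -
    have "(\<lambda>v. exp (a * \<tau>) * w (v - \<tau>)) = u"
      using that u unfolding P by (intro normal_solution_expansion_unique[where \<rho>="pi / CARD('n)" and \<mu>=\<mu>]) (auto intro: normal_solution_cmult)
    then have "exp (a * \<tau>) * w z = u (z + \<tau>)" for z by (auto dest: fun_cong[of _ _ "z + \<tau>"])
    then have "w z = w0 z" for z unfolding w0_def by (metis (no_types, lifting) ee mult.assoc mult.commute mult_1_left)
    then show ?thesis by (rule ext)
  qed
  ultimately have "bessel_second \<mu> \<xi> = w0" unfolding bessel_second_def P_def[symmetric] by (rule the_equality)
  then show ?thesis unfolding w0_def a_def \<tau>_def by simp
qed

lemma normal_bessel_expansion:
  fixes B D \<delta> :: real and M :: nat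
  assumes "B \<ge> 0" "D \<ge> 0" "0 \<le> \<delta>" "\<delta> < pi/2"
  shows "\<exists>C X. \<forall>(\<nu> :: complex ^ 'n) v. \<nu> \<in> zero_sum \<and> generic \<nu> \<and> (\<forall>k. norm (\<nu> $ k) \<le> B) \<and>
     (\<forall>i<M + 2. norm (normal_series \<nu> (int i)) \<le> D) \<and> \<bar>Im v\<bar> \<le> \<delta> \<and> Re v \<ge> X \<longrightarrow>
     norm (normal_bessel (($) \<nu>) v / exp (bessel_exponent CARD('n) * v - exp v) - (\<Sum>i<M. normal_series \<nu> (int i) * exp (- of_nat i * v)))
       \<le> C * exp (- real M * Re v)"
proof -
  obtain C X where CX: "\<forall>(\<nu> :: 'n \<Rightarrow> complex) f v. (\<Sum>k\<in>UNIV. \<nu> k) = 0 \<and> (\<forall>k. norm (\<nu> k) \<le> B) \<and>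
     (\<forall>k l. k \<noteq> l \<longrightarrow> \<nu> k - \<nu> l \<notin> \<int>) \<and>
     formal_normal_solution \<nu> f \<and> f 0 = 1 \<and> (\<forall>i<M + 2. norm (f (int i)) \<le> D) \<and> \<bar>Im v\<bar> \<le> \<delta> \<and> Re v \<ge> X \<longrightarrow>
     norm (of_nat CARD('n) * of_real (gamma_ratio_limit CARD('n)) * barnes_sum \<nu> (v - of_real (ln (real CARD('n))))
       / exp (bessel_exponent CARD('n) * v - exp v) - (\<Sum>i<M. f (int i) * exp (- of_nat i * v)))
       \<le> C * exp (- real M * Re v)"
    using barnes_sum_expansion[OF assms, where 'a='n, of M] by (elim exE)
  have "norm (normal_bessel (($) \<nu>) v / exp (bessel_exponent CARD('n) * v - exp v) - (\<Sum>i<M. normal_series \<nu> (int i) * exp (- of_nat i * v)))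
       \<le> C * exp (- real M * Re v)"
    if "\<nu> \<in> zero_sum" "generic \<nu>" "\<forall>k. norm (\<nu> $ k) \<le> B"
      "\<forall>i<M + 2. norm (normal_series \<nu> (int i)) \<le> D" "\<bar>Im v\<bar> \<le> \<delta>" "Re v \<ge> X" for \<nu> :: "complex ^ 'n" and v
  proof -
    have "normal_series \<nu> 0 = 1" by (simp add: normal_series_def)
    then show ?thesis
      unfolding normal_bessel_def
      by (intro CX[rule_format])
         (use that formal_normal_solution_normal_series[OF that(1)] in \<open>auto simp: zero_sum_def generic_iff\<close>)
  qed
  then show ?thesis by blast
qed

lemma normal_bessel_solution:
  fixes \<nu> :: "complex ^ 'n"
  assumes "generic \<nu>"
  shows "normal_solution (index_poly (($) \<nu>)) (normal_bessel (($) \<nu>))"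
  unfolding normal_bessel_def[abs_def]
  by (intro normal_solution_cmult barnes_sum_normal_solution) (use assms in \<open>simp add: generic_iff\<close>)

lemma normal_bessel_normal_expansion:
  fixes \<nu> :: "complex ^ 'n"
  assumes n: "CARD('n) \<ge> 2" and \<nu>: "\<nu> \<in> zero_sum" "generic \<nu>"
  shows "normal_expansion \<nu> (normal_bessel (($) \<nu>)) (pi / CARD('n))"
  unfolding normal_expansion_def
proof (intro allI impI)
  fix \<delta> :: real and M :: nat
  assume \<delta>: "\<delta> < pi / CARD('n)"
  define \<delta>' where "\<delta>' = max \<delta> 0"
  \<comment> \<open>Here n >= 2 is used: the sector of half-opening pi/n lies in the half-plane |arg
    y| < pi/2.\<close>
  have "pi / CARD('n) \<le> pi / 2" using n by (intro divide_left_mono) auto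
  then have "\<delta> < pi / 2" using \<delta> by linarith
  then have \<delta>': "0 \<le> \<delta>'" "\<delta>' < pi / 2" using pi_half_gt_zero unfolding \<delta>'_def max_def by auto
  define B where "B = Max (range (\<lambda>k. norm (\<nu> $ k)))"
  have B: "norm (\<nu> $ k) \<le> B" for k unfolding B_def by (intro Max_ge) auto
  then have B0: "B \<ge> 0" by (meson norm_ge_zero order_trans)
  define D where "D = (\<Sum>i<M+2. norm (normal_series \<nu> (int i)))"
  have D: "norm (normal_series \<nu> (int i)) \<le> D" if "i < M + 2" for i
    unfolding D_def by (rule member_le_sum) (use that in auto)
  have D0: "D \<ge> 0" unfolding D_def by (intro sum_nonneg) auto
  obtain C X where CX: "\<forall>(\<nu> :: complex ^ 'n) v. \<nu> \<in> zero_sum \<and> generic \<nu> \<and> (\<forall>k. norm (\<nu> $ k) \<le> B) \<and>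
     (\<forall>i<M + 2. norm (normal_series \<nu> (int i)) \<le> D) \<and> \<bar>Im v\<bar> \<le> \<delta>' \<and> Re v \<ge> X \<longrightarrow>
     norm (normal_bessel (($) \<nu>) v / exp (bessel_exponent CARD('n) * v - exp v) - (\<Sum>i<M. normal_series \<nu> (int i) * exp (- of_nat i * v)))
       \<le> C * exp (- real M * Re v)"
    using normal_bessel_expansion[OF B0 D0 \<delta>', where 'n='n, of M] by (elim exE)
  show "\<exists>C X. \<forall>v. \<bar>Im v\<bar> \<le> \<delta> \<and> Re v \<ge> X \<longrightarrow>
     norm (normal_bessel (($) \<nu>) v / exp (bessel_exponent CARD('n) * v - exp v) - (\<Sum>m<M. normal_series \<nu> (int m) * exp (- of_nat m * v)))
       \<le> C * exp (- real M * Re v)"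
    by (rule exI[of _ C], rule exI[of _ X], intro allI impI, rule CX[rule_format])
       (use \<nu> B D in \<open>auto simp: \<delta>'_def\<close>)
qed

section \<open>Limits of the generic solutions\<close>

lemma continuous_on_poly_expr:
  assumes "poly_expr p"
  shows "continuous_on UNIV p"
proof -
  obtain E c where E: "finite E" "\<And>\<mu>. p \<mu> = (\<Sum>\<alpha>\<in>E. c \<alpha> * (\<Prod>k\<in>UNIV. (\<mu> $ k) ^ \<alpha> k))"
    using assms unfolding poly_expr_def by blast
  show ?thesis unfolding E(2)[abs_def] by (intro continuous_intros)
qed

lemma tendsto_symmetric_polynomial:
  assumes "symmetric_polynomial p" "X \<longlonglongrightarrow> \<mu>"
  shows "(\<lambda>i. p (X i)) \<longlonglongrightarrow> p \<mu>"
  using continuous_on_poly_expr[of p] assms unfolding symmetric_polynomial_iff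
  by (auto simp: continuous_on_eq_continuous_at isCont_def intro: isCont_tendsto_compose)

lemma tendsto_normal_series:
  assumes "X \<longlonglongrightarrow> \<mu>"
  shows "(\<lambda>i. normal_series (X i) m) \<longlonglongrightarrow> normal_series \<mu> m"
  unfolding normal_series_def using tendsto_symmetric_polynomial[OF symmetric_polynomial_normal_coeff assms] by simp

lemma normal_bessel_subsequence:
  fixes \<mu> :: "complex ^ 'n" and X :: "nat \<Rightarrow> complex ^ 'n"
  assumes n: "CARD('n) \<ge> 2" and \<mu>: "\<mu> \<in> zero_sum"
    and X: "\<And>i. X i \<in> zero_sum" "\<And>i. generic (X i)" "X \<longlonglongrightarrow> \<mu>"
  shows "\<exists>r g. strict_mono r \<and> (\<forall>v. (\<lambda>i. normal_bessel (($) (X (r i))) v) \<longlonglongrightarrow> g v) \<and>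
    normal_solution (index_poly (($) \<mu>)) g \<and> normal_expansion \<mu> g (pi / CARD('n))"
proof -
  define a where "a = bessel_exponent CARD('n)"
  define u where "u i = normal_bessel (($) (X i))" for i
  have sol: "normal_solution (index_poly (($) (X i))) (u i)" for i
    unfolding u_def by (rule normal_bessel_solution[OF X(2)])
  then have hol: "u i holomorphic_on UNIV" for i unfolding normal_solution_def by blast
  have "Bseq X" using X(3) by (rule convergent_imp_Bseq[OF convergentI])
  then obtain B where B: "B > 0" "\<And>i. norm (X i) \<le> B" unfolding Bseq_def by blast
  have Bk: "norm (X i $ k) \<le> B" for i k using Finite_Cartesian_Product.norm_nth_le[of "X i" k] B(2)[of i] by linarith
  have "\<exists>D. \<forall>i. norm (normal_series (X i) (int m)) \<le> D" for m
    using convergent_imp_Bseq[OF convergentI, OF tendsto_normal_series[OF X(3), of "int m"]] unfolding Bseq_def by blast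
  then obtain D where D: "\<And>i m. norm (normal_series (X i) (int m)) \<le> D m" by metis
  have D0: "D m \<ge> 0" for m using D[of 0 m] by (meson norm_ge_zero order_trans)
  \<comment> \<open>One pair of constants serves the whole sequence: a convergent sequence of
    indices is bounded, and so are its formal coefficients, which are polynomials in the
    indices.\<close>
  have unif: "\<exists>C Y. \<forall>i v. \<bar>Im v\<bar> \<le> \<delta> \<and> Re v \<ge> Y \<longrightarrow>
     norm (u i v / exp (a * v - exp v) - (\<Sum>m<M. normal_series (X i) (int m) * exp (- of_nat m * v))) \<le> C * exp (- real M * Re v)"
    if \<delta>: "0 \<le> \<delta>" "\<delta> < pi / 2" for \<delta> M
  proof -
    define DM where "DM = (\<Sum>m<M+2. D m)"
    have DM: "norm (normal_series (X i) (int m)) \<le> DM" if "m < M + 2" for i m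
    proof -
      have "D m \<le> DM" unfolding DM_def by (rule member_le_sum) (use that D0 in auto)
      then show ?thesis using D[of i m] by linarith
    qed
    have DM0: "DM \<ge> 0" unfolding DM_def by (intro sum_nonneg D0)
    have B0: "B \<ge> 0" using B by simp
    obtain C Y where CX: "\<forall>(\<nu> :: complex ^ 'n) v. \<nu> \<in> zero_sum \<and> generic \<nu> \<and> (\<forall>k. norm (\<nu> $ k) \<le> B) \<and>
     (\<forall>i<M + 2. norm (normal_series \<nu> (int i)) \<le> DM) \<and> \<bar>Im v\<bar> \<le> \<delta> \<and> Re v \<ge> Y \<longrightarrow>
     norm (normal_bessel (($) \<nu>) v / exp (bessel_exponent CARD('n) * v - exp v) - (\<Sum>i<M. normal_series \<nu> (int i) * exp (- of_nat i * v)))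
       \<le> C * exp (- real M * Re v)"
      using normal_bessel_expansion[OF B0 DM0 \<delta>, where 'n='n, of M] by (elim exE)
    show ?thesis
      unfolding u_def a_def
      by (rule exI[of _ C], rule exI[of _ Y], intro allI impI, rule CX[rule_format]) (use X Bk DM in auto)
  qed
  \<comment> \<open>The expansion with M = 0 bounds all u i on one disc to the right; Cauchy's
    inequality gives the initial data at s0, and the local bound carries them to K.\<close>
  have bounded: "\<exists>C. \<forall>h\<in>range u. \<forall>z\<in>K. norm (h z) \<le> C" if K: "compact K" for K
  proof -
    obtain C Y where CY: "\<And>i v. \<bar>Im v\<bar> \<le> 1 \<Longrightarrow> Re v \<ge> Y \<Longrightarrow> norm (u i v / exp (a * v - exp v)) \<le> C"
      using unif[of 1 0] pi_gt3 by auto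
    define s0 where "s0 = complex_of_real (Y + 1)"
    have "bounded ((\<lambda>v. exp (a * v - exp v)) ` cball s0 1)"
      by (intro compact_imp_bounded compact_continuous_image continuous_intros) auto
    then obtain E where E: "\<And>v. v \<in> cball s0 1 \<Longrightarrow> norm (exp (a * v - exp v)) \<le> E"
      unfolding bounded_iff by blast
    have ub: "norm (u i v) \<le> \<bar>C\<bar> * \<bar>E\<bar>" if "v \<in> cball s0 1" for i v
    proof -
      have "norm (v - s0) \<le> 1" using that by (simp add: dist_norm norm_minus_commute)
      then have "\<bar>Im v\<bar> \<le> 1" "Re v \<ge> Y"
        using abs_Re_le_cmod[of "v - s0"] abs_Im_le_cmod[of "v - s0"] unfolding s0_def by auto
      then have "norm (u i v / exp (a * v - exp v)) * norm (exp (a * v - exp v)) \<le> \<bar>C\<bar> * \<bar>E\<bar>"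
        using CY[of v i] E[OF that] by (intro mult_mono) auto
      then show ?thesis by (simp add: norm_divide)
    qed
    define D1 where "D1 = (\<Sum>k<CARD('n). fact k * (\<bar>C\<bar> * \<bar>E\<bar>))"
    have dk: "norm ((deriv ^^ k) (u i) s0) \<le> D1" if "k < CARD('n)" for i k
    proof -
      have "norm ((deriv ^^ k) (u i) s0) \<le> fact k * (\<bar>C\<bar> * \<bar>E\<bar>) / 1 ^ k"
      proof (rule Cauchy_inequality)
        show "u i holomorphic_on ball s0 1" "continuous_on (cball s0 1) (u i)"
          using hol by (auto intro: holomorphic_on_subset holomorphic_on_imp_continuous_on)
        show "norm (u i x) \<le> \<bar>C\<bar> * \<bar>E\<bar>" if "norm (s0 - x) = 1" for x
          by (rule ub) (use that in \<open>simp add: dist_norm\<close>)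
      qed simp
      also have "\<dots> \<le> D1" unfolding D1_def using that by (simp, intro member_le_sum) auto
      finally show ?thesis .
    qed
    obtain R0 where R0: "\<And>z. z \<in> K \<Longrightarrow> norm z \<le> R0" using compact_imp_bounded[OF K] unfolding bounded_iff by blast
    define R where "R = \<bar>R0\<bar> + norm s0"
    define A where "A = (1 + real CARD('n) * B) ^ CARD('n)"
    have A: "A \<ge> 0" unfolding A_def using B by simp
    have coefb: "norm (coeff (index_poly (($) (X i))) j) \<le> A" for i j
      unfolding index_poly_def A_def
      using norm_coeff_prod_linear_le[of "UNIV :: 'n set" "\<lambda>k. of_nat CARD('n) * X i $ k" "real CARD('n) * B" j] Bk B
      by (simp add: norm_mult mult_left_mono)
    have R: "R \<ge> 0" unfolding R_def by simp
    have npos: "CARD('n) > 0" by simp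
    obtain CC where CC: "\<forall>Q u s0 \<zeta> D. normal_solution Q u \<and> degree Q = CARD('n) \<and> coeff Q CARD('n) = 1 \<and> (\<forall>j. norm (coeff Q j) \<le> A) \<and>
       norm s0 \<le> R \<and> norm \<zeta> \<le> R \<and> (\<forall>k<CARD('n). norm ((deriv ^^ k) u s0) \<le> D) \<longrightarrow> norm (u (s0 + \<zeta>)) \<le> CC * D"
      using normal_solution_local_bound[OF A npos R] by (elim exE)
    have "norm (u i z) \<le> CC * D1" if "z \<in> K" for i z
    proof -
      have "norm (z - s0) \<le> R" using R0[OF that] norm_triangle_ineq4[of z s0] unfolding R_def by linarith
      moreover have "norm s0 \<le> R" unfolding R_def by simp
      ultimately have "norm (u i (s0 + (z - s0))) \<le> CC * D1"
        by (intro CC[rule_format, of "index_poly (($) (X i))"])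
           (use sol dk coefb lead_coeff_index_poly[of "($) (X i)"] in \<open>auto simp: degree_index_poly\<close>)
      then show ?thesis by simp
    qed
    then show ?thesis by blast
  qed
  obtain g r where g: "g holomorphic_on UNIV" "strict_mono (r :: nat \<Rightarrow> nat)"
    "\<And>x. (\<lambda>i. u (r i) x) \<longlonglongrightarrow> g x" "\<And>K. compact K \<Longrightarrow> uniform_limit K (u \<circ> r) g sequentially"
    by (rule Montel[of UNIV "range u" u]) (use hol bounded in blast)+
  have Xr: "(\<lambda>i. X (r i)) \<longlonglongrightarrow> \<mu>" using LIMSEQ_subseq_LIMSEQ[OF X(3) g(2)] by (simp add: o_def)
  have "normal_solution (index_poly (($) \<mu>)) g"
    unfolding normal_solution_def degree_index_poly
  proof (intro conjI allI g(1))
    fix s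
    have dl: "(\<lambda>i. (deriv ^^ j) (u (r i)) s) \<longlonglongrightarrow> (deriv ^^ j) g s" for j
    proof (rule higher_deriv_complex_uniform_limit)
      have "uniform_limit (cball s 1) (u \<circ> r) g sequentially" by (rule g(4)) simp
      then show "uniform_limit (ball s 1) (\<lambda>i. u (r i)) g sequentially"
        unfolding o_def by (rule uniform_limit_on_subset) auto
      show "eventually (\<lambda>i. u (r i) holomorphic_on ball s 1) sequentially"
        using hol holomorphic_on_subset by (intro always_eventually) blast
    qed auto
    have lhs: "(\<lambda>i. \<Sum>j\<le>CARD('n). coeff (index_poly (($) (X (r i)))) j * (deriv ^^ j) (u (r i)) s) \<longlonglongrightarrow>
       (\<Sum>j\<le>CARD('n). coeff (index_poly (($) \<mu>)) j * (deriv ^^ j) g s)"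
      by (intro tendsto_sum tendsto_mult dl tendsto_symmetric_polynomial[OF symmetric_polynomial_coeff_index_poly Xr])
    have eq: "(\<Sum>j\<le>CARD('n). coeff (index_poly (($) (X (r i)))) j * (deriv ^^ j) (u (r i)) s) =
       (-1) ^ CARD('n) * exp (of_nat CARD('n) * s) * u (r i) s" for i
      using sol[of "r i"] unfolding normal_solution_def degree_index_poly by blast
    have rhs: "(\<lambda>i. (-1) ^ CARD('n) * exp (of_nat CARD('n) * s) * u (r i) s) \<longlonglongrightarrow> (-1) ^ CARD('n) * exp (of_nat CARD('n) * s) * g s"
      by (intro tendsto_intros g(3))
    show "(\<Sum>j\<le>CARD('n). coeff (index_poly (($) \<mu>)) j * (deriv ^^ j) g s) = (-1) ^ CARD('n) * exp (of_nat CARD('n) * s) * g s"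
      by (rule LIMSEQ_unique[OF lhs[unfolded eq] rhs])
  qed
  moreover have "normal_expansion \<mu> g (pi / CARD('n))"
    unfolding normal_expansion_def a_def[symmetric]
  proof (intro allI impI)
    fix \<delta> :: real and M :: nat
    assume \<delta>: "\<delta> < pi / CARD('n)"
    have "pi / CARD('n) \<le> pi / 2" using n by (intro divide_left_mono) auto
    then have "\<delta> < pi / 2" using \<delta> by linarith
    then have \<delta>': "0 \<le> max \<delta> 0" "max \<delta> 0 < pi / 2" using pi_half_gt_zero unfolding max_def by auto
    obtain C Y where CY: "\<And>i v. \<bar>Im v\<bar> \<le> max \<delta> 0 \<Longrightarrow> Re v \<ge> Y \<Longrightarrow>
       norm (u i v / exp (a * v - exp v) - (\<Sum>m<M. normal_series (X i) (int m) * exp (- of_nat m * v))) \<le> C * exp (- real M * Re v)"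
      using unif[OF \<delta>', of M] by blast
    \<comment> \<open>The error bound holds along the sequence with the same constants, hence also
      in the pointwise limit.\<close>
    have "norm (g v / exp (a * v - exp v) - (\<Sum>m<M. normal_series \<mu> (int m) * exp (- of_nat m * v))) \<le> C * exp (- real M * Re v)"
      if v: "\<bar>Im v\<bar> \<le> \<delta>" "Re v \<ge> Y" for v
    proof (rule LIMSEQ_le_const2)
      show "(\<lambda>i. norm (u (r i) v / exp (a * v - exp v) - (\<Sum>m<M. normal_series (X (r i)) (int m) * exp (- of_nat m * v)))) \<longlonglongrightarrow>
         norm (g v / exp (a * v - exp v) - (\<Sum>m<M. normal_series \<mu> (int m) * exp (- of_nat m * v)))"
        by (intro tendsto_intros g(3) tendsto_normal_series[OF Xr]) auto
      show "\<exists>N. \<forall>i\<ge>N. norm (u (r i) v / exp (a * v - exp v) - (\<Sum>m<M. normal_series (X (r i)) (int m) * exp (- of_nat m * v))) \<le> C * exp (- real M * Re v)"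
        using CY[of v] v by auto
    qed
    then show "\<exists>C X. \<forall>v. \<bar>Im v\<bar> \<le> \<delta> \<and> Re v \<ge> X \<longrightarrow>
       norm (g v / exp (a * v - exp v) - (\<Sum>m<M. normal_series \<mu> (int m) * exp (- of_nat m * v))) \<le> C * exp (- real M * Re v)" by blast
  qed
  ultimately show ?thesis using g(2,3) unfolding u_def by blast
qed

theorem corollary12p5:
  fixes \<mu> :: "complex ^ 'n" and \<sigma> :: complex and \<xi> z :: ucover
  assumes "CARD('n) \<ge> 2"
    and "\<mu> \<in> zero_sum"
    and "\<sigma> \<in> {1, -1}"
    and "uproj \<xi> ^ CARD('n) = \<sigma>"
  shows "let R = (\<lambda>\<nu> :: complex ^ 'n.
               of_real (sqrt (real CARD('n))) * connection_factor CARD('n) \<xi> *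
               (\<Sum>l\<in>UNIV. conj_power \<nu> \<xi> l * bessel_S \<nu> l * bessel_first \<sigma> \<nu> l z))
         in (generic \<mu> \<longrightarrow> bessel_second \<mu> \<xi> z = R \<mu>) \<and>
            (\<not> generic \<mu> \<longrightarrow>
               (R \<longlongrightarrow> bessel_second \<mu> \<xi> z) (at \<mu> within {\<nu> \<in> zero_sum. generic \<nu>}))"
proof -
  \<comment> \<open>As \<sigma> is a sign, \<xi> has modulus 1, that is, real part 0 in the
    logarithmic coordinate.\<close>
  have "norm (uproj \<xi>) ^ CARD('n) = 1" using assms(3,4) by (auto simp flip: norm_power)
  then have "norm (uproj \<xi>) = 1" by (intro power_eq_imp_eq_base[of _ "CARD('n)" 1]) auto
  then have re: "Re \<xi> = 0" by (simp add: uproj_def)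
  define c where "c = exp (- bessel_exponent CARD('n) * log_shift CARD('n) \<xi>)"
  define s where "s = z + log_shift CARD('n) \<xi>"
  define R where "R = (\<lambda>\<nu> :: complex ^ 'n.
               of_real (sqrt (real CARD('n))) * connection_factor CARD('n) \<xi> *
               (\<Sum>l\<in>UNIV. conj_power \<nu> \<xi> l * bessel_S \<nu> l * bessel_first \<sigma> \<nu> l z))"
  have R: "R \<nu> = c * normal_bessel (($) \<nu>) s" if "generic \<nu>" for \<nu>
    unfolding R_def c_def s_def by (rule bessel_connection[OF that assms(4) re])
  have "bessel_second \<mu> \<xi> z = R \<mu>" if gen: "generic \<mu>"
    unfolding R[OF gen] unfolding c_def s_def
    by (rule bessel_second_eq[OF assms(2) re normal_bessel_solution[OF gen] normal_bessel_normal_expansion[OF assms(1,2) gen]])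
  moreover have "(R \<longlongrightarrow> bessel_second \<mu> \<xi> z) (at \<mu> within {\<nu> \<in> zero_sum. generic \<nu>})"
    unfolding tendsto_at_iff_sequentially
  proof (intro allI impI)
    fix X :: "nat \<Rightarrow> complex ^ 'n"
    assume X: "\<forall>i. X i \<in> {\<nu> \<in> zero_sum. generic \<nu>} - {\<mu>}" "X \<longlonglongrightarrow> \<mu>"
    show "(R \<circ> X) \<longlonglongrightarrow> bessel_second \<mu> \<xi> z"
    \<comment> \<open>Otherwise a subsequence stays at distance e; a further subsequence converges
      to a solution with the right expansion, which by uniqueness yields the second-kind function
      after all.\<close>
    proof (rule ccontr)
      assume "\<not> (R \<circ> X) \<longlonglongrightarrow> bessel_second \<mu> \<xi> z"
      then obtain e where e: "e > 0" "\<forall>N. \<exists>i\<ge>N. dist ((R \<circ> X) i) (bessel_second \<mu> \<xi> z) \<ge> e"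
        unfolding lim_sequentially by (auto simp: not_less)
      have "infinite {i. dist ((R \<circ> X) i) (bessel_second \<mu> \<xi> z) \<ge> e}"
        unfolding infinite_nat_iff_unbounded_le using e(2) by auto
      then obtain p :: "nat \<Rightarrow> nat" where p: "strict_mono p" "\<And>i. dist ((R \<circ> X) (p i)) (bessel_second \<mu> \<xi> z) \<ge> e"
        using infinite_enumerate by blast
      define Y where "Y = X \<circ> p"
      have Y: "Y i \<in> zero_sum" "generic (Y i)" for i using X(1) unfolding Y_def by auto
      have "Y \<longlonglongrightarrow> \<mu>" unfolding Y_def by (rule LIMSEQ_subseq_LIMSEQ[OF X(2) p(1)])
      from normal_bessel_subsequence[OF assms(1,2) Y this]
      obtain r g where g: "\<And>v. (\<lambda>i. normal_bessel (($) (Y (r i))) v) \<longlonglongrightarrow> g v"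
        "normal_solution (index_poly (($) \<mu>)) g" "normal_expansion \<mu> g (pi / CARD('n))" by blast
      have "(\<lambda>i. c * normal_bessel (($) (Y (r i))) s) \<longlonglongrightarrow> c * g s" by (intro tendsto_intros g)
      moreover have "bessel_second \<mu> \<xi> z = c * g s"
        unfolding c_def s_def by (rule bessel_second_eq[OF assms(2) re g(2,3)])
      ultimately have "(\<lambda>i. R (Y (r i))) \<longlonglongrightarrow> bessel_second \<mu> \<xi> z" by (simp add: R[OF Y(2)])
      then obtain N where "\<And>i. i \<ge> N \<Longrightarrow> dist (R (Y (r i))) (bessel_second \<mu> \<xi> z) < e"
        using e(1) unfolding lim_sequentially by blast
      then show False using p(2)[of "r N"] unfolding Y_def by (simp add: not_less[symmetric])
    qed
  qed
  ultimately show ?thesis unfolding Let_def R_def by blast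
qed

end
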